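(* Let $k$ be a field, $H$ a Hopf algebra over $k$, and $\alpha:H\times H\to k$ a normalized convolution-invertible two-cocycle. Let $K$ be a field extension of $k$, let $\beta:H\times H\to K$ be a normalized convolution-invertible two-cocycle with values in $K$, and suppose that $K\otimes{}^{\beta}H$ is a $K$-form of ${}^{\alpha}H$. Then there are an algebra morphism $\lambda:\mathcal B_H^{\alpha}\to K$ and a $K$-linear isomorphism of $H$-comodule algebras $$K\otimes_{\mathcal B_H^{\alpha}}\mathcal A_H^{\alpha}\cong K\otimes{}^{\beta}H,$$ where $K$ is regarded as a $\mathcal B_H^{\alpha}$-module via $\lambda$.
   Context: All algebras are associative unital $k$-algebras; unadorned tensor products are over $k$; $\Delta$, $\varepsilon$ are the comultiplication and counit of $H$, with Sweedler notation. An $H$-comodule algebra is an algebra with a right $H$-coaction that is an algebra morphism; morphisms are algebra morphisms that are comodule maps. Cocycles and twisted algebras: let $R$ be a commutative algebra. A two-cocycle with values in $R$ is a bilinear map $\alpha:H\times H\to R$ with $\sum\alpha(x_{(1)},y_{(1)})\alpha(x_{(2)}y_{(2)},z)=\sum\alpha(y_{(1)},z_{(1)})\alpha(x,y_{(2)}z_{(2)})$ for all $x,y,z\in H$; it is normalized if $\alpha(x,1)=\alpha(1,x)=\varepsilon(x)1$, and convolution-invertible if it is invertible for convolution in $\operatorname{Hom}(H\otimes H,R)$. The twisted algebra $R\otimes{}^{\alpha}H$ is $R\otimes H$ with product $(b\otimes x)\cdot_\alpha(c\otimes y)=\sum bc\,\alpha(x_{(1)},y_{(1)})\otimes x_{(2)}y_{(2)}$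 and coaction $\mathrm{id}_R\otimes\Delta$. For $R=k$ write ${}^{\alpha}H=k\otimes{}^{\alpha}H$. Forms: for a field extension $K$ of $k$ and a normalized convolution-invertible two-cocycle $\beta:H\times H\to K$, the $H$-comodule algebra $K\otimes{}^{\beta}H$ is a $K$-form of ${}^{\alpha}H$ if there are a field extension $L$ of $K$ and an $L$-linear isomorphism of $H$-comodule algebras $L\otimes_K(K\otimes{}^{\beta}H)\cong L\otimes_k{}^{\alpha}H$. Universal cocycle: let $t_H$ be a copy of the vector space $H$ (with identity map $h\mapsto t_h$), $S(t_H)$ its symmetric algebra, $K_H$ the field of fractions of $S(t_H)$. Let $t^{-1}:H\to K_H$, $h\mapsto t_h^{-1}$, be the unique linear map with $\sum t_{h_{(1)}}t^{-1}_{h_{(2)}}=\sum t^{-1}_{h_{(1)}}t_{h_{(2)}}=\varepsilon(h)1$ for all $h\in H$ (it exists; note that $t^{-1}_h$ is in general not $1/t_h$). Define $\sigma:H\times H\to K_H$ by $\sigma(x,y)=\sum t_{x_{(1)}}t_{y_{(1)}}\alpha(x_{(2)},y_{(2)})t^{-1}_{x_{(3)}y_{(3)}}$; it is a convolution-invertible two-cocycle with convolution inverse $\sigma^{-1}(x,y)=\sum t_{x_{(1)}y_{(1)}}\alpha^{-1}(x_{(2)},y_{(2)})t^{-1}_{x_{(3)}}t^{-1}_{y_{(3)}}$. $\mathcal B_H^{\alpha}$ is the subalgebra of $K_H$ generated by all values of $\sigma$ and $\sigma^{-1}$, and $\mathcal A_H^{\alpha}=\mathcal B_H^{\alpha}\otimes{}^{\sigma}H$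 is the corresponding twisted algebra, which is associative with unit $t_1^{-1}\otimes1$ and is an $H$-comodule $\mathcal B_H^{\alpha}$-algebra. *)

theory Defs
  imports "HOL-Algebra.Algebra" "HOL-Algebra.Algebraic_Closure_Type"
begin

text \<open>
  Fields and the Hopf algebra \<open>H\<close> are types (fields of class \<open>field\<close>; \<open>H\<close> of class \<open>ring_1\<close> with
  an explicit scalar multiplication).  Every other algebra occurring below (tensor products,
  subalgebras of \<open>K\<^sub>H\<close>) has a carrier that depends on this data, hence is a record of HOL-Algebra;
  a type is turned into such a record by \<^const>\<open>ring_of_type_algebra\<close>.
  A commutative \<open>k\<close>-algebra \<open>R\<close> is a ring record together with its structure map \<open>k \<rightarrow> R\<close>.
\<close>

section \<open>Tensor products\<close>

text \<open>
  \<open>M \<otimes>\<^sub>R N\<close> is the quotient of the free abelian group on \<open>M \<times> N\<close> by the subgroup generated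
  by the bilinearity relations; its elements are cosets of formal sums.
\<close>

type_synonym ('m, 'n) tensor = "(('m \<times> 'n) \<Rightarrow>\<^sub>0 int) set"

definition tensor_rels ::
  "('r, 'x) ring_scheme \<Rightarrow> ('r, 'm, 'y) module_scheme \<Rightarrow> ('r, 'n, 'z) module_scheme
    \<Rightarrow> (('m \<times> 'n) \<Rightarrow>\<^sub>0 int) set" where
  "tensor_rels R M N =
    {frag_of (m \<oplus>\<^bsub>M\<^esub> m', n) - (frag_of (m, n) + frag_of (m', n)) | m m' n.
      m \<in> carrier M \<and> m' \<in> carrier M \<and> n \<in> carrier N} \<union>
    {frag_of (m, n \<oplus>\<^bsub>N\<^esub> n') - (frag_of (m, n) + frag_of (m, n')) | m n n'.
      m \<in> carrier M \<and> n \<in> carrier N \<and> n' \<in> carrier N} \<union>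
    {frag_of (r \<odot>\<^bsub>M\<^esub> m, n) - frag_of (m, r \<odot>\<^bsub>N\<^esub> n) | r m n.
      r \<in> carrier R \<and> m \<in> carrier M \<and> n \<in> carrier N}"

definition tensor_subgroup ::
  "('r, 'x) ring_scheme \<Rightarrow> ('r, 'm, 'y) module_scheme \<Rightarrow> ('r, 'n, 'z) module_scheme
    \<Rightarrow> (('m \<times> 'n) \<Rightarrow>\<^sub>0 int) set" where
  "tensor_subgroup R M N =
    generate (free_Abelian_group (carrier M \<times> carrier N)) (tensor_rels R M N)"

definition tensor_group ::
  "('r, 'x) ring_scheme \<Rightarrow> ('r, 'm, 'y) module_scheme \<Rightarrow> ('r, 'n, 'z) module_scheme
    \<Rightarrow> ('m, 'n) tensor monoid" where
  "tensor_group R M N =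
    free_Abelian_group (carrier M \<times> carrier N) Mod tensor_subgroup R M N"

definition pure_tensor ::
  "('r, 'x) ring_scheme \<Rightarrow> ('r, 'm, 'y) module_scheme \<Rightarrow> ('r, 'n, 'z) module_scheme
    \<Rightarrow> 'm \<Rightarrow> 'n \<Rightarrow> ('m, 'n) tensor" where
  "pure_tensor R M N m n =
    tensor_subgroup R M N #>\<^bsub>free_Abelian_group (carrier M \<times> carrier N)\<^esub> frag_of (m, n)"

text \<open>
  The additive map \<open>M \<otimes> N \<rightarrow> G\<close>, \<open>m \<otimes> n \<mapsto> f m n\<close>, for a biadditive balanced \<open>f\<close> with values in an
  abelian group \<open>G\<close>, evaluated on any representative of the coset.  \<open>G\<close> is a monoid record, so
  products and powers in \<open>G\<close> stand for sums and integer multiples.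
\<close>

definition tensor_lift ::
  "('v, 'w) monoid_scheme \<Rightarrow> ('m \<Rightarrow> 'n \<Rightarrow> 'v) \<Rightarrow> ('m, 'n) tensor \<Rightarrow> 'v" where
  "tensor_lift G f T =
    (let u = (SOME u. u \<in> T)
     in finprod G (\<lambda>p. f (fst p) (snd p) [^]\<^bsub>G\<^esub> Poly_Mapping.lookup u p) (Poly_Mapping.keys u))"

text \<open>
  The tensor product of two algebras over a commutative ring.  It is also used for mere modules,
  where \<open>mult\<close> and \<open>one\<close> are ignored.
\<close>

definition tensor_product ::
  "('r, 'x) ring_scheme \<Rightarrow> ('r, 'm, 'y) module_scheme \<Rightarrow> ('r, 'n, 'z) module_scheme
    \<Rightarrow> ('r, ('m, 'n) tensor) module" where
  "tensor_product R M N =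
    (let G = tensor_group R M N; t = pure_tensor R M N in
      \<lparr>carrier = carrier G,
       monoid.mult = (\<lambda>S T. tensor_lift G (\<lambda>m n. tensor_lift G (\<lambda>m' n'.
                 t (m \<otimes>\<^bsub>M\<^esub> m') (n \<otimes>\<^bsub>N\<^esub> n')) T) S),
       one = t \<one>\<^bsub>M\<^esub> \<one>\<^bsub>N\<^esub>,
       ring.zero = \<one>\<^bsub>G\<^esub>,
       add = (\<lambda>S T. S \<otimes>\<^bsub>G\<^esub> T),
       module.smult = (\<lambda>r. tensor_lift G (\<lambda>m n. t (r \<odot>\<^bsub>M\<^esub> m) n))\<rparr>)"

section \<open>Change of scalars\<close>

definition ring_as_module ::
  "('r \<Rightarrow> 's) \<Rightarrow> ('s, 'z) ring_scheme \<Rightarrow> ('r, 's) module" where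
  "ring_as_module f S =
    \<lparr>carrier = carrier S, monoid.mult = monoid.mult S, one = \<one>\<^bsub>S\<^esub>, ring.zero = \<zero>\<^bsub>S\<^esub>, add = add S,
     module.smult = (\<lambda>r s. f r \<otimes>\<^bsub>S\<^esub> s)\<rparr>"

definition restrict_scalars ::
  "('r \<Rightarrow> 's) \<Rightarrow> ('s, 'm, 'z) module_scheme \<Rightarrow> ('r, 'm) module" where
  "restrict_scalars f M =
    \<lparr>carrier = carrier M, monoid.mult = monoid.mult M, one = \<one>\<^bsub>M\<^esub>, ring.zero = \<zero>\<^bsub>M\<^esub>, add = add M,
     module.smult = (\<lambda>r m. f r \<odot>\<^bsub>M\<^esub> m)\<rparr>"

text \<open>\<open>S \<otimes>\<^sub>R M\<close> with scalars from \<open>S\<close>, where \<open>S\<close> is an \<open>R\<close>-module via \<open>f : R \<rightarrow> S\<close>.\<close>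

definition extend_scalars ::
  "('r, 'x) ring_scheme \<Rightarrow> ('s, 'y) ring_scheme \<Rightarrow> ('r \<Rightarrow> 's) \<Rightarrow> ('r, 'm, 'z) module_scheme
    \<Rightarrow> ('s, ('s, 'm) tensor) module" where
  "extend_scalars R S f M =
    (let T = tensor_product R (ring_as_module f S) M; t = pure_tensor R (ring_as_module f S) M in
      \<lparr>carrier = carrier T, monoid.mult = monoid.mult T, one = \<one>\<^bsub>T\<^esub>, ring.zero = \<zero>\<^bsub>T\<^esub>, add = add T,
       module.smult = (\<lambda>s. tensor_lift (add_monoid T) (\<lambda>s' m. t (s \<otimes>\<^bsub>S\<^esub> s') m))\<rparr>)"

section \<open>Hopf algebras\<close>

definition hopf_module :: "('k::field \<Rightarrow> 'h::ring_1 \<Rightarrow> 'h) \<Rightarrow> ('k, 'h) module" where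
  "hopf_module scale =
    \<lparr>carrier = UNIV, monoid.mult = (*), one = 1, ring.zero = 0, add = (+), module.smult = scale\<rparr>"

text \<open>
  \<open>sweedler R \<Delta> f x\<close> is the sum \<open>\<Sum> f(x\<^sub>(\<^sub>1\<^sub>), x\<^sub>(\<^sub>2\<^sub>))\<close> formed in (the additive group of) \<open>R\<close>;
  \<open>sweedler3\<close> uses the iterated comultiplication.
\<close>

definition sweedler ::
  "('v, 'w) ring_scheme \<Rightarrow> ('h \<Rightarrow> ('h, 'h) tensor) \<Rightarrow> ('h \<Rightarrow> 'h \<Rightarrow> 'v) \<Rightarrow> 'h \<Rightarrow> 'v" where
  "sweedler R \<Delta> f x = tensor_lift (add_monoid R) f (\<Delta> x)"

definition sweedler3 ::
  "('v, 'w) ring_scheme \<Rightarrow> ('h \<Rightarrow> ('h, 'h) tensor) \<Rightarrow> ('h \<Rightarrow> 'h \<Rightarrow> 'h \<Rightarrow> 'v) \<Rightarrow> 'h \<Rightarrow> 'v" where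
  "sweedler3 R \<Delta> f = sweedler R \<Delta> (\<lambda>x1 x'. sweedler R \<Delta> (\<lambda>x2 x3. f x1 x2 x3) x')"

text \<open>
  Coassociativity is stated in \<open>(H \<otimes> H) \<otimes> H\<close>: the left side is \<open>(\<Delta> \<otimes> id) \<circ> \<Delta>\<close>, the right side
  is \<open>(id \<otimes> \<Delta>) \<circ> \<Delta>\<close> followed by reassociation.
\<close>

locale hopf_algebra = vector_space scale
  for scale :: "'k::field \<Rightarrow> 'h::ring_1 \<Rightarrow> 'h" +
  fixes \<Delta> :: "'h \<Rightarrow> ('h, 'h) tensor" and \<epsilon> :: "'h \<Rightarrow> 'k"
  assumes scale_mult_left: "scale a x * y = scale a (x * y)"
    and scale_mult_right: "x * scale a y = scale a (x * y)"
    and comult_hom: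
      "\<Delta> \<in> ring_hom (hopf_module scale)
        (tensor_product ring_of_type_algebra (hopf_module scale) (hopf_module scale))"
    and comult_scale:
      "\<Delta> (scale a x) =
        a \<odot>\<^bsub>tensor_product ring_of_type_algebra (hopf_module scale) (hopf_module scale)\<^esub> \<Delta> x"
    and counit_linear: "Vector_Spaces.linear scale (*) \<epsilon>"
    and counit_one: "\<epsilon> 1 = 1"
    and counit_mult: "\<epsilon> (x * y) = \<epsilon> x * \<epsilon> y"
    and coassoc:
      "(let H = hopf_module scale; k = ring_of_type_algebra; H2 = tensor_product k H H;
            H3 = tensor_product k H2 H in
        sweedler H3 \<Delta> (\<lambda>x1 x2. pure_tensor k H2 H (\<Delta> x1) x2) x =
        sweedler H3 \<Delta> (\<lambda>x1 x'. sweedler H3 \<Delta> (\<lambda>x2 x3.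
          pure_tensor k H2 H (pure_tensor k H H x1 x2) x3) x') x)"
    and counit_left: "sweedler (hopf_module scale) \<Delta> (\<lambda>x1 x2. scale (\<epsilon> x1) x2) x = x"
    and counit_right: "sweedler (hopf_module scale) \<Delta> (\<lambda>x1 x2. scale (\<epsilon> x2) x1) x = x"
    and antipode:
      "\<exists>S. Vector_Spaces.linear scale scale S \<and>
        (\<forall>x. sweedler (hopf_module scale) \<Delta> (\<lambda>x1 x2. S x1 * x2) x = scale (\<epsilon> x) 1 \<and>
             sweedler (hopf_module scale) \<Delta> (\<lambda>x1 x2. x1 * S x2) x = scale (\<epsilon> x) 1)"

section \<open>Cocycles and twisted algebras\<close>

text \<open>Throughout, \<open>R\<close> is a commutative \<open>k\<close>-algebra with structure map \<open>\<iota> : k \<rightarrow> R\<close>.\<close>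

definition linear_to ::
  "('k::field \<Rightarrow> 'h::ring_1 \<Rightarrow> 'h) \<Rightarrow> ('r, 'z) ring_scheme \<Rightarrow> ('k \<Rightarrow> 'r) \<Rightarrow> ('h \<Rightarrow> 'r) \<Rightarrow> bool" where
  "linear_to scale R \<iota> g \<longleftrightarrow>
    (\<forall>x. g x \<in> carrier R) \<and> (\<forall>x y. g (x + y) = g x \<oplus>\<^bsub>R\<^esub> g y) \<and>
    (\<forall>a x. g (scale a x) = \<iota> a \<otimes>\<^bsub>R\<^esub> g x)"

definition bilinear_to ::
  "('k::field \<Rightarrow> 'h::ring_1 \<Rightarrow> 'h) \<Rightarrow> ('r, 'z) ring_scheme \<Rightarrow> ('k \<Rightarrow> 'r) \<Rightarrow> ('h \<Rightarrow> 'h \<Rightarrow> 'r) \<Rightarrow> bool" where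
  "bilinear_to scale R \<iota> \<alpha> \<longleftrightarrow>
    (\<forall>x. linear_to scale R \<iota> (\<alpha> x)) \<and> (\<forall>y. linear_to scale R \<iota> (\<lambda>x. \<alpha> x y))"

definition two_cocycle ::
  "('k::field \<Rightarrow> 'h::ring_1 \<Rightarrow> 'h) \<Rightarrow> ('h \<Rightarrow> ('h, 'h) tensor) \<Rightarrow> ('r, 'z) ring_scheme \<Rightarrow> ('k \<Rightarrow> 'r)
    \<Rightarrow> ('h \<Rightarrow> 'h \<Rightarrow> 'r) \<Rightarrow> bool" where
  "two_cocycle scale \<Delta> R \<iota> \<alpha> \<longleftrightarrow> bilinear_to scale R \<iota> \<alpha> \<and>
    (\<forall>x y z.
      sweedler R \<Delta> (\<lambda>x1 x2. sweedler R \<Delta> (\<lambda>y1 y2. \<alpha> x1 y1 \<otimes>\<^bsub>R\<^esub> \<alpha> (x2 * y2) z) y) x =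
      sweedler R \<Delta> (\<lambda>y1 y2. sweedler R \<Delta> (\<lambda>z1 z2. \<alpha> y1 z1 \<otimes>\<^bsub>R\<^esub> \<alpha> x (y2 * z2)) z) y)"

definition normalized ::
  "('h::ring_1 \<Rightarrow> 'k::field) \<Rightarrow> ('k \<Rightarrow> 'r) \<Rightarrow> ('h \<Rightarrow> 'h \<Rightarrow> 'r) \<Rightarrow> bool" where
  "normalized \<epsilon> \<iota> \<alpha> \<longleftrightarrow> (\<forall>x. \<alpha> x 1 = \<iota> (\<epsilon> x) \<and> \<alpha> 1 x = \<iota> (\<epsilon> x))"

text \<open>
  Elements of \<open>Hom(H \<otimes> H, R)\<close> are written as bilinear maps on \<open>H \<times> H\<close>; the comultiplication of
  \<open>H \<otimes> H\<close> is \<open>x \<otimes> y \<mapsto> \<Sum> (x\<^sub>(\<^sub>1\<^sub>) \<otimes> y\<^sub>(\<^sub>1\<^sub>)) \<otimes> (x\<^sub>(\<^sub>2\<^sub>) \<otimes> y\<^sub>(\<^sub>2\<^sub>))\<close>, its counit is \<open>\<epsilon> \<otimes> \<epsilon>\<close>.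
\<close>

definition convolution ::
  "('h \<Rightarrow> ('h, 'h) tensor) \<Rightarrow> ('r, 'z) ring_scheme \<Rightarrow> ('h \<Rightarrow> 'h \<Rightarrow> 'r) \<Rightarrow> ('h \<Rightarrow> 'h \<Rightarrow> 'r)
    \<Rightarrow> 'h \<Rightarrow> 'h \<Rightarrow> 'r" where
  "convolution \<Delta> R f g x y =
    sweedler R \<Delta> (\<lambda>x1 x2. sweedler R \<Delta> (\<lambda>y1 y2. f x1 y1 \<otimes>\<^bsub>R\<^esub> g x2 y2) y) x"

definition is_conv_inverse ::
  "('k::field \<Rightarrow> 'h::ring_1 \<Rightarrow> 'h) \<Rightarrow> ('h \<Rightarrow> ('h, 'h) tensor) \<Rightarrow> ('h \<Rightarrow> 'k) \<Rightarrow> ('r, 'z) ring_scheme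
    \<Rightarrow> ('k \<Rightarrow> 'r) \<Rightarrow> ('h \<Rightarrow> 'h \<Rightarrow> 'r) \<Rightarrow> ('h \<Rightarrow> 'h \<Rightarrow> 'r) \<Rightarrow> bool" where
  "is_conv_inverse scale \<Delta> \<epsilon> R \<iota> f g \<longleftrightarrow> bilinear_to scale R \<iota> g \<and>
    (\<forall>x y. convolution \<Delta> R f g x y = \<iota> (\<epsilon> x * \<epsilon> y) \<and> convolution \<Delta> R g f x y = \<iota> (\<epsilon> x * \<epsilon> y))"

definition conv_inverse ::
  "('k::field \<Rightarrow> 'h::ring_1 \<Rightarrow> 'h) \<Rightarrow> ('h \<Rightarrow> ('h, 'h) tensor) \<Rightarrow> ('h \<Rightarrow> 'k) \<Rightarrow> ('r, 'z) ring_scheme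
    \<Rightarrow> ('k \<Rightarrow> 'r) \<Rightarrow> ('h \<Rightarrow> 'h \<Rightarrow> 'r) \<Rightarrow> 'h \<Rightarrow> 'h \<Rightarrow> 'r" where
  "conv_inverse scale \<Delta> \<epsilon> R \<iota> f = (THE g. is_conv_inverse scale \<Delta> \<epsilon> R \<iota> f g)"

definition normalized_invertible_cocycle ::
  "('k::field \<Rightarrow> 'h::ring_1 \<Rightarrow> 'h) \<Rightarrow> ('h \<Rightarrow> ('h, 'h) tensor) \<Rightarrow> ('h \<Rightarrow> 'k) \<Rightarrow> ('r, 'z) ring_scheme
    \<Rightarrow> ('k \<Rightarrow> 'r) \<Rightarrow> ('h \<Rightarrow> 'h \<Rightarrow> 'r) \<Rightarrow> bool" where
  "normalized_invertible_cocycle scale \<Delta> \<epsilon> R \<iota> \<alpha> \<longleftrightarrow>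
    two_cocycle scale \<Delta> R \<iota> \<alpha> \<and> normalized \<epsilon> \<iota> \<alpha> \<and> (\<exists>g. is_conv_inverse scale \<Delta> \<epsilon> R \<iota> \<alpha> g)"

text \<open>
  An \<open>H\<close>-comodule \<open>R\<close>-algebra \<open>A\<close>.  Its coaction takes values in \<open>A \<otimes>\<^sub>k H\<close>, where \<open>A\<close> is a
  \<open>k\<close>-module by restriction of scalars along \<open>\<iota>\<close>.
\<close>

record ('r, 'a, 'h) comodule_algebra = "('r, 'a) module" +
  coact :: "'a \<Rightarrow> ('a, 'h) tensor"

text \<open>
  \<open>R \<otimes> \<^sup>\<alpha>H\<close>.  The unit of the twisted product of an invertible cocycle is \<open>\<alpha>(1,1)\<^sup>-\<^sup>1 \<otimes> 1\<close>: this is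
  \<open>1 \<otimes> 1\<close> if \<open>\<alpha>\<close> is normalized, and it is \<open>t\<^sub>1\<^sup>-\<^sup>1 \<otimes> 1\<close> for the universal cocycle \<open>\<sigma>\<close>, since
  \<open>\<sigma>(1,1) = t\<^sub>1\<close>.
\<close>

definition twisted_algebra ::
  "('k::field \<Rightarrow> 'h::ring_1 \<Rightarrow> 'h) \<Rightarrow> ('h \<Rightarrow> ('h, 'h) tensor) \<Rightarrow> ('r, 'z) ring_scheme \<Rightarrow> ('k \<Rightarrow> 'r)
    \<Rightarrow> ('h \<Rightarrow> 'h \<Rightarrow> 'r) \<Rightarrow> ('r, ('r, 'h) tensor, 'h) comodule_algebra" where
  "twisted_algebra scale \<Delta> R \<iota> \<alpha> =
    (let k = ring_of_type_algebra; H = hopf_module scale;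
         M = extend_scalars k R \<iota> H; t = pure_tensor k (ring_as_module \<iota> R) H;
         MH = tensor_product k (restrict_scalars \<iota> M) H; t' = pure_tensor k (restrict_scalars \<iota> M) H
     in \<lparr>carrier = carrier M,
         monoid.mult = (\<lambda>S T. tensor_lift (add_monoid M) (\<lambda>b x. tensor_lift (add_monoid M) (\<lambda>c y.
           sweedler M \<Delta> (\<lambda>x1 x2. sweedler M \<Delta> (\<lambda>y1 y2.
             t (b \<otimes>\<^bsub>R\<^esub> c \<otimes>\<^bsub>R\<^esub> \<alpha> x1 y1) (x2 * y2)) y) x) T) S),
         one = t (inv\<^bsub>R\<^esub> (\<alpha> 1 1)) 1,
         ring.zero = \<zero>\<^bsub>M\<^esub>, add = add M, module.smult = module.smult M,
         coact = tensor_lift (add_monoid MH) (\<lambda>b x.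
           sweedler MH \<Delta> (\<lambda>x1 x2. t' (t b x1) x2) x)\<rparr>)"

text \<open>
  The comodule algebra \<open>S \<otimes>\<^sub>R A\<close> over \<open>S\<close>, for \<open>f : R \<rightarrow> S\<close>, with coaction
  \<open>s \<otimes> a \<mapsto> \<Sum> (s \<otimes> a\<^sub>(\<^sub>0\<^sub>)) \<otimes> a\<^sub>(\<^sub>1\<^sub>)\<close>.
\<close>

definition base_change ::
  "('k::field \<Rightarrow> 'h::ring_1 \<Rightarrow> 'h) \<Rightarrow> ('r, 'x) ring_scheme \<Rightarrow> ('k \<Rightarrow> 'r)
    \<Rightarrow> ('s, 'y) ring_scheme \<Rightarrow> ('r \<Rightarrow> 's) \<Rightarrow> ('r, 'a, 'h) comodule_algebra
    \<Rightarrow> ('s, ('s, 'a) tensor, 'h) comodule_algebra" where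
  "base_change scale R \<iota> S f A =
    (let k = ring_of_type_algebra; H = hopf_module scale;
         M = extend_scalars R S f A; t = pure_tensor R (ring_as_module f S) A;
         MH = tensor_product k (restrict_scalars (f \<circ> \<iota>) M) H;
         t' = pure_tensor k (restrict_scalars (f \<circ> \<iota>) M) H
     in \<lparr>carrier = carrier M, monoid.mult = monoid.mult M, one = \<one>\<^bsub>M\<^esub>,
         ring.zero = \<zero>\<^bsub>M\<^esub>, add = add M, module.smult = module.smult M,
         coact = tensor_lift (add_monoid MH) (\<lambda>s a.
           tensor_lift (add_monoid MH) (\<lambda>a0 a1. t' (t s a0) a1) (coact A a))\<rparr>)"

definition comodule_algebra_iso ::
  "('k::field \<Rightarrow> 'h::ring_1 \<Rightarrow> 'h) \<Rightarrow> ('r, 'z) ring_scheme \<Rightarrow> ('k \<Rightarrow> 'r)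
    \<Rightarrow> ('r, 'a, 'h) comodule_algebra \<Rightarrow> ('r, 'b, 'h) comodule_algebra \<Rightarrow> ('a \<Rightarrow> 'b) \<Rightarrow> bool" where
  "comodule_algebra_iso scale R \<iota> A B \<Phi> \<longleftrightarrow>
    \<Phi> \<in> ring_iso A B \<and>
    (\<forall>r \<in> carrier R. \<forall>a \<in> carrier A. \<Phi> (r \<odot>\<^bsub>A\<^esub> a) = r \<odot>\<^bsub>B\<^esub> \<Phi> a) \<and>
    (\<forall>a \<in> carrier A. coact B (\<Phi> a) =
      (let k = ring_of_type_algebra; H = hopf_module scale
       in tensor_lift (tensor_group k (restrict_scalars \<iota> B) H)
            (\<lambda>a0 a1. pure_tensor k (restrict_scalars \<iota> B) H (\<Phi> a0) a1) (coact A a)))"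

text \<open>
  \<open>K \<otimes> \<^sup>\<beta>H\<close> is a \<open>K\<close>-form of \<open>\<^sup>\<alpha>H\<close>, witnessed by the field extension \<open>j : K \<rightarrow> L\<close>; \<open>K\<close> is a field
  extension of \<open>k\<close> via \<open>i\<close>.  HOL cannot quantify over the type \<open>L\<close> inside a formula.  As a
  hypothesis, "there is \<open>L\<close> such that ..." is rendered by leaving \<open>L\<close> and \<open>j\<close> universally
  quantified in the theorem.
\<close>

definition is_form_via ::
  "('k::field \<Rightarrow> 'h::ring_1 \<Rightarrow> 'h) \<Rightarrow> ('h \<Rightarrow> ('h, 'h) tensor) \<Rightarrow> ('k \<Rightarrow> 'K::field) \<Rightarrow> ('K \<Rightarrow> 'L::field)
    \<Rightarrow> ('h \<Rightarrow> 'h \<Rightarrow> 'k) \<Rightarrow> ('h \<Rightarrow> 'h \<Rightarrow> 'K) \<Rightarrow> bool" where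
  "is_form_via scale \<Delta> i j \<alpha> \<beta> \<longleftrightarrow>
    (let k = ring_of_type_algebra :: 'k ring; K = ring_of_type_algebra :: 'K ring;
         L = ring_of_type_algebra :: 'L ring
     in j \<in> ring_hom K L \<and>
        (\<exists>\<Phi>. comodule_algebra_iso scale L (j \<circ> i)
          (base_change scale K i L j (twisted_algebra scale \<Delta> K i \<beta>))
          (base_change scale k id L (j \<circ> i) (twisted_algebra scale \<Delta> k id \<alpha>)) \<Phi>))"

section \<open>The universal cocycle\<close>

text \<open>
  The symmetric algebra of the vector space \<open>H\<close>: polynomials over \<open>k\<close> in variables \<open>X\<^sub>h\<close>, \<open>h \<in> H\<close>,
  modulo the ideal making \<open>h \<mapsto> X\<^sub>h\<close> linear.
\<close>

type_synonym ('k, 'h) poly_in = "('h \<Rightarrow>\<^sub>0 nat) \<Rightarrow>\<^sub>0 'k"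

definition poly_const :: "'k::field \<Rightarrow> ('k, 'h) poly_in" where
  "poly_const a = Poly_Mapping.single 0 a"

definition poly_var :: "'h \<Rightarrow> ('k::field, 'h) poly_in" where
  "poly_var h = Poly_Mapping.single (Poly_Mapping.single h 1) 1"

definition sym_ideal :: "('k::field \<Rightarrow> 'h::ring_1 \<Rightarrow> 'h) \<Rightarrow> ('k, 'h) poly_in set" where
  "sym_ideal scale = genideal ring_of_type_algebra
    {poly_var (scale a x + scale b y) - (poly_const a * poly_var x + poly_const b * poly_var y)
      | a b x y. True}"

definition sym_algebra :: "('k::field \<Rightarrow> 'h::ring_1 \<Rightarrow> 'h) \<Rightarrow> ('k, 'h) poly_in set ring" where
  "sym_algebra scale = ring_of_type_algebra Quot sym_ideal scale"

text \<open>
  The field of fractions of a domain \<open>D\<close>; \<open>fraction D a s\<close> is the fraction \<open>a / s\<close>, that is, the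
  equivalence class of \<open>(a, s)\<close>.
\<close>

definition fraction :: "('a, 'z) ring_scheme \<Rightarrow> 'a \<Rightarrow> 'a \<Rightarrow> ('a \<times> 'a) set" where
  "fraction D a s =
    {(b, t). b \<in> carrier D \<and> t \<in> carrier D - {\<zero>\<^bsub>D\<^esub>} \<and> a \<otimes>\<^bsub>D\<^esub> t = b \<otimes>\<^bsub>D\<^esub> s}"

definition fraction_field :: "('a, 'z) ring_scheme \<Rightarrow> ('a \<times> 'a) set ring" where
  "fraction_field D =
    \<lparr>carrier = {fraction D a s | a s. a \<in> carrier D \<and> s \<in> carrier D - {\<zero>\<^bsub>D\<^esub>}},
     monoid.mult = (\<lambda>F G. \<Union>(a, s)\<in>F. \<Union>(b, t)\<in>G. fraction D (a \<otimes>\<^bsub>D\<^esub> b) (s \<otimes>\<^bsub>D\<^esub> t)),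
     one = fraction D \<one>\<^bsub>D\<^esub> \<one>\<^bsub>D\<^esub>,
     ring.zero = fraction D \<zero>\<^bsub>D\<^esub> \<one>\<^bsub>D\<^esub>,
     add = (\<lambda>F G. \<Union>(a, s)\<in>F. \<Union>(b, t)\<in>G.
       fraction D ((a \<otimes>\<^bsub>D\<^esub> t) \<oplus>\<^bsub>D\<^esub> (b \<otimes>\<^bsub>D\<^esub> s)) (s \<otimes>\<^bsub>D\<^esub> t))\<rparr>"

type_synonym ('k, 'h) sym_frac = "(('k, 'h) poly_in set \<times> ('k, 'h) poly_in set) set"

definition KH :: "('k::field \<Rightarrow> 'h::ring_1 \<Rightarrow> 'h) \<Rightarrow> ('k, 'h) sym_frac ring" where
  "KH scale = fraction_field (sym_algebra scale)"

definition KH_of_poly ::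
  "('k::field \<Rightarrow> 'h::ring_1 \<Rightarrow> 'h) \<Rightarrow> ('k, 'h) poly_in \<Rightarrow> ('k, 'h) sym_frac" where
  "KH_of_poly scale p =
    fraction (sym_algebra scale) (sym_ideal scale +>\<^bsub>ring_of_type_algebra\<^esub> p) \<one>\<^bsub>sym_algebra scale\<^esub>"

definition KH_const :: "('k::field \<Rightarrow> 'h::ring_1 \<Rightarrow> 'h) \<Rightarrow> 'k \<Rightarrow> ('k, 'h) sym_frac" where
  "KH_const scale a = KH_of_poly scale (poly_const a)"

definition t_gen :: "('k::field \<Rightarrow> 'h::ring_1 \<Rightarrow> 'h) \<Rightarrow> 'h \<Rightarrow> ('k, 'h) sym_frac" where
  "t_gen scale h = KH_of_poly scale (poly_var h)"

definition t_inv ::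
  "('k::field \<Rightarrow> 'h::ring_1 \<Rightarrow> 'h) \<Rightarrow> ('h \<Rightarrow> ('h, 'h) tensor) \<Rightarrow> ('h \<Rightarrow> 'k) \<Rightarrow> 'h \<Rightarrow> ('k, 'h) sym_frac" where
  "t_inv scale \<Delta> \<epsilon> = (THE g. linear_to scale (KH scale) (KH_const scale) g \<and>
    (\<forall>h. sweedler (KH scale) \<Delta> (\<lambda>h1 h2. t_gen scale h1 \<otimes>\<^bsub>KH scale\<^esub> g h2) h = KH_const scale (\<epsilon> h) \<and>
         sweedler (KH scale) \<Delta> (\<lambda>h1 h2. g h1 \<otimes>\<^bsub>KH scale\<^esub> t_gen scale h2) h = KH_const scale (\<epsilon> h)))"

definition univ_cocycle ::
  "('k::field \<Rightarrow> 'h::ring_1 \<Rightarrow> 'h) \<Rightarrow> ('h \<Rightarrow> ('h, 'h) tensor) \<Rightarrow> ('h \<Rightarrow> 'k) \<Rightarrow> ('h \<Rightarrow> 'h \<Rightarrow> 'k)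
    \<Rightarrow> 'h \<Rightarrow> 'h \<Rightarrow> ('k, 'h) sym_frac" where
  "univ_cocycle scale \<Delta> \<epsilon> \<alpha> x y =
    sweedler3 (KH scale) \<Delta> (\<lambda>x1 x2 x3. sweedler3 (KH scale) \<Delta> (\<lambda>y1 y2 y3.
      t_gen scale x1 \<otimes>\<^bsub>KH scale\<^esub> t_gen scale y1 \<otimes>\<^bsub>KH scale\<^esub> KH_const scale (\<alpha> x2 y2)
        \<otimes>\<^bsub>KH scale\<^esub> t_inv scale \<Delta> \<epsilon> (x3 * y3)) y) x"

definition univ_cocycle_inv ::
  "('k::field \<Rightarrow> 'h::ring_1 \<Rightarrow> 'h) \<Rightarrow> ('h \<Rightarrow> ('h, 'h) tensor) \<Rightarrow> ('h \<Rightarrow> 'k) \<Rightarrow> ('h \<Rightarrow> 'h \<Rightarrow> 'k)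
    \<Rightarrow> 'h \<Rightarrow> 'h \<Rightarrow> ('k, 'h) sym_frac" where
  "univ_cocycle_inv scale \<Delta> \<epsilon> \<alpha> x y =
    sweedler3 (KH scale) \<Delta> (\<lambda>x1 x2 x3. sweedler3 (KH scale) \<Delta> (\<lambda>y1 y2 y3.
      t_gen scale (x1 * y1)
        \<otimes>\<^bsub>KH scale\<^esub> KH_const scale (conv_inverse scale \<Delta> \<epsilon> ring_of_type_algebra id \<alpha> x2 y2)
        \<otimes>\<^bsub>KH scale\<^esub> t_inv scale \<Delta> \<epsilon> x3 \<otimes>\<^bsub>KH scale\<^esub> t_inv scale \<Delta> \<epsilon> y3) y) x"

text \<open>\<open>\<B>\<^sub>H\<^sup>\<alpha>\<close> and \<open>\<A>\<^sub>H\<^sup>\<alpha>\<close>.  The structure map \<open>k \<rightarrow> \<B>\<^sub>H\<^sup>\<alpha>\<close> is \<^const>\<open>KH_const\<close>.\<close>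

definition BH ::
  "('k::field \<Rightarrow> 'h::ring_1 \<Rightarrow> 'h) \<Rightarrow> ('h \<Rightarrow> ('h, 'h) tensor) \<Rightarrow> ('h \<Rightarrow> 'k) \<Rightarrow> ('h \<Rightarrow> 'h \<Rightarrow> 'k)
    \<Rightarrow> ('k, 'h) sym_frac ring" where
  "BH scale \<Delta> \<epsilon> \<alpha> = (KH scale)\<lparr>carrier := generate_ring (KH scale)
    (range (KH_const scale) \<union> {univ_cocycle scale \<Delta> \<epsilon> \<alpha> x y | x y. True}
      \<union> {univ_cocycle_inv scale \<Delta> \<epsilon> \<alpha> x y | x y. True})\<rparr>"

definition AH ::
  "('k::field \<Rightarrow> 'h::ring_1 \<Rightarrow> 'h) \<Rightarrow> ('h \<Rightarrow> ('h, 'h) tensor) \<Rightarrow> ('h \<Rightarrow> 'k) \<Rightarrow> ('h \<Rightarrow> 'h \<Rightarrow> 'k)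
    \<Rightarrow> (('k, 'h) sym_frac, (('k, 'h) sym_frac, 'h) tensor, 'h) comodule_algebra" where
  "AH scale \<Delta> \<epsilon> \<alpha> =
    twisted_algebra scale \<Delta> (BH scale \<Delta> \<epsilon> \<alpha>) (KH_const scale) (univ_cocycle scale \<Delta> \<epsilon> \<alpha>)"

end

theory Submission
  imports "Jordan_Normal_Form.Determinant" Defs "HOL-Computational_Algebra.Fraction_Field"
begin

text \<open>
  The form isomorphism over \<open>L\<close> is an isomorphism of twisted algebras \<open>L \<otimes> \<^sup>\<beta>H \<cong> L \<otimes> \<^sup>\<alpha>H\<close>, and a
  colinear map between twisted algebras is \<open>1 \<otimes> x \<mapsto> \<Sum> m(x\<^sub>(\<^sub>1\<^sub>)) \<otimes> x\<^sub>(\<^sub>2\<^sub>)\<close> for a linear map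
  \<open>m : H \<rightarrow> L\<close>.  Bijectivity makes \<open>m\<close> invertible for convolution and multiplicativity says that
  \<open>\<beta>(x, y) = \<Sum> m(x\<^sub>(\<^sub>1\<^sub>)) m(y\<^sub>(\<^sub>1\<^sub>)) \<alpha>(x\<^sub>(\<^sub>2\<^sub>), y\<^sub>(\<^sub>2\<^sub>)) m\<^sup>-\<^sup>1(x\<^sub>(\<^sub>3\<^sub>) y\<^sub>(\<^sub>3\<^sub>))\<close>.  This is the value of \<open>\<sigma>\<close> under
  the specialisation \<open>t\<^sub>h \<mapsto> m(h)\<close>, which is defined on all of \<open>\<B>\<^sub>H\<^sup>\<alpha>\<close>: every \<open>t\<^sup>-\<^sup>1\<^sub>h\<close> is a polynomial
  in the \<open>t\<^sub>h\<close> divided by \<open>det (t(d\<^sub>i\<^sub>j))\<close> for a matrix \<open>d\<close> of coefficients of a finite-dimensional coideal,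
  and \<open>det (m(d\<^sub>i\<^sub>j)) \<noteq> 0\<close> because the matrix \<open>(m\<^sup>-\<^sup>1(d\<^sub>i\<^sub>j))\<close> is inverse to \<open>(m(d\<^sub>i\<^sub>j))\<close>.  Hence the
  specialisation maps \<open>\<sigma>\<close> and \<open>\<sigma>\<^sup>-\<^sup>1\<close> to \<open>\<beta>\<close> and \<open>\<beta>\<^sup>-\<^sup>1\<close>, so it sends \<open>\<B>\<^sub>H\<^sup>\<alpha>\<close> into \<open>K\<close>, and base change of
  a twisted algebra is the twisted algebra of the image cocycle.
\<close>

section \<open>Tensor products\<close>

text \<open>Tensor products are quotients carried by records, and \<open>tensor_lift\<close>
  evaluates an arbitrary representative. So every map out of a tensor product has to be shown
  balanced before it can be computed, and identities are obtained as equalities of additive maps on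
  pure tensors. With values in a field, a Sweedler sum is replaced by a finite sum over a chosen
  presentation of \<Delta> x, so that sums can be swapped. \<open>K\<^sub>H\<close> is a record as
  well; it is embedded in the fraction field of a polynomial ring, a type of class
  \<open>field\<close>, and convolutions are computed there. The map
  \<open>t\<^sup>-\<^sup>1\<close> enters as a definite description. The determinants that are
  nonzero at m also serve to construct it, coideal by coideal, and uniqueness glues the pieces.
  Their nonvanishing comes from a one-sided relation between the functionals of the isomorphism and
  of its inverse; the two-sided convolution inverse of m is afterwards obtained as the
  specialisation of \<open>t\<^sup>-\<^sup>1\<close>. The point m has coordinates in L, so the
  specialisation is a map to L; it factors through the embedding j of K because its values on the
  generators do.\<close>

lemma carrier_add_monoid [simp]: "carrier (add_monoid R) = carrier R"
  and mult_add_monoid [simp]: "monoid.mult (add_monoid R) = add R"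
  and one_add_monoid [simp]: "\<one>\<^bsub>add_monoid R\<^esub> = \<zero>\<^bsub>R\<^esub>"
  by simp_all

definition balanced_map ::
  "('r, 'x) ring_scheme \<Rightarrow> ('r, 'm, 'y) module_scheme \<Rightarrow> ('r, 'n, 'z) module_scheme
    \<Rightarrow> ('v, 'w) monoid_scheme \<Rightarrow> ('m \<Rightarrow> 'n \<Rightarrow> 'v) \<Rightarrow> bool" where
  "balanced_map R M N G f \<longleftrightarrow>
    (\<forall>n\<in>carrier N. (\<lambda>m. f m n) \<in> hom (add_monoid M) G) \<and>
    (\<forall>m\<in>carrier M. (\<lambda>n. f m n) \<in> hom (add_monoid N) G) \<and>
    (\<forall>r\<in>carrier R. \<forall>m\<in>carrier M. \<forall>n\<in>carrier N. f (r \<odot>\<^bsub>M\<^esub> m) n = f m (r \<odot>\<^bsub>N\<^esub> n))"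

lemma balanced_mapD:
  assumes "balanced_map R M N G f"
  shows "n \<in> carrier N \<Longrightarrow> (\<lambda>m. f m n) \<in> hom (add_monoid M) G"
    and "m \<in> carrier M \<Longrightarrow> (\<lambda>n. f m n) \<in> hom (add_monoid N) G"
    and "r \<in> carrier R \<Longrightarrow> m \<in> carrier M \<Longrightarrow> n \<in> carrier N \<Longrightarrow> f (r \<odot>\<^bsub>M\<^esub> m) n = f m (r \<odot>\<^bsub>N\<^esub> n)"
    and "m \<in> carrier M \<Longrightarrow> n \<in> carrier N \<Longrightarrow> f m n \<in> carrier G"
  using assms by (auto simp: balanced_map_def hom_def)

lemma hom_add:
  assumes "h \<in> hom (add_monoid A) G" "x \<in> carrier A" "y \<in> carrier A"
  shows "h (add A x y) = monoid.mult G (h x) (h y)"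
  using assms by (simp add: hom_def)

text \<open>What \<open>tensor_lift\<close> does once a representative is chosen. Separating it from
  the choice turns well-definedness into the statement that this homomorphism on formal sums kills
  the bilinearity relations.\<close>

definition frag_eval ::
  "('v, 'w) monoid_scheme \<Rightarrow> ('m \<Rightarrow> 'n \<Rightarrow> 'v) \<Rightarrow> (('m \<times> 'n) \<Rightarrow>\<^sub>0 int) \<Rightarrow> 'v" where
  "frag_eval G f u =
    finprod G (\<lambda>p. f (fst p) (snd p) [^]\<^bsub>G\<^esub> Poly_Mapping.lookup u p) (Poly_Mapping.keys u)"

lemma tensor_lift_frag_eval: "tensor_lift G f T = frag_eval G f (SOME u. u \<in> T)"
  by (simp add: tensor_lift_def frag_eval_def Let_def)

text \<open>The index set of \<open>frag_eval\<close> is the support of the formal sum, which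
  changes under addition. Passing to \<open>gfinprod\<close> over all of \<open>S\<close>, where
  only finitely many factors differ from the unit, makes multiplicativity a factorwise
  statement.\<close>

lemma (in comm_group) frag_eval_hom:
  fixes f :: "'m \<Rightarrow> 'n \<Rightarrow> 'a"
  assumes f: "\<And>m n. (m, n) \<in> S \<Longrightarrow> f m n \<in> carrier G"
  shows "frag_eval G f \<in> hom (free_Abelian_group S) G"
    and "(m, n) \<in> S \<Longrightarrow> frag_eval G f (frag_of (m, n)) = f m n"
proof -
  define h where "h = (\<lambda>u :: 'm \<times> 'n \<Rightarrow>\<^sub>0 int. gfinprod G (\<lambda>p. f (fst p) (snd p) [^] Poly_Mapping.lookup u p) S)"
  have fin: "Poly_Mapping.keys u \<subseteq> S \<Longrightarrow>
      finite {p \<in> S. f (fst p) (snd p) [^] Poly_Mapping.lookup u p \<noteq> \<one>}" for u :: "_ \<Rightarrow>\<^sub>0 int"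
    by (rule finite_subset[OF _ finite_keys[of u]]) (auto simp: in_keys_iff intro: ccontr)
  have cl: "p \<in> S \<Longrightarrow> f (fst p) (snd p) \<in> carrier G" for p
    using f[of "fst p" "snd p"] by simp
  have eq: "frag_eval G f u = h u" if u: "Poly_Mapping.keys u \<subseteq> S" for u
  proof -
    have "frag_eval G f u = gfinprod G (\<lambda>p. f (fst p) (snd p) [^] Poly_Mapping.lookup u p) (Poly_Mapping.keys u)"
      unfolding frag_eval_def using u cl by (subst gfinprod_eq_finprod) auto
    also have "\<dots> = h u"
      unfolding h_def using u cl
      by (intro gfinprod_mono_neutral_cong_left) (auto simp: in_keys_iff)
    finally show ?thesis .
  qed
  show "frag_eval G f \<in> hom (free_Abelian_group S) G"
  proof (rule homI)
    fix x y :: "'m \<times> 'n \<Rightarrow>\<^sub>0 int"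
    assume xy: "x \<in> carrier (free_Abelian_group S)" "y \<in> carrier (free_Abelian_group S)"
    then have k: "Poly_Mapping.keys x \<subseteq> S" "Poly_Mapping.keys y \<subseteq> S"
      by auto
    then have kk: "Poly_Mapping.keys (x + y) \<subseteq> S"
      using keys_add[of x y] by blast
    have "h (x + y) = gfinprod G (\<lambda>p. f (fst p) (snd p) [^] Poly_Mapping.lookup x p \<otimes>
        f (fst p) (snd p) [^] Poly_Mapping.lookup y p) S"
      unfolding h_def using cl by (intro gfinprod_cong) (auto simp: lookup_add int_pow_mult simp_implies_def)
    also have "\<dots> = h x \<otimes> h y"
      unfolding h_def using cl by (intro gfinprod_distrib fin k) auto
    finally show "frag_eval G f (x \<otimes>\<^bsub>free_Abelian_group S\<^esub> y) = frag_eval G f x \<otimes> frag_eval G f y"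
      using k kk by (simp add: eq)
  next
    fix x :: "_ \<Rightarrow>\<^sub>0 int" assume "x \<in> carrier (free_Abelian_group S)"
    then have k: "Poly_Mapping.keys x \<subseteq> S"
      by auto
    show "frag_eval G f x \<in> carrier G"
      unfolding eq[OF k] h_def using cl by (intro gfinprod_closed) auto
  qed
  show "frag_eval G f (frag_of (m, n)) = f m n" if "(m, n) \<in> S"
    unfolding frag_eval_def using f[OF that]
    by simp
qed

section \<open>The universal property of the tensor product\<close>

locale tensor_modules =
  fixes R :: "('r, 'x) ring_scheme" and M :: "('r, 'm, 'y) module_scheme"
    and N :: "('r, 'n, 'z) module_scheme"
  assumes M: "abelian_group M" and N: "abelian_group N"
    and smultM: "r \<in> carrier R \<Longrightarrow> m \<in> carrier M \<Longrightarrow> r \<odot>\<^bsub>M\<^esub> m \<in> carrier M"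
    and smultN: "r \<in> carrier R \<Longrightarrow> n \<in> carrier N \<Longrightarrow> r \<odot>\<^bsub>N\<^esub> n \<in> carrier N"
begin

sublocale M: abelian_group M by (rule M)
sublocale N: abelian_group N by (rule N)

lemma rels_carrier: "tensor_rels R M N \<subseteq> carrier (free_Abelian_group (carrier M \<times> carrier N))"
proof -
  have *: "frag_of p - (frag_of q + frag_of r) \<in> carrier (free_Abelian_group S)"
    "frag_of p - frag_of q \<in> carrier (free_Abelian_group S)"
    if "p \<in> S" "q \<in> S" "r \<in> S" for p q r :: "'m \<times> 'n" and S
    using that keys_diff[of "frag_of p" "frag_of q + frag_of r"] keys_add[of "frag_of q" "frag_of r"]
      keys_diff[of "frag_of p" "frag_of q"]
    by auto
  show ?thesis
    unfolding tensor_rels_def using smultM smultN by (auto intro!: * simp del: carrier_free_Abelian_group_iff)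
qed

lemma subgroup_tensor:
  "subgroup (tensor_subgroup R M N) (free_Abelian_group (carrier M \<times> carrier N))"
  unfolding tensor_subgroup_def
  by (rule group.generate_is_subgroup[OF group_free_Abelian_group rels_carrier])

lemma rel_in_subgroup: "u \<in> tensor_rels R M N \<Longrightarrow> u \<in> tensor_subgroup R M N"
  unfolding tensor_subgroup_def by (rule generate.incl)

lemma normal_tensor: "tensor_subgroup R M N \<lhd> free_Abelian_group (carrier M \<times> carrier N)"
  by (rule comm_group.subgroup_imp_normal[OF abelian_free_Abelian_group subgroup_tensor])

sublocale T: comm_group "tensor_group R M N"
  unfolding tensor_group_def
  by (rule comm_group.abelian_FactGroup[OF abelian_free_Abelian_group subgroup_tensor])

abbreviation "cosetT \<equiv> r_coset (free_Abelian_group (carrier M \<times> carrier N)) (tensor_subgroup R M N)"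

lemma coset_hom: "cosetT \<in> hom (free_Abelian_group (carrier M \<times> carrier N)) (tensor_group R M N)"
  unfolding tensor_group_def by (rule normal.r_coset_hom_Mod[OF normal_tensor])

lemma carrier_tensor: "carrier (tensor_group R M N) = cosetT ` carrier (free_Abelian_group (carrier M \<times> carrier N))"
  unfolding tensor_group_def by (rule carrier_FactGroup)

lemma pure_closed: "m \<in> carrier M \<Longrightarrow> n \<in> carrier N \<Longrightarrow> pure_tensor R M N m n \<in> carrier (tensor_group R M N)"
  unfolding pure_tensor_def carrier_tensor by (rule imageI) simp

lemma coset_eq:
  assumes "u \<in> carrier (free_Abelian_group (carrier M \<times> carrier N))"
    "v \<in> carrier (free_Abelian_group (carrier M \<times> carrier N))" "u - v \<in> tensor_subgroup R M N"
  shows "cosetT u = cosetT v"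
proof -
  let ?F = "free_Abelian_group (carrier M \<times> carrier N)"
  interpret F: comm_group ?F by (rule abelian_free_Abelian_group)
  have "u \<in> cosetT v"
    using assms(3) by (auto simp: r_coset_def intro!: bexI[of _ "u - v"])
  then show ?thesis
    using F.repr_independence[OF _ _ subgroup_tensor] assms(2) by metis
qed

lemma pure_add_left:
  assumes "m \<in> carrier M" "m' \<in> carrier M" "n \<in> carrier N"
  shows "pure_tensor R M N (m \<oplus>\<^bsub>M\<^esub> m') n =
    pure_tensor R M N m n \<otimes>\<^bsub>tensor_group R M N\<^esub> pure_tensor R M N m' n"
proof -
  have c: "frag_of (m, n) \<otimes>\<^bsub>free_Abelian_group (carrier M \<times> carrier N)\<^esub> frag_of (m', n) \<in>
      carrier (free_Abelian_group (carrier M \<times> carrier N))"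
    using assms keys_add[of "frag_of (m, n)" "frag_of (m', n)"] by auto
  have "pure_tensor R M N (m \<oplus>\<^bsub>M\<^esub> m') n =
      cosetT (frag_of (m, n) \<otimes>\<^bsub>free_Abelian_group (carrier M \<times> carrier N)\<^esub> frag_of (m', n))"
    unfolding pure_tensor_def
    by (rule coset_eq[OF _ c], use assms in simp) (rule rel_in_subgroup, use assms in \<open>auto simp: tensor_rels_def\<close>)
  also have "\<dots> = pure_tensor R M N m n \<otimes>\<^bsub>tensor_group R M N\<^esub> pure_tensor R M N m' n"
    unfolding pure_tensor_def using assms by (intro hom_mult[OF coset_hom]) simp_all
  finally show ?thesis .
qed

lemma pure_add_right:
  assumes "m \<in> carrier M" "n \<in> carrier N" "n' \<in> carrier N"
  shows "pure_tensor R M N m (n \<oplus>\<^bsub>N\<^esub> n') =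
    pure_tensor R M N m n \<otimes>\<^bsub>tensor_group R M N\<^esub> pure_tensor R M N m n'"
proof -
  have c: "frag_of (m, n) \<otimes>\<^bsub>free_Abelian_group (carrier M \<times> carrier N)\<^esub> frag_of (m, n') \<in>
      carrier (free_Abelian_group (carrier M \<times> carrier N))"
    using assms keys_add[of "frag_of (m, n)" "frag_of (m, n')"] by auto
  have "pure_tensor R M N m (n \<oplus>\<^bsub>N\<^esub> n') =
      cosetT (frag_of (m, n) \<otimes>\<^bsub>free_Abelian_group (carrier M \<times> carrier N)\<^esub> frag_of (m, n'))"
    unfolding pure_tensor_def
    by (rule coset_eq[OF _ c], use assms in simp) (rule rel_in_subgroup, use assms in \<open>auto simp: tensor_rels_def\<close>)
  also have "\<dots> = pure_tensor R M N m n \<otimes>\<^bsub>tensor_group R M N\<^esub> pure_tensor R M N m n'"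
    unfolding pure_tensor_def using assms by (intro hom_mult[OF coset_hom]) simp_all
  finally show ?thesis .
qed

lemma pure_smult:
  assumes "r \<in> carrier R" "m \<in> carrier M" "n \<in> carrier N"
  shows "pure_tensor R M N (r \<odot>\<^bsub>M\<^esub> m) n = pure_tensor R M N m (r \<odot>\<^bsub>N\<^esub> n)"
  unfolding pure_tensor_def
  by (rule coset_eq)
    (use assms smultM smultN in \<open>auto intro!: rel_in_subgroup simp: tensor_rels_def\<close>)

text \<open>Since \<open>f\<close> is balanced, the kernel of \<open>frag_eval G f\<close> contains
  the three kinds of relations, hence the subgroup that they generate; the choice of a
  representative therefore does not affect the value.\<close>

lemma tensor_lift_coset:
  assumes "comm_group G" and f: "balanced_map R M N G f"
    and u: "u \<in> carrier (free_Abelian_group (carrier M \<times> carrier N))"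
  shows "tensor_lift G f (cosetT u) = frag_eval G f u"
proof -
  let ?F = "free_Abelian_group (carrier M \<times> carrier N)"
  interpret G: comm_group G by fact
  interpret F: comm_group ?F by (rule abelian_free_Abelian_group)
  have fc: "(m, n) \<in> carrier M \<times> carrier N \<Longrightarrow> f m n \<in> carrier G" for m n
    using balanced_mapD(4)[OF f] by blast
  have ev: "frag_eval G f \<in> hom ?F G"
    and ev1: "m \<in> carrier M \<Longrightarrow> n \<in> carrier N \<Longrightarrow> frag_eval G f (frag_of (m, n)) = f m n" for m n
    by (rule G.frag_eval_hom[OF fc]; blast)+
  interpret h: group_hom ?F G "frag_eval G f"
    by unfold_locales (rule ev)
  have diff: "frag_eval G f (a - b) = frag_eval G f a \<otimes>\<^bsub>G\<^esub> inv\<^bsub>G\<^esub> frag_eval G f b"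
    if "a \<in> carrier ?F" "b \<in> carrier ?F" for a b
    using h.hom_mult[OF that(1) F.inv_closed[OF that(2)]] h.hom_inv[OF that(2)] that by simp
  have add: "frag_eval G f (a + b) = frag_eval G f a \<otimes>\<^bsub>G\<^esub> frag_eval G f b"
    "a + b \<in> carrier ?F"
    if "a \<in> carrier ?F" "b \<in> carrier ?F" for a b
    using h.hom_mult[OF that] F.m_closed[OF that] by simp_all
  have rels: "frag_eval G f w = \<one>\<^bsub>G\<^esub>" if "w \<in> tensor_rels R M N" for w
  proof -
    from that consider
      (1) m m' n where "w = frag_of (m \<oplus>\<^bsub>M\<^esub> m', n) - (frag_of (m, n) + frag_of (m', n))"
        "m \<in> carrier M" "m' \<in> carrier M" "n \<in> carrier N"
      | (2) m n n' where "w = frag_of (m, n \<oplus>\<^bsub>N\<^esub> n') - (frag_of (m, n) + frag_of (m, n'))"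
        "m \<in> carrier M" "n \<in> carrier N" "n' \<in> carrier N"
      | (3) r m n where "w = frag_of (r \<odot>\<^bsub>M\<^esub> m, n) - frag_of (m, r \<odot>\<^bsub>N\<^esub> n)"
        "r \<in> carrier R" "m \<in> carrier M" "n \<in> carrier N"
      unfolding tensor_rels_def by blast
    then show ?thesis
    proof cases
      case 1
      then show ?thesis
        using hom_add[OF balanced_mapD(1)[OF f]] balanced_mapD(4)[OF f]
        by (simp add: diff add ev1 del: carrier_free_Abelian_group_iff)
    next
      case 2
      then show ?thesis
        using hom_add[OF balanced_mapD(2)[OF f]] balanced_mapD(4)[OF f]
        by (simp add: diff add ev1 del: carrier_free_Abelian_group_iff)
    next
      case 3
      then show ?thesis
        using balanced_mapD(3,4)[OF f] smultM smultN
        by (simp add: diff ev1 del: carrier_free_Abelian_group_iff)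
    qed
  qed
  have ker: "frag_eval G f w = \<one>\<^bsub>G\<^esub>" if "w \<in> tensor_subgroup R M N" for w
  proof -
    have "tensor_rels R M N \<subseteq> kernel ?F G (frag_eval G f)"
      using rels rels_carrier unfolding kernel_def by blast
    then have "tensor_subgroup R M N \<subseteq> kernel ?F G (frag_eval G f)"
      unfolding tensor_subgroup_def
      by (rule F.generate_subgroup_incl) (rule h.subgroup_kernel)
    then show ?thesis
      using that by (auto simp: kernel_def)
  qed
  \<comment> \<open>The representative picked by \<open>tensor_lift\<close> differs from
    \<open>u\<close> by an element of the subgroup of relations.\<close>
  have "(SOME v. v \<in> cosetT u) \<in> cosetT u"
    using F.rcos_self[OF u subgroup_tensor] by (rule someI)
  then obtain w where w: "w \<in> tensor_subgroup R M N" "(SOME v. v \<in> cosetT u) = w + u"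
    by (auto simp: r_coset_def)
  have wc: "w \<in> carrier ?F"
    using w(1) subgroup.mem_carrier[OF subgroup_tensor] by blast
  show ?thesis
    unfolding tensor_lift_frag_eval w(2) using add[OF wc u] ker[OF w(1)] h.hom_closed[OF u] by simp
qed

lemma tensor_lift_hom:
  assumes "comm_group G" and f: "balanced_map R M N G f"
  shows "tensor_lift G f \<in> hom (tensor_group R M N) G"
proof (rule homI)
  let ?F = "free_Abelian_group (carrier M \<times> carrier N)"
  interpret G: comm_group G by fact
  interpret F: comm_group ?F by (rule abelian_free_Abelian_group)
  have fc: "(m, n) \<in> carrier M \<times> carrier N \<Longrightarrow> f m n \<in> carrier G" for m n
    using balanced_mapD(4)[OF f] by blast
  have ev: "frag_eval G f \<in> hom ?F G"
    by (rule G.frag_eval_hom(1)[OF fc])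
  fix S T assume "S \<in> carrier (tensor_group R M N)" "T \<in> carrier (tensor_group R M N)"
  then obtain u v where u: "u \<in> carrier ?F" "S = cosetT u" and v: "v \<in> carrier ?F" "T = cosetT v"
    unfolding carrier_tensor by blast
  have "tensor_lift G f (S \<otimes>\<^bsub>tensor_group R M N\<^esub> T) = tensor_lift G f (cosetT (u \<otimes>\<^bsub>?F\<^esub> v))"
    unfolding u v by (simp only: hom_mult[OF coset_hom u(1) v(1)])
  also have "\<dots> = tensor_lift G f S \<otimes>\<^bsub>G\<^esub> tensor_lift G f T"
    unfolding u(2) v(2) tensor_lift_coset[OF assms u(1)] tensor_lift_coset[OF assms v(1)]
      tensor_lift_coset[OF assms F.m_closed[OF u(1) v(1)]]
    by (rule hom_mult[OF ev u(1) v(1)])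
  finally show "tensor_lift G f (S \<otimes>\<^bsub>tensor_group R M N\<^esub> T) = tensor_lift G f S \<otimes>\<^bsub>G\<^esub> tensor_lift G f T" .
next
  let ?F = "free_Abelian_group (carrier M \<times> carrier N)"
  interpret G: comm_group G by fact
  have fc: "(m, n) \<in> carrier M \<times> carrier N \<Longrightarrow> f m n \<in> carrier G" for m n
    using balanced_mapD(4)[OF f] by blast
  have ev: "frag_eval G f \<in> hom ?F G"
    by (rule G.frag_eval_hom(1)[OF fc])
  fix S assume "S \<in> carrier (tensor_group R M N)"
  then obtain u where u: "u \<in> carrier ?F" "S = cosetT u"
    unfolding carrier_tensor by blast
  show "tensor_lift G f S \<in> carrier G"
    unfolding u(2) tensor_lift_coset[OF assms u(1)] by (rule hom_in_carrier[OF ev u(1)])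
qed

lemma tensor_lift_pure:
  assumes "comm_group G" "balanced_map R M N G f" "m \<in> carrier M" "n \<in> carrier N"
  shows "tensor_lift G f (pure_tensor R M N m n) = f m n"
proof -
  interpret G: comm_group G by fact
  have fc: "(m, n) \<in> carrier M \<times> carrier N \<Longrightarrow> f m n \<in> carrier G" for m n
    using balanced_mapD(4)[OF assms(2)] by blast
  show ?thesis
    unfolding pure_tensor_def using assms(3,4)
    by (subst tensor_lift_coset[OF assms(1,2)]) (simp, rule G.frag_eval_hom(2)[where S = "carrier M \<times> carrier N"], rule fc, simp_all)
qed

text \<open>Inherited from the induction on formal sums, which builds them by differences; this is
  why the closure case is a difference and not a sum.\<close>

lemma tensor_induct [consumes 1, case_names one pure diff]:
  assumes "T \<in> carrier (tensor_group R M N)"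
    and one: "P \<one>\<^bsub>tensor_group R M N\<^esub>"
    and pure: "\<And>m n. m \<in> carrier M \<Longrightarrow> n \<in> carrier N \<Longrightarrow> P (pure_tensor R M N m n)"
    and diff: "\<And>S T. S \<in> carrier (tensor_group R M N) \<Longrightarrow> T \<in> carrier (tensor_group R M N) \<Longrightarrow>
      P S \<Longrightarrow> P T \<Longrightarrow> P (S \<otimes>\<^bsub>tensor_group R M N\<^esub> inv\<^bsub>tensor_group R M N\<^esub> T)"
  shows "P T"
proof -
  let ?F = "free_Abelian_group (carrier M \<times> carrier N)"
  interpret F: comm_group ?F by (rule abelian_free_Abelian_group)
  interpret h: group_hom ?F "tensor_group R M N" cosetT
    by (intro group_hom.intro group_hom_axioms.intro F.is_group T.is_group coset_hom)
  obtain u where u: "u \<in> carrier ?F" "T = cosetT u"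
    using assms(1) unfolding carrier_tensor by blast
  from u(1) have "Poly_Mapping.keys u \<subseteq> carrier M \<times> carrier N"
    by (simp only: carrier_free_Abelian_group_iff)
  then have "P (cosetT u)"
  proof (induction u rule: free_Abelian_group_induct[where S = "carrier M \<times> carrier N",
        consumes 1, case_names zero diff frag])
    case zero
    show ?case
      using one h.hom_one by (simp only: one_free_Abelian_group)
  next
    case (diff x y)
    have xy: "x \<in> carrier ?F" "y \<in> carrier ?F"
      using diff.hyps by simp_all
    have "inv\<^bsub>?F\<^esub> y = - y"
      by (rule inv_free_Abelian_group) (rule diff.hyps(2))
    then have "x - y = x \<otimes>\<^bsub>?F\<^esub> inv\<^bsub>?F\<^esub> y"
      unfolding mult_free_Abelian_group by (metis diff_conv_add_uminus)
    then have eq: "cosetT (x - y) = cosetT (x \<otimes>\<^bsub>?F\<^esub> inv\<^bsub>?F\<^esub> y)"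
      by (rule arg_cong)
    also have "\<dots> = cosetT x \<otimes>\<^bsub>tensor_group R M N\<^esub> cosetT (inv\<^bsub>?F\<^esub> y)"
      by (rule h.hom_mult[OF xy(1) F.inv_closed[OF xy(2)]])
    also have "cosetT (inv\<^bsub>?F\<^esub> y) = inv\<^bsub>tensor_group R M N\<^esub> cosetT y"
      by (rule h.hom_inv[OF xy(2)])
    finally show ?case
      using assms(4)[OF h.hom_closed[OF xy(1)] h.hom_closed[OF xy(2)] diff.IH] by (rule ssubst)
  next
    case (frag p)
    obtain m n where p: "p = (m, n)" by (cases p)
    show ?case
      using pure[of m n] frag unfolding p pure_tensor_def by blast
  qed
  then show ?thesis
    by (simp only: u(2))
qed

lemma tensor_hom_eqI:
  assumes "group G" and h: "h \<in> hom (tensor_group R M N) G" "h' \<in> hom (tensor_group R M N) G"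
    and eq: "\<And>m n. m \<in> carrier M \<Longrightarrow> n \<in> carrier N \<Longrightarrow>
      h (pure_tensor R M N m n) = h' (pure_tensor R M N m n)"
    and T: "T \<in> carrier (tensor_group R M N)"
  shows "h T = h' T"
proof -
  interpret G: group G by fact
  have gh: "group_hom (tensor_group R M N) G h" "group_hom (tensor_group R M N) G h'"
    by (intro group_hom.intro group_hom_axioms.intro G.is_group T.is_group h)+
  show ?thesis
    using T
  proof (induction rule: tensor_induct)
    case one
    show ?case
      unfolding group_hom.hom_one[OF gh(1)] group_hom.hom_one[OF gh(2)] by (rule refl)
  next
    case (pure m n)
    then show ?case
      by (rule eq)
  next
    case (diff S T)
    show ?case
      unfolding group_hom.hom_mult[OF gh(1) diff.hyps(1) T.inv_closed[OF diff.hyps(2)]]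
        group_hom.hom_mult[OF gh(2) diff.hyps(1) T.inv_closed[OF diff.hyps(2)]]
        group_hom.hom_inv[OF gh(1) diff.hyps(2)] group_hom.hom_inv[OF gh(2) diff.hyps(2)] diff.IH
      by (rule refl)
  qed
qed

end

text \<open>Depends on the carrier and the addition of the two records only. The same additive group
  occurs below under many records (tensor product, extension of scalars, twisted algebra,
  restriction of scalars), and additive maps pass between them by
  \<open>addhom_cong_structure\<close>.\<close>

definition addhom :: "('a, 'x) ring_scheme \<Rightarrow> ('b, 'y) ring_scheme \<Rightarrow> ('a \<Rightarrow> 'b) set" where
  "addhom Y Z = hom (add_monoid Y) (add_monoid Z)"

lemma addhomI:
  assumes "\<And>x. x \<in> carrier Y \<Longrightarrow> h x \<in> carrier Z"
    and "\<And>x y. x \<in> carrier Y \<Longrightarrow> y \<in> carrier Y \<Longrightarrow> h (x \<oplus>\<^bsub>Y\<^esub> y) = h x \<oplus>\<^bsub>Z\<^esub> h y"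
  shows "h \<in> addhom Y Z"
  using assms by (auto simp: addhom_def intro!: homI)

lemma addhomD:
  assumes "h \<in> addhom Y Z"
  shows "x \<in> carrier Y \<Longrightarrow> h x \<in> carrier Z"
    and "x \<in> carrier Y \<Longrightarrow> y \<in> carrier Y \<Longrightarrow> h (x \<oplus>\<^bsub>Y\<^esub> y) = h x \<oplus>\<^bsub>Z\<^esub> h y"
  using assms by (auto simp: addhom_def hom_def)

lemma addhom_comp:
  "h \<in> addhom Y Z \<Longrightarrow> g \<in> addhom Z V \<Longrightarrow> (\<lambda>x. g (h x)) \<in> addhom Y V"
  by (rule addhomI) (simp_all add: addhomD)

lemma addhom_plus:
  assumes "abelian_group Z" "h \<in> addhom Y Z" "g \<in> addhom Y Z"
  shows "(\<lambda>x. h x \<oplus>\<^bsub>Z\<^esub> g x) \<in> addhom Y Z"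
proof -
  interpret Z: abelian_group Z by fact
  show ?thesis
    using addhomD[OF assms(2)] addhomD[OF assms(3)]
    by (intro addhomI) (simp_all add: Z.a_ac)
qed

lemma addhom_cong_structure:
  assumes "carrier Y = carrier Y'" "add Y = add Y'" "carrier Z = carrier Z'" "add Z = add Z'"
  shows "addhom Y Z = addhom Y' Z'"
  using assms by (auto simp: addhom_def hom_def)

lemma addhom_restrict_eq:
  assumes "h \<in> addhom Y Z" "abelian_group Y" and eq: "\<And>y. y \<in> carrier Y \<Longrightarrow> h y = h' y"
  shows "h' \<in> addhom Y Z"
proof (rule addhomI)
  fix x y assume x: "x \<in> carrier Y" and y: "y \<in> carrier Y"
  have xy: "x \<oplus>\<^bsub>Y\<^esub> y \<in> carrier Y"
    using abelian_groupE(1)[OF assms(2) x y] .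
  show "h' x \<in> carrier Z"
    using addhomD(1)[OF assms(1) x] eq[OF x] by simp
  show "h' (x \<oplus>\<^bsub>Y\<^esub> y) = h' x \<oplus>\<^bsub>Z\<^esub> h' y"
    using addhomD(2)[OF assms(1) x y] eq[OF x] eq[OF y] eq[OF xy] by simp
qed

lemma comm_group_add: "abelian_group Y \<Longrightarrow> comm_group (add_monoid Y)"
  by (rule abelian_group.a_comm_group)

lemma comm_group_cong_structure:
  assumes "comm_group G" "carrier G' = carrier G" "monoid.mult G' = monoid.mult G" "\<one>\<^bsub>G'\<^esub> = \<one>\<^bsub>G\<^esub>"
  shows "comm_group G'"
proof -
  interpret comm_group G by fact
  show ?thesis
    by (rule comm_groupI; unfold assms(2-4)) (simp_all add: m_ac l_inv_ex)
qed

lemma abelian_group_cong_structure: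
  assumes "abelian_group Y" "carrier Y' = carrier Y" "add Y' = add Y" "\<zero>\<^bsub>Y'\<^esub> = \<zero>\<^bsub>Y\<^esub>"
  shows "abelian_group Y'"
  by (rule comm_group_abelian_groupI, rule comm_group_cong_structure[OF comm_group_add[OF assms(1)]])
    (simp_all add: assms)

lemma tensor_product_simps [simp]:
  "carrier (tensor_product R M N) = carrier (tensor_group R M N)"
  "add (tensor_product R M N) = monoid.mult (tensor_group R M N)"
  "\<zero>\<^bsub>tensor_product R M N\<^esub> = \<one>\<^bsub>tensor_group R M N\<^esub>"
  "\<one>\<^bsub>tensor_product R M N\<^esub> = pure_tensor R M N \<one>\<^bsub>M\<^esub> \<one>\<^bsub>N\<^esub>"
  by (simp_all add: tensor_product_def Let_def)

lemma tensor_group_cong: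
  assumes "carrier M = carrier M'" "add M = add M'" "module.smult M = module.smult M'"
  shows "tensor_group R M N = tensor_group R M' N" "pure_tensor R M N = pure_tensor R M' N"
  using assms by (simp_all add: tensor_group_def pure_tensor_def tensor_subgroup_def tensor_rels_def fun_eq_iff)

lemma hom_to_addhom: "h \<in> hom (tensor_group R M N) (add_monoid Y) \<longleftrightarrow> h \<in> addhom (tensor_product R M N) Y"
  by (simp add: addhom_def hom_def)

definition bal where
  "bal R M N Y f \<longleftrightarrow> balanced_map R M N (add_monoid Y) f"

lemma balI:
  assumes "\<And>n. n \<in> carrier N \<Longrightarrow> (\<lambda>m. f m n) \<in> addhom M Y"
    and "\<And>m. m \<in> carrier M \<Longrightarrow> (\<lambda>n. f m n) \<in> addhom N Y"
    and "\<And>r m n. r \<in> carrier R \<Longrightarrow> m \<in> carrier M \<Longrightarrow> n \<in> carrier N \<Longrightarrow>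
      f (r \<odot>\<^bsub>M\<^esub> m) n = f m (r \<odot>\<^bsub>N\<^esub> n)"
  shows "bal R M N Y f"
  using assms by (simp add: bal_def balanced_map_def addhom_def)

lemma balD:
  assumes "bal R M N Y f"
  shows "n \<in> carrier N \<Longrightarrow> (\<lambda>m. f m n) \<in> addhom M Y"
    and "m \<in> carrier M \<Longrightarrow> (\<lambda>n. f m n) \<in> addhom N Y"
    and "r \<in> carrier R \<Longrightarrow> m \<in> carrier M \<Longrightarrow> n \<in> carrier N \<Longrightarrow> f (r \<odot>\<^bsub>M\<^esub> m) n = f m (r \<odot>\<^bsub>N\<^esub> n)"
    and "m \<in> carrier M \<Longrightarrow> n \<in> carrier N \<Longrightarrow> f m n \<in> carrier Y"
  using assms balanced_mapD[of R M N "add_monoid Y" f] by (auto simp: bal_def addhom_def)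

lemma bal_comp:
  assumes "bal R M N Y f" "h \<in> addhom Y Z"
  shows "bal R M N Z (\<lambda>m n. h (f m n))"
  by (intro balI addhom_comp[OF balD(1)[OF assms(1)] assms(2)] addhom_comp[OF balD(2)[OF assms(1)] assms(2)])
    (simp_all add: balD(3)[OF assms(1)])

context tensor_modules
begin

lemma abelian_tensor: "abelian_group (tensor_product R M N)"
  by (rule comm_group_abelian_groupI, rule comm_group_cong_structure[OF T.comm_group_axioms]) simp_all

lemma lift_addhom:
  assumes "abelian_group Y" "bal R M N Y f"
  shows "tensor_lift (add_monoid Y) f \<in> addhom (tensor_product R M N) Y"
  using tensor_lift_hom[OF comm_group_add[OF assms(1)]] assms(2)
  by (simp add: bal_def hom_to_addhom)

lemma lift_pure:
  assumes "abelian_group Y" "bal R M N Y f" "m \<in> carrier M" "n \<in> carrier N"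
  shows "tensor_lift (add_monoid Y) f (pure_tensor R M N m n) = f m n"
  using tensor_lift_pure[OF comm_group_add[OF assms(1)]] assms(2-4)
  by (simp add: bal_def)

lemma addhom_ext:
  assumes "abelian_group Y" "h \<in> addhom (tensor_product R M N) Y" "h' \<in> addhom (tensor_product R M N) Y"
    and "\<And>m n. m \<in> carrier M \<Longrightarrow> n \<in> carrier N \<Longrightarrow>
      h (pure_tensor R M N m n) = h' (pure_tensor R M N m n)"
    and "T \<in> carrier (tensor_group R M N)"
  shows "h T = h' T"
  by (rule tensor_hom_eqI[OF comm_group.axioms(2)[OF comm_group_add[OF assms(1)]]])
    (simp_all add: hom_to_addhom assms)

lemma bal_pure: "bal R M N (tensor_product R M N) (pure_tensor R M N)"
proof (rule balI)
  show "(\<lambda>m. pure_tensor R M N m n) \<in> addhom M (tensor_product R M N)" if "n \<in> carrier N" for n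
    using that by (intro addhomI) (simp_all add: pure_add_left pure_closed)
  show "(\<lambda>n. pure_tensor R M N m n) \<in> addhom N (tensor_product R M N)" if "m \<in> carrier M" for m
    using that by (intro addhomI) (simp_all add: pure_add_right pure_closed)
qed (rule pure_smult)

text \<open>Pure tensors generate, so a lift is recognised by its values on them. Most computations
  with \<open>tensor_lift\<close> below reduce to this.\<close>

lemma lift_unique:
  assumes "abelian_group Y" "bal R M N Y f" "h \<in> addhom (tensor_product R M N) Y"
    and "\<And>m n. m \<in> carrier M \<Longrightarrow> n \<in> carrier N \<Longrightarrow> h (pure_tensor R M N m n) = f m n"
    and "T \<in> carrier (tensor_group R M N)"
  shows "tensor_lift (add_monoid Y) f T = h T"
  by (rule addhom_ext[OF assms(1) lift_addhom[OF assms(1,2)] assms(3) _ assms(5)])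
    (simp add: lift_pure[OF assms(1,2)] assms(4))

lemma lift_cong:
  assumes "abelian_group Y" "bal R M N Y f"
    and "\<And>m n. m \<in> carrier M \<Longrightarrow> n \<in> carrier N \<Longrightarrow> f m n = f' m n"
    and "T \<in> carrier (tensor_group R M N)"
  shows "tensor_lift (add_monoid Y) f T = tensor_lift (add_monoid Y) f' T"
proof -
  have b: "bal R M N Y f'"
  proof (rule balI)
    show "(\<lambda>m. f' m n) \<in> addhom M Y" if "n \<in> carrier N" for n
      by (rule addhom_restrict_eq[OF balD(1)[OF assms(2) that] M]) (rule assms(3)[OF _ that])
    show "(\<lambda>n. f' m n) \<in> addhom N Y" if "m \<in> carrier M" for m
      by (rule addhom_restrict_eq[OF balD(2)[OF assms(2) that] N]) (rule assms(3)[OF that])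
    show "f' (r \<odot>\<^bsub>M\<^esub> m) n = f' m (r \<odot>\<^bsub>N\<^esub> n)"
      if "r \<in> carrier R" "m \<in> carrier M" "n \<in> carrier N" for r m n
      using balD(3)[OF assms(2) that] assms(3)[OF smultM[OF that(1,2)] that(3)]
        assms(3)[OF that(2) smultN[OF that(1,3)]] by simp
  qed
  show ?thesis
    by (rule lift_unique[OF assms(1,2) lift_addhom[OF assms(1) b] _ assms(4)])
      (simp add: lift_pure[OF assms(1) b] assms(3))
qed

lemma lift_map:
  assumes "abelian_group Y" "bal R M N Y f" "abelian_group Z" "h \<in> addhom Y Z"
    and "T \<in> carrier (tensor_group R M N)"
  shows "h (tensor_lift (add_monoid Y) f T) = tensor_lift (add_monoid Z) (\<lambda>m n. h (f m n)) T"
  using lift_unique[OF assms(3) bal_comp[OF assms(2,4)] addhom_comp[OF lift_addhom[OF assms(1,2)] assms(4)] _ assms(5)]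
  by (simp add: lift_pure[OF assms(1,2)])

text \<open>The product and the scalar action of \<open>tensor_product\<close> lift into the record
  \<open>tensor_group\<close>, other definitions lift into an \<open>add_monoid\<close>. The finite
  products in the two records are different terms; the lifts agree because both are homomorphisms
  with the same values on pure tensors.\<close>

lemma lift_group_eq:
  assumes "abelian_group Y" "bal R M N Y f" "comm_group G" "carrier G = carrier Y" "monoid.mult G = add Y"
    and "T \<in> carrier (tensor_group R M N)"
  shows "tensor_lift G f T = tensor_lift (add_monoid Y) f T"
proof (rule tensor_hom_eqI)
  show "Group.group G"
    using assms(3) by (rule comm_group.axioms(2))
  have b: "balanced_map R M N G f"
    using assms(2,4,5) by (simp add: bal_def balanced_map_def hom_def)
  show "tensor_lift G f \<in> hom (tensor_group R M N) G"
    by (rule tensor_lift_hom[OF assms(3) b])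
  show "tensor_lift (add_monoid Y) f \<in> hom (tensor_group R M N) G"
    using lift_addhom[OF assms(1,2)] assms(4,5) by (simp add: addhom_def hom_def)
  show "tensor_lift G f (pure_tensor R M N m n) = tensor_lift (add_monoid Y) f (pure_tensor R M N m n)"
    if "m \<in> carrier M" "n \<in> carrier N" for m n
    by (simp add: lift_pure[OF assms(1,2) that] tensor_lift_pure[OF assms(3) b that])
qed fact

text \<open>Products of tensors are nested lifts. For the outer lift to be well defined, the inner
  one has to be additive in the outer variable while its tensor \<open>T\<close> stays
  fixed.\<close>

lemma lift_param:
  assumes Y: "abelian_group Y" and P: "abelian_group P"
    and b: "\<And>p. p \<in> carrier P \<Longrightarrow> bal R M N Y (f p)"
    and h: "\<And>m n. m \<in> carrier M \<Longrightarrow> n \<in> carrier N \<Longrightarrow> (\<lambda>p. f p m n) \<in> addhom P Y"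
    and T: "T \<in> carrier (tensor_group R M N)"
  shows "(\<lambda>p. tensor_lift (add_monoid Y) (f p) T) \<in> addhom P Y"
proof (rule addhomI)
  interpret P: abelian_group P by fact
  fix p q assume p: "p \<in> carrier P" and q: "q \<in> carrier P"
  show "tensor_lift (add_monoid Y) (f p) T \<in> carrier Y"
    using addhomD(1)[OF lift_addhom[OF Y b[OF p]]] T by simp
  show "tensor_lift (add_monoid Y) (f (p \<oplus>\<^bsub>P\<^esub> q)) T =
      tensor_lift (add_monoid Y) (f p) T \<oplus>\<^bsub>Y\<^esub> tensor_lift (add_monoid Y) (f q) T"
    by (rule lift_unique[OF Y b[OF P.add.m_closed[OF p q]]
          addhom_plus[OF Y lift_addhom[OF Y b[OF p]] lift_addhom[OF Y b[OF q]]] _ T])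
      (simp add: lift_pure[OF Y b[OF p]] lift_pure[OF Y b[OF q]] addhomD(2)[OF h p q])
qed

end

lemma type_ring_simps [simp]:
  "carrier (ring_of_type_algebra :: 'a::ring_1 ring) = UNIV"
  "monoid.mult (ring_of_type_algebra :: 'a::ring_1 ring) = (*)"
  "add (ring_of_type_algebra :: 'a::ring_1 ring) = (+)"
  "\<one>\<^bsub>ring_of_type_algebra :: 'a::ring_1 ring\<^esub> = 1"
  "\<zero>\<^bsub>ring_of_type_algebra :: 'a::ring_1 ring\<^esub> = 0"
  by (simp_all add: ring_of_type_algebra_def fun_eq_iff)

lemma hopf_module_simps [simp]:
  "carrier (hopf_module scale) = UNIV"
  "monoid.mult (hopf_module scale) = (*)"
  "add (hopf_module scale) = (+)"
  "\<one>\<^bsub>hopf_module scale\<^esub> = 1"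
  "\<zero>\<^bsub>hopf_module scale\<^esub> = 0"
  "module.smult (hopf_module scale) = scale"
  by (simp_all add: hopf_module_def)

text \<open>Commuting additive operators are all that is used of a module structure.\<close>

definition opmod :: "('r, 'x) ring_scheme \<Rightarrow> ('r, 'm, 'y) module_scheme \<Rightarrow> bool" where
  "opmod R M \<longleftrightarrow> abelian_group M \<and> (\<forall>r\<in>carrier R. module.smult M r \<in> addhom M M) \<and>
    (\<forall>r\<in>carrier R. \<forall>s\<in>carrier R. \<forall>m\<in>carrier M.
      r \<odot>\<^bsub>M\<^esub> (s \<odot>\<^bsub>M\<^esub> m) = s \<odot>\<^bsub>M\<^esub> (r \<odot>\<^bsub>M\<^esub> m))"

lemma opmodI:
  assumes "abelian_group M" "\<And>r. r \<in> carrier R \<Longrightarrow> module.smult M r \<in> addhom M M"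
    "\<And>r s m. r \<in> carrier R \<Longrightarrow> s \<in> carrier R \<Longrightarrow> m \<in> carrier M \<Longrightarrow>
      r \<odot>\<^bsub>M\<^esub> (s \<odot>\<^bsub>M\<^esub> m) = s \<odot>\<^bsub>M\<^esub> (r \<odot>\<^bsub>M\<^esub> m)"
  shows "opmod R M"
  using assms by (simp add: opmod_def)

lemma opmodD:
  assumes "opmod R M"
  shows "abelian_group M" "r \<in> carrier R \<Longrightarrow> module.smult M r \<in> addhom M M"
    "r \<in> carrier R \<Longrightarrow> s \<in> carrier R \<Longrightarrow> m \<in> carrier M \<Longrightarrow>
      r \<odot>\<^bsub>M\<^esub> (s \<odot>\<^bsub>M\<^esub> m) = s \<odot>\<^bsub>M\<^esub> (r \<odot>\<^bsub>M\<^esub> m)"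
    "r \<in> carrier R \<Longrightarrow> m \<in> carrier M \<Longrightarrow> r \<odot>\<^bsub>M\<^esub> m \<in> carrier M"
  using assms by (auto simp: opmod_def intro: addhomD)

lemma opmod_tensor_modules: "opmod R M \<Longrightarrow> opmod R N \<Longrightarrow> tensor_modules R M N"
  by (rule tensor_modules.intro) (auto dest: opmodD)

lemma smult_tensor_product:
  "module.smult (tensor_product R M N) r =
    tensor_lift (tensor_group R M N) (\<lambda>m n. pure_tensor R M N (r \<odot>\<^bsub>M\<^esub> m) n)"
  by (simp add: tensor_product_def Let_def)

context
  fixes R :: "('r, 'x) ring_scheme" and M :: "('r, 'm, 'y) module_scheme"
    and N :: "('r, 'n, 'z) module_scheme"
  assumes MN: "opmod R M" "opmod R N"
begin

interpretation tensor_modules R M N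
  using MN by (rule opmod_tensor_modules)

text \<open>Makes \<open>h \<otimes> id\<close> well defined. It is applied to multiplication by a
  scalar, where the commutation hypothesis is what \<open>opmod\<close> provides.\<close>

lemma bal_left_operator:
  assumes h: "h \<in> addhom M M"
    and comm: "\<And>r m. r \<in> carrier R \<Longrightarrow> m \<in> carrier M \<Longrightarrow> h (r \<odot>\<^bsub>M\<^esub> m) = r \<odot>\<^bsub>M\<^esub> h m"
  shows "bal R M N (tensor_product R M N) (\<lambda>m n. pure_tensor R M N (h m) n)"
proof (rule balI)
  show "(\<lambda>m. pure_tensor R M N (h m) n) \<in> addhom M (tensor_product R M N)" if "n \<in> carrier N" for n
    by (rule addhom_comp[OF h balD(1)[OF bal_pure that]])
  show "(\<lambda>n. pure_tensor R M N (h m) n) \<in> addhom N (tensor_product R M N)" if "m \<in> carrier M" for m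
    by (rule balD(2)[OF bal_pure addhomD(1)[OF h that]])
  show "pure_tensor R M N (h (r \<odot>\<^bsub>M\<^esub> m)) n = pure_tensor R M N (h m) (r \<odot>\<^bsub>N\<^esub> n)"
    if "r \<in> carrier R" "m \<in> carrier M" "n \<in> carrier N" for r m n
    unfolding comm[OF that(1,2)] by (rule pure_smult[OF that(1) addhomD(1)[OF h that(2)] that(3)])
qed

lemma smult_tensor:
  assumes r: "r \<in> carrier R"
  shows "module.smult (tensor_product R M N) r \<in> addhom (tensor_product R M N) (tensor_product R M N)"
    and "m \<in> carrier M \<Longrightarrow> n \<in> carrier N \<Longrightarrow>
      r \<odot>\<^bsub>tensor_product R M N\<^esub> pure_tensor R M N m n = pure_tensor R M N (r \<odot>\<^bsub>M\<^esub> m) n"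
proof -
  let ?f = "\<lambda>m n. pure_tensor R M N (r \<odot>\<^bsub>M\<^esub> m) n" and ?T = "tensor_product R M N"
  have b: "bal R M N ?T ?f"
    using opmodD(2,3)[OF MN(1) r] r by (intro bal_left_operator) auto
  have "tensor_lift (add_monoid ?T) ?f T = module.smult ?T r T" if "T \<in> carrier ?T" for T
    unfolding smult_tensor_product using that
    by (intro lift_group_eq[OF abelian_tensor b T.comm_group_axioms, symmetric]) simp_all
  then show "module.smult ?T r \<in> addhom ?T ?T"
    and "m \<in> carrier M \<Longrightarrow> n \<in> carrier N \<Longrightarrow>
      r \<odot>\<^bsub>?T\<^esub> pure_tensor R M N m n = pure_tensor R M N (r \<odot>\<^bsub>M\<^esub> m) n"
    using addhom_restrict_eq[OF lift_addhom[OF abelian_tensor b] abelian_tensor]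
      lift_pure[OF abelian_tensor b] pure_closed by (blast, fastforce)
qed

lemma opmod_tensor: "opmod R (tensor_product R M N)"
proof (rule opmodI)
  let ?T = "tensor_product R M N"
  show "abelian_group ?T"
    by (rule abelian_tensor)
  show "module.smult ?T r \<in> addhom ?T ?T" if "r \<in> carrier R" for r
    by (rule smult_tensor(1)[OF that])
  show "r \<odot>\<^bsub>?T\<^esub> (s \<odot>\<^bsub>?T\<^esub> T) = s \<odot>\<^bsub>?T\<^esub> (r \<odot>\<^bsub>?T\<^esub> T)"
    if r: "r \<in> carrier R" and s: "s \<in> carrier R" and T: "T \<in> carrier ?T" for r s T
  proof (rule addhom_ext[where h = "\<lambda>T. r \<odot>\<^bsub>?T\<^esub> (s \<odot>\<^bsub>?T\<^esub> T)" and h' = "\<lambda>T. s \<odot>\<^bsub>?T\<^esub> (r \<odot>\<^bsub>?T\<^esub> T)"])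
    show "(\<lambda>T. r \<odot>\<^bsub>?T\<^esub> (s \<odot>\<^bsub>?T\<^esub> T)) \<in> addhom ?T ?T" "(\<lambda>T. s \<odot>\<^bsub>?T\<^esub> (r \<odot>\<^bsub>?T\<^esub> T)) \<in> addhom ?T ?T"
      by (rule addhom_comp[OF smult_tensor(1)[OF s] smult_tensor(1)[OF r]])
        (rule addhom_comp[OF smult_tensor(1)[OF r] smult_tensor(1)[OF s]])
    show "r \<odot>\<^bsub>?T\<^esub> (s \<odot>\<^bsub>?T\<^esub> pure_tensor R M N m n) = s \<odot>\<^bsub>?T\<^esub> (r \<odot>\<^bsub>?T\<^esub> pure_tensor R M N m n)"
      if "m \<in> carrier M" "n \<in> carrier N" for m n
      using that r s by (simp add: smult_tensor(2) opmodD(3)[OF MN(1) r s] opmodD(4)[OF MN(1)])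
    show "T \<in> carrier (tensor_group R M N)"
      using T by simp
  qed (rule abelian_tensor)
qed

end

section \<open>Sweedler sums with values in an abelian group\<close>

context hopf_algebra
begin

abbreviation kk :: "'k ring" where "kk \<equiv> ring_of_type_algebra"
abbreviation HH :: "('k, 'h) module" where "HH \<equiv> hopf_module scale"
abbreviation H2 where "H2 \<equiv> tensor_product kk HH HH"
abbreviation H3 where "H3 \<equiv> tensor_product kk H2 HH"

lemma opmod_HH: "opmod kk HH"
proof (rule opmodI)
  show "abelian_group HH"
  proof (rule abelian_groupI)
    show "\<exists>y\<in>carrier HH. y \<oplus>\<^bsub>HH\<^esub> x = \<zero>\<^bsub>HH\<^esub>" for x
      by (rule bexI[of _ "- x"]) simp_all
  qed (simp_all add: ac_simps)
qed (auto intro!: addhomI simp: scale_right_distrib scale_left_commute)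

lemma opmod_H2: "opmod kk H2"
  by (rule opmod_tensor[OF opmod_HH opmod_HH])

sublocale T2: tensor_modules kk HH HH
  by (rule opmod_tensor_modules[OF opmod_HH opmod_HH])

sublocale T3: tensor_modules kk H2 HH
  by (rule opmod_tensor_modules[OF opmod_H2 opmod_HH])

lemma comult_closed [simp]: "\<Delta> x \<in> carrier (tensor_group kk HH HH)"
  using ring_hom_closed[OF comult_hom, of x] by simp

lemma comult_addhom: "\<Delta> \<in> addhom HH H2"
  using ring_hom_add[OF comult_hom] by (intro addhomI) simp_all

text \<open>The action of k on the target is a parameter, because it takes different forms: the
  scalar multiplication of a tensor product over k, multiplication by \<iota> a in an algebra R, or
  \<iota> a acting on an R-module.\<close>

definition klin :: "('y, 'z) ring_scheme \<Rightarrow> ('k \<Rightarrow> 'y \<Rightarrow> 'y) \<Rightarrow> ('h \<Rightarrow> 'y) \<Rightarrow> bool" where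
  "klin Y act h \<longleftrightarrow> h \<in> addhom HH Y \<and> (\<forall>a x. h (scale a x) = act a (h x))"

definition kbilin :: "('y, 'z) ring_scheme \<Rightarrow> ('k \<Rightarrow> 'y \<Rightarrow> 'y) \<Rightarrow> ('h \<Rightarrow> 'h \<Rightarrow> 'y) \<Rightarrow> bool" where
  "kbilin Y act f \<longleftrightarrow> (\<forall>y. klin Y act (\<lambda>x. f x y)) \<and> (\<forall>x. klin Y act (\<lambda>y. f x y))"

definition kmod :: "('y, 'z) ring_scheme \<Rightarrow> ('k \<Rightarrow> 'y \<Rightarrow> 'y) \<Rightarrow> bool" where
  "kmod Y act \<longleftrightarrow> abelian_group Y \<and> (\<forall>a. act a \<in> addhom Y Y)"

lemma kmodD: "kmod Y act \<Longrightarrow> abelian_group Y" "kmod Y act \<Longrightarrow> act a \<in> addhom Y Y"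
  by (simp_all add: kmod_def)

lemma klinI:
  assumes "\<And>x. h x \<in> carrier Y" "\<And>x y. h (x + y) = h x \<oplus>\<^bsub>Y\<^esub> h y" "\<And>a x. h (scale a x) = act a (h x)"
  shows "klin Y act h"
  using assms by (auto simp: klin_def intro!: addhomI)

lemma klinD:
  assumes "klin Y act h"
  shows "h x \<in> carrier Y" "h (x + y) = h x \<oplus>\<^bsub>Y\<^esub> h y" "h (scale a x) = act a (h x)" "h \<in> addhom HH Y"
  using assms addhomD[of h HH Y] by (auto simp: klin_def)

lemma kbilinI:
  "(\<And>y. klin Y act (\<lambda>x. f x y)) \<Longrightarrow> (\<And>x. klin Y act (\<lambda>y. f x y)) \<Longrightarrow> kbilin Y act f"
  by (simp add: kbilin_def)

lemma kbilinD:
  "kbilin Y act f \<Longrightarrow> klin Y act (\<lambda>x. f x y)" "kbilin Y act f \<Longrightarrow> klin Y act (\<lambda>y. f x y)"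
  by (simp_all add: kbilin_def)

lemma klin_comp: "klin HH scale g \<Longrightarrow> klin Y act h \<Longrightarrow> klin Y act (\<lambda>x. h (g x))"
  by (rule klinI) (simp_all add: klinD)

lemma klin_post:
  assumes "klin Y act g" "h \<in> addhom Y Z" "\<And>a y. y \<in> carrier Y \<Longrightarrow> h (act a y) = act' a (h y)"
  shows "klin Z act' (\<lambda>x. h (g x))"
  using assms by (intro klinI) (simp_all add: klinD addhomD)

lemma klin_id: "klin HH scale (\<lambda>x. x)"
  and klin_mult_left: "klin HH scale (\<lambda>x. x * y)"
  and klin_mult_right: "klin HH scale (\<lambda>x. y * x)"
  by (rule klinI; simp add: distrib_left distrib_right scale_mult_left scale_mult_right)+

lemma kbilin_bal:
  assumes "kbilin Y act f" shows "bal kk HH HH Y f"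
  by (rule balI) (simp_all add: klinD(4)[OF kbilinD(1)[OF assms]] klinD(4)[OF kbilinD(2)[OF assms]]
      klinD(3)[OF kbilinD(1)[OF assms]] klinD(3)[OF kbilinD(2)[OF assms]])

lemma kmod_opmod: "opmod kk M \<Longrightarrow> kmod M (module.smult M)"
  by (simp add: kmod_def opmodD(1,2))

lemma sw_closed:
  assumes "abelian_group Y" "bal kk HH HH Y f"
  shows "sweedler Y \<Delta> f x \<in> carrier Y"
  unfolding sweedler_def using addhomD(1)[OF T2.lift_addhom[OF assms]] by simp

lemma sw_addhom:
  assumes "abelian_group Y" "bal kk HH HH Y f"
  shows "sweedler Y \<Delta> f \<in> addhom HH Y"
  unfolding sweedler_def[abs_def] by (rule addhom_comp[OF comult_addhom T2.lift_addhom[OF assms]])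

lemma sw_map:
  assumes "abelian_group Y" "bal kk HH HH Y f" "abelian_group Z" "h \<in> addhom Y Z"
  shows "h (sweedler Y \<Delta> f x) = sweedler Z \<Delta> (\<lambda>p q. h (f p q)) x"
  unfolding sweedler_def by (rule T2.lift_map[OF assms comult_closed])

text \<open>\<Delta> is k-linear and the scalar action on H \<otimes> H is defined through the left
  factor. The scalar stays inside \<open>f\<close>, so that the target may be a mere abelian
  group.\<close>

lemma sw_scale:
  assumes "abelian_group Y" "bal kk HH HH Y f"
  shows "sweedler Y \<Delta> f (scale a x) = sweedler Y \<Delta> (\<lambda>p q. f (scale a p) q) x"
proof -
  have b: "bal kk HH HH Y (\<lambda>p q. f (scale a p) q)"
  proof (rule balI)
    show "(\<lambda>p. f (scale a p) q) \<in> addhom HH Y" for q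
      using addhomD[OF balD(1)[OF assms(2)], of q] by (intro addhomI) (simp_all add: scale_right_distrib)
    show "(\<lambda>q. f (scale a p) q) \<in> addhom HH Y" for p
      using balD(2)[OF assms(2)] by simp
    show "f (scale a (r \<odot>\<^bsub>HH\<^esub> m)) n = f (scale a m) (r \<odot>\<^bsub>HH\<^esub> n)" for r m n
      using balD(3)[OF assms(2), of r "scale a m" n] by (simp add: mult.commute)
  qed
  have "tensor_lift (add_monoid Y) f (a \<odot>\<^bsub>H2\<^esub> \<Delta> x) = tensor_lift (add_monoid Y) (\<lambda>p q. f (scale a p) q) (\<Delta> x)"
    by (rule T2.lift_unique[OF assms(1) b addhom_comp[OF smult_tensor(1)[OF opmod_HH opmod_HH]
            T2.lift_addhom[OF assms]] _ comult_closed, symmetric])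
      (simp_all add: smult_tensor(2)[OF opmod_HH opmod_HH] T2.lift_pure[OF assms])
  then show ?thesis
    by (simp add: sweedler_def comult_scale)
qed

lemma sw_klin:
  assumes "kmod Y act" "kbilin Y act f"
  shows "klin Y act (\<lambda>x. sweedler Y \<Delta> f x)"
proof (rule klinI)
  note Y = kmodD(1)[OF assms(1)] and b = kbilin_bal[OF assms(2)]
  show "sweedler Y \<Delta> f x \<in> carrier Y" for x
    by (rule sw_closed[OF Y b])
  show "sweedler Y \<Delta> f (x + y) = sweedler Y \<Delta> f x \<oplus>\<^bsub>Y\<^esub> sweedler Y \<Delta> f y" for x y
    using addhomD(2)[OF sw_addhom[OF Y b], of x y] by simp
  show "sweedler Y \<Delta> f (scale a x) = act a (sweedler Y \<Delta> f x)" for a x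
    by (simp add: sw_scale[OF Y b] sw_map[OF Y b Y kmodD(2)[OF assms(1)]] klinD(3)[OF kbilinD(1)[OF assms(2)]])
qed

lemma sw_param:
  assumes "abelian_group Y" "abelian_group P" "\<And>p. p \<in> carrier P \<Longrightarrow> bal kk HH HH Y (f p)"
    and "\<And>m n. (\<lambda>p. f p m n) \<in> addhom P Y"
  shows "(\<lambda>p. sweedler Y \<Delta> (f p) x) \<in> addhom P Y"
  unfolding sweedler_def
  by (rule T2.lift_param[OF assms(1,2,3) _ comult_closed]) (simp_all add: assms(4))

lemma sw_param_klin:
  assumes "kmod Y act" "\<And>z. kbilin Y act (f z)" "\<And>m n. klin Y act (\<lambda>z. f z m n)"
  shows "klin Y act (\<lambda>z. sweedler Y \<Delta> (f z) x)"
  unfolding klin_def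
proof (intro conjI allI)
  note Y = kmodD(1)[OF assms(1)] and b = kbilin_bal[OF assms(2)]
  show "(\<lambda>z. sweedler Y \<Delta> (f z) x) \<in> addhom HH Y"
    by (rule sw_param[OF Y opmodD(1)[OF opmod_HH] b klinD(4)[OF assms(3)]])
  show "sweedler Y \<Delta> (f (scale a z)) x = act a (sweedler Y \<Delta> (f z) x)" for a z
    by (simp add: sw_map[OF Y b Y kmodD(2)[OF assms(1)]] klinD(3)[OF assms(3), symmetric])
qed

lemma counit_add: "\<epsilon> (x + y) = \<epsilon> x + \<epsilon> y"
  and counit_scale: "\<epsilon> (scale a x) = a * \<epsilon> x"
proof -
  interpret e: Vector_Spaces.linear scale "(*)" \<epsilon>
    by (rule counit_linear)
  show "\<epsilon> (x + y) = \<epsilon> x + \<epsilon> y" "\<epsilon> (scale a x) = a * \<epsilon> x"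
    by (rule e.add e.scale)+
qed

lemma sw_counit_left:
  assumes "abelian_group Y" "klin Y act h"
  shows "sweedler Y \<Delta> (\<lambda>p q. act (\<epsilon> p) (h q)) x = h x"
proof -
  have b: "kbilin HH scale (\<lambda>p q. scale (\<epsilon> p) q)"
    by (intro kbilinI klinI) (simp_all add: counit_add counit_scale scale_left_distrib scale_right_distrib mult.commute)
  have "h x = h (sweedler HH \<Delta> (\<lambda>p q. scale (\<epsilon> p) q) x)"
    by (simp add: counit_left)
  also have "\<dots> = sweedler Y \<Delta> (\<lambda>p q. h (scale (\<epsilon> p) q)) x"
    by (rule sw_map[OF opmodD(1)[OF opmod_HH] kbilin_bal[OF b] assms(1) klinD(4)[OF assms(2)]])
  finally show ?thesis
    by (simp add: klinD(3)[OF assms(2)])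
qed

lemma sw_counit_right:
  assumes "abelian_group Y" "klin Y act h"
  shows "sweedler Y \<Delta> (\<lambda>p q. act (\<epsilon> q) (h p)) x = h x"
proof -
  have b: "kbilin HH scale (\<lambda>p q. scale (\<epsilon> q) p)"
    by (intro kbilinI klinI) (simp_all add: counit_add counit_scale scale_left_distrib scale_right_distrib mult.commute)
  have "h x = h (sweedler HH \<Delta> (\<lambda>p q. scale (\<epsilon> q) p) x)"
    by (simp add: counit_right)
  also have "\<dots> = sweedler Y \<Delta> (\<lambda>p q. h (scale (\<epsilon> q) p)) x"
    by (rule sw_map[OF opmodD(1)[OF opmod_HH] kbilin_bal[OF b] assms(1) klinD(4)[OF assms(2)]])
  finally show ?thesis
    by (simp add: klinD(3)[OF assms(2)])
qed

lemma sw_one: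
  assumes "abelian_group Y" "bal kk HH HH Y f"
  shows "sweedler Y \<Delta> f 1 = f 1 1"
  using ring_hom_one[OF comult_hom] by (simp add: sweedler_def T2.lift_pure[OF assms])

text \<open>The axiom is an equation in (H \<otimes> H) \<otimes> H. A trilinear \<open>f\<close>
  factors through an additive map \<open>G\<close> on that group, and applying \<open>G\<close> to
  the two sides of the axiom produces the two iterated sums.\<close>

lemma sw_coassoc:
  assumes Y: "kmod Y act"
    and f1: "\<And>q r. klin Y act (\<lambda>p. f p q r)" and f2: "\<And>p r. klin Y act (\<lambda>q. f p q r)"
    and f3: "\<And>p q. klin Y act (\<lambda>r. f p q r)"
  shows "sweedler Y \<Delta> (\<lambda>p q. sweedler Y \<Delta> (\<lambda>r s. f r s q) p) x =
    sweedler Y \<Delta> (\<lambda>p q. sweedler Y \<Delta> (\<lambda>r s. f p r s) q) x"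
proof -
  note aY = kmodD(1)[OF Y]
  let ?p2 = "pure_tensor kk HH HH" and ?p3 = "pure_tensor kk H2 HH"
  have bq: "bal kk HH HH Y (\<lambda>r s. f r s q)" for q
    by (rule kbilin_bal[of Y act], rule kbilinI) (rule f1 f2)+
  define g where "g = (\<lambda>T q. tensor_lift (add_monoid Y) (\<lambda>r s. f r s q) T)"
  have g: "bal kk H2 HH Y g"
  proof (rule balI)
    show "(\<lambda>T. g T q) \<in> addhom H2 Y" for q
      unfolding g_def by (rule T2.lift_addhom[OF aY bq])
    show "(\<lambda>q. g T q) \<in> addhom HH Y" if "T \<in> carrier H2" for T
      unfolding g_def using that
      by (intro T2.lift_param[OF aY opmodD(1)[OF opmod_HH] bq klinD(4)[OF f3]]) simp
    show "g (a \<odot>\<^bsub>H2\<^esub> T) q = g T (a \<odot>\<^bsub>HH\<^esub> q)" if T: "T \<in> carrier H2" for a T q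
    proof -
      have "tensor_lift (add_monoid Y) (\<lambda>r s. f r s (scale a q)) T = tensor_lift (add_monoid Y) (\<lambda>r s. f r s q) (a \<odot>\<^bsub>H2\<^esub> T)"
        by (rule T2.lift_unique[OF aY bq addhom_comp[OF smult_tensor(1)[OF opmod_HH opmod_HH] T2.lift_addhom[OF aY bq]]])
          (use T in \<open>simp_all add: smult_tensor(2)[OF opmod_HH opmod_HH] T2.lift_pure[OF aY bq] klinD(3)[OF f1] klinD(3)[OF f3]\<close>)
      then show ?thesis
        by (simp add: g_def)
    qed
  qed
  define G where "G = tensor_lift (add_monoid Y) g"
  have G: "G \<in> addhom H3 Y"
    unfolding G_def by (rule T3.lift_addhom[OF aY g])
  have Gp: "G (?p3 T q) = g T q" if "T \<in> carrier (tensor_group kk HH HH)" for T q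
    unfolding G_def using that by (intro T3.lift_pure[OF aY g]) simp_all
  have k3: "kmod H3 (module.smult H3)"
    by (rule kmod_opmod[OF opmod_tensor[OF opmod_H2 opmod_HH]])
  have sm3: "a \<odot>\<^bsub>H3\<^esub> ?p3 T q = ?p3 (a \<odot>\<^bsub>H2\<^esub> T) q" if "T \<in> carrier (tensor_group kk HH HH)" for a T q
    using smult_tensor(2)[OF opmod_H2 opmod_HH] that by simp
  have sm2: "a \<odot>\<^bsub>H2\<^esub> ?p2 p q = ?p2 (scale a p) q" for a p q
    using smult_tensor(2)[OF opmod_HH opmod_HH] by simp
  have sm2': "?p2 p (scale a q) = ?p2 (scale a p) q" for a p q
    using T2.pure_smult[of a p q] by simp
  have sm3': "?p3 T (scale a q) = ?p3 (a \<odot>\<^bsub>H2\<^esub> T) q" if "T \<in> carrier (tensor_group kk HH HH)" for a T q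
    using T3.pure_smult[of a T q] that by simp
  have p2c: "?p2 p q \<in> carrier (tensor_group kk HH HH)" for p q
    by (rule T2.pure_closed) simp_all
  have p3c: "?p3 T q \<in> carrier (tensor_group kk H2 HH)" if "T \<in> carrier (tensor_group kk HH HH)" for T q
    using that by (intro T3.pure_closed) simp_all
  have b1: "kbilin H3 (module.smult H3) (\<lambda>x1 x2. ?p3 (\<Delta> x1) x2)"
    by (intro kbilinI klinI)
      (simp_all add: p3c sm3 sm3' comult_scale addhomD(2)[OF comult_addhom, simplified]
        T3.pure_add_left[simplified] T3.pure_add_right[simplified])
  have b2: "klin H3 (module.smult H3) (\<lambda>x1. ?p3 (?p2 x1 x2) x3)"
    "klin H3 (module.smult H3) (\<lambda>x2. ?p3 (?p2 x1 x2) x3)"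
    "klin H3 (module.smult H3) (\<lambda>x3. ?p3 (?p2 x1 x2) x3)" for x1 x2 x3
    by (intro klinI; simp add: p3c p2c sm3 sm3' sm2 sm2' T2.pure_add_left[simplified] T2.pure_add_right[simplified]
        T3.pure_add_left[simplified] T3.pure_add_right[simplified])+
  have b3: "kbilin H3 (module.smult H3) (\<lambda>x2 x3. ?p3 (?p2 x1 x2) x3)" for x1
    by (intro kbilinI b2)
  have b4: "kbilin H3 (module.smult H3) (\<lambda>x1 x'. sweedler H3 \<Delta> (\<lambda>x2 x3. ?p3 (?p2 x1 x2) x3) x')"
    by (intro kbilinI sw_klin[OF k3] sw_param_klin[OF k3] b2)
  have "G (sweedler H3 \<Delta> (\<lambda>x1 x2. ?p3 (\<Delta> x1) x2) x) =
      G (sweedler H3 \<Delta> (\<lambda>x1 x'. sweedler H3 \<Delta> (\<lambda>x2 x3. ?p3 (?p2 x1 x2) x3) x') x)"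
    using coassoc by (simp add: Let_def)
  then show ?thesis
    unfolding sw_map[OF kmodD(1)[OF k3] kbilin_bal[OF b1] aY G]
      sw_map[OF kmodD(1)[OF k3] kbilin_bal[OF b4] aY G]
      sw_map[OF kmodD(1)[OF k3] kbilin_bal[OF b3] aY G]
    by (simp add: Gp p2c) (simp add: g_def T2.lift_pure[OF aY bq] sweedler_def)
qed

text \<open>\<Delta> is an algebra map, so \<Delta> (x * y) is a double Sweedler sum inside H
  \<otimes> H; the lift of \<open>f\<close> is then pushed through both sums.\<close>

lemma sw_mult:
  assumes Y: "kmod Y act" and f: "kbilin Y act f"
  shows "sweedler Y \<Delta> f (x * y) =
    sweedler Y \<Delta> (\<lambda>p q. sweedler Y \<Delta> (\<lambda>r s. f (p * r) (q * s)) y) x"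
proof -
  note aY = kmodD(1)[OF Y]
  let ?p2 = "pure_tensor kk HH HH" and ?G = "tensor_group kk HH HH"
  have k2: "kmod H2 (module.smult H2)"
    by (rule kmod_opmod[OF opmod_H2])
  note a2 = kmodD(1)[OF k2]
  have p2: "klin H2 (module.smult H2) (\<lambda>p. ?p2 p q)" "klin H2 (module.smult H2) (\<lambda>q. ?p2 p q)" for p q
    using smult_tensor(2)[OF opmod_HH opmod_HH] T2.pure_smult
    by (intro klinI; simp add: T2.pure_closed[simplified] T2.pure_add_left[simplified] T2.pure_add_right[simplified])+
  have b1: "kbilin H2 (module.smult H2) (\<lambda>r s. ?p2 (p * r) (q * s))" for p q
    by (intro kbilinI klin_comp[OF klin_mult_right p2(1)] klin_comp[OF klin_mult_right p2(2)])
  have b2: "kbilin H2 (module.smult H2) (\<lambda>p q. sweedler H2 \<Delta> (\<lambda>r s. ?p2 (p * r) (q * s)) y)"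
    by (intro kbilinI sw_param_klin[OF k2] b1 klin_comp[OF klin_mult_left p2(1)] klin_comp[OF klin_mult_left p2(2)])
  have "\<Delta> (x * y) = \<Delta> x \<otimes>\<^bsub>H2\<^esub> \<Delta> y"
    using ring_hom_mult[OF comult_hom, of x y] by simp
  also have "\<dots> = tensor_lift ?G (\<lambda>p q. tensor_lift ?G (\<lambda>r s. ?p2 (p * r) (q * s)) (\<Delta> y)) (\<Delta> x)"
    by (simp add: tensor_product_def Let_def)
  also have "\<dots> = sweedler H2 \<Delta> (\<lambda>p q. sweedler H2 \<Delta> (\<lambda>r s. ?p2 (p * r) (q * s)) y) x"
    using T2.lift_group_eq[OF a2 kbilin_bal[OF b1] T2.T.comm_group_axioms]
      T2.lift_group_eq[OF a2 kbilin_bal[OF b2] T2.T.comm_group_axioms]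
    by (simp add: sweedler_def)
  finally have "\<Delta> (x * y) = \<dots>" .
  moreover note L = T2.lift_addhom[OF aY kbilin_bal[OF f]]
  ultimately have "sweedler Y \<Delta> f (x * y) = tensor_lift (add_monoid Y) f
      (sweedler H2 \<Delta> (\<lambda>p q. sweedler H2 \<Delta> (\<lambda>r s. ?p2 (p * r) (q * s)) y) x)"
    by (simp add: sweedler_def)
  also have "\<dots> = sweedler Y \<Delta> (\<lambda>p q. sweedler Y \<Delta> (\<lambda>r s. f (p * r) (q * s)) y) x"
    unfolding sw_map[OF a2 kbilin_bal[OF b2] aY L] sw_map[OF a2 kbilin_bal[OF b1] aY L]
    by (simp add: T2.lift_pure[OF aY kbilin_bal[OF f]])
  finally show ?thesis .
qed

end

lemma ring_as_module_simps [simp]: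
  "carrier (ring_as_module f S) = carrier S" "add (ring_as_module f S) = add S"
  "\<zero>\<^bsub>ring_as_module f S\<^esub> = \<zero>\<^bsub>S\<^esub>" "\<one>\<^bsub>ring_as_module f S\<^esub> = \<one>\<^bsub>S\<^esub>"
  "monoid.mult (ring_as_module f S) = monoid.mult S"
  "module.smult (ring_as_module f S) = (\<lambda>r s. f r \<otimes>\<^bsub>S\<^esub> s)"
  by (simp_all add: ring_as_module_def)

lemma restrict_scalars_simps [simp]:
  "carrier (restrict_scalars f M) = carrier M" "add (restrict_scalars f M) = add M"
  "\<zero>\<^bsub>restrict_scalars f M\<^esub> = \<zero>\<^bsub>M\<^esub>"
  "module.smult (restrict_scalars f M) = (\<lambda>r m. f r \<odot>\<^bsub>M\<^esub> m)"
  by (simp_all add: restrict_scalars_def)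

lemma extend_scalars_simps [simp]:
  "carrier (extend_scalars R S f M) = carrier (tensor_group R (ring_as_module f S) M)"
  "add (extend_scalars R S f M) = monoid.mult (tensor_group R (ring_as_module f S) M)"
  "\<zero>\<^bsub>extend_scalars R S f M\<^esub> = \<one>\<^bsub>tensor_group R (ring_as_module f S) M\<^esub>"
  "\<one>\<^bsub>extend_scalars R S f M\<^esub> = pure_tensor R (ring_as_module f S) M \<one>\<^bsub>S\<^esub> \<one>\<^bsub>M\<^esub>"
  "monoid.mult (extend_scalars R S f M) = monoid.mult (tensor_product R (ring_as_module f S) M)"
  by (simp_all add: extend_scalars_def Let_def)

lemma addhom_ring_as_module [simp]: "addhom (ring_as_module f S) Y = addhom S Y"
  by (rule addhom_cong_structure) simp_all

lemma addhom_restrict_scalars [simp]: "addhom (restrict_scalars f M) Y = addhom M Y"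
  by (rule addhom_cong_structure) simp_all

lemma opmod_restrict_scalars:
  assumes "opmod S M" "\<And>r. r \<in> carrier R \<Longrightarrow> f r \<in> carrier S"
  shows "opmod R (restrict_scalars f M)"
proof (rule opmodI)
  show "abelian_group (restrict_scalars f M)"
    by (rule abelian_group_cong_structure[OF opmodD(1)[OF assms(1)]]) simp_all
  show "module.smult (restrict_scalars f M) r \<in> addhom (restrict_scalars f M) (restrict_scalars f M)"
    if "r \<in> carrier R" for r
    using addhomD[OF opmodD(2)[OF assms(1) assms(2)[OF that]]] by (intro addhomI) simp_all
qed (simp add: opmodD(3)[OF assms(1) assms(2) assms(2)])

lemma opmod_ring_as_module:
  assumes "cring S" "\<And>r. r \<in> carrier R \<Longrightarrow> f r \<in> carrier S"
  shows "opmod R (ring_as_module f S)"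
proof -
  interpret S: cring S by fact
  show ?thesis
  proof (rule opmodI)
    show "abelian_group (ring_as_module f S)"
      by (rule abelian_group_cong_structure[OF S.abelian_group_axioms]) simp_all
    show "module.smult (ring_as_module f S) r \<in> addhom (ring_as_module f S) (ring_as_module f S)"
      if "r \<in> carrier R" for r
      using assms(2)[OF that] by (intro addhomI) (simp_all add: S.r_distr)
  qed (simp add: S.m_lcomm assms(2))
qed

section \<open>Extension of scalars\<close>

text \<open>Instantiated twice: for R \<otimes> H over k, the module underlying a twisted algebra,
  and for S \<otimes> A over R, the module underlying its base change.\<close>

locale scalar_extension =
  fixes R :: "('r, 'x) ring_scheme" and S :: "('s, 'y) ring_scheme" and f :: "'r \<Rightarrow> 's"
    and M :: "('r, 'm, 'z) module_scheme"
  assumes S: "cring S" and f: "r \<in> carrier R \<Longrightarrow> f r \<in> carrier S" and M: "opmod R M"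
begin

sublocale S: cring S by (rule S)

abbreviation "SM \<equiv> ring_as_module f S"
abbreviation "tS \<equiv> pure_tensor R SM M"
abbreviation "SX \<equiv> extend_scalars R S f M"

lemma opmod_SM: "opmod R SM"
  by (rule opmod_ring_as_module[OF S f])

sublocale T: tensor_modules R SM M
  by (rule opmod_tensor_modules[OF opmod_SM M])

lemma abelian_X: "abelian_group SX"
  by (rule abelian_group_cong_structure[OF T.abelian_tensor]) simp_all

lemma addhom_SX: "addhom SX Y = addhom (tensor_product R SM M) Y"
  "addhom Y SX = addhom Y (tensor_product R SM M)"
  by (rule addhom_cong_structure; simp)+

lemma tS_closed [simp]: "s \<in> carrier S \<Longrightarrow> m \<in> carrier M \<Longrightarrow> tS s m \<in> carrier (tensor_group R SM M)"
  by (rule T.pure_closed) simp_all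

lemma tS_addhom_left: "m \<in> carrier M \<Longrightarrow> (\<lambda>s. tS s m) \<in> addhom S SX"
  using balD(1)[OF T.bal_pure] by (simp add: addhom_SX)

lemma tS_addhom_right: "s \<in> carrier S \<Longrightarrow> (\<lambda>m. tS s m) \<in> addhom M SX"
  using balD(2)[OF T.bal_pure] by (simp add: addhom_SX)

lemma tS_smult: "r \<in> carrier R \<Longrightarrow> s \<in> carrier S \<Longrightarrow> m \<in> carrier M \<Longrightarrow>
    tS s (r \<odot>\<^bsub>M\<^esub> m) = tS (f r \<otimes>\<^bsub>S\<^esub> s) m"
  using T.pure_smult by simp

lemma lift_X:
  assumes "abelian_group Y"
    and "\<And>m. m \<in> carrier M \<Longrightarrow> (\<lambda>s. g s m) \<in> addhom S Y"
    and "\<And>s. s \<in> carrier S \<Longrightarrow> (\<lambda>m. g s m) \<in> addhom M Y"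
    and "\<And>r s m. r \<in> carrier R \<Longrightarrow> s \<in> carrier S \<Longrightarrow> m \<in> carrier M \<Longrightarrow>
      g (f r \<otimes>\<^bsub>S\<^esub> s) m = g s (r \<odot>\<^bsub>M\<^esub> m)"
  shows "bal R SM M Y g" "tensor_lift (add_monoid Y) g \<in> addhom SX Y"
    and "\<And>s m. s \<in> carrier S \<Longrightarrow> m \<in> carrier M \<Longrightarrow> tensor_lift (add_monoid Y) g (tS s m) = g s m"
proof -
  show b: "bal R SM M Y g"
    by (rule balI) (use assms(2-4) in \<open>simp_all\<close>)
  show "tensor_lift (add_monoid Y) g \<in> addhom SX Y"
    unfolding addhom_SX by (rule T.lift_addhom[OF assms(1) b])
  show "tensor_lift (add_monoid Y) g (tS s m) = g s m" if "s \<in> carrier S" "m \<in> carrier M" for s m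
    using that by (intro T.lift_pure[OF assms(1) b]) simp_all
qed

lemma ext_X:
  assumes "abelian_group Y" "h \<in> addhom SX Y" "h' \<in> addhom SX Y"
    and "\<And>s m. s \<in> carrier S \<Longrightarrow> m \<in> carrier M \<Longrightarrow> h (tS s m) = h' (tS s m)"
    and "T \<in> carrier SX"
  shows "h T = h' T"
  by (rule T.addhom_ext[OF assms(1) assms(2,3)[unfolded addhom_SX]]) (use assms(4,5) in simp_all)

lemma smult_X:
  assumes s: "s \<in> carrier S"
  shows "module.smult SX s \<in> addhom SX SX"
    and "\<And>s' m. s' \<in> carrier S \<Longrightarrow> m \<in> carrier M \<Longrightarrow> s \<odot>\<^bsub>SX\<^esub> tS s' m = tS (s \<otimes>\<^bsub>S\<^esub> s') m"
proof -
  let ?g = "\<lambda>s' m. tS (s \<otimes>\<^bsub>S\<^esub> s') m" and ?Y = "tensor_product R SM M"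
  have eq: "module.smult SX s = tensor_lift (add_monoid ?Y) ?g"
    by (simp add: extend_scalars_def Let_def)
  have m: "(\<lambda>s'. s \<otimes>\<^bsub>S\<^esub> s') \<in> addhom S S"
    using s by (intro addhomI) (simp_all add: S.r_distr)
  note L = lift_X[OF T.abelian_tensor, of ?g]
  have 1: "(\<lambda>s'. ?g s' m) \<in> addhom S ?Y" if "m \<in> carrier M" for m
    using addhom_comp[OF m tS_addhom_left[OF that]] by (simp add: addhom_SX)
  have 2: "(\<lambda>m. ?g s' m) \<in> addhom M ?Y" if "s' \<in> carrier S" for s'
    using tS_addhom_right[of "s \<otimes>\<^bsub>S\<^esub> s'"] that s by (simp add: addhom_SX)
  have 3: "?g (f r \<otimes>\<^bsub>S\<^esub> s') m = ?g s' (r \<odot>\<^bsub>M\<^esub> m)"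
    if "r \<in> carrier R" "s' \<in> carrier S" "m \<in> carrier M" for r s' m
    using that s f by (simp add: tS_smult S.m_lcomm)
  show "module.smult SX s \<in> addhom SX SX"
    using L(2)[OF 1 2 3] by (simp add: eq addhom_SX)
  show "s \<odot>\<^bsub>SX\<^esub> tS s' m = tS (s \<otimes>\<^bsub>S\<^esub> s') m" if "s' \<in> carrier S" "m \<in> carrier M" for s' m
    using L(3)[OF 1 2 3] that by (simp add: eq)
qed

lemma smult_smult_X:
  assumes "r \<in> carrier S" "s \<in> carrier S" "T \<in> carrier SX"
  shows "r \<odot>\<^bsub>SX\<^esub> (s \<odot>\<^bsub>SX\<^esub> T) = (r \<otimes>\<^bsub>S\<^esub> s) \<odot>\<^bsub>SX\<^esub> T"
  by (rule ext_X[OF abelian_X addhom_comp[OF smult_X(1)[OF assms(2)] smult_X(1)[OF assms(1)]]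
        smult_X(1)[OF S.m_closed[OF assms(1,2)]] _ assms(3)])
    (simp add: smult_X(2) assms S.m_assoc)

lemma opmod_X: "opmod S SX"
proof (rule opmodI[OF abelian_X smult_X(1)])
  show "r \<odot>\<^bsub>SX\<^esub> (s \<odot>\<^bsub>SX\<^esub> m) = s \<odot>\<^bsub>SX\<^esub> (r \<odot>\<^bsub>SX\<^esub> m)"
    if "r \<in> carrier S" "s \<in> carrier S" "m \<in> carrier SX" for r s m
    using that smult_smult_X S.m_comm by metis
qed

end

section \<open>Twisted algebras\<close>

lemma (in hopf_algebra) linear_to_klin:
  "linear_to scale R \<iota> g \<longleftrightarrow> klin R (\<lambda>a r. \<iota> a \<otimes>\<^bsub>R\<^esub> r) g"
  using addhomD[of g HH R] by (auto simp: linear_to_def klin_def intro!: addhomI)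

lemma (in hopf_algebra) bilinear_to_kbilin:
  "bilinear_to scale R \<iota> g \<longleftrightarrow> kbilin R (\<lambda>a r. \<iota> a \<otimes>\<^bsub>R\<^esub> r) g"
  by (auto simp: bilinear_to_def kbilin_def linear_to_klin)

locale twisted_data = hopf_algebra scale \<Delta> \<epsilon>
  for scale :: "'k::field \<Rightarrow> 'h::ring_1 \<Rightarrow> 'h" and \<Delta> :: "'h \<Rightarrow> ('h, 'h) tensor" and \<epsilon> :: "'h \<Rightarrow> 'k" +
  fixes R :: "('r, 'z) ring_scheme" and \<iota> :: "'k \<Rightarrow> 'r" and \<gamma> :: "'h \<Rightarrow> 'h \<Rightarrow> 'r"
  assumes R: "cring R" and \<iota>: "\<iota> a \<in> carrier R" and \<gamma>: "bilinear_to scale R \<iota> \<gamma>"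
begin

sublocale E: scalar_extension kk R \<iota> HH
  by (intro scalar_extension.intro R \<iota> opmod_HH)

abbreviation "M \<equiv> E.SX"
abbreviation "t \<equiv> E.tS"
abbreviation "RM \<equiv> restrict_scalars \<iota> M"
abbreviation "MH \<equiv> tensor_product kk RM HH"
abbreviation "t' \<equiv> pure_tensor kk RM HH"
abbreviation "A \<equiv> twisted_algebra scale \<Delta> R \<iota> \<gamma>"
abbreviation "actR \<equiv> (\<lambda>a r. \<iota> a \<otimes>\<^bsub>R\<^esub> r)"
abbreviation "actM \<equiv> (\<lambda>a m. \<iota> a \<odot>\<^bsub>M\<^esub> m)"

lemma opmod_RM: "opmod kk RM"
  by (rule opmod_restrict_scalars[OF E.opmod_X \<iota>])

sublocale MH: tensor_modules kk RM HH
  by (rule opmod_tensor_modules[OF opmod_RM opmod_HH])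

lemma kmod_M: "kmod M actM"
  using E.abelian_X E.smult_X(1)[OF \<iota>] by (simp add: kmod_def)

lemma kmod_MH: "kmod MH (module.smult MH)"
  by (rule kmod_opmod[OF opmod_tensor[OF opmod_RM opmod_HH]])

lemma klin_\<gamma>: "klin R actR (\<lambda>y. \<gamma> x y)" "klin R actR (\<lambda>x. \<gamma> x y)"
  using \<gamma> by (simp_all add: bilinear_to_kbilin kbilinD)

lemma \<gamma>_closed [simp]: "\<gamma> x y \<in> carrier R"
  using klinD(1)[OF klin_\<gamma>(1)] .

lemma klin_t: "b \<in> carrier R \<Longrightarrow> klin M actM (\<lambda>x. t b x)"
  using addhomD[OF E.tS_addhom_right[of b]] E.tS_smult[of _ b] \<iota>
  by (intro klinI) (simp_all add: E.smult_X(2))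

lemma klin_t_coeff:
  assumes "b \<in> carrier R" "klin R actR g"
  shows "klin M actM (\<lambda>x. t (b \<otimes>\<^bsub>R\<^esub> g x) y)"
  using addhomD(2)[OF E.tS_addhom_left[of y]] klinD[OF assms(2)] assms(1) \<iota>
  by (intro klinI) (simp_all add: E.smult_X(2) E.S.r_distr E.S.m_lcomm)

lemma A_simps [simp]:
  "carrier A = carrier M" "add A = add M" "\<zero>\<^bsub>A\<^esub> = \<zero>\<^bsub>M\<^esub>" "module.smult A = module.smult M"
  "\<one>\<^bsub>A\<^esub> = t (inv\<^bsub>R\<^esub> (\<gamma> 1 1)) 1"
  by (simp_all add: twisted_algebra_def Let_def)

lemma addhom_A: "addhom A Y = addhom M Y" "addhom Y A = addhom Y M"
  by (rule addhom_cong_structure; simp)+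

lemma abelian_A: "abelian_group A"
  by (rule abelian_group_cong_structure[OF E.abelian_X]) simp_all

lemma opmod_A: "opmod R A"
  by (rule opmodI[OF abelian_A]) (simp_all add: addhom_A E.smult_X(1) opmodD(3)[OF E.opmod_X])

text \<open>The product of b \<otimes> x and c \<otimes> y. That the twisted product has this value
  on pure tensors follows only after \<open>W\<close> is known to be additive in each of its four
  arguments and compatible with scalars.\<close>

definition W where
  "W b c x y = sweedler M \<Delta> (\<lambda>x1 x2. sweedler M \<Delta> (\<lambda>y1 y2.
     t (b \<otimes>\<^bsub>R\<^esub> c \<otimes>\<^bsub>R\<^esub> \<gamma> x1 y1) (x2 * y2)) y) x"

lemma W_summand:
  assumes "d \<in> carrier R"
  shows "klin M actM (\<lambda>x1. t (d \<otimes>\<^bsub>R\<^esub> \<gamma> x1 y1) (x2 * y2))"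
    "klin M actM (\<lambda>x2. t (d \<otimes>\<^bsub>R\<^esub> \<gamma> x1 y1) (x2 * y2))"
    "klin M actM (\<lambda>y1. t (d \<otimes>\<^bsub>R\<^esub> \<gamma> x1 y1) (x2 * y2))"
    "klin M actM (\<lambda>y2. t (d \<otimes>\<^bsub>R\<^esub> \<gamma> x1 y1) (x2 * y2))"
  using assms
  by (intro klin_t_coeff klin_\<gamma> klin_comp[OF klin_mult_left klin_t] klin_comp[OF klin_mult_right klin_t]
      E.S.m_closed \<gamma>_closed; simp)+

lemma W_inner:
  assumes "d \<in> carrier R"
  shows "kbilin M actM (\<lambda>y1 y2. t (d \<otimes>\<^bsub>R\<^esub> \<gamma> x1 y1) (x2 * y2))"
    and "kbilin M actM (\<lambda>x1 x2. sweedler M \<Delta> (\<lambda>y1 y2. t (d \<otimes>\<^bsub>R\<^esub> \<gamma> x1 y1) (x2 * y2)) y)"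
  by (intro kbilinI sw_param_klin[OF kmod_M] W_summand[OF assms])+

lemma W_klin:
  assumes "b \<in> carrier R" "c \<in> carrier R"
  shows "klin M actM (\<lambda>x. W b c x y)" "klin M actM (\<lambda>y. W b c x y)"
proof -
  have d: "b \<otimes>\<^bsub>R\<^esub> c \<in> carrier R"
    using assms by simp
  show "klin M actM (\<lambda>x. W b c x y)"
    unfolding W_def by (rule sw_klin[OF kmod_M W_inner(2)[OF d]])
  show "klin M actM (\<lambda>y. W b c x y)"
    unfolding W_def by (rule sw_param_klin[OF kmod_M W_inner(2)[OF d] sw_klin[OF kmod_M W_inner(1)[OF d]]])
qed

lemma W_addhom_left:
  assumes "c \<in> carrier R"
  shows "(\<lambda>b. W b c x y) \<in> addhom R M"
proof -
  have *: "(\<lambda>d. t (d \<otimes>\<^bsub>R\<^esub> \<gamma> x1 y1) z) \<in> addhom R M" for x1 y1 z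
  proof (rule addhom_comp[OF _ E.tS_addhom_left])
    show "(\<lambda>d. d \<otimes>\<^bsub>R\<^esub> \<gamma> x1 y1) \<in> addhom R R"
      by (rule addhomI) (simp_all add: E.S.l_distr)
  qed simp
  have **: "(\<lambda>d. sweedler M \<Delta> (\<lambda>x1 x2. sweedler M \<Delta> (\<lambda>y1 y2. t (d \<otimes>\<^bsub>R\<^esub> \<gamma> x1 y1) (x2 * y2)) y) x) \<in> addhom R M"
    by (intro sw_param[OF E.abelian_X E.S.abelian_group_axioms] kbilin_bal[OF W_inner(1)] kbilin_bal[OF W_inner(2)] *)
  have "(\<lambda>b. b \<otimes>\<^bsub>R\<^esub> c) \<in> addhom R R"
    using assms by (intro addhomI) (simp_all add: E.S.l_distr)
  from addhom_comp[OF this **] show ?thesis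
    by (simp add: W_def)
qed

lemma W_addhom_right:
  assumes b: "b \<in> carrier R"
  shows "(\<lambda>c. W b c x y) \<in> addhom R M"
  by (rule addhom_restrict_eq[OF W_addhom_left[OF b] E.S.abelian_group_axioms])
    (simp add: W_def E.S.m_comm[OF b])

lemma W_smult:
  assumes "r \<in> carrier R" "b \<in> carrier R" "c \<in> carrier R"
  shows "W (r \<otimes>\<^bsub>R\<^esub> b) c x y = r \<odot>\<^bsub>M\<^esub> W b c x y" "W b (r \<otimes>\<^bsub>R\<^esub> c) x y = r \<odot>\<^bsub>M\<^esub> W b c x y"
proof -
  have d: "b \<otimes>\<^bsub>R\<^esub> c \<in> carrier R"
    using assms by simp
  have "r \<odot>\<^bsub>M\<^esub> W b c x y = sweedler M \<Delta> (\<lambda>x1 x2. sweedler M \<Delta> (\<lambda>y1 y2.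
     t (r \<otimes>\<^bsub>R\<^esub> (b \<otimes>\<^bsub>R\<^esub> c \<otimes>\<^bsub>R\<^esub> \<gamma> x1 y1)) (x2 * y2)) y) x"
    unfolding W_def sw_map[OF E.abelian_X kbilin_bal[OF W_inner(2)[OF d]] E.abelian_X E.smult_X(1)[OF assms(1)]]
      sw_map[OF E.abelian_X kbilin_bal[OF W_inner(1)[OF d]] E.abelian_X E.smult_X(1)[OF assms(1)]]
    using assms by (simp add: E.smult_X(2))
  then show "W (r \<otimes>\<^bsub>R\<^esub> b) c x y = r \<odot>\<^bsub>M\<^esub> W b c x y" "W b (r \<otimes>\<^bsub>R\<^esub> c) x y = r \<odot>\<^bsub>M\<^esub> W b c x y"
    using assms by (simp_all add: W_def E.S.m_ac)
qed

lemma mult_A: "S \<otimes>\<^bsub>A\<^esub> T = tensor_lift (add_monoid M) (\<lambda>b x. tensor_lift (add_monoid M) (\<lambda>c y. W b c x y) T) S"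
  by (simp add: twisted_algebra_def Let_def W_def)

lemma mult_inner:
  assumes "b \<in> carrier R"
  shows "bal kk E.SM HH M (\<lambda>c y. W b c x y)"
    "tensor_lift (add_monoid M) (\<lambda>c y. W b c x y) \<in> addhom M M"
    "c \<in> carrier R \<Longrightarrow> tensor_lift (add_monoid M) (\<lambda>c y. W b c x y) (t c y) = W b c x y"
proof -
  have 1: "(\<lambda>c. W b c x y) \<in> addhom R M" for y
    by (rule W_addhom_right[OF assms])
  have 2: "(\<lambda>y. W b c x y) \<in> addhom HH M" if "c \<in> carrier R" for c
    by (rule klinD(4)[OF W_klin(2)[OF assms that]])
  have 3: "W b (\<iota> a \<otimes>\<^bsub>R\<^esub> c) x y = W b c x (a \<odot>\<^bsub>HH\<^esub> y)" if "c \<in> carrier R" for a c y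
    using klinD(3)[OF W_klin(2)[OF assms that]] W_smult(2)[OF \<iota> assms that] by simp
  show "bal kk E.SM HH M (\<lambda>c y. W b c x y)"
    "tensor_lift (add_monoid M) (\<lambda>c y. W b c x y) \<in> addhom M M"
    by (rule E.lift_X[OF E.abelian_X]; use 1 2 3 in simp)+
  show "tensor_lift (add_monoid M) (\<lambda>c y. W b c x y) (t c y) = W b c x y" if "c \<in> carrier R"
    by (rule E.lift_X[OF E.abelian_X]; use 1 2 3 that in simp)
qed

text \<open>The inner lift is regarded as a function of the pure tensor b \<otimes> x of the left
  factor, with \<open>T\<close> fixed. Moving a scalar from b to x changes the integrand of the
  inner lift only by an equality of values of \<open>W\<close>.\<close>

lemma mult_outer:
  assumes T: "T \<in> carrier M"
  shows "bal kk E.SM HH M (\<lambda>b x. tensor_lift (add_monoid M) (\<lambda>c y. W b c x y) T)"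
    "(\<lambda>S. S \<otimes>\<^bsub>A\<^esub> T) \<in> addhom M M"
    "b \<in> carrier R \<Longrightarrow> t b x \<otimes>\<^bsub>A\<^esub> T = tensor_lift (add_monoid M) (\<lambda>c y. W b c x y) T"
proof -
  let ?g = "\<lambda>b x. tensor_lift (add_monoid M) (\<lambda>c y. W b c x y) T"
  have T': "T \<in> carrier (tensor_group kk E.SM HH)"
    using T by simp
  have 1: "(\<lambda>b. ?g b x) \<in> addhom R M" for x
    by (rule E.T.lift_param[OF E.abelian_X E.S.abelian_group_axioms mult_inner(1) _ T'])
      (simp_all add: W_addhom_left)
  have 2: "(\<lambda>x. ?g b x) \<in> addhom HH M" if "b \<in> carrier R" for b
    by (rule E.T.lift_param[OF E.abelian_X opmodD(1)[OF opmod_HH] mult_inner(1)[OF that] _ T'])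
      (simp add: klinD(4)[OF W_klin(1)[OF that]])
  have 3: "?g (\<iota> a \<otimes>\<^bsub>R\<^esub> b) x = ?g b (a \<odot>\<^bsub>HH\<^esub> x)" if b: "b \<in> carrier R" for a b x
    by (rule E.T.lift_cong[OF E.abelian_X mult_inner(1) _ T'])
      (use b \<iota> in \<open>simp_all add: klinD(3)[OF W_klin(1)[OF b]] W_smult(1)[OF \<iota> b]\<close>)
  show "bal kk E.SM HH M ?g"
    by (rule E.lift_X[OF E.abelian_X]; use 1 2 3 in simp)
  show "(\<lambda>S. S \<otimes>\<^bsub>A\<^esub> T) \<in> addhom M M"
    unfolding mult_A by (rule E.lift_X[OF E.abelian_X]; use 1 2 3 in simp)
  show "t b x \<otimes>\<^bsub>A\<^esub> T = tensor_lift (add_monoid M) (\<lambda>c y. W b c x y) T" if "b \<in> carrier R"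
    unfolding mult_A by (rule E.lift_X[OF E.abelian_X]; use 1 2 3 that in simp)
qed

lemma mult_pure:
  assumes "b \<in> carrier R" "c \<in> carrier R"
  shows "t b x \<otimes>\<^bsub>A\<^esub> t c y = W b c x y"
  by (rule trans[OF mult_outer(3)[OF _ assms(1)] mult_inner(3)[OF assms]]) (use assms in simp)

lemma mult_addhom_left: "T \<in> carrier A \<Longrightarrow> (\<lambda>S. S \<otimes>\<^bsub>A\<^esub> T) \<in> addhom A A"
  using mult_outer(2) by (simp add: addhom_A)

lemma mult_addhom_right:
  assumes "S \<in> carrier A" shows "(\<lambda>T. S \<otimes>\<^bsub>A\<^esub> T) \<in> addhom A A"
  unfolding addhom_A mult_A
  by (rule E.T.lift_param[OF E.abelian_X E.abelian_X mult_outer(1)], assumption, rule mult_inner(2))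
    (use assms in simp_all)

lemma mult_A_closed: "S \<in> carrier A \<Longrightarrow> T \<in> carrier A \<Longrightarrow> S \<otimes>\<^bsub>A\<^esub> T \<in> carrier A"
  using addhomD(1)[OF mult_addhom_left] by blast

text \<open>Proved one factor at a time, first with a pure left factor. The R-bilinearity of the
  product is what makes the product of S \<otimes> A over R balanced.\<close>

lemma smult_mult_A:
  assumes r: "r \<in> carrier R" and S: "S \<in> carrier A" and T: "T \<in> carrier A"
  shows "(r \<odot>\<^bsub>A\<^esub> S) \<otimes>\<^bsub>A\<^esub> T = r \<odot>\<^bsub>A\<^esub> (S \<otimes>\<^bsub>A\<^esub> T)"
    and "S \<otimes>\<^bsub>A\<^esub> (r \<odot>\<^bsub>A\<^esub> T) = r \<odot>\<^bsub>A\<^esub> (S \<otimes>\<^bsub>A\<^esub> T)"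
proof -
  note sm = E.smult_X(1)[OF r]
  have ml: "(\<lambda>S. S \<otimes>\<^bsub>A\<^esub> T) \<in> addhom M M" if "T \<in> carrier A" for T
    using mult_addhom_left[OF that] by (simp add: addhom_A)
  have mr: "(\<lambda>T. S \<otimes>\<^bsub>A\<^esub> T) \<in> addhom M M" if "S \<in> carrier A" for S
    using mult_addhom_right[OF that] by (simp add: addhom_A)
  have smc: "r \<odot>\<^bsub>M\<^esub> T \<in> carrier A" if "T \<in> carrier A" for T
    using addhomD(1)[OF sm, of T] that by simp
  have tc: "t b x \<in> carrier A" if "b \<in> carrier R" for b x
    using that by simp
  have p1: "(r \<odot>\<^bsub>M\<^esub> t b x) \<otimes>\<^bsub>A\<^esub> T = r \<odot>\<^bsub>M\<^esub> (t b x \<otimes>\<^bsub>A\<^esub> T)" if b: "b \<in> carrier R" and "T \<in> carrier A" for b x T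
    by (rule E.ext_X[OF E.abelian_X mr[OF smc[OF tc[OF b]]] addhom_comp[OF mr[OF tc[OF b]] sm]])
      (use that r in \<open>simp_all add: E.smult_X(2) mult_pure W_smult\<close>)
  have p2: "t b x \<otimes>\<^bsub>A\<^esub> (r \<odot>\<^bsub>M\<^esub> T) = r \<odot>\<^bsub>M\<^esub> (t b x \<otimes>\<^bsub>A\<^esub> T)" if b: "b \<in> carrier R" and "T \<in> carrier A" for b x T
    by (rule E.ext_X[OF E.abelian_X addhom_comp[OF sm mr[OF tc[OF b]]] addhom_comp[OF mr[OF tc[OF b]] sm]])
      (use that r in \<open>simp_all add: E.smult_X(2) mult_pure W_smult\<close>)
  have "(r \<odot>\<^bsub>M\<^esub> S) \<otimes>\<^bsub>A\<^esub> T = r \<odot>\<^bsub>M\<^esub> (S \<otimes>\<^bsub>A\<^esub> T)"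
    by (rule E.ext_X[OF E.abelian_X addhom_comp[OF sm ml[OF T]] addhom_comp[OF ml[OF T] sm]])
      (use S T p1 in simp_all)
  then show "(r \<odot>\<^bsub>A\<^esub> S) \<otimes>\<^bsub>A\<^esub> T = r \<odot>\<^bsub>A\<^esub> (S \<otimes>\<^bsub>A\<^esub> T)"
    by simp
  have "S \<otimes>\<^bsub>A\<^esub> (r \<odot>\<^bsub>M\<^esub> T) = r \<odot>\<^bsub>M\<^esub> (S \<otimes>\<^bsub>A\<^esub> T)"
    by (rule E.ext_X[OF E.abelian_X ml[OF smc[OF T]] addhom_comp[OF ml[OF T] sm]])
      (use S T p2 in simp_all)
  then show "S \<otimes>\<^bsub>A\<^esub> (r \<odot>\<^bsub>A\<^esub> T) = r \<odot>\<^bsub>A\<^esub> (S \<otimes>\<^bsub>A\<^esub> T)"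
    by simp
qed

lemma coact_A: "coact A = tensor_lift (add_monoid MH) (\<lambda>b x. sweedler MH \<Delta> (\<lambda>x1 x2. t' (t b x1) x2) x)"
  by (simp add: twisted_algebra_def Let_def)

lemma smult_MH: "T \<in> carrier M \<Longrightarrow> a \<odot>\<^bsub>MH\<^esub> t' T x = t' (\<iota> a \<odot>\<^bsub>M\<^esub> T) x"
  using smult_tensor(2)[OF opmod_RM opmod_HH, of a T x] by simp

lemma t'_addhom: "(\<lambda>T. t' T x) \<in> addhom M MH"
  using balD(1)[OF MH.bal_pure, of x] by simp

lemma klin_t': "T \<in> carrier M \<Longrightarrow> klin MH (module.smult MH) (\<lambda>x. t' T x)"
  using addhomD[OF balD(2)[OF MH.bal_pure, of T]] MH.pure_smult[of _ T]
  by (intro klinI) (simp_all add: smult_MH)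

lemma klin_t't: "b \<in> carrier R \<Longrightarrow> klin MH (module.smult MH) (\<lambda>x1. t' (t b x1) x2)"
  by (rule klin_post[OF klin_t t'_addhom]) (simp_all add: smult_MH)

lemma coact_summand: "b \<in> carrier R \<Longrightarrow> kbilin MH (module.smult MH) (\<lambda>x1 x2. t' (t b x1) x2)"
  by (intro kbilinI klin_t' klin_t't) simp_all

lemma coact_facts:
  shows "bal kk E.SM HH MH (\<lambda>b x. sweedler MH \<Delta> (\<lambda>x1 x2. t' (t b x1) x2) x)"
    "coact A \<in> addhom A MH"
    "b \<in> carrier R \<Longrightarrow> coact A (t b x) = sweedler MH \<Delta> (\<lambda>x1 x2. t' (t b x1) x2) x"
proof -
  let ?g = "\<lambda>b x. sweedler MH \<Delta> (\<lambda>x1 x2. t' (t b x1) x2) x"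
  have 1: "(\<lambda>b. ?g b x) \<in> addhom R MH" for x
    by (rule sw_param[OF MH.abelian_tensor E.S.abelian_group_axioms kbilin_bal[OF coact_summand]])
      (simp_all add: addhom_comp[OF E.tS_addhom_left t'_addhom])
  have 2: "(\<lambda>x. ?g b x) \<in> addhom HH MH" if "b \<in> carrier R" for b
    by (rule klinD(4)[OF sw_klin[OF kmod_MH coact_summand[OF that]]])
  have 3: "?g (\<iota> a \<otimes>\<^bsub>R\<^esub> b) x = ?g b (a \<odot>\<^bsub>HH\<^esub> x)" if b: "b \<in> carrier R" for a b x
    using b sw_scale[OF MH.abelian_tensor kbilin_bal[OF coact_summand[OF b]]] \<iota>
    by (simp add: klinD(3)[OF klin_t[OF b]] E.smult_X(2))
  show "bal kk E.SM HH MH ?g"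
    by (rule E.lift_X[OF MH.abelian_tensor]; use 1 2 3 in simp)
  show "coact A \<in> addhom A MH"
    unfolding coact_A addhom_A by (rule E.lift_X[OF MH.abelian_tensor]; use 1 2 3 in simp)
  show "coact A (t b x) = ?g b x" if "b \<in> carrier R"
    unfolding coact_A by (rule E.lift_X[OF MH.abelian_tensor]; use 1 2 3 that in simp)
qed

end

text \<open>A right inverse of passing to \<open>add_monoid\<close>. It makes the facts about lifts
  into the additive group of a ring applicable to lifts into \<open>tensor_group\<close>, which
  occur in the product of a base change.\<close>

definition group_as_ring :: "'a monoid \<Rightarrow> 'a ring" where
  "group_as_ring G = \<lparr>carrier = carrier G, monoid.mult = monoid.mult G, one = \<one>\<^bsub>G\<^esub>,
    ring.zero = \<one>\<^bsub>G\<^esub>, add = monoid.mult G\<rparr>"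

lemma group_as_ring_simps [simp]:
  "carrier (group_as_ring G) = carrier G" "add (group_as_ring G) = monoid.mult G"
  "\<zero>\<^bsub>group_as_ring G\<^esub> = \<one>\<^bsub>G\<^esub>"
  by (simp_all add: group_as_ring_def)

lemma add_monoid_group_as_ring: "add_monoid (group_as_ring G) = G"
  by (simp add: group_as_ring_def)

lemma (in tensor_modules) abelian_group_as_ring: "abelian_group (group_as_ring (tensor_group R M N))"
  by (rule abelian_group_cong_structure[OF abelian_tensor]) simp_all

lemma (in tensor_modules) lift_group_eq':
  assumes "tensor_modules R' M' N'" "bal R M N (tensor_product R' M' N') f" "T \<in> carrier (tensor_group R M N)"
  shows "tensor_lift (tensor_group R' M' N') f T = tensor_lift (add_monoid (tensor_product R' M' N')) f T"
proof -
  interpret P: tensor_modules R' M' N' by fact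
  show ?thesis
    by (rule lift_group_eq[OF P.abelian_tensor assms(2) P.T.comm_group_axioms _ _ assms(3)]) simp_all
qed

lemma (in tensor_modules) lift_param_group:
  assumes "abelian_group (group_as_ring G)" "abelian_group P"
    and "\<And>p. p \<in> carrier P \<Longrightarrow> bal R M N (group_as_ring G) (f p)"
    and "\<And>m n. m \<in> carrier M \<Longrightarrow> n \<in> carrier N \<Longrightarrow> (\<lambda>p. f p m n) \<in> addhom P (group_as_ring G)"
    and "T \<in> carrier (tensor_group R M N)"
  shows "(\<lambda>p. tensor_lift G (f p) T) \<in> addhom P (group_as_ring G)"
  using lift_param[of "group_as_ring G" P f T] assms unfolding add_monoid_group_as_ring by blast

lemma (in tensor_modules) lift_cong_group:
  assumes "abelian_group (group_as_ring G)" "bal R M N (group_as_ring G) f"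
    and "\<And>m n. m \<in> carrier M \<Longrightarrow> n \<in> carrier N \<Longrightarrow> f m n = f' m n"
    and "T \<in> carrier (tensor_group R M N)"
  shows "tensor_lift G f T = tensor_lift G f' T"
  using lift_cong[of "group_as_ring G" f f' T] assms unfolding add_monoid_group_as_ring by blast

lemma (in scalar_extension) lift_X_group:
  assumes "abelian_group (group_as_ring G)"
    and "\<And>m. m \<in> carrier M \<Longrightarrow> (\<lambda>s. g s m) \<in> addhom S (group_as_ring G)"
    and "\<And>s. s \<in> carrier S \<Longrightarrow> (\<lambda>m. g s m) \<in> addhom M (group_as_ring G)"
    and "\<And>r s m. r \<in> carrier R \<Longrightarrow> s \<in> carrier S \<Longrightarrow> m \<in> carrier M \<Longrightarrow>
      g (f r \<otimes>\<^bsub>S\<^esub> s) m = g s (r \<odot>\<^bsub>M\<^esub> m)"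
  shows "bal R SM M (group_as_ring G) g" "tensor_lift G g \<in> addhom SX (group_as_ring G)"
    and "\<And>s m. s \<in> carrier S \<Longrightarrow> m \<in> carrier M \<Longrightarrow> tensor_lift G g (tS s m) = g s m"
  using lift_X[where Y = "group_as_ring G" and g = g, OF assms(1) assms(2) assms(3) assms(4)]
  unfolding add_monoid_group_as_ring by blast+

section \<open>Base change of twisted algebras\<close>

text \<open>The unit of a twisted algebra is the inverse of \<gamma>(1,1), tensored with 1. A ring
  homomorphism takes this inverse to the inverse of the image when \<gamma>(1,1) is a unit, hence
  the last assumption.\<close>

locale twisted_base_change = twisted_data scale \<Delta> \<epsilon> R \<iota> \<gamma>
  for scale :: "'k::field \<Rightarrow> 'h::ring_1 \<Rightarrow> 'h" and \<Delta> :: "'h \<Rightarrow> ('h, 'h) tensor" and \<epsilon> :: "'h \<Rightarrow> 'k"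
    and R :: "('r, 'z) ring_scheme" and \<iota> :: "'k \<Rightarrow> 'r" and \<gamma> :: "'h \<Rightarrow> 'h \<Rightarrow> 'r" +
  fixes S :: "('s, 'w) ring_scheme" and f :: "'r \<Rightarrow> 's"
  assumes S: "cring S" and f: "f \<in> ring_hom R S" and \<gamma>11: "\<gamma> 1 1 \<in> Units R"
begin

lemma f_simps [simp]:
  "a \<in> carrier R \<Longrightarrow> f a \<in> carrier S"
  "a \<in> carrier R \<Longrightarrow> b \<in> carrier R \<Longrightarrow> f (a \<otimes>\<^bsub>R\<^esub> b) = f a \<otimes>\<^bsub>S\<^esub> f b"
  "a \<in> carrier R \<Longrightarrow> b \<in> carrier R \<Longrightarrow> f (a \<oplus>\<^bsub>R\<^esub> b) = f a \<oplus>\<^bsub>S\<^esub> f b"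
  "f \<one>\<^bsub>R\<^esub> = \<one>\<^bsub>S\<^esub>"
  using f by (simp_all add: ring_hom_closed ring_hom_mult ring_hom_add ring_hom_one)

lemma bilinear_image: "bilinear_to scale S (f \<circ> \<iota>) (\<lambda>x y. f (\<gamma> x y))"
  using \<gamma> \<iota> by (simp add: bilinear_to_def linear_to_def)

sublocale U: twisted_data scale \<Delta> \<epsilon> S "f \<circ> \<iota>" "\<lambda>x y. f (\<gamma> x y)"
  by (intro twisted_data.intro twisted_data_axioms.intro hopf_algebra_axioms S bilinear_image) (simp add: \<iota>)

sublocale B: scalar_extension R S f A
  by (intro scalar_extension.intro S opmod_A) simp

abbreviation "BX \<equiv> B.SX"
abbreviation "tB \<equiv> B.tS"
abbreviation "BC \<equiv> base_change scale R \<iota> S f A"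
abbreviation "BR \<equiv> restrict_scalars (f \<circ> \<iota>) BX"
abbreviation "BMH \<equiv> tensor_product kk BR HH"
abbreviation "tB' \<equiv> pure_tensor kk BR HH"

lemma opmod_BR: "opmod kk BR"
  by (rule opmod_restrict_scalars[OF B.opmod_X]) (simp add: \<iota>)

sublocale BH: tensor_modules kk BR HH
  by (rule opmod_tensor_modules[OF opmod_BR opmod_HH])

lemma BC_simps [simp]:
  "carrier BC = carrier BX" "add BC = add BX" "\<zero>\<^bsub>BC\<^esub> = \<zero>\<^bsub>BX\<^esub>" "module.smult BC = module.smult BX"
  "\<one>\<^bsub>BC\<^esub> = tB \<one>\<^bsub>S\<^esub> (t (inv\<^bsub>R\<^esub> (\<gamma> 1 1)) 1)"
  by (simp_all add: base_change_def Let_def)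

lemma addhom_BC: "addhom BC Y = addhom BX Y" "addhom Y BC = addhom Y BX"
  by (rule addhom_cong_structure; simp)+

lemma abelian_BC: "abelian_group BC"
  by (rule abelian_group_cong_structure[OF B.abelian_X]) simp_all

lemma opmod_BC: "opmod S BC"
  by (rule opmodI[OF abelian_BC]) (simp_all add: addhom_BC B.smult_X(1) opmodD(3)[OF B.opmod_X])

lemma inv_\<gamma>11: "inv\<^bsub>R\<^esub> (\<gamma> 1 1) \<in> carrier R" "f (inv\<^bsub>R\<^esub> (\<gamma> 1 1)) = inv\<^bsub>S\<^esub> (f (\<gamma> 1 1))"
proof -
  show c: "inv\<^bsub>R\<^esub> (\<gamma> 1 1) \<in> carrier R"
    using E.S.Units_inv_closed[OF \<gamma>11] .
  have "f (inv\<^bsub>R\<^esub> (\<gamma> 1 1)) \<otimes>\<^bsub>S\<^esub> f (\<gamma> 1 1) = \<one>\<^bsub>S\<^esub>"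
    using c E.S.Units_l_inv[OF \<gamma>11] f_simps(2)[OF c, of "\<gamma> 1 1"] by simp
  then show "f (inv\<^bsub>R\<^esub> (\<gamma> 1 1)) = inv\<^bsub>S\<^esub> (f (\<gamma> 1 1))"
    using c by (intro U.E.S.comm_inv_char[symmetric]) (simp_all add: U.E.S.m_comm)
qed

text \<open>The elements s \<otimes> (b \<otimes> x) generate S \<otimes> (R \<otimes> H): pure
  tensors of the outer product are followed by pure tensors of the inner one.\<close>

lemma ext_BX2:
  assumes Y: "abelian_group Y" and h: "h \<in> addhom BX Y" "h' \<in> addhom BX Y"
    and eq: "\<And>s b x. s \<in> carrier S \<Longrightarrow> b \<in> carrier R \<Longrightarrow> h (tB s (t b x)) = h' (tB s (t b x))"
    and T: "T \<in> carrier BX"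
  shows "h T = h' T"
proof (rule B.ext_X[OF Y h _ T])
  fix s a assume s: "s \<in> carrier S" and a: "a \<in> carrier A"
  have l: "(\<lambda>a. tB s a) \<in> addhom M BX"
    using B.tS_addhom_right[OF s] by (simp add: addhom_A)
  show "h (tB s a) = h' (tB s a)"
    by (rule E.ext_X[OF Y addhom_comp[OF l h(1)] addhom_comp[OF l h(2)]]) (use s a eq in simp_all)
qed

lemma mult_BC: "P \<otimes>\<^bsub>BC\<^esub> Q = tensor_lift (tensor_group R B.SM A) (\<lambda>s a.
    tensor_lift (tensor_group R B.SM A) (\<lambda>s' a'. tB (s \<otimes>\<^bsub>S\<^esub> s') (a \<otimes>\<^bsub>A\<^esub> a')) Q) P"
  by (simp add: base_change_def Let_def tensor_product_def)

abbreviation "BG \<equiv> group_as_ring (tensor_group R B.SM A)"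

lemma addhom_BG: "addhom Y BG = addhom Y BX" "addhom BG Y = addhom BX Y"
  by (rule addhom_cong_structure; simp)+

lemma tB_addhom: "a \<in> carrier A \<Longrightarrow> (\<lambda>s. tB s a) \<in> addhom S BX"
  "s \<in> carrier S \<Longrightarrow> (\<lambda>a. tB s a) \<in> addhom A BX"
  using B.tS_addhom_left B.tS_addhom_right by simp_all

lemma tB_mult_addhom:
  assumes "s' \<in> carrier S" "a' \<in> carrier A"
  shows "a \<in> carrier A \<Longrightarrow> (\<lambda>s. tB (s \<otimes>\<^bsub>S\<^esub> s') (a \<otimes>\<^bsub>A\<^esub> a')) \<in> addhom S BG"
    "a \<in> carrier A \<Longrightarrow> (\<lambda>s. tB (s' \<otimes>\<^bsub>S\<^esub> s) (a' \<otimes>\<^bsub>A\<^esub> a)) \<in> addhom S BG"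
    "s \<in> carrier S \<Longrightarrow> (\<lambda>a. tB (s \<otimes>\<^bsub>S\<^esub> s') (a \<otimes>\<^bsub>A\<^esub> a')) \<in> addhom A BG"
    "s \<in> carrier S \<Longrightarrow> (\<lambda>a. tB (s' \<otimes>\<^bsub>S\<^esub> s) (a' \<otimes>\<^bsub>A\<^esub> a)) \<in> addhom A BG"
proof -
  have "(\<lambda>s. s \<otimes>\<^bsub>S\<^esub> s') \<in> addhom S S" "(\<lambda>s. s' \<otimes>\<^bsub>S\<^esub> s) \<in> addhom S S"
    using assms(1) by (auto intro!: addhomI simp: U.E.S.l_distr U.E.S.r_distr)
  note l = addhom_comp[OF this(1) tB_addhom(1)] addhom_comp[OF this(2) tB_addhom(1)]
  show "(\<lambda>s. tB (s \<otimes>\<^bsub>S\<^esub> s') (a \<otimes>\<^bsub>A\<^esub> a')) \<in> addhom S BG"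
    "(\<lambda>s. tB (s' \<otimes>\<^bsub>S\<^esub> s) (a' \<otimes>\<^bsub>A\<^esub> a)) \<in> addhom S BG" if "a \<in> carrier A"
    unfolding addhom_BG by (rule l, rule mult_A_closed[OF that assms(2)])
      (rule l, rule mult_A_closed[OF assms(2) that])
  show "(\<lambda>a. tB (s \<otimes>\<^bsub>S\<^esub> s') (a \<otimes>\<^bsub>A\<^esub> a')) \<in> addhom A BG"
    "(\<lambda>a. tB (s' \<otimes>\<^bsub>S\<^esub> s) (a' \<otimes>\<^bsub>A\<^esub> a)) \<in> addhom A BG" if "s \<in> carrier S"
    unfolding addhom_BG
    by (rule addhom_comp[OF mult_addhom_left[OF assms(2)] tB_addhom(2)], use that assms in simp)
      (rule addhom_comp[OF mult_addhom_right[OF assms(2)] tB_addhom(2)], use that assms in simp)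
qed

lemma mult_BC_inner:
  assumes s: "s \<in> carrier S" and a: "a \<in> carrier A"
  defines "g \<equiv> \<lambda>s' a'. tB (s \<otimes>\<^bsub>S\<^esub> s') (a \<otimes>\<^bsub>A\<^esub> a')"
  shows "bal R B.SM A BG g" "tensor_lift (tensor_group R B.SM A) g \<in> addhom BX BG"
    "s' \<in> carrier S \<Longrightarrow> a' \<in> carrier A \<Longrightarrow> tensor_lift (tensor_group R B.SM A) g (tB s' a') = g s' a'"
proof -
  have 3: "g (f r \<otimes>\<^bsub>S\<^esub> s') a' = g s' (r \<odot>\<^bsub>A\<^esub> a')"
    if "r \<in> carrier R" "s' \<in> carrier S" "a' \<in> carrier A" for r s' a'
    using that s a B.tS_smult[of r "s \<otimes>\<^bsub>S\<^esub> s'" "a \<otimes>\<^bsub>A\<^esub> a'"] mult_A_closed[of a a'] smult_mult_A(2)[of r a a']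
    unfolding g_def by (simp add: U.E.S.m_lcomm)
  have 1: "(\<lambda>s'. g s' a') \<in> addhom S BG" if "a' \<in> carrier A" for a'
    unfolding g_def by (rule tB_mult_addhom(2)[OF s a that])
  have 2: "(\<lambda>a'. g s' a') \<in> addhom A BG" if "s' \<in> carrier S" for s'
    unfolding g_def by (rule tB_mult_addhom(4)[OF s a that])
  note L = B.lift_X_group[where g = g, OF B.T.abelian_group_as_ring]
  show "bal R B.SM A BG g"
    by (rule L(1)) (fact 1 2 3)+
  show "tensor_lift (tensor_group R B.SM A) g \<in> addhom BX BG"
    by (rule L(2)) (fact 1 2 3)+
  show "tensor_lift (tensor_group R B.SM A) g (tB s' a') = g s' a'" if "s' \<in> carrier S" "a' \<in> carrier A"
    by (rule L(3)) (fact 1 2 3 that)+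
qed

lemma mult_BC_outer:
  assumes Q: "Q \<in> carrier BX"
  defines "g \<equiv> \<lambda>s a. tensor_lift (tensor_group R B.SM A) (\<lambda>s' a'. tB (s \<otimes>\<^bsub>S\<^esub> s') (a \<otimes>\<^bsub>A\<^esub> a')) Q"
  shows "bal R B.SM A BG g" "(\<lambda>P. P \<otimes>\<^bsub>BC\<^esub> Q) \<in> addhom BX BG"
    "s \<in> carrier S \<Longrightarrow> a \<in> carrier A \<Longrightarrow> tB s a \<otimes>\<^bsub>BC\<^esub> Q = g s a"
proof -
  have Q': "Q \<in> carrier (tensor_group R B.SM A)"
    using Q by simp
  note aBG = B.T.abelian_group_as_ring
  have 1: "(\<lambda>s. g s a) \<in> addhom S BG" if a: "a \<in> carrier A" for a
    unfolding g_def
    by (rule B.T.lift_param_group[OF aBG U.E.S.abelian_group_axioms _ _ Q'])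
      (rule mult_BC_inner(1)[OF _ a], assumption, rule tB_mult_addhom(1)[OF _ _ a], simp_all only: ring_as_module_simps)
  have 2: "(\<lambda>a. g s a) \<in> addhom A BG" if s: "s \<in> carrier S" for s
    unfolding g_def
    by (rule B.T.lift_param_group[OF aBG abelian_A _ _ Q'])
      (rule mult_BC_inner(1)[OF s], assumption, rule tB_mult_addhom(3)[OF _ _ s], simp_all only: ring_as_module_simps)
  have 3: "g (f r \<otimes>\<^bsub>S\<^esub> s) a = g s (r \<odot>\<^bsub>A\<^esub> a)"
    if r: "r \<in> carrier R" and s: "s \<in> carrier S" and a: "a \<in> carrier A" for r s a
  proof -
    have c: "f r \<otimes>\<^bsub>S\<^esub> s \<in> carrier S"
      using r s by simp
    have "tB (f r \<otimes>\<^bsub>S\<^esub> s \<otimes>\<^bsub>S\<^esub> s') (a \<otimes>\<^bsub>A\<^esub> a') = tB (s \<otimes>\<^bsub>S\<^esub> s') ((r \<odot>\<^bsub>A\<^esub> a) \<otimes>\<^bsub>A\<^esub> a')"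
      if "s' \<in> carrier B.SM" "a' \<in> carrier A" for s' a'
      using that r s a B.tS_smult[of r "s \<otimes>\<^bsub>S\<^esub> s'" "a \<otimes>\<^bsub>A\<^esub> a'"] mult_A_closed[of a a'] smult_mult_A(1)[of r a a']
      by (simp add: U.E.S.m_assoc)
    then show ?thesis
      unfolding g_def by (intro B.T.lift_cong_group[OF aBG mult_BC_inner(1)[OF c a] _ Q'])
  qed
  note L = B.lift_X_group[where g = g, OF aBG]
  show "bal R B.SM A BG g"
    by (rule L(1)) (fact 1 2 3)+
  show "(\<lambda>P. P \<otimes>\<^bsub>BC\<^esub> Q) \<in> addhom BX BG"
    unfolding mult_BC g_def[symmetric] by (rule L(2)) (fact 1 2 3)+
  show "tB s a \<otimes>\<^bsub>BC\<^esub> Q = g s a" if "s \<in> carrier S" "a \<in> carrier A"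
    unfolding mult_BC g_def[symmetric] by (rule L(3)) (fact 1 2 3 that)+
qed

lemma mult_BC_addhom_left: "Q \<in> carrier BX \<Longrightarrow> (\<lambda>P. P \<otimes>\<^bsub>BC\<^esub> Q) \<in> addhom BX BX"
  using mult_BC_outer(2) by (simp only: addhom_BG)

lemma mult_BC_addhom_right:
  assumes "P \<in> carrier BX" shows "(\<lambda>Q. P \<otimes>\<^bsub>BC\<^esub> Q) \<in> addhom BX BX"
  unfolding mult_BC addhom_BG(1)[symmetric]
  by (rule B.T.lift_param_group[OF B.T.abelian_group_as_ring B.abelian_X mult_BC_outer(1)],
      assumption, rule mult_BC_inner(2)) (use assms in simp_all)

lemma mult_BC_pure:
  assumes "s \<in> carrier S" "a \<in> carrier A" "s' \<in> carrier S" "a' \<in> carrier A"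
  shows "tB s a \<otimes>\<^bsub>BC\<^esub> tB s' a' = tB (s \<otimes>\<^bsub>S\<^esub> s') (a \<otimes>\<^bsub>A\<^esub> a')"
  by (rule trans[OF mult_BC_outer(3)[OF _ assms(1,2)] mult_BC_inner(3)[OF assms]]) (use assms in simp)

lemma tB'_addhom: "(\<lambda>T. tB' T x) \<in> addhom BX BMH"
  using balD(1)[OF BH.bal_pure, of x] by simp

lemma coact_BC: "coact BC = tensor_lift (add_monoid BMH) (\<lambda>s a.
    tensor_lift (add_monoid BMH) (\<lambda>a0 a1. tB' (tB s a0) a1) (coact A a))"
  by (simp add: base_change_def Let_def)

lemma coact_BC_inner:
  assumes s: "s \<in> carrier S"
  shows "bal kk RM HH BMH (\<lambda>a0 a1. tB' (tB s a0) a1)"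
proof (rule balI)
  show "(\<lambda>a0. tB' (tB s a0) a1) \<in> addhom RM BMH" for a1
    using addhom_comp[OF tB_addhom(2)[OF s] tB'_addhom] by (simp add: addhom_A)
  show "(\<lambda>a1. tB' (tB s a0) a1) \<in> addhom HH BMH" if "a0 \<in> carrier RM" for a0
    using balD(2)[OF BH.bal_pure, of "tB s a0"] that s by simp
  show "tB' (tB s (r \<odot>\<^bsub>RM\<^esub> a0)) a1 = tB' (tB s a0) (r \<odot>\<^bsub>HH\<^esub> a1)"
    if "a0 \<in> carrier RM" for r a0 a1
    using that s \<iota> BH.pure_smult[of r "tB s a0" a1] B.tS_smult[of "\<iota> r" s a0] by (simp add: B.smult_X(2))
qed

lemma coact_A_closed: "a \<in> carrier A \<Longrightarrow> coact A a \<in> carrier (tensor_group kk RM HH)"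
  using addhomD(1)[OF coact_facts(2)] by simp

lemma coact_BC_facts:
  shows "coact BC \<in> addhom BX BMH"
    and "\<And>s a. s \<in> carrier S \<Longrightarrow> a \<in> carrier A \<Longrightarrow>
      coact BC (tB s a) = tensor_lift (add_monoid BMH) (\<lambda>a0 a1. tB' (tB s a0) a1) (coact A a)"
proof -
  let ?g = "\<lambda>s a. tensor_lift (add_monoid BMH) (\<lambda>a0 a1. tB' (tB s a0) a1) (coact A a)"
  note aB = BH.abelian_tensor
  have 1: "(\<lambda>s. ?g s a) \<in> addhom S BMH" if a: "a \<in> carrier A" for a
    by (rule MH.lift_param[OF aB U.E.S.abelian_group_axioms coact_BC_inner _ coact_A_closed[OF a]])
      (simp_all add: addhom_comp[OF tB_addhom(1) tB'_addhom])
  have 2: "(\<lambda>a. ?g s a) \<in> addhom A BMH" if s: "s \<in> carrier S" for s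
    by (rule addhom_comp[OF coact_facts(2) MH.lift_addhom[OF aB coact_BC_inner[OF s]]])
  have 3: "?g (f r \<otimes>\<^bsub>S\<^esub> s) a = ?g s (r \<odot>\<^bsub>A\<^esub> a)"
    if r: "r \<in> carrier R" and s: "s \<in> carrier S" and a: "a \<in> carrier A" for r s a
  proof -
    have c: "f r \<otimes>\<^bsub>S\<^esub> s \<in> carrier S"
      using r s by simp
    have sw: "tensor_lift (add_monoid BMH) (\<lambda>a0 a1. tB' (tB s a0) a1) (sweedler MH \<Delta> (\<lambda>x1 x2. t' (t b x1) x2) x) =
        sweedler BMH \<Delta> (\<lambda>x1 x2. tB' (tB s (t b x1)) x2) x" if b: "b \<in> carrier R" and s: "s \<in> carrier S" for b s x
    proof -
      have lp: "tensor_lift (add_monoid BMH) (\<lambda>a0 a1. tB' (tB s a0) a1) (t' (t b p) q) = tB' (tB s (t b p)) q" for p q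
        by (rule MH.lift_pure[OF aB coact_BC_inner[OF s]]) (simp_all add: b)
      show ?thesis
        unfolding sw_map[OF MH.abelian_tensor kbilin_bal[OF coact_summand[OF b]] aB
            MH.lift_addhom[OF aB coact_BC_inner[OF s]]] lp by (rule refl)
    qed
    \<comment> \<open>Both sides are additive in \<open>a\<close>, so \<open>a\<close> may be taken
      pure; there the coaction is an explicit Sweedler sum and the scalar r moves across the tensor
      over R.\<close>
    show ?thesis
    proof (rule E.ext_X[where h = "\<lambda>a. ?g (f r \<otimes>\<^bsub>S\<^esub> s) a" and h' = "\<lambda>a. ?g s (r \<odot>\<^bsub>A\<^esub> a)", OF aB])
      show "(\<lambda>a. ?g (f r \<otimes>\<^bsub>S\<^esub> s) a) \<in> addhom M BMH"
        using 2[OF c] by (simp only: addhom_A)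
      show "(\<lambda>a. ?g s (r \<odot>\<^bsub>A\<^esub> a)) \<in> addhom M BMH"
        using addhom_comp[OF opmodD(2)[OF opmod_A r] 2[OF s]] by (simp only: addhom_A)
      show "?g (f r \<otimes>\<^bsub>S\<^esub> s) (t b x) = ?g s (r \<odot>\<^bsub>A\<^esub> t b x)" if b: "b \<in> carrier R" for b x
      proof -
        have rb: "r \<otimes>\<^bsub>R\<^esub> b \<in> carrier R"
          using r b by simp
        have "tB (f r \<otimes>\<^bsub>S\<^esub> s) (t b y) = tB s (t (r \<otimes>\<^bsub>R\<^esub> b) y)" for y
          using B.tS_smult[of r s "t b y"] r s b by (simp add: E.smult_X(2))
        then show ?thesis
          using r b by (simp only: A_simps E.smult_X(2) hopf_module_simps UNIV_I coact_facts(3) sw[OF b c] sw[OF rb s] rb)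
      qed
    qed (use a in simp_all)
  qed
  note L = B.lift_X[where g = ?g, OF aB 1 2 3]
  show "coact BC \<in> addhom BX BMH"
    unfolding coact_BC by (rule L(2))
  show "coact BC (tB s a) = ?g s a" if "s \<in> carrier S" "a \<in> carrier A" for s a
    unfolding coact_BC by (rule L(3)) (assumption | rule that)+
qed

text \<open>\<open>Phi\<close> is the cancellation of R in S \<otimes> (R \<otimes> H), sending s
  \<otimes> (b \<otimes> x) to s f(b) \<otimes> x. It is assembled from the maps
  \<open>Phi1 s\<close> on the inner tensor product; \<open>Psi\<close> goes back by inserting the
  unit of R.\<close>

definition Phi1 where
  "Phi1 s = tensor_lift (add_monoid U.M) (\<lambda>b x. U.t (s \<otimes>\<^bsub>S\<^esub> f b) x)"

definition Phi where
  "Phi = tensor_lift (add_monoid U.M) (\<lambda>s a. Phi1 s a)"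

definition Psi where
  "Psi = tensor_lift (add_monoid BX) (\<lambda>s x. tB s (t \<one>\<^bsub>R\<^esub> x))"

lemma Phi1_facts:
  assumes s: "s \<in> carrier S"
  shows "bal kk E.SM HH U.M (\<lambda>b x. U.t (s \<otimes>\<^bsub>S\<^esub> f b) x)" "Phi1 s \<in> addhom M U.M"
    "b \<in> carrier R \<Longrightarrow> Phi1 s (t b x) = U.t (s \<otimes>\<^bsub>S\<^esub> f b) x"
proof -
  let ?g = "\<lambda>b x. U.t (s \<otimes>\<^bsub>S\<^esub> f b) x"
  have "(\<lambda>b. s \<otimes>\<^bsub>S\<^esub> f b) \<in> addhom R S"
    using s by (intro addhomI) (simp_all add: U.E.S.r_distr)
  then have 1: "(\<lambda>b. ?g b x) \<in> addhom R U.M" for x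
    by (rule addhom_comp) (rule U.E.tS_addhom_left, simp)
  have 2: "(\<lambda>x. ?g b x) \<in> addhom HH U.M" if "b \<in> carrier R" for b
    by (rule U.E.tS_addhom_right) (simp add: s that)
  have 3: "?g (\<iota> a \<otimes>\<^bsub>R\<^esub> b) x = ?g b (a \<odot>\<^bsub>HH\<^esub> x)" if "b \<in> carrier R" for a b x
    using U.E.tS_smult[of a "s \<otimes>\<^bsub>S\<^esub> f b" x] s that \<iota> by (simp add: U.E.S.m_lcomm)
  note L = E.lift_X[where g = ?g, OF U.E.abelian_X 1 2 3]
  show "bal kk E.SM HH U.M ?g"
    by (rule L(1))
  show "Phi1 s \<in> addhom M U.M"
    unfolding Phi1_def by (rule L(2))
  show "b \<in> carrier R \<Longrightarrow> Phi1 s (t b x) = ?g b x"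
    unfolding Phi1_def by (rule L(3)) simp_all
qed

lemma Phi_facts:
  "Phi \<in> addhom BX U.M"
  "s \<in> carrier S \<Longrightarrow> a \<in> carrier A \<Longrightarrow> Phi (tB s a) = Phi1 s a"
proof -
  have 1: "(\<lambda>s. Phi1 s a) \<in> addhom S U.M" if a: "a \<in> carrier A" for a
    unfolding Phi1_def
  proof (rule E.T.lift_param[OF U.E.abelian_X U.E.S.abelian_group_axioms Phi1_facts(1)])
    show "(\<lambda>s. U.t (s \<otimes>\<^bsub>S\<^esub> f b) x) \<in> addhom S U.M" if "b \<in> carrier E.SM" for b x
      by (rule addhom_comp[OF _ U.E.tS_addhom_left]) (use that in \<open>auto intro!: addhomI simp: U.E.S.l_distr\<close>)
    show "a \<in> carrier (tensor_group kk E.SM HH)"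
      using a by simp
  qed
  have 2: "(\<lambda>a. Phi1 s a) \<in> addhom A U.M" if "s \<in> carrier S" for s
    unfolding addhom_A by (rule Phi1_facts(2)[OF that])
  have 3: "Phi1 (f r \<otimes>\<^bsub>S\<^esub> s) a = Phi1 s (r \<odot>\<^bsub>A\<^esub> a)"
    if r: "r \<in> carrier R" and s: "s \<in> carrier S" and a: "a \<in> carrier A" for r s a
  proof (rule E.ext_X[where h = "Phi1 (f r \<otimes>\<^bsub>S\<^esub> s)" and h' = "\<lambda>a. Phi1 s (r \<odot>\<^bsub>A\<^esub> a)", OF U.E.abelian_X])
    show "Phi1 (f r \<otimes>\<^bsub>S\<^esub> s) \<in> addhom M U.M"
      by (rule Phi1_facts(2)) (simp add: r s)
    show "(\<lambda>a. Phi1 s (r \<odot>\<^bsub>A\<^esub> a)) \<in> addhom M U.M"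
      using addhom_comp[OF E.smult_X(1)[OF r] Phi1_facts(2)[OF s]] by simp
    show "Phi1 (f r \<otimes>\<^bsub>S\<^esub> s) (t b x) = Phi1 s (r \<odot>\<^bsub>A\<^esub> t b x)" if "b \<in> carrier R" for b x
      using that r s by (simp add: Phi1_facts(3) E.smult_X(2) U.E.S.m_ac)
  qed (use a in simp)
  note L = B.lift_X[where g = Phi1, OF U.E.abelian_X 1 2 3]
  show "Phi \<in> addhom BX U.M"
    unfolding Phi_def by (rule L(2))
  show "s \<in> carrier S \<Longrightarrow> a \<in> carrier A \<Longrightarrow> Phi (tB s a) = Phi1 s a"
    unfolding Phi_def by (rule L(3))
qed

lemma Phi_pure: "s \<in> carrier S \<Longrightarrow> b \<in> carrier R \<Longrightarrow> Phi (tB s (t b x)) = U.t (s \<otimes>\<^bsub>S\<^esub> f b) x"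
  by (simp add: Phi_facts(2) Phi1_facts(3))

lemma Psi_facts:
  "Psi \<in> addhom U.M BX"
  "s \<in> carrier S \<Longrightarrow> Psi (U.t s x) = tB s (t \<one>\<^bsub>R\<^esub> x)"
proof -
  let ?g = "\<lambda>s x. tB s (t \<one>\<^bsub>R\<^esub> x)"
  have 1: "(\<lambda>s. ?g s x) \<in> addhom S BX" for x
    by (rule tB_addhom(1)) simp
  have 2: "(\<lambda>x. ?g s x) \<in> addhom HH BX" if "s \<in> carrier S" for s
    by (rule addhom_comp[OF _ tB_addhom(2)[OF that, unfolded addhom_A]]) (rule E.tS_addhom_right, simp)
  have 3: "?g ((f \<circ> \<iota>) a \<otimes>\<^bsub>S\<^esub> s) x = ?g s (a \<odot>\<^bsub>HH\<^esub> x)" if "s \<in> carrier S" for a s x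
    using B.tS_smult[of "\<iota> a" s "t \<one>\<^bsub>R\<^esub> x"] E.tS_smult[of a "\<one>\<^bsub>R\<^esub>" x] that \<iota> by (simp add: E.smult_X(2))
  note L = U.E.lift_X[where g = ?g, OF B.abelian_X 1 2 3]
  show "Psi \<in> addhom U.M BX"
    unfolding Psi_def by (rule L(2))
  show "s \<in> carrier S \<Longrightarrow> Psi (U.t s x) = ?g s x"
    unfolding Psi_def by (rule L(3)) simp_all
qed

text \<open>The tensor product is over R, so b can be moved across it: s f(b) \<otimes> (1 \<otimes>
  x) = s \<otimes> (b \<otimes> x).\<close>

lemma Psi_Phi: "P \<in> carrier BX \<Longrightarrow> Psi (Phi P) = P"
proof (rule ext_BX2[where h = "\<lambda>P. Psi (Phi P)" and h' = "\<lambda>P. P", OF B.abelian_X addhom_comp[OF Phi_facts(1) Psi_facts(1)]])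
  show "(\<lambda>P. P) \<in> addhom BX BX"
    by (rule addhomI) simp_all
  show "Psi (Phi (tB s (t b x))) = tB s (t b x)" if "s \<in> carrier S" "b \<in> carrier R" for s b x
    using that B.tS_smult[of b s "t \<one>\<^bsub>R\<^esub> x"]
    by (simp add: Phi_pure Psi_facts(2) E.smult_X(2) U.E.S.m_comm)
qed

lemma Phi_Psi: "P \<in> carrier U.M \<Longrightarrow> Phi (Psi P) = P"
proof (rule U.E.ext_X[where h = "\<lambda>P. Phi (Psi P)" and h' = "\<lambda>P. P", OF U.E.abelian_X addhom_comp[OF Psi_facts(1) Phi_facts(1)]])
  show "(\<lambda>P. P) \<in> addhom U.M U.M"
    by (rule addhomI) simp_all
qed (simp_all add: Psi_facts(2) Phi_pure)

lemma Phi_smult: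
  assumes r: "r \<in> carrier S" and P: "P \<in> carrier BX"
  shows "Phi (r \<odot>\<^bsub>BX\<^esub> P) = r \<odot>\<^bsub>U.M\<^esub> Phi P"
  by (rule ext_BX2[where h = "\<lambda>P. Phi (r \<odot>\<^bsub>BX\<^esub> P)" and h' = "\<lambda>P. r \<odot>\<^bsub>U.M\<^esub> Phi P", OF U.E.abelian_X
        addhom_comp[OF B.smult_X(1)[OF r] Phi_facts(1)] addhom_comp[OF Phi_facts(1) U.E.smult_X(1)[OF r]] _ P])
    (simp add: B.smult_X(2) U.E.smult_X(2) r Phi_pure U.E.S.m_assoc)

text \<open>The structure constants b c \<gamma>(x1, y1) of the product are carried by the ring
  homomorphism f to those of the image cocycle.\<close>

lemma Phi1_W:
  assumes s: "s \<in> carrier S" "s' \<in> carrier S" and b: "b \<in> carrier R" "c \<in> carrier R"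
  shows "Phi1 (s \<otimes>\<^bsub>S\<^esub> s') (W b c x y) = U.W (s \<otimes>\<^bsub>S\<^esub> f b) (s' \<otimes>\<^bsub>S\<^esub> f c) x y"
proof -
  have d: "b \<otimes>\<^bsub>R\<^esub> c \<in> carrier R" and ss: "s \<otimes>\<^bsub>S\<^esub> s' \<in> carrier S"
    using assms by simp_all
  have "Phi1 (s \<otimes>\<^bsub>S\<^esub> s') (t (b \<otimes>\<^bsub>R\<^esub> c \<otimes>\<^bsub>R\<^esub> \<gamma> x1 y1) z) =
      U.t (s \<otimes>\<^bsub>S\<^esub> f b \<otimes>\<^bsub>S\<^esub> (s' \<otimes>\<^bsub>S\<^esub> f c) \<otimes>\<^bsub>S\<^esub> f (\<gamma> x1 y1)) z" for x1 y1 z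
    using assms by (simp add: Phi1_facts(3) U.E.S.m_ac)
  then show ?thesis
    unfolding W_def U.W_def
      sw_map[OF E.abelian_X kbilin_bal[OF W_inner(2)[OF d]] U.E.abelian_X Phi1_facts(2)[OF ss]]
      sw_map[OF E.abelian_X kbilin_bal[OF W_inner(1)[OF d]] U.E.abelian_X Phi1_facts(2)[OF ss]]
    by (simp only:)
qed

lemma Phi_mult:
  assumes P: "P \<in> carrier BX" and Q: "Q \<in> carrier BX"
  shows "Phi (P \<otimes>\<^bsub>BC\<^esub> Q) = Phi P \<otimes>\<^bsub>U.A\<^esub> Phi Q"
proof -
  have cA: "t b x \<in> carrier A" if "b \<in> carrier R" for b x
    using that by simp
  have cB: "tB s (t b x) \<in> carrier BX" if "s \<in> carrier S" "b \<in> carrier R" for s b x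
    using that by simp
  have cU: "Phi P \<in> carrier U.A" if "P \<in> carrier BX" for P
    using addhomD(1)[OF Phi_facts(1) that] by simp
  have ml: "(\<lambda>S. S \<otimes>\<^bsub>U.A\<^esub> T) \<in> addhom U.M U.M" if "T \<in> carrier U.A" for T
    using U.mult_addhom_left[OF that] by (simp only: U.addhom_A)
  have mr: "(\<lambda>T. S \<otimes>\<^bsub>U.A\<^esub> T) \<in> addhom U.M U.M" if "S \<in> carrier U.A" for S
    using U.mult_addhom_right[OF that] by (simp only: U.addhom_A)
  have 1: "Phi (tB s (t b x) \<otimes>\<^bsub>BC\<^esub> tB s' (t c y)) = Phi (tB s (t b x)) \<otimes>\<^bsub>U.A\<^esub> Phi (tB s' (t c y))"
    if s: "s \<in> carrier S" "s' \<in> carrier S" and b: "b \<in> carrier R" "c \<in> carrier R" for s s' b c x y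
  proof -
    have "Phi (tB s (t b x) \<otimes>\<^bsub>BC\<^esub> tB s' (t c y)) = Phi1 (s \<otimes>\<^bsub>S\<^esub> s') (t b x \<otimes>\<^bsub>A\<^esub> t c y)"
      using mult_BC_pure[OF s(1) cA[OF b(1)] s(2) cA[OF b(2)]]
        Phi_facts(2)[OF U.E.S.m_closed[OF s] mult_A_closed[OF cA[OF b(1)] cA[OF b(2)]]] by simp
    also have "\<dots> = Phi (tB s (t b x)) \<otimes>\<^bsub>U.A\<^esub> Phi (tB s' (t c y))"
      using s b by (simp add: mult_pure Phi1_W Phi_pure U.mult_pure)
    finally show ?thesis .
  qed
  have 2: "Phi (tB s (t b x) \<otimes>\<^bsub>BC\<^esub> Q) = Phi (tB s (t b x)) \<otimes>\<^bsub>U.A\<^esub> Phi Q"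
    if s: "s \<in> carrier S" and b: "b \<in> carrier R" and Q: "Q \<in> carrier BX" for s b x Q
    by (rule ext_BX2[where h = "\<lambda>Q. Phi (tB s (t b x) \<otimes>\<^bsub>BC\<^esub> Q)" and h' = "\<lambda>Q. Phi (tB s (t b x)) \<otimes>\<^bsub>U.A\<^esub> Phi Q",
          OF U.E.abelian_X addhom_comp[OF mult_BC_addhom_right[OF cB[OF s b]] Phi_facts(1)]
            addhom_comp[OF Phi_facts(1) mr[OF cU[OF cB[OF s b]]]] 1[OF s _ b] Q])
  show ?thesis
    by (rule ext_BX2[where h = "\<lambda>P. Phi (P \<otimes>\<^bsub>BC\<^esub> Q)" and h' = "\<lambda>P. Phi P \<otimes>\<^bsub>U.A\<^esub> Phi Q",
          OF U.E.abelian_X addhom_comp[OF mult_BC_addhom_left[OF Q] Phi_facts(1)]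
            addhom_comp[OF Phi_facts(1) ml[OF cU[OF Q]]] 2[OF _ _ Q] P])
qed

lemma bal_Phi: "bal kk BR HH U.MH (\<lambda>a0 a1. U.t' (Phi a0) a1)"
proof (rule balI)
  show "(\<lambda>a0. U.t' (Phi a0) a1) \<in> addhom BR U.MH" for a1
    using addhom_comp[OF Phi_facts(1) U.t'_addhom] by simp
  show "(\<lambda>a1. U.t' (Phi a0) a1) \<in> addhom HH U.MH" if "a0 \<in> carrier BR" for a0
    by (rule klinD(4)[OF U.klin_t']) (use that addhomD(1)[OF Phi_facts(1)] in simp)
  show "U.t' (Phi (r \<odot>\<^bsub>BR\<^esub> a0)) a1 = U.t' (Phi a0) (r \<odot>\<^bsub>HH\<^esub> a1)" if "a0 \<in> carrier BR" for r a0 a1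
  proof -
    have a0: "a0 \<in> carrier BX"
      using that by simp
    show ?thesis
      using U.MH.pure_smult[of r "Phi a0" a1] Phi_smult[OF _ a0, of "f (\<iota> r)"] addhomD(1)[OF Phi_facts(1) a0] \<iota>
      by simp
  qed
qed

lemma Phi_coact:
  assumes P: "P \<in> carrier BX"
  shows "coact U.A (Phi P) = tensor_lift (add_monoid U.MH) (\<lambda>a0 a1. U.t' (Phi a0) a1) (coact BC P)"
proof (rule ext_BX2[OF U.MH.abelian_tensor _ _ _ P])
  note aU = U.MH.abelian_tensor and aB = BH.abelian_tensor
  show "(\<lambda>P. coact U.A (Phi P)) \<in> addhom BX U.MH"
    by (rule addhom_comp[OF Phi_facts(1) U.coact_facts(2)[unfolded U.addhom_A]])
  show "(\<lambda>P. tensor_lift (add_monoid U.MH) (\<lambda>a0 a1. U.t' (Phi a0) a1) (coact BC P)) \<in> addhom BX U.MH"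
    by (rule addhom_comp[OF coact_BC_facts(1) BH.lift_addhom[OF aU bal_Phi]])
  fix s b x assume s: "s \<in> carrier S" and b: "b \<in> carrier R"
  have lp: "tensor_lift (add_monoid BMH) (\<lambda>a0 a1. tB' (tB s a0) a1) (t' (t b p) q) = tB' (tB s (t b p)) q" for p q
    by (rule MH.lift_pure[OF aB coact_BC_inner[OF s]]) (simp_all add: b)
  have lq: "tensor_lift (add_monoid U.MH) (\<lambda>a0 a1. U.t' (Phi a0) a1) (tB' (tB s (t b p)) q) = U.t' (U.t (s \<otimes>\<^bsub>S\<^esub> f b) p) q" for p q
    unfolding Phi_pure[OF s b, symmetric] by (rule BH.lift_pure[OF aU bal_Phi]) (simp_all add: b s)
  have kb: "bal kk HH HH BMH (\<lambda>x1 x2. tB' (tB s (t b x1)) x2)"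
    using bal_comp[OF kbilin_bal[OF coact_summand[OF b]] MH.lift_addhom[OF aB coact_BC_inner[OF s]]]
    unfolding lp .
  have tA: "t b x \<in> carrier A"
    using b by simp
  have sb: "s \<otimes>\<^bsub>S\<^esub> f b \<in> carrier S"
    using s b by simp
  show "coact U.A (Phi (tB s (t b x))) =
      tensor_lift (add_monoid U.MH) (\<lambda>a0 a1. U.t' (Phi a0) a1) (coact BC (tB s (t b x)))"
    unfolding coact_BC_facts(2)[OF s tA] coact_facts(3)[OF b] Phi_pure[OF s b] U.coact_facts(3)[OF sb]
      sw_map[OF MH.abelian_tensor kbilin_bal[OF coact_summand[OF b]] aB
            MH.lift_addhom[OF aB coact_BC_inner[OF s]]] lp
      sw_map[OF aB kb aU BH.lift_addhom[OF aU bal_Phi]] lq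
    by (rule refl)
qed

theorem base_change_iso: "comodule_algebra_iso scale S (f \<circ> \<iota>) BC U.A Phi"
  unfolding comodule_algebra_iso_def Let_def
proof (intro conjI ballI)
  have PhiC: "Phi P \<in> carrier U.M" if "P \<in> carrier BX" for P
    by (rule addhomD(1)[OF Phi_facts(1) that])
  have PsiC: "Psi P \<in> carrier BX" if "P \<in> carrier U.M" for P
    by (rule addhomD(1)[OF Psi_facts(1) that])
  show "Phi \<in> ring_iso BC U.A"
  proof (rule ring_iso_memI)
    show "bij_betw Phi (carrier BC) (carrier U.A)"
      unfolding BC_simps(1) U.A_simps(1)
      by (rule bij_betw_byWitness[where f' = Psi]) (use PhiC PsiC Psi_Phi Phi_Psi in blast)+
    show "Phi \<one>\<^bsub>BC\<^esub> = \<one>\<^bsub>U.A\<^esub>"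
      using Phi_pure[of "\<one>\<^bsub>S\<^esub>" "inv\<^bsub>R\<^esub> (\<gamma> 1 1)" 1] inv_\<gamma>11
        f_simps(1)[OF inv_\<gamma>11(1)] by simp
  next
    fix P Q assume "P \<in> carrier BC" "Q \<in> carrier BC"
    then have P: "P \<in> carrier BX" and Q: "Q \<in> carrier BX"
      by simp_all
    show "Phi P \<in> carrier U.A"
      using PhiC[OF P] by simp
    show "Phi (P \<otimes>\<^bsub>BC\<^esub> Q) = Phi P \<otimes>\<^bsub>U.A\<^esub> Phi Q"
      by (rule Phi_mult[OF P Q])
    show "Phi (P \<oplus>\<^bsub>BC\<^esub> Q) = Phi P \<oplus>\<^bsub>U.A\<^esub> Phi Q"
      using addhomD(2)[OF Phi_facts(1) P Q] by simp
  qed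
next
  fix r P assume "r \<in> carrier S" "P \<in> carrier BC"
  then show "Phi (r \<odot>\<^bsub>BC\<^esub> P) = r \<odot>\<^bsub>U.A\<^esub> Phi P"
    using Phi_smult[of r P] by simp
next
  fix P assume "P \<in> carrier BC"
  then have P: "P \<in> carrier BX"
    by simp
  \<comment> \<open>The isomorphism predicate speaks of \<open>U.A\<close>, the coaction lemmas of
    \<open>U.M\<close>. The two records share carrier, addition and scalar action, and the tensor
    product depends on nothing else.\<close>
  have c: "tensor_group kk (restrict_scalars (f \<circ> \<iota>) U.A) HH = tensor_group kk U.RM HH"
    "pure_tensor kk (restrict_scalars (f \<circ> \<iota>) U.A) HH = U.t'"
    by (rule tensor_group_cong; simp)+
  have "coact BC P \<in> carrier (tensor_group kk BR HH)"
    using addhomD(1)[OF coact_BC_facts(1) P] by simp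
  then show "coact U.A (Phi P) = tensor_lift (tensor_group kk (restrict_scalars (f \<circ> \<iota>) U.A) HH)
      (\<lambda>a0 a1. pure_tensor kk (restrict_scalars (f \<circ> \<iota>) U.A) HH (Phi a0) a1) (coact BC P)"
    unfolding c Phi_coact[OF P] by (rule BH.lift_group_eq'[OF U.MH.tensor_modules_axioms bal_Phi, symmetric])
qed

end

section \<open>Isomorphisms of comodule algebras\<close>

context hopf_algebra
begin

text \<open>Closure conditions that \<open>comodule_algebra_iso\<close> takes for granted of its two
  algebras; composing and inverting isomorphisms relies on them.\<close>

definition comod_ok where
  "comod_ok R \<iota> A \<longleftrightarrow> opmod R A \<and> (\<forall>a. \<iota> a \<in> carrier R) \<and>
    (\<forall>a\<in>carrier A. coact A a \<in> carrier (tensor_group kk (restrict_scalars \<iota> A) HH)) \<and>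
    (\<forall>a\<in>carrier A. \<forall>b\<in>carrier A. a \<otimes>\<^bsub>A\<^esub> b \<in> carrier A) \<and> \<one>\<^bsub>A\<^esub> \<in> carrier A"

lemma comod_okD:
  assumes "comod_ok R \<iota> A"
  shows "opmod R A" "\<iota> a \<in> carrier R" "abelian_group A"
    "x \<in> carrier A \<Longrightarrow> coact A x \<in> carrier (tensor_group kk (restrict_scalars \<iota> A) HH)"
    "x \<in> carrier A \<Longrightarrow> y \<in> carrier A \<Longrightarrow> x \<otimes>\<^bsub>A\<^esub> y \<in> carrier A" "\<one>\<^bsub>A\<^esub> \<in> carrier A"
    "opmod kk (restrict_scalars \<iota> A)" "tensor_modules kk (restrict_scalars \<iota> A) HH"
proof -
  show 1: "opmod R A" and 2: "\<And>a. \<iota> a \<in> carrier R"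
    and "x \<in> carrier A \<Longrightarrow> coact A x \<in> carrier (tensor_group kk (restrict_scalars \<iota> A) HH)"
    and "x \<in> carrier A \<Longrightarrow> y \<in> carrier A \<Longrightarrow> x \<otimes>\<^bsub>A\<^esub> y \<in> carrier A" "\<one>\<^bsub>A\<^esub> \<in> carrier A"
    using assms by (simp_all add: comod_ok_def)
  show "abelian_group A"
    by (rule opmodD(1)[OF 1])
  show 3: "opmod kk (restrict_scalars \<iota> A)"
    by (rule opmod_restrict_scalars[OF 1 2])
  show "tensor_modules kk (restrict_scalars \<iota> A) HH"
    by (rule opmod_tensor_modules[OF 3 opmod_HH])
qed

lemma bal_tensor_map:
  assumes A: "comod_ok R \<iota> A" and B: "comod_ok R \<iota> B" and add: "\<Phi> \<in> addhom A B"
    and smult: "\<And>r a. r \<in> carrier R \<Longrightarrow> a \<in> carrier A \<Longrightarrow> \<Phi> (r \<odot>\<^bsub>A\<^esub> a) = r \<odot>\<^bsub>B\<^esub> \<Phi> a"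
  shows "bal kk (restrict_scalars \<iota> A) HH (tensor_product kk (restrict_scalars \<iota> B) HH)
    (\<lambda>a0 a1. pure_tensor kk (restrict_scalars \<iota> B) HH (\<Phi> a0) a1)"
proof -
  interpret B: tensor_modules kk "restrict_scalars \<iota> B" HH
    by (rule comod_okD(8)[OF B])
  show ?thesis
  proof (rule balI)
    fix a1
    show "(\<lambda>a0. pure_tensor kk (restrict_scalars \<iota> B) HH (\<Phi> a0) a1) \<in>
        addhom (restrict_scalars \<iota> A) (tensor_product kk (restrict_scalars \<iota> B) HH)"
      using addhom_comp[OF add balD(1)[OF B.bal_pure, simplified]] by simp
  next
    fix a0 assume "a0 \<in> carrier (restrict_scalars \<iota> A)"
    then have "a0 \<in> carrier A"
      by simp
    then show "(\<lambda>a1. pure_tensor kk (restrict_scalars \<iota> B) HH (\<Phi> a0) a1) \<in>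
        addhom HH (tensor_product kk (restrict_scalars \<iota> B) HH)"
      using balD(2)[OF B.bal_pure, of "\<Phi> a0"] addhomD(1)[OF add] by simp
  next
    fix r a0 a1 assume "a0 \<in> carrier (restrict_scalars \<iota> A)"
    then have a0: "a0 \<in> carrier A"
      by simp
    show "pure_tensor kk (restrict_scalars \<iota> B) HH (\<Phi> (r \<odot>\<^bsub>restrict_scalars \<iota> A\<^esub> a0)) a1 =
        pure_tensor kk (restrict_scalars \<iota> B) HH (\<Phi> a0) (r \<odot>\<^bsub>HH\<^esub> a1)"
      using B.pure_smult[of r "\<Phi> a0" a1] smult[OF comod_okD(2)[OF A, of r] a0] addhomD(1)[OF add a0] by simp
  qed
qed

lemma iso_facts:
  assumes A: "comod_ok R \<iota> A" and B: "comod_ok R \<iota> B" and iso: "comodule_algebra_iso scale R \<iota> A B \<Phi>"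
  shows "\<Phi> \<in> addhom A B"
    and "r \<in> carrier R \<Longrightarrow> a \<in> carrier A \<Longrightarrow> \<Phi> (r \<odot>\<^bsub>A\<^esub> a) = r \<odot>\<^bsub>B\<^esub> \<Phi> a"
    and "bij_betw \<Phi> (carrier A) (carrier B)"
    and "a \<in> carrier A \<Longrightarrow> b \<in> carrier A \<Longrightarrow> \<Phi> (a \<otimes>\<^bsub>A\<^esub> b) = \<Phi> a \<otimes>\<^bsub>B\<^esub> \<Phi> b"
    and "\<Phi> \<one>\<^bsub>A\<^esub> = \<one>\<^bsub>B\<^esub>"
    and "bal kk (restrict_scalars \<iota> A) HH (tensor_product kk (restrict_scalars \<iota> B) HH)
      (\<lambda>a0 a1. pure_tensor kk (restrict_scalars \<iota> B) HH (\<Phi> a0) a1)"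
    and "a \<in> carrier A \<Longrightarrow> coact B (\<Phi> a) =
      tensor_lift (add_monoid (tensor_product kk (restrict_scalars \<iota> B) HH))
        (\<lambda>a0 a1. pure_tensor kk (restrict_scalars \<iota> B) HH (\<Phi> a0) a1) (coact A a)"
proof -
  from iso have ri: "\<Phi> \<in> ring_iso A B"
    by (simp add: comodule_algebra_iso_def)
  show add: "\<Phi> \<in> addhom A B"
    using ring_iso_memE[OF ri] by (intro addhomI)
  show sm: "\<Phi> (r \<odot>\<^bsub>A\<^esub> a) = r \<odot>\<^bsub>B\<^esub> \<Phi> a" if "r \<in> carrier R" "a \<in> carrier A" for r a
    using iso that by (simp add: comodule_algebra_iso_def)
  show "bij_betw \<Phi> (carrier A) (carrier B)" "a \<in> carrier A \<Longrightarrow> b \<in> carrier A \<Longrightarrow> \<Phi> (a \<otimes>\<^bsub>A\<^esub> b) = \<Phi> a \<otimes>\<^bsub>B\<^esub> \<Phi> b"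
    "\<Phi> \<one>\<^bsub>A\<^esub> = \<one>\<^bsub>B\<^esub>"
    using ring_iso_memE[OF ri] by auto
  show b: "bal kk (restrict_scalars \<iota> A) HH (tensor_product kk (restrict_scalars \<iota> B) HH)
      (\<lambda>a0 a1. pure_tensor kk (restrict_scalars \<iota> B) HH (\<Phi> a0) a1)"
    by (rule bal_tensor_map[OF A B add sm])
  interpret A: tensor_modules kk "restrict_scalars \<iota> A" HH
    by (rule comod_okD(8)[OF A])
  show "coact B (\<Phi> a) =
      tensor_lift (add_monoid (tensor_product kk (restrict_scalars \<iota> B) HH))
        (\<lambda>a0 a1. pure_tensor kk (restrict_scalars \<iota> B) HH (\<Phi> a0) a1) (coact A a)" if a: "a \<in> carrier A"
    unfolding A.lift_group_eq'[OF comod_okD(8)[OF B] b comod_okD(4)[OF A a], symmetric]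
    using iso a by (simp only: comodule_algebra_iso_def Let_def)
qed

lemma isoI:
  assumes A: "comod_ok R \<iota> A" and B: "comod_ok R \<iota> B"
    and add: "\<Phi> \<in> addhom A B"
    and smult: "\<And>r a. r \<in> carrier R \<Longrightarrow> a \<in> carrier A \<Longrightarrow> \<Phi> (r \<odot>\<^bsub>A\<^esub> a) = r \<odot>\<^bsub>B\<^esub> \<Phi> a"
    and bij: "bij_betw \<Phi> (carrier A) (carrier B)"
    and mult: "\<And>a b. a \<in> carrier A \<Longrightarrow> b \<in> carrier A \<Longrightarrow> \<Phi> (a \<otimes>\<^bsub>A\<^esub> b) = \<Phi> a \<otimes>\<^bsub>B\<^esub> \<Phi> b"
    and one: "\<Phi> \<one>\<^bsub>A\<^esub> = \<one>\<^bsub>B\<^esub>"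
    and coact: "\<And>a. a \<in> carrier A \<Longrightarrow> coact B (\<Phi> a) =
      tensor_lift (add_monoid (tensor_product kk (restrict_scalars \<iota> B) HH))
        (\<lambda>a0 a1. pure_tensor kk (restrict_scalars \<iota> B) HH (\<Phi> a0) a1) (coact A a)"
  shows "comodule_algebra_iso scale R \<iota> A B \<Phi>"
  unfolding comodule_algebra_iso_def Let_def
proof (intro conjI ballI)
  interpret A: tensor_modules kk "restrict_scalars \<iota> A" HH
    by (rule comod_okD(8)[OF A])
  show "\<Phi> \<in> ring_iso A B"
    by (rule ring_iso_memI) (simp_all add: addhomD[OF add] bij mult one)
  show "coact B (\<Phi> a) = tensor_lift (tensor_group kk (restrict_scalars \<iota> B) HH)
      (\<lambda>a0 a1. pure_tensor kk (restrict_scalars \<iota> B) HH (\<Phi> a0) a1) (coact A a)" if a: "a \<in> carrier A" for a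
    unfolding coact[OF a]
    by (rule A.lift_group_eq'[OF comod_okD(8)[OF B] bal_tensor_map[OF A B add smult] comod_okD(4)[OF A a], symmetric])
qed (rule smult)

text \<open>Functoriality of tensoring with H, which turns the colinearity of two maps into that of
  their composite.\<close>

lemma tensor_map_comp:
  assumes A: "comod_ok R \<iota> A" and B: "comod_ok R \<iota> B"
    and b: "bal kk (restrict_scalars \<iota> A) HH (tensor_product kk (restrict_scalars \<iota> B) HH)
      (\<lambda>a0 a1. pure_tensor kk (restrict_scalars \<iota> B) HH (\<Phi> a0) a1)"
    and Y: "abelian_group Y" and c: "bal kk (restrict_scalars \<iota> B) HH Y g"
    and \<Phi>: "\<And>a. a \<in> carrier A \<Longrightarrow> \<Phi> a \<in> carrier B"
    and T: "T \<in> carrier (tensor_group kk (restrict_scalars \<iota> A) HH)"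
  shows "tensor_lift (add_monoid Y) g (tensor_lift (add_monoid (tensor_product kk (restrict_scalars \<iota> B) HH))
      (\<lambda>a0 a1. pure_tensor kk (restrict_scalars \<iota> B) HH (\<Phi> a0) a1) T) =
    tensor_lift (add_monoid Y) (\<lambda>a0 a1. g (\<Phi> a0) a1) T"
proof -
  interpret A: tensor_modules kk "restrict_scalars \<iota> A" HH
    by (rule comod_okD(8)[OF A])
  interpret B: tensor_modules kk "restrict_scalars \<iota> B" HH
    by (rule comod_okD(8)[OF B])
  show ?thesis
    unfolding A.lift_map[OF B.abelian_tensor b Y B.lift_addhom[OF Y c] T]
  proof (rule A.lift_cong[OF Y bal_comp[OF b B.lift_addhom[OF Y c]] _ T])
    fix m n assume "m \<in> carrier (restrict_scalars \<iota> A)" "n \<in> carrier HH"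
    then show "tensor_lift (add_monoid Y) g (pure_tensor kk (restrict_scalars \<iota> B) HH (\<Phi> m) n) = g (\<Phi> m) n"
      by (intro B.lift_pure[OF Y c]) (simp_all add: \<Phi>)
  qed
qed

lemma iso_trans:
  assumes A: "comod_ok R \<iota> A" and B: "comod_ok R \<iota> B" and C: "comod_ok R \<iota> C"
    and f: "comodule_algebra_iso scale R \<iota> A B \<Phi>" and g: "comodule_algebra_iso scale R \<iota> B C \<Psi>"
  shows "comodule_algebra_iso scale R \<iota> A C (\<lambda>a. \<Psi> (\<Phi> a))"
proof (rule isoI[OF A C addhom_comp[OF iso_facts(1)[OF A B f] iso_facts(1)[OF B C g]]])
  note F = iso_facts[OF A B f] and G = iso_facts[OF B C g]
  have cl: "\<Phi> a \<in> carrier B" if "a \<in> carrier A" for a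
    by (rule addhomD(1)[OF F(1) that])
  show "bij_betw (\<lambda>a. \<Psi> (\<Phi> a)) (carrier A) (carrier C)"
    using bij_betw_trans[OF F(3) G(3)] by (simp add: comp_def)
  interpret C: tensor_modules kk "restrict_scalars \<iota> C" HH
    by (rule comod_okD(8)[OF C])
  show "coact C (\<Psi> (\<Phi> a)) = tensor_lift (add_monoid (tensor_product kk (restrict_scalars \<iota> C) HH))
        (\<lambda>a0 a1. pure_tensor kk (restrict_scalars \<iota> C) HH (\<Psi> (\<Phi> a0)) a1) (coact A a)" if a: "a \<in> carrier A" for a
    unfolding G(7)[OF cl[OF a]] F(7)[OF a]
    by (rule tensor_map_comp[OF A B F(6) C.abelian_tensor G(6) cl comod_okD(4)[OF A a]])
qed (use iso_facts[OF A B f] iso_facts[OF B C g] addhomD(1)[OF iso_facts(1)[OF A B f]] in simp_all)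

text \<open>For colinearity of the inverse: \<Psi> \<otimes> id applied to the coaction of \<Phi> x
  gives \<Psi>\<Phi> \<otimes> id of the coaction of x, that is, the coaction of x itself.\<close>

lemma iso_sym:
  assumes A: "comod_ok R \<iota> A" and B: "comod_ok R \<iota> B"
    and f: "comodule_algebra_iso scale R \<iota> A B \<Phi>"
  shows "comodule_algebra_iso scale R \<iota> B A (inv_into (carrier A) \<Phi>)"
proof -
  note F = iso_facts[OF A B f]
  define \<Psi> where "\<Psi> = inv_into (carrier A) \<Phi>"
  have cl: "\<Phi> a \<in> carrier B" if "a \<in> carrier A" for a
    by (rule addhomD(1)[OF F(1) that])
  have \<Psi>\<Phi>: "\<Psi> (\<Phi> a) = a" if "a \<in> carrier A" for a
    unfolding \<Psi>_def by (rule bij_betw_inv_into_left[OF F(3) that])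
  have ex: "\<exists>a. a \<in> carrier A \<and> b = \<Phi> a" if "b \<in> carrier B" for b
    using F(3) that unfolding bij_betw_def by blast
  have \<Psi>: "\<Psi> \<in> addhom B A"
  proof (rule addhomI)
    show "\<Psi> b \<in> carrier A" if "b \<in> carrier B" for b
      using ex[OF that] \<Psi>\<Phi> by auto
    show "\<Psi> (b \<oplus>\<^bsub>B\<^esub> c) = \<Psi> b \<oplus>\<^bsub>A\<^esub> \<Psi> c" if bB: "b \<in> carrier B" and cB: "c \<in> carrier B" for b c
    proof -
      obtain x where x: "x \<in> carrier A" "b = \<Phi> x"
        using ex[OF bB] by blast
      obtain y where y: "y \<in> carrier A" "c = \<Phi> y"
        using ex[OF cB] by blast
      show ?thesis
        unfolding x(2) y(2) addhomD(2)[OF F(1) x(1) y(1), symmetric] \<Psi>\<Phi>[OF x(1)] \<Psi>\<Phi>[OF y(1)]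
        by (rule \<Psi>\<Phi>) (rule abelian_groupE(1)[OF comod_okD(3)[OF A] x(1) y(1)])
    qed
  qed
  have sm: "\<Psi> (r \<odot>\<^bsub>B\<^esub> b) = r \<odot>\<^bsub>A\<^esub> \<Psi> b" if r: "r \<in> carrier R" and b: "b \<in> carrier B" for r b
  proof -
    obtain x where x: "x \<in> carrier A" "b = \<Phi> x"
      using ex b by blast
    show ?thesis
      unfolding x(2) F(2)[OF r x(1), symmetric] \<Psi>\<Phi>[OF x(1)]
      by (rule \<Psi>\<Phi>) (rule opmodD(4)[OF comod_okD(1)[OF A] r x(1)])
  qed
  note b\<Psi> = bal_tensor_map[OF B A \<Psi> sm]
  interpret A: tensor_modules kk "restrict_scalars \<iota> A" HH
    by (rule comod_okD(8)[OF A])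
  show ?thesis
    unfolding \<Psi>_def[symmetric]
  proof (rule isoI[OF B A \<Psi> sm])
    show "bij_betw \<Psi> (carrier B) (carrier A)"
      unfolding \<Psi>_def by (rule bij_betw_inv_into[OF F(3)])
    show "\<Psi> \<one>\<^bsub>B\<^esub> = \<one>\<^bsub>A\<^esub>"
      unfolding F(5)[symmetric] by (rule \<Psi>\<Phi>[OF comod_okD(6)[OF A]])
    fix b assume b: "b \<in> carrier B"
    obtain x where x: "x \<in> carrier A" "b = \<Phi> x"
      using ex b by blast
    show "\<Psi> (b \<otimes>\<^bsub>B\<^esub> c) = \<Psi> b \<otimes>\<^bsub>A\<^esub> \<Psi> c" if c: "c \<in> carrier B" for c
    proof -
      obtain y where y: "y \<in> carrier A" "c = \<Phi> y"
        using ex c by blast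
      show ?thesis
        unfolding x(2) y(2) F(4)[OF x(1) y(1), symmetric] \<Psi>\<Phi>[OF x(1)] \<Psi>\<Phi>[OF y(1)]
        by (rule \<Psi>\<Phi>) (rule comod_okD(5)[OF A x(1) y(1)])
    qed
    have cA: "coact A x \<in> carrier (tensor_group kk (restrict_scalars \<iota> A) HH)"
      by (rule comod_okD(4)[OF A x(1)])
    have e: "bal kk (restrict_scalars \<iota> A) HH (tensor_product kk (restrict_scalars \<iota> A) HH)
      (\<lambda>a0 a1. pure_tensor kk (restrict_scalars \<iota> A) HH (\<Psi> (\<Phi> a0)) a1)"
      using bal_tensor_map[OF A A addhom_comp[OF F(1) \<Psi>]] sm F(2) cl by simp
    have "tensor_lift (add_monoid (tensor_product kk (restrict_scalars \<iota> A) HH))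
        (\<lambda>b0 b1. pure_tensor kk (restrict_scalars \<iota> A) HH (\<Psi> b0) b1) (coact B b) =
      tensor_lift (add_monoid (tensor_product kk (restrict_scalars \<iota> A) HH))
        (\<lambda>b0 b1. pure_tensor kk (restrict_scalars \<iota> A) HH (\<Psi> (\<Phi> b0)) b1) (coact A x)"
      unfolding x(2) F(7)[OF x(1)]
      by (rule tensor_map_comp[OF A B F(6) A.abelian_tensor b\<Psi> cl cA])
    also have "\<dots> = coact A x"
    proof (rule A.lift_unique[OF A.abelian_tensor e, where h = "\<lambda>T. T"])
      show "(\<lambda>T. T) \<in> addhom (tensor_product kk (restrict_scalars \<iota> A) HH) (tensor_product kk (restrict_scalars \<iota> A) HH)"
        by (rule addhomI) simp_all
    qed (simp_all add: \<Psi>\<Phi> cA)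
    finally show "coact A (\<Psi> b) = tensor_lift (add_monoid (tensor_product kk (restrict_scalars \<iota> A) HH))
        (\<lambda>b0 b1. pure_tensor kk (restrict_scalars \<iota> A) HH (\<Psi> b0) b1) (coact B b)"
      using \<Psi>\<Phi>[OF x(1)] x(2) by simp
  qed
qed

end

lemma (in twisted_data) comod_ok_A:
  assumes "\<gamma> 1 1 \<in> Units R"
  shows "comod_ok R \<iota> A"
proof -
  have "tensor_group kk (restrict_scalars \<iota> A) HH = tensor_group kk RM HH"
    by (rule tensor_group_cong) simp_all
  then show ?thesis
    unfolding comod_ok_def using opmod_A \<iota> addhomD(1)[OF coact_facts(2)] mult_A_closed E.S.Units_inv_closed[OF assms]
    by (auto simp del: A_simps(1)) simp_all
qed

lemma (in twisted_base_change) comod_ok_BC: "comod_ok S (f \<circ> \<iota>) BC"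
proof -
  have "tensor_group kk (restrict_scalars (f \<circ> \<iota>) BC) HH = tensor_group kk BR HH"
    by (rule tensor_group_cong) simp_all
  moreover have "P \<otimes>\<^bsub>BC\<^esub> Q \<in> carrier BX" if "P \<in> carrier BX" "Q \<in> carrier BX" for P Q
    by (rule addhomD(1)[OF mult_BC_addhom_left[OF that(2)] that(1)])
  moreover have "coact BC P \<in> carrier (tensor_group kk BR HH)" if "P \<in> carrier BX" for P
    using addhomD(1)[OF coact_BC_facts(1) that] by simp
  moreover have "\<one>\<^bsub>BC\<^esub> \<in> carrier BC"
    using B.tS_closed[of "\<one>\<^bsub>S\<^esub>" "t (inv\<^bsub>R\<^esub> \<gamma> 1 1) 1"] inv_\<gamma>11(1) by simp
  ultimately show ?thesis
    unfolding comod_ok_def using opmod_BC \<iota> by simp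
qed

section \<open>Colinear maps between twisted algebras\<close>

locale twisted_hom_data = twisted_data scale \<Delta> \<epsilon> R \<iota> \<gamma>
  for scale :: "'k::field \<Rightarrow> 'h::ring_1 \<Rightarrow> 'h" and \<Delta> :: "'h \<Rightarrow> ('h, 'h) tensor" and \<epsilon> :: "'h \<Rightarrow> 'k"
    and R :: "('r, 'z) ring_scheme" and \<iota> :: "'k \<Rightarrow> 'r" and \<gamma> :: "'h \<Rightarrow> 'h \<Rightarrow> 'r" +
  assumes \<iota>_hom: "\<iota> \<in> ring_hom kk R"
begin

lemma \<iota>_simps [simp]:
  "\<iota> a \<in> carrier R" "\<iota> (a + b) = \<iota> a \<oplus>\<^bsub>R\<^esub> \<iota> b" "\<iota> (a * b) = \<iota> a \<otimes>\<^bsub>R\<^esub> \<iota> b" "\<iota> 1 = \<one>\<^bsub>R\<^esub>"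
  using \<iota> ring_hom_add[OF \<iota>_hom, of a b] ring_hom_mult[OF \<iota>_hom, of a b] ring_hom_one[OF \<iota>_hom] by simp_all

lemma klin_\<epsilon>: "klin R actR (\<lambda>x. \<iota> (\<epsilon> x))"
  by (rule klinI) (simp_all add: counit_add counit_scale)

lemma klin_mult_const:
  assumes "klin R actR g" "c \<in> carrier R"
  shows "klin R actR (\<lambda>x. c \<otimes>\<^bsub>R\<^esub> g x)" "klin R actR (\<lambda>x. g x \<otimes>\<^bsub>R\<^esub> c)"
  by (rule klinI; simp add: klinD[OF assms(1)] assms(2) E.S.r_distr E.S.l_distr E.S.m_ac)+

definition ev where
  "ev = tensor_lift (add_monoid R) (\<lambda>b x. b \<otimes>\<^bsub>R\<^esub> \<iota> (\<epsilon> x))"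

lemma ev_facts:
  "ev \<in> addhom M R"
  "b \<in> carrier R \<Longrightarrow> ev (t b x) = b \<otimes>\<^bsub>R\<^esub> \<iota> (\<epsilon> x)"
proof -
  let ?g = "\<lambda>b x. b \<otimes>\<^bsub>R\<^esub> \<iota> (\<epsilon> x)"
  have 1: "(\<lambda>b. ?g b x) \<in> addhom R R" for x
    by (rule addhomI) (simp_all add: E.S.l_distr)
  have 2: "(\<lambda>x. ?g b x) \<in> addhom HH R" if "b \<in> carrier R" for b
    by (rule klinD(4)[OF klin_mult_const(1)[OF klin_\<epsilon> that]])
  have 3: "?g (\<iota> a \<otimes>\<^bsub>R\<^esub> b) x = ?g b (a \<odot>\<^bsub>HH\<^esub> x)" if "b \<in> carrier R" for a b x
    using that by (simp add: counit_scale E.S.m_ac)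
  note L = E.lift_X[where g = ?g, OF E.S.abelian_group_axioms 1 2 3]
  show "ev \<in> addhom M R"
    unfolding ev_def by (rule L(2))
  show "b \<in> carrier R \<Longrightarrow> ev (t b x) = b \<otimes>\<^bsub>R\<^esub> \<iota> (\<epsilon> x)"
    unfolding ev_def by (rule L(3)) simp_all
qed

lemma ev_closed [simp]: "P \<in> carrier (tensor_group kk E.SM HH) \<Longrightarrow> ev P \<in> carrier R"
  using addhomD(1)[OF ev_facts(1)] by simp

lemma ev_smult:
  assumes r: "r \<in> carrier R" and P: "P \<in> carrier M"
  shows "ev (r \<odot>\<^bsub>M\<^esub> P) = r \<otimes>\<^bsub>R\<^esub> ev P"
proof -
  have m: "(\<lambda>b. r \<otimes>\<^bsub>R\<^esub> b) \<in> addhom R R"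
    using r by (intro addhomI) (simp_all add: E.S.r_distr)
  show ?thesis
    by (rule E.ext_X[where h = "\<lambda>P. ev (r \<odot>\<^bsub>M\<^esub> P)" and h' = "\<lambda>P. r \<otimes>\<^bsub>R\<^esub> ev P", OF E.S.abelian_group_axioms
          addhom_comp[OF E.smult_X(1)[OF r] ev_facts(1)] addhom_comp[OF ev_facts(1) m] _ P])
      (simp add: r E.smult_X(2) ev_facts(2) E.S.m_assoc)
qed

text \<open>\<epsilon> is multiplicative, so \<epsilon>(x2 y2) splits and the counit axiom removes
  the second legs of x and of y; what is left is the value of the cocycle. Thus \<open>ev\<close>,
  which is id \<otimes> \<epsilon>, reads off \<gamma> from the product.\<close>

lemma ev_W:
  assumes b: "b \<in> carrier R" and c: "c \<in> carrier R"
  shows "ev (W b c x y) = b \<otimes>\<^bsub>R\<^esub> c \<otimes>\<^bsub>R\<^esub> \<gamma> x y"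
proof -
  have d: "b \<otimes>\<^bsub>R\<^esub> c \<in> carrier R"
    using b c by simp
  have "ev (W b c x y) = sweedler R \<Delta> (\<lambda>x1 x2. sweedler R \<Delta> (\<lambda>y1 y2.
      actR (\<epsilon> y2) (actR (\<epsilon> x2) (b \<otimes>\<^bsub>R\<^esub> c \<otimes>\<^bsub>R\<^esub> \<gamma> x1 y1))) y) x"
    unfolding W_def sw_map[OF E.abelian_X kbilin_bal[OF W_inner(2)[OF d]] E.S.abelian_group_axioms ev_facts(1)]
      sw_map[OF E.abelian_X kbilin_bal[OF W_inner(1)[OF d]] E.S.abelian_group_axioms ev_facts(1)]
    using d by (simp add: ev_facts(2) counit_mult E.S.m_ac)
  also have "\<dots> = sweedler R \<Delta> (\<lambda>x1 x2. actR (\<epsilon> x2) (b \<otimes>\<^bsub>R\<^esub> c \<otimes>\<^bsub>R\<^esub> \<gamma> x1 y)) x"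
    by (subst sw_counit_right[OF E.S.abelian_group_axioms])
      (intro klin_mult_const(1) klin_\<gamma> d \<iota>_simps, rule refl)
  also have "\<dots> = b \<otimes>\<^bsub>R\<^esub> c \<otimes>\<^bsub>R\<^esub> \<gamma> x y"
    by (rule sw_counit_right[OF E.S.abelian_group_axioms]) (intro klin_mult_const(1) klin_\<gamma> d)
  finally show ?thesis .
qed

text \<open>\<open>ev \<otimes> id\<close>, a map from (R \<otimes> H) \<otimes> H to R \<otimes> H.
  By the counit axiom it is a left inverse of the coaction.\<close>

definition theta where
  "theta = tensor_lift (add_monoid M) (\<lambda>P x. t (ev P) x)"

lemma theta_facts:
  "bal kk RM HH M (\<lambda>P x. t (ev P) x)"
  "theta \<in> addhom MH M"
  "P \<in> carrier M \<Longrightarrow> theta (t' P x) = t (ev P) x"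
proof -
  show b: "bal kk RM HH M (\<lambda>P x. t (ev P) x)"
  proof (rule balI)
    show "(\<lambda>P. t (ev P) x) \<in> addhom RM M" for x
      using addhom_comp[OF ev_facts(1) E.tS_addhom_left[of x]] by simp
    show "(\<lambda>x. t (ev P) x) \<in> addhom HH M" if "P \<in> carrier RM" for P
      by (rule E.tS_addhom_right) (use that in simp)
    show "t (ev (r \<odot>\<^bsub>RM\<^esub> P)) x = t (ev P) (r \<odot>\<^bsub>HH\<^esub> x)" if "P \<in> carrier RM" for r P x
      using that ev_smult[of "\<iota> r" P] E.tS_smult[of r "ev P" x] by simp
  qed
  show "theta \<in> addhom MH M"
    unfolding theta_def by (rule MH.lift_addhom[OF E.abelian_X b])
  show "P \<in> carrier M \<Longrightarrow> theta (t' P x) = t (ev P) x"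
    unfolding theta_def by (rule MH.lift_pure[OF E.abelian_X b]) simp_all
qed

lemma theta_coact:
  assumes P: "P \<in> carrier M"
  shows "theta (coact A P) = P"
proof (rule E.ext_X[where h = "\<lambda>P. theta (coact A P)" and h' = "\<lambda>P. P", OF E.abelian_X
      addhom_comp[OF coact_facts(2)[unfolded addhom_A] theta_facts(2)] _ _ P])
  show "(\<lambda>P. P) \<in> addhom M M"
    by (rule addhomI) simp_all
  fix b x assume b: "b \<in> carrier R"
  have "theta (coact A (t b x)) = sweedler M \<Delta> (\<lambda>x1 x2. t (b \<otimes>\<^bsub>R\<^esub> \<iota> (\<epsilon> x1)) x2) x"
    unfolding coact_facts(3)[OF b] sw_map[OF MH.abelian_tensor kbilin_bal[OF coact_summand[OF b]] E.abelian_X theta_facts(2)]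
    using b by (simp add: theta_facts(3) ev_facts(2))
  also have "\<dots> = sweedler M \<Delta> (\<lambda>x1 x2. actM (\<epsilon> x1) (t b x2)) x"
    using b by (simp add: E.smult_X(2) E.S.m_comm)
  also have "\<dots> = t b x"
    by (rule sw_counit_left[OF E.abelian_X klin_t[OF b]])
  finally show "theta (coact A (t b x)) = t b x" .
qed

end

text \<open>
  A colinear map is determined by its composite with \<open>id \<otimes> \<epsilon>\<close>.
\<close>

locale colinear_map = A: twisted_hom_data scale \<Delta> \<epsilon> R \<iota> \<gamma> + B: twisted_hom_data scale \<Delta> \<epsilon> R \<iota> \<delta>
  for scale :: "'k::field \<Rightarrow> 'h::ring_1 \<Rightarrow> 'h" and \<Delta> :: "'h \<Rightarrow> ('h, 'h) tensor" and \<epsilon> :: "'h \<Rightarrow> 'k"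
    and R :: "('r, 'z) ring_scheme" and \<iota> :: "'k \<Rightarrow> 'r" and \<gamma> \<delta> :: "'h \<Rightarrow> 'h \<Rightarrow> 'r" +
  fixes \<Theta>
  assumes iso: "comodule_algebra_iso scale R \<iota> A.A B.A \<Theta>"
    and units: "\<gamma> 1 1 \<in> Units R" "\<delta> 1 1 \<in> Units R"
begin

lemmas F = A.iso_facts[OF A.comod_ok_A[OF units(1)] B.comod_ok_A[OF units(2)] iso]

lemma F1: "\<Theta> \<in> addhom A.M A.M"
  using F(1) by (simp only: A.addhom_A B.addhom_A)

definition mu where
  "mu x = A.ev (\<Theta> (A.t \<one>\<^bsub>R\<^esub> x))"

lemma \<Theta>_closed: "P \<in> carrier A.M \<Longrightarrow> \<Theta> P \<in> carrier A.M"
  by (rule addhomD(1)[OF F1])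

lemma t1_closed: "A.t \<one>\<^bsub>R\<^esub> x \<in> carrier A.M"
  by simp

lemma mu_closed [simp]: "mu x \<in> carrier R"
  unfolding mu_def using \<Theta>_closed[OF t1_closed] by simp

lemma \<Theta>_smult: "r \<in> carrier R \<Longrightarrow> P \<in> carrier A.M \<Longrightarrow> \<Theta> (r \<odot>\<^bsub>A.M\<^esub> P) = r \<odot>\<^bsub>A.M\<^esub> \<Theta> P"
  using F(2) by simp

lemma klin_\<Theta>t: "A.klin A.M A.actM (\<lambda>x. \<Theta> (A.t \<one>\<^bsub>R\<^esub> x))"
  by (rule A.klin_post[OF A.klin_t F1]) (simp_all add: \<Theta>_smult)

lemma klin_mu: "A.klin R A.actR mu"
  unfolding mu_def[abs_def] by (rule A.klin_post[OF klin_\<Theta>t A.ev_facts(1)]) (simp add: A.ev_smult)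

text \<open>\<open>theta\<close> applied to the colinearity equation at 1 \<otimes> x: it undoes the
  coaction on the left, and on the right it replaces the image of 1 \<otimes> x1 by the scalar
  \<open>mu x1\<close>.\<close>

lemma \<Theta>_t: "\<Theta> (A.t \<one>\<^bsub>R\<^esub> x) = sweedler A.M \<Delta> (\<lambda>x1 x2. A.t (mu x1) x2) x"
proof -
  have c: "tensor_group A.kk (restrict_scalars \<iota> A.A) A.HH = tensor_group A.kk A.RM A.HH"
    "tensor_group A.kk (restrict_scalars \<iota> B.A) A.HH = tensor_group A.kk A.RM A.HH"
    "pure_tensor A.kk (restrict_scalars \<iota> B.A) A.HH = A.t'"
    by (rule tensor_group_cong; simp)+
  have b: "bal A.kk A.RM A.HH A.MH (\<lambda>a0 a1. A.t' (\<Theta> a0) a1)"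
  proof (rule balI)
    show "(\<lambda>a0. A.t' (\<Theta> a0) a1) \<in> addhom A.RM A.MH" for a1
      using addhom_comp[OF F1 A.t'_addhom] by simp
    show "(\<lambda>a1. A.t' (\<Theta> a0) a1) \<in> addhom A.HH A.MH" if "a0 \<in> carrier A.RM" for a0
      by (rule A.klinD(4)[OF A.klin_t']) (rule \<Theta>_closed, use that in simp)
    show "A.t' (\<Theta> (r \<odot>\<^bsub>A.RM\<^esub> a0)) a1 = A.t' (\<Theta> a0) (r \<odot>\<^bsub>A.HH\<^esub> a1)" if "a0 \<in> carrier A.RM" for r a0 a1
      using A.MH.pure_smult[of r "\<Theta> a0" a1] \<Theta>_closed[of a0] \<Theta>_smult[of "\<iota> r" a0] that by simp
  qed
  have cA: "coact A.A P \<in> carrier (tensor_group A.kk A.RM A.HH)" if "P \<in> carrier A.M" for P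
    using addhomD(1)[OF A.coact_facts(2)] that by simp
  have "coact B.A (\<Theta> P) = tensor_lift (add_monoid A.MH) (\<lambda>a0 a1. A.t' (\<Theta> a0) a1) (coact A.A P)"
    if P: "P \<in> carrier A.M" for P
  proof -
    have "coact B.A (\<Theta> P) = tensor_lift (tensor_group A.kk (restrict_scalars \<iota> B.A) A.HH)
        (\<lambda>a0 a1. pure_tensor A.kk (restrict_scalars \<iota> B.A) A.HH (\<Theta> a0) a1) (coact A.A P)"
      using iso P by (simp add: comodule_algebra_iso_def Let_def)
    also have "\<dots> = tensor_lift (add_monoid A.MH) (\<lambda>a0 a1. A.t' (\<Theta> a0) a1) (coact A.A P)"
      unfolding c by (rule A.MH.lift_group_eq'[OF A.MH.tensor_modules_axioms b cA[OF P]])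
    finally show ?thesis .
  qed
  note co = this[OF t1_closed, unfolded A.coact_facts(3)[OF A.E.S.one_closed]]
  have lp: "tensor_lift (add_monoid A.MH) (\<lambda>a0 a1. A.t' (\<Theta> a0) a1) (A.t' (A.t \<one>\<^bsub>R\<^esub> p) q) = A.t' (\<Theta> (A.t \<one>\<^bsub>R\<^esub> p)) q" for p q
    by (rule A.MH.lift_pure[OF A.MH.abelian_tensor b]) simp_all
  have k: "bal A.kk A.HH A.HH A.MH (\<lambda>x1 x2. A.t' (\<Theta> (A.t \<one>\<^bsub>R\<^esub> x1)) x2)"
    using bal_comp[OF A.kbilin_bal[OF A.coact_summand[OF A.E.S.one_closed]] A.MH.lift_addhom[OF A.MH.abelian_tensor b]]
    unfolding lp .
  have tp: "A.theta (A.t' (\<Theta> (A.t \<one>\<^bsub>R\<^esub> x1)) x2) = A.t (mu x1) x2" for x1 x2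
    unfolding mu_def by (rule A.theta_facts(3)[OF \<Theta>_closed[OF t1_closed]])
  \<comment> \<open>\<open>theta\<close> does not involve the cocycle, so the same map inverts the
    coactions of both twisted algebras.\<close>
  have "\<Theta> (A.t \<one>\<^bsub>R\<^esub> x) = A.theta (coact B.A (\<Theta> (A.t \<one>\<^bsub>R\<^esub> x)))"
    by (rule B.theta_coact[OF \<Theta>_closed[OF t1_closed], symmetric])
  then show ?thesis
    unfolding co A.sw_map[OF A.MH.abelian_tensor A.kbilin_bal[OF A.coact_summand[OF A.E.S.one_closed]]
        A.MH.abelian_tensor A.MH.lift_addhom[OF A.MH.abelian_tensor b]] lp
      A.sw_map[OF A.MH.abelian_tensor k A.E.abelian_X A.theta_facts(2)] tp .
qed

lemma kbilin_t_mu: "A.kbilin A.M A.actM (\<lambda>x1 x2. A.t (mu x1) x2)"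
proof (rule A.kbilinI)
  show "A.klin A.M A.actM (\<lambda>x. A.t (mu x) y)" for y
    using A.klin_t_coeff[OF A.E.S.one_closed klin_mu, of y] by simp
qed (rule A.klin_t, simp)

text \<open>\<open>ev\<close> of \<Theta>((1 \<otimes> x)(1 \<otimes> y)) is computed twice: from
  the product in the \<gamma>-algebra, where \<Theta> turns the last factor into \<open>mu\<close>,
  and as a product in the \<delta>-algebra of the two sums given by
  \<open>\<Theta>_t\<close>.\<close>

lemma mu_mult:
  "sweedler R \<Delta> (\<lambda>x1 x2. sweedler R \<Delta> (\<lambda>y1 y2. mu x1 \<otimes>\<^bsub>R\<^esub> mu y1 \<otimes>\<^bsub>R\<^esub> \<delta> x2 y2) y) x =
   sweedler R \<Delta> (\<lambda>x1 x2. sweedler R \<Delta> (\<lambda>y1 y2. \<gamma> x1 y1 \<otimes>\<^bsub>R\<^esub> mu (x2 * y2)) y) x"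
proof -
  let ?p = "A.t \<one>\<^bsub>R\<^esub>"
  note aM = A.E.abelian_X and aR = A.E.S.abelian_group_axioms
  have one: "\<one>\<^bsub>R\<^esub> \<otimes>\<^bsub>R\<^esub> \<one>\<^bsub>R\<^esub> \<in> carrier R"
    by simp
  note ev\<Theta> = addhom_comp[OF F1 A.ev_facts(1)]
  have e1: "A.ev (\<Theta> (A.t (\<one>\<^bsub>R\<^esub> \<otimes>\<^bsub>R\<^esub> \<one>\<^bsub>R\<^esub> \<otimes>\<^bsub>R\<^esub> \<gamma> x1 y1) z)) = \<gamma> x1 y1 \<otimes>\<^bsub>R\<^esub> mu z" for x1 y1 z
  proof -
    have "A.t (\<one>\<^bsub>R\<^esub> \<otimes>\<^bsub>R\<^esub> \<one>\<^bsub>R\<^esub> \<otimes>\<^bsub>R\<^esub> \<gamma> x1 y1) z = \<gamma> x1 y1 \<odot>\<^bsub>A.M\<^esub> ?p z"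
      by (simp add: A.E.smult_X(2))
    then show ?thesis
      unfolding mu_def using \<Theta>_smult[OF A.\<gamma>_closed t1_closed] A.ev_smult[OF A.\<gamma>_closed \<Theta>_closed[OF t1_closed]] by simp
  qed
  have "A.ev (\<Theta> (?p x \<otimes>\<^bsub>A.A\<^esub> ?p y)) = A.ev (\<Theta> (A.W \<one>\<^bsub>R\<^esub> \<one>\<^bsub>R\<^esub> x y))"
    by (simp only: A.mult_pure A.E.S.one_closed)
  also have "\<dots> = sweedler R \<Delta> (\<lambda>x1 x2. sweedler R \<Delta> (\<lambda>y1 y2.
      A.ev (\<Theta> (A.t (\<one>\<^bsub>R\<^esub> \<otimes>\<^bsub>R\<^esub> \<one>\<^bsub>R\<^esub> \<otimes>\<^bsub>R\<^esub> \<gamma> x1 y1) (x2 * y2)))) y) x"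
    unfolding A.W_def A.sw_map[OF aM A.kbilin_bal[OF A.W_inner(2)[OF one]] aR ev\<Theta>]
      A.sw_map[OF aM A.kbilin_bal[OF A.W_inner(1)[OF one]] aR ev\<Theta>] by (rule refl)
  finally have 1: "A.ev (\<Theta> (?p x \<otimes>\<^bsub>A.A\<^esub> ?p y)) =
      sweedler R \<Delta> (\<lambda>x1 x2. sweedler R \<Delta> (\<lambda>y1 y2. \<gamma> x1 y1 \<otimes>\<^bsub>R\<^esub> mu (x2 * y2)) y) x"
    unfolding e1 .
  have cl: "\<Theta> (?p x) \<in> carrier B.A" "A.t (mu p) q \<in> carrier B.A" for x p q
    using \<Theta>_closed[OF t1_closed] by simp_all
  have mL: "(\<lambda>P. P \<otimes>\<^bsub>B.A\<^esub> \<Theta> (?p y)) \<in> addhom A.M A.M"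
    using B.mult_addhom_left[OF cl(1)] by (simp only: B.addhom_A)
  have mR: "(\<lambda>Q. A.t (mu p) q \<otimes>\<^bsub>B.A\<^esub> Q) \<in> addhom A.M A.M" for p q
    using B.mult_addhom_right[OF cl(2)] by (simp only: B.addhom_A)
  have e2: "A.ev (A.t (mu x1) x2 \<otimes>\<^bsub>B.A\<^esub> A.t (mu y1) y2) = mu x1 \<otimes>\<^bsub>R\<^esub> mu y1 \<otimes>\<^bsub>R\<^esub> \<delta> x2 y2" for x1 x2 y1 y2
    by (simp add: B.mult_pure B.ev_W)
  have "A.ev (\<Theta> (?p x \<otimes>\<^bsub>A.A\<^esub> ?p y)) = A.ev (\<Theta> (?p x) \<otimes>\<^bsub>B.A\<^esub> \<Theta> (?p y))"
    by (subst F(4)) simp_all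
  also have "\<dots> = sweedler R \<Delta> (\<lambda>x1 x2. sweedler R \<Delta> (\<lambda>y1 y2. A.ev (A.t (mu x1) x2 \<otimes>\<^bsub>B.A\<^esub> A.t (mu y1) y2)) y) x"
    unfolding \<Theta>_t[of x] A.sw_map[OF aM A.kbilin_bal[OF kbilin_t_mu] aR addhom_comp[OF mL A.ev_facts(1)]]
    unfolding \<Theta>_t[of y] A.sw_map[OF aM A.kbilin_bal[OF kbilin_t_mu] aR addhom_comp[OF mR A.ev_facts(1)]]
    by (rule refl)
  finally show ?thesis
    unfolding e2 1 by (rule sym)
qed

end

text \<open>An isomorphism together with its inverse: two colinear maps with \<gamma> and \<delta>
  exchanged. The composite recorded in \<open>inv\<close> is the one from which
  \<open>mu_inv\<close> is read off.\<close>

locale colinear_inverse = colinear_map scale \<Delta> \<epsilon> R \<iota> \<gamma> \<delta> \<Theta> + I: colinear_map scale \<Delta> \<epsilon> R \<iota> \<delta> \<gamma> \<Xi>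
  for scale :: "'k::field \<Rightarrow> 'h::ring_1 \<Rightarrow> 'h" and \<Delta> :: "'h \<Rightarrow> ('h, 'h) tensor" and \<epsilon> :: "'h \<Rightarrow> 'k"
    and R :: "('r, 'z) ring_scheme" and \<iota> :: "'k \<Rightarrow> 'r" and \<gamma> \<delta> :: "'h \<Rightarrow> 'h \<Rightarrow> 'r" and \<Theta> \<Xi> +
  assumes inv: "P \<in> carrier B.A \<Longrightarrow> \<Theta> (\<Xi> P) = P"
begin

text \<open>\<open>ev\<close> evaluated on \<Theta>(\<Xi>(1 \<otimes> x)) = 1 \<otimes> x, after
  expanding the inner image by \<open>\<Theta>_t\<close> and pulling its coefficients out of
  \<Theta>.\<close>

lemma mu_inv: "sweedler R \<Delta> (\<lambda>x1 x2. I.mu x1 \<otimes>\<^bsub>R\<^esub> mu x2) x = \<iota> (\<epsilon> x)"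
proof -
  have e3: "A.ev (\<Theta> (A.t (I.mu x1) x2)) = I.mu x1 \<otimes>\<^bsub>R\<^esub> mu x2" for x1 x2
  proof -
    have "A.t (I.mu x1) x2 = I.mu x1 \<odot>\<^bsub>A.M\<^esub> A.t \<one>\<^bsub>R\<^esub> x2"
      by (simp add: A.E.smult_X(2))
    then show ?thesis
      unfolding mu_def using \<Theta>_smult[OF I.mu_closed t1_closed] A.ev_smult[OF I.mu_closed \<Theta>_closed[OF t1_closed]] by simp
  qed
  have "\<iota> (\<epsilon> x) = A.ev (\<Theta> (\<Xi> (A.t \<one>\<^bsub>R\<^esub> x)))"
    by (subst inv) (simp_all add: A.ev_facts(2))
  also have "\<dots> = sweedler R \<Delta> (\<lambda>x1 x2. A.ev (\<Theta> (A.t (I.mu x1) x2))) x"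
    unfolding I.\<Theta>_t A.sw_map[OF A.E.abelian_X A.kbilin_bal[OF I.kbilin_t_mu] A.E.S.abelian_group_axioms addhom_comp[OF F1 A.ev_facts(1)]]
    by (rule refl)
  finally show ?thesis
    unfolding e3 by (rule sym)
qed

end

section \<open>Sweedler sums with values in a field\<close>

context hopf_algebra
begin

abbreviation "TG \<equiv> tensor_group kk HH HH"

text \<open>A list of pairs stands for the sum of its pure tensors. With such a presentation of
  \<Delta> x a Sweedler sum in a field is a finite sum over indices.\<close>

fun tsum :: "('h \<times> 'h) list \<Rightarrow> ('h, 'h) tensor" where
  "tsum [] = \<one>\<^bsub>TG\<^esub>"
| "tsum (p # ps) = pure_tensor kk HH HH (fst p) (snd p) \<otimes>\<^bsub>TG\<^esub> tsum ps"

lemma pure_closed_HH [simp]: "pure_tensor kk HH HH x y \<in> carrier TG"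
  by (rule T2.pure_closed) simp_all

lemma tsum_closed [simp]: "tsum ps \<in> carrier TG"
  by (induction ps) (simp_all add: T2.T.m_closed)

lemma tsum_append: "tsum (ps @ qs) = tsum ps \<otimes>\<^bsub>TG\<^esub> tsum qs"
  by (induction ps) (simp_all add: T2.T.m_assoc)

lemma inv_pure: "inv\<^bsub>TG\<^esub> pure_tensor kk HH HH x y = pure_tensor kk HH HH (- x) y"
proof -
  have z: "pure_tensor kk HH HH 0 y = \<one>\<^bsub>TG\<^esub>"
  proof -
    have "pure_tensor kk HH HH 0 y \<otimes>\<^bsub>TG\<^esub> pure_tensor kk HH HH 0 y = pure_tensor kk HH HH 0 y"
      using T2.pure_add_left[of 0 0 y] by simp
    then show ?thesis
      using T2.T.l_cancel_one'[of "pure_tensor kk HH HH 0 y" "pure_tensor kk HH HH 0 y"]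
      by (metis T2.T.r_cancel_one pure_closed_HH)
  qed
  have "pure_tensor kk HH HH (- x) y \<otimes>\<^bsub>TG\<^esub> pure_tensor kk HH HH x y = \<one>\<^bsub>TG\<^esub>"
    using T2.pure_add_left[of "- x" x y] z by simp
  then show ?thesis
    by (intro T2.T.inv_equality) simp_all
qed

lemma inv_tsum: "inv\<^bsub>TG\<^esub> tsum ps = tsum (map (\<lambda>(x, y). (- x, y)) ps)"
  by (induction ps) (auto simp: T2.T.inv_mult inv_pure)

text \<open>The negative of x \<otimes> y is the pure tensor (-x) \<otimes> y, so differences are
  covered by lists without integer coefficients.\<close>

lemma ex_tsum: "T \<in> carrier TG \<Longrightarrow> \<exists>ps. T = tsum ps"
proof (induction rule: T2.tensor_induct)
  case one
  have "\<one>\<^bsub>TG\<^esub> = tsum []"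
    by simp
  then show ?case ..
next
  case (pure m n)
  have "pure_tensor kk HH HH m n = tsum [(m, n)]"
    by simp
  then show ?case ..
next
  case (diff S T)
  then obtain ps qs where "S = tsum ps" "T = tsum qs"
    by blast
  then have "S \<otimes>\<^bsub>TG\<^esub> inv\<^bsub>TG\<^esub> T = tsum (ps @ map (\<lambda>(x, y). (- x, y)) qs)"
    by (simp only: tsum_append inv_tsum)
  then show ?case ..
qed

text \<open>An arbitrary fixed presentation of \<Delta> x. Nothing relates the presentations of x, y
  and x + y; additivity in x holds only after summation of a bilinear map and is imported from
  \<open>sweedler\<close>.\<close>

definition D :: "'h \<Rightarrow> ('h \<times> 'h) list" where
  "D x = (SOME ps. \<Delta> x = tsum ps)"

lemma \<Delta>_D: "\<Delta> x = tsum (D x)"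
  unfolding D_def by (rule someI_ex) (rule ex_tsum, simp)

abbreviation "N x \<equiv> length (D x)"
abbreviation "d1 x i \<equiv> fst (D x ! i)"
abbreviation "d2 x i \<equiv> snd (D x ! i)"

text \<open>Formed for every \<open>f\<close>, which permits exchanging sums over different
  arguments as ordinary finite sums. For bilinear \<open>f\<close> with values in a field it is the
  Sweedler sum, independent of the presentation.\<close>

definition SS :: "('h \<Rightarrow> 'h \<Rightarrow> 'a) \<Rightarrow> 'h \<Rightarrow> 'a::comm_monoid_add" where
  "SS f x = (\<Sum>i<N x. f (d1 x i) (d2 x i))"

lemma lift_tsum:
  fixes f :: "'h \<Rightarrow> 'h \<Rightarrow> 'a::ab_group_add"
  assumes Y: "abelian_group Y" "carrier Y = UNIV" "add Y = (+)" "\<zero>\<^bsub>Y\<^esub> = 0" and f: "bal kk HH HH Y f"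
  shows "tensor_lift (add_monoid Y) f (tsum ps) = (\<Sum>i<length ps. f (fst (ps ! i)) (snd (ps ! i)))"
proof (induction ps)
  case Nil
  have "tensor_lift (add_monoid Y) f (\<one>\<^bsub>TG\<^esub>) = \<zero>\<^bsub>Y\<^esub>"
  proof -
    interpret Y: abelian_group Y by (rule Y(1))
    have "tensor_lift (add_monoid Y) f \<in> hom TG (add_monoid Y)"
      using T2.lift_addhom[OF Y(1) f] by (simp only: hom_to_addhom)
    from hom_one[OF this T2.T.is_group Y.a_group] show ?thesis
      by simp
  qed
  then show ?case
    by (simp add: Y(4))
next
  case (Cons p ps)
  have "tensor_lift (add_monoid Y) f (tsum (p # ps)) = f (fst p) (snd p) + tensor_lift (add_monoid Y) f (tsum ps)"
    using addhomD(2)[OF T2.lift_addhom[OF Y(1) f], of "pure_tensor kk HH HH (fst p) (snd p)" "tsum ps"]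
      T2.lift_pure[OF Y(1) f, of "fst p" "snd p"] Y(3) by simp
  also have "\<dots> = (\<Sum>i<length (p # ps). f (fst ((p # ps) ! i)) (snd ((p # ps) ! i)))"
    unfolding Cons.IH by (simp add: sum.lessThan_Suc_shift del: sum.lessThan_Suc)
  finally show ?case .
qed

lemma sw_SS:
  fixes f :: "'h \<Rightarrow> 'h \<Rightarrow> 'a::ab_group_add"
  assumes "abelian_group Y" "carrier Y = UNIV" "add Y = (+)" "\<zero>\<^bsub>Y\<^esub> = 0" "bal kk HH HH Y f"
  shows "sweedler Y \<Delta> f x = SS f x"
  unfolding sweedler_def SS_def by (rule trans[OF arg_cong[where f = "tensor_lift (add_monoid Y) f", OF \<Delta>_D] lift_tsum[OF assms]])

lemma counit_left_SS: "SS (\<lambda>p q. scale (\<epsilon> p) q) x = x"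
proof -
  have b: "kbilin HH scale (\<lambda>p q. scale (\<epsilon> p) q)"
    by (intro kbilinI klinI) (simp_all add: counit_add counit_scale scale_left_distrib scale_right_distrib mult.commute)
  show ?thesis
    by (rule trans[OF sw_SS[OF opmodD(1)[OF opmod_HH] _ _ _ kbilin_bal[OF b], symmetric] counit_left]) simp_all
qed

end

text \<open>The field is k itself, K, L, or the fraction field of a polynomial ring over k in which
  \<open>K\<^sub>H\<close> will be embedded.\<close>

locale hopf_field = hopf_algebra scale \<Delta> \<epsilon>
  for scale :: "'k::field \<Rightarrow> 'h::ring_1 \<Rightarrow> 'h" and \<Delta> :: "'h \<Rightarrow> ('h, 'h) tensor" and \<epsilon> :: "'h \<Rightarrow> 'k" +
  fixes \<iota> :: "'k \<Rightarrow> 'f::field"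
  assumes \<iota>_hom: "\<iota> \<in> ring_hom kk (ring_of_type_algebra :: 'f ring)"
begin

abbreviation "F \<equiv> ring_of_type_algebra :: 'f ring"

lemma \<iota>_simps [simp]: "\<iota> (a + b) = \<iota> a + \<iota> b" "\<iota> (a * b) = \<iota> a * \<iota> b" "\<iota> 1 = 1" "\<iota> 0 = 0"
proof -
  show "\<iota> (a + b) = \<iota> a + \<iota> b" for a b
    using ring_hom_add[OF \<iota>_hom] by simp
  from this[of 0 0] show "\<iota> 0 = 0"
    by (simp only: add_0_left add_cancel_right_right)
qed (use ring_hom_mult[OF \<iota>_hom] ring_hom_one[OF \<iota>_hom] in simp_all)

lemma \<iota>_sum: "\<iota> (sum g B) = (\<Sum>b\<in>B. \<iota> (g b))"
  by (induction B rule: infinite_finite_induct) simp_all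

definition lin :: "('h \<Rightarrow> 'f) \<Rightarrow> bool" where
  "lin g \<longleftrightarrow> (\<forall>x y. g (x + y) = g x + g y) \<and> (\<forall>a x. g (scale a x) = \<iota> a * g x)"

definition bilin :: "('h \<Rightarrow> 'h \<Rightarrow> 'f) \<Rightarrow> bool" where
  "bilin f \<longleftrightarrow> (\<forall>y. lin (\<lambda>x. f x y)) \<and> (\<forall>x. lin (\<lambda>y. f x y))"

lemma linD: "lin g \<Longrightarrow> g (x + y) = g x + g y" "lin g \<Longrightarrow> g (scale a x) = \<iota> a * g x"
  by (simp_all add: lin_def)

lemma linI: "(\<And>x y. g (x + y) = g x + g y) \<Longrightarrow> (\<And>a x. g (scale a x) = \<iota> a * g x) \<Longrightarrow> lin g"
  by (simp add: lin_def)

lemma bilinI: "(\<And>y. lin (\<lambda>x. f x y)) \<Longrightarrow> (\<And>x. lin (\<lambda>y. f x y)) \<Longrightarrow> bilin f"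
  by (simp add: bilin_def)

lemma bilinD: "bilin f \<Longrightarrow> lin (\<lambda>x. f x y)" "bilin f \<Longrightarrow> lin (\<lambda>y. f x y)"
  by (simp_all add: bilin_def)

lemma lin_zero: "lin g \<Longrightarrow> g 0 = 0"
  using linD(1)[of g 0 0] by (simp only: add_0_left add_cancel_right_right)

lemma lin_sum: "lin g \<Longrightarrow> g (sum u B) = (\<Sum>b\<in>B. g (u b))"
  by (induction B rule: infinite_finite_induct) (simp_all add: lin_zero linD)

lemma lin_times: "lin g \<Longrightarrow> lin (\<lambda>x. c * g x)" "lin g \<Longrightarrow> lin (\<lambda>x. g x * c)"
  by (simp_all add: lin_def algebra_simps)

lemma lin_setsum: "(\<And>b. b \<in> B \<Longrightarrow> lin (g b)) \<Longrightarrow> lin (\<lambda>x. \<Sum>b\<in>B. g b x)"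
  by (simp add: lin_def sum.distrib sum_distrib_left)

lemma lin_mult: "lin g \<Longrightarrow> lin (\<lambda>x. g (x * y))" "lin g \<Longrightarrow> lin (\<lambda>x. g (y * x))"
  by (simp_all add: lin_def distrib_left distrib_right scale_mult_left scale_mult_right)

lemma lin_\<epsilon>: "lin (\<lambda>x. \<iota> (\<epsilon> x))"
  by (simp add: lin_def counit_add counit_scale)

abbreviation "actF \<equiv> (\<lambda>a r. \<iota> a * r)"

lemma abelian_F: "abelian_group F"
  using cring_from_type_algebra[where 'a = 'f] by (simp add: cring_def ring_def)

lemma kmod_F: "kmod F actF"
  unfolding kmod_def using abelian_F by (auto intro!: addhomI simp: algebra_simps)

lemma klin_lin: "klin F actF g \<longleftrightarrow> lin g"
  using addhomD[of g HH F] by (auto simp: klin_def lin_def intro!: addhomI)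

lemma kbilin_bilin: "kbilin F actF f \<longleftrightarrow> bilin f"
  by (simp add: kbilin_def bilin_def klin_lin)

lemma bilin_bal: "bilin f \<Longrightarrow> bal kk HH HH F f"
  by (rule kbilin_bal[of F actF]) (simp only: kbilin_bilin)

lemma sw_F: "bilin f \<Longrightarrow> sweedler F \<Delta> f x = SS f x"
  by (rule sw_SS[OF abelian_F]) (simp_all add: bilin_bal)

lemma SS_lin: "bilin f \<Longrightarrow> lin (SS f)"
  using sw_klin[OF kmod_F, of f] by (simp add: kbilin_bilin sw_F klin_lin)

lemma SS_lin_param: "(\<And>p q. lin (\<lambda>z. f z p q)) \<Longrightarrow> lin (\<lambda>z. SS (f z) x)"
  unfolding SS_def by (rule lin_setsum)

lemma SS_counit_left:
  assumes "lin g" shows "SS (\<lambda>p q. \<iota> (\<epsilon> p) * g q) x = g x"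
proof -
  have "bilin (\<lambda>p q. \<iota> (\<epsilon> p) * g q)"
    by (rule bilinI) (rule lin_times(2)[OF lin_\<epsilon>], rule lin_times(1)[OF assms])
  from sw_F[OF this, symmetric] show ?thesis
    by (rule trans) (rule sw_counit_left[OF abelian_F], simp only: klin_lin assms)
qed

lemma SS_counit_right:
  assumes "lin g" shows "SS (\<lambda>p q. \<iota> (\<epsilon> q) * g p) x = g x"
proof -
  have "bilin (\<lambda>p q. \<iota> (\<epsilon> q) * g p)"
    by (rule bilinI) (rule lin_times(1)[OF assms], rule lin_times(2)[OF lin_\<epsilon>])
  from sw_F[OF this, symmetric] show ?thesis
    by (rule trans) (rule sw_counit_right[OF abelian_F], simp only: klin_lin assms)
qed

lemma SS_coassoc:
  assumes "\<And>q r. lin (\<lambda>p. f p q r)" "\<And>p r. lin (\<lambda>q. f p q r)" "\<And>p q. lin (\<lambda>r. f p q r)"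
  shows "SS (\<lambda>p q. SS (\<lambda>r s. f r s q) p) x = SS (\<lambda>p q. SS (\<lambda>r s. f p r s) q) x"
proof -
  have b: "bilin (\<lambda>r s. f r s q)" "bilin (\<lambda>r s. f q r s)" for q
    by (intro bilinI assms)+
  have c: "bilin (\<lambda>p q. SS (\<lambda>r s. f r s q) p)" "bilin (\<lambda>p q. SS (\<lambda>r s. f p r s) q)"
    by (intro bilinI SS_lin b SS_lin_param assms)+
  show ?thesis
    using sw_coassoc[OF kmod_F, of f x] by (simp add: klin_lin assms sw_F b c)
qed

lemma SS_mult:
  assumes "bilin f"
  shows "SS f (x * y) = SS (\<lambda>p q. SS (\<lambda>r s. f (p * r) (q * s)) y) x"
proof -
  have b: "bilin (\<lambda>r s. f (p * r) (q * s))" for p q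
    by (rule bilinI) (rule lin_mult(2)[OF bilinD(1)[OF assms]], rule lin_mult(2)[OF bilinD(2)[OF assms]])
  have c: "bilin (\<lambda>p q. SS (\<lambda>r s. f (p * r) (q * s)) y)"
    by (rule bilinI) (rule SS_lin_param, rule lin_mult(1)[OF bilinD(1)[OF assms]],
        rule SS_lin_param, rule lin_mult(1)[OF bilinD(2)[OF assms]])
  show ?thesis
    using sw_mult[OF kmod_F, of f x y] assms by (simp add: kbilin_bilin sw_F b c)
qed

lemma SS_one: "bilin f \<Longrightarrow> SS f 1 = f 1 1"
  by (rule trans[OF sw_F[symmetric] sw_one[OF abelian_F bilin_bal]])

lemma SS_swap: "SS (\<lambda>p q. SS (\<lambda>r s. f p q r s) y) x = SS (\<lambda>r s. SS (\<lambda>p q. f p q r s) x) y"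
  unfolding SS_def by (rule sum.swap)

lemma SS_times: fixes c :: 'f shows "c * SS f x = SS (\<lambda>p q. c * f p q) x" "SS f x * c = SS (\<lambda>p q. f p q * c) x"
  by (simp_all add: SS_def sum_distrib_left sum_distrib_right)

section \<open>Convolution of bilinear maps\<close>

definition conv :: "('h \<Rightarrow> 'h \<Rightarrow> 'f) \<Rightarrow> ('h \<Rightarrow> 'h \<Rightarrow> 'f) \<Rightarrow> 'h \<Rightarrow> 'h \<Rightarrow> 'f" where
  "conv f g x y = SS (\<lambda>p q. SS (\<lambda>r s. f p r * g q s) y) x"

definition conv_counit :: "'h \<Rightarrow> 'h \<Rightarrow> 'f" where "conv_counit x y = \<iota> (\<epsilon> x) * \<iota> (\<epsilon> y)"

lemma bilin_conv:
  assumes f: "bilin f" and g: "bilin g"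
  shows "bilin (conv f g)"
proof -
  have b: "bilin (\<lambda>r s. f p r * g q s)" for p q
    by (intro bilinI lin_times bilinD[OF f] bilinD[OF g])
  have c: "bilin (\<lambda>p q. SS (\<lambda>r s. f p r * g q s) y)" for y
    by (intro bilinI SS_lin_param lin_times bilinD[OF f] bilinD[OF g])
  show ?thesis
    unfolding conv_def[abs_def] by (intro bilinI SS_lin SS_lin_param b c)
qed

text \<open>Coassociativity is applied once to y and once to x; the other steps only move factors
  into finite sums and exchange these sums.\<close>

lemma conv_assoc:
  assumes f: "bilin f" and g: "bilin g" and h: "bilin h"
  shows "conv (conv f g) h = conv f (conv g h)"
proof (intro ext)
  fix x y
  have "conv (conv f g) h x y =
      SS (\<lambda>p q. SS (\<lambda>r s. SS (\<lambda>p' q'. SS (\<lambda>r' s'. f r r' * g s s' * h q q') p') y) p) x"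
    unfolding conv_def SS_times SS_swap[where y = y] by (rule refl)
  also have "\<dots> = SS (\<lambda>p q. SS (\<lambda>r s. SS (\<lambda>p' q'. SS (\<lambda>r' s'. f r p' * g s r' * h q s') q') y) p) x"
    by (subst SS_coassoc[where x = y])
      (intro lin_times bilinD[OF f] bilinD[OF g] bilinD[OF h] | rule refl)+
  also have "\<dots> = SS (\<lambda>p q. SS (\<lambda>r s. SS (\<lambda>p' q'. SS (\<lambda>r' s'. f p p' * g r r' * h s s') q') y) q) x"
    by (subst SS_coassoc[where x = x])
      (intro SS_lin_param lin_times bilinD[OF f] bilinD[OF g] bilinD[OF h] | rule refl)+
  also have "\<dots> = conv f (conv g h) x y"
    unfolding conv_def SS_times SS_swap[where y = y] by (simp add: mult.assoc)
  finally show "conv (conv f g) h x y = conv f (conv g h) x y" .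
qed

lemma conv_unit:
  assumes f: "bilin f"
  shows "conv conv_counit f = f" "conv f conv_counit = f"
proof -
  have "conv conv_counit f x y = f x y" for x y
  proof -
    have "conv conv_counit f x y = SS (\<lambda>p q. SS (\<lambda>r s. \<iota> (\<epsilon> r) * (\<iota> (\<epsilon> p) * f q s)) y) x"
      by (simp add: conv_def conv_counit_def ac_simps)
    then show ?thesis
      by (simp add: SS_counit_left lin_times bilinD[OF f])
  qed
  then show "conv conv_counit f = f"
    by (intro ext)
  have "conv f conv_counit x y = f x y" for x y
  proof -
    have "conv f conv_counit x y = SS (\<lambda>p q. SS (\<lambda>r s. \<iota> (\<epsilon> s) * (\<iota> (\<epsilon> q) * f p r)) y) x"
      by (simp add: conv_def conv_counit_def ac_simps)
    then show ?thesis
      by (simp add: SS_counit_right lin_times bilinD[OF f])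
  qed
  then show "conv f conv_counit = f"
    by (intro ext)
qed

definition of_product :: "('h \<Rightarrow> 'f) \<Rightarrow> 'h \<Rightarrow> 'h \<Rightarrow> 'f" where "of_product m x y = m (x * y)"
definition tensor_square :: "('h \<Rightarrow> 'f) \<Rightarrow> 'h \<Rightarrow> 'h \<Rightarrow> 'f" where "tensor_square m x y = m x * m y"

lemma bilin_of_product: "lin m \<Longrightarrow> bilin (of_product m)"
  unfolding of_product_def[abs_def] by (intro bilinI lin_mult)

lemma bilin_tensor_square: "lin m \<Longrightarrow> bilin (tensor_square m)"
  unfolding tensor_square_def[abs_def] by (intro bilinI lin_times)

text \<open>Because \<Delta> is multiplicative, composing functionals with the product of H is
  compatible with convolution: the left side is (m * n) composed with the product.\<close>

lemma conv_of_product: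
  assumes m: "lin m" "lin n" and inv: "\<And>x. SS (\<lambda>p q. m p * n q) x = \<iota> (\<epsilon> x)"
  shows "conv (of_product m) (of_product n) = conv_counit"
proof (intro ext)
  fix x y
  have "bilin (\<lambda>p q. m p * n q)"
    by (intro bilinI lin_times m)
  from SS_mult[OF this, of x y] show "conv (of_product m) (of_product n) x y = conv_counit x y"
    by (simp add: conv_def of_product_def conv_counit_def inv counit_mult)
qed

lemma conv_tensor_square:
  assumes inv: "\<And>x. SS (\<lambda>p q. m p * n q) x = \<iota> (\<epsilon> x)"
  shows "conv (tensor_square m) (tensor_square n) = conv_counit"
proof (intro ext)
  fix x y
  have "conv (tensor_square m) (tensor_square n) x y = SS (\<lambda>p q. m p * n q) x * SS (\<lambda>p q. m p * n q) y"
  proof -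
    have "SS (\<lambda>p q. m p * n q) x * SS (\<lambda>p q. m p * n q) y =
        SS (\<lambda>p q. m p * n q * SS (\<lambda>r s. m r * n s) y) x"
      by (rule SS_times(2))
    also have "\<dots> = conv (tensor_square m) (tensor_square n) x y"
      unfolding conv_def tensor_square_def SS_times(1) by (simp add: ac_simps)
    finally show ?thesis
      by (rule sym)
  qed
  then show "conv (tensor_square m) (tensor_square n) x y = conv_counit x y"
    by (simp add: inv conv_counit_def)
qed

text \<open>In the convolution algebra of bilinear maps, \<open>eq\<close> can be solved for \<beta>
  by multiplying on the right with the inverse of \<open>of_product m\<close>. The second expression
  is checked to be a right inverse of \<beta>; multiplication by \<beta>' from the left then
  identifies it with \<beta>'.\<close>

lemma gauge:
  assumes m: "lin m" and n: "lin n"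
    and mn: "\<And>x. SS (\<lambda>p q. m p * n q) x = \<iota> (\<epsilon> x)" and nm: "\<And>x. SS (\<lambda>p q. n p * m q) x = \<iota> (\<epsilon> x)"
    and b: "bilin \<beta>" "bilin \<beta>'" "conv \<beta>' \<beta> = conv_counit" and a: "bilin \<alpha>" "bilin \<alpha>'" "conv \<alpha> \<alpha>' = conv_counit"
    and eq: "conv (tensor_square m) \<alpha> = conv \<beta> (of_product m)"
  shows "conv (tensor_square m) (conv \<alpha> (of_product n)) = \<beta>" "conv (of_product m) (conv \<alpha>' (tensor_square n)) = \<beta>'"
proof -
  note bl = bilin_conv bilin_of_product[OF m] bilin_of_product[OF n] bilin_tensor_square[OF m] bilin_tensor_square[OF n] b(1,2) a(1,2)
  have "conv (tensor_square m) (conv \<alpha> (of_product n)) = conv (conv (tensor_square m) \<alpha>) (of_product n)"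
    by (rule conv_assoc[symmetric]) (rule bl)+
  also have "\<dots> = conv \<beta> (conv (of_product m) (of_product n))"
    unfolding eq by (rule conv_assoc) (rule bl)+
  finally show "conv (tensor_square m) (conv \<alpha> (of_product n)) = \<beta>"
    by (simp add: conv_of_product[OF m n mn] conv_unit b)
  have "conv \<beta> (conv (of_product m) (conv \<alpha>' (tensor_square n))) = conv (conv (tensor_square m) \<alpha>) (conv \<alpha>' (tensor_square n))"
    unfolding eq by (rule conv_assoc[symmetric]) (intro bl)+
  also have "\<dots> = conv (tensor_square m) (conv (conv \<alpha> \<alpha>') (tensor_square n))"
    by (subst conv_assoc[of "tensor_square m"], (intro bl)+) (subst conv_assoc[of \<alpha>], (intro bl)+, rule refl)
  also have "\<dots> = conv_counit"
    unfolding a(3) using conv_unit(1)[OF bilin_tensor_square[OF n]] conv_tensor_square[OF mn] by simp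
  finally have *: "conv \<beta> (conv (of_product m) (conv \<alpha>' (tensor_square n))) = conv_counit" .
  have "conv (of_product m) (conv \<alpha>' (tensor_square n)) = conv (conv \<beta>' \<beta>) (conv (of_product m) (conv \<alpha>' (tensor_square n)))"
    unfolding b(3) by (rule conv_unit(1)[symmetric]) (intro bl)
  also have "\<dots> = conv \<beta>' conv_counit"
    unfolding *[symmetric] by (rule conv_assoc) (intro bl)+
  finally show "conv (of_product m) (conv \<alpha>' (tensor_square n)) = \<beta>'"
    by (simp add: conv_unit b)
qed

lemma conv_inverse_unique:
  assumes "bilin f" "bilin g" "bilin h" "conv g f = conv_counit" "conv f h = conv_counit"
  shows "g = h"
  using conv_assoc[of g f h] conv_unit[OF assms(2)] conv_unit[OF assms(3)] assms by simp

end

section \<open>Finite left coideals\<close>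

context hopf_algebra
begin

interpretation k: hopf_field scale \<Delta> \<epsilon> "id :: 'k \<Rightarrow> 'k"
  by unfold_locales (rule ring_hom_memI; simp)

definition BB :: "'h set" where "BB = extend_basis {}"

definition co :: "'h \<Rightarrow> 'h \<Rightarrow> 'k" where "co e x = representation BB x e"

definition supp :: "'h \<Rightarrow> 'h set" where "supp x = {e. co e x \<noteq> 0}"

lemma BB: "independent BB" "span BB = UNIV"
  unfolding BB_def by (rule independent_extend_basis[OF independent_empty] span_extend_basis[OF independent_empty])+

lemma finite_supp [simp]: "finite (supp x)"
  unfolding supp_def co_def by (rule finite_representation)

lemma lin_co: "k.lin (co e)"
proof (rule k.linI)
  show "co e (x + y) = co e x + co e y" for x y
    using representation_add[OF BB(1), of y x] by (simp add: co_def BB(2))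
  show "co e (scale a x) = id a * co e x" for a x
    using representation_scale[OF BB(1), of x a] by (simp add: co_def BB(2))
qed

lemma lin_counit: "k.lin \<epsilon>"
  by (rule k.linI) (simp_all add: counit_add counit_scale)

lemma co_expand:
  assumes "finite C" "supp x \<subseteq> C"
  shows "x = (\<Sum>e\<in>C. scale (co e x) e)"
proof -
  have "x = (\<Sum>e\<in>supp x. scale (co e x) e)"
    unfolding supp_def co_def by (rule sum_nonzero_representation_eq[symmetric]) (simp_all add: BB)
  also have "\<dots> = (\<Sum>e\<in>C. scale (co e x) e)"
    by (rule sum.mono_neutral_left) (use assms in \<open>auto simp: supp_def\<close>)
  finally show ?thesis .
qed

end

text \<open>Coideals are defined by testing with k-valued forms, since a definition cannot quantify
  over the type of the target field, but they are applied to forms with values in that field. On the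
  finitely many vectors involved, such a form is a combination of products of two coordinate
  functions, and for these products the hypothesis is available.\<close>

lemma (in hopf_field) bilinear_transfer:
  assumes fin: "finite P" "finite Q"
    and eq: "\<And>g. hopf_field.bilin scale (id :: 'k \<Rightarrow> 'k) g \<Longrightarrow> (\<Sum>p\<in>P. g (a p) (b p)) = (\<Sum>q\<in>Q. g (a' q) (b' q))"
    and f: "bilin f"
  shows "(\<Sum>p\<in>P. f (a p) (b p)) = (\<Sum>q\<in>Q. f (a' q) (b' q))"
proof -
  interpret k: hopf_field scale \<Delta> \<epsilon> "id :: 'k \<Rightarrow> 'k"
    by unfold_locales (rule ring_hom_memI; simp)
  define C where "C = (\<Union>p\<in>P. supp (a p) \<union> supp (b p)) \<union> (\<Union>q\<in>Q. supp (a' q) \<union> supp (b' q))"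
  have C: "finite C"
    using fin by (simp add: C_def)
  have ex: "f u w = (\<Sum>e\<in>C. \<Sum>e'\<in>C. \<iota> (co e u * co e' w) * f e e')" if "supp u \<subseteq> C" "supp w \<subseteq> C" for u w
  proof -
    have "f u w = f (\<Sum>e\<in>C. scale (co e u) e) (\<Sum>e'\<in>C. scale (co e' w) e')"
      by (rule arg_cong2[where f = f, OF co_expand[OF C that(1)] co_expand[OF C that(2)]])
    also have "\<dots> = (\<Sum>e\<in>C. \<iota> (co e u) * f e (\<Sum>e'\<in>C. scale (co e' w) e'))"
      by (simp add: lin_sum[OF bilinD(1)[OF f]] linD(2)[OF bilinD(1)[OF f]])
    also have "\<dots> = (\<Sum>e\<in>C. \<iota> (co e u) * (\<Sum>e'\<in>C. \<iota> (co e' w) * f e e'))"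
      by (simp only: lin_sum[OF bilinD(2)[OF f]] linD(2)[OF bilinD(2)[OF f]])
    also have "\<dots> = (\<Sum>e\<in>C. \<Sum>e'\<in>C. \<iota> (co e u * co e' w) * f e e')"
      by (simp add: sum_distrib_left mult.assoc)
    finally show ?thesis .
  qed
  have g: "k.bilin (\<lambda>u w. co e u * co e' w)" for e e'
    by (intro k.bilinI k.lin_times lin_co)
  have *: "(\<Sum>p\<in>P. f (a p) (b p)) = (\<Sum>e\<in>C. \<Sum>e'\<in>C. \<iota> (\<Sum>p\<in>P. co e (a p) * co e' (b p)) * f e e')"
    if "\<And>p. p \<in> P \<Longrightarrow> supp (a p) \<subseteq> C \<and> supp (b p) \<subseteq> C" for P :: "'x set" and a b
  proof -
    have "(\<Sum>p\<in>P. f (a p) (b p)) = (\<Sum>p\<in>P. \<Sum>e\<in>C. \<Sum>e'\<in>C. \<iota> (co e (a p) * co e' (b p)) * f e e')"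
      by (rule sum.cong[OF refl]) (use that ex in blast)
    also have "\<dots> = (\<Sum>e\<in>C. \<Sum>p\<in>P. \<Sum>e'\<in>C. \<iota> (co e (a p) * co e' (b p)) * f e e')"
      by (rule sum.swap)
    also have "\<dots> = (\<Sum>e\<in>C. \<Sum>e'\<in>C. \<Sum>p\<in>P. \<iota> (co e (a p) * co e' (b p)) * f e e')"
      by (rule sum.cong[OF refl]) (rule sum.swap)
    finally show ?thesis
      by (simp only: \<iota>_sum sum_distrib_right)
  qed
  have "(\<Sum>p\<in>P. f (a p) (b p)) = (\<Sum>e\<in>C. \<Sum>e'\<in>C. \<iota> (\<Sum>p\<in>P. co e (a p) * co e' (b p)) * f e e')"
    by (rule *) (auto simp: C_def)
  also have "\<dots> = (\<Sum>e\<in>C. \<Sum>e'\<in>C. \<iota> (\<Sum>q\<in>Q. co e (a' q) * co e' (b' q)) * f e e')"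
    using eq[OF g] by simp
  also have "\<dots> = (\<Sum>q\<in>Q. f (a' q) (b' q))"
  proof -
    have "(\<Sum>q\<in>Q. f (a' q) (b' q)) = (\<Sum>q\<in>Q. \<Sum>e\<in>C. \<Sum>e'\<in>C. \<iota> (co e (a' q) * co e' (b' q)) * f e e')"
      by (rule sum.cong[OF refl], rule ex) (auto simp: C_def)
    also have "\<dots> = (\<Sum>e\<in>C. \<Sum>q\<in>Q. \<Sum>e'\<in>C. \<iota> (co e (a' q) * co e' (b' q)) * f e e')"
      by (rule sum.swap)
    also have "\<dots> = (\<Sum>e\<in>C. \<Sum>e'\<in>C. \<Sum>q\<in>Q. \<iota> (co e (a' q) * co e' (b' q)) * f e e')"
      by (rule sum.cong[OF refl]) (rule sum.swap)
    finally show ?thesis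
      by (simp only: \<iota>_sum sum_distrib_right)
  qed
  finally show ?thesis .
qed

context hopf_algebra
begin

interpretation k: hopf_field scale \<Delta> \<epsilon> "id :: 'k \<Rightarrow> 'k"
  by unfold_locales (rule ring_hom_memI; simp)

definition EE :: "'h \<Rightarrow> 'h set" where "EE x = (\<Union>i<N x. supp (d1 x i))"

text \<open>The second factor that accompanies e when the first legs of \<Delta> x are expanded in
  the basis \<open>BB\<close>: \<Delta> x is the sum of e \<otimes> \<open>bb x e\<close> over the
  finite set \<open>EE x\<close>.\<close>

definition bb :: "'h \<Rightarrow> 'h \<Rightarrow> 'h" where "bb x e = (\<Sum>i<N x. scale (co e (d1 x i)) (d2 x i))"

lemma finite_EE [simp]: "finite (EE x)"
  by (simp add: EE_def)

lemma d1_expand: "i < N x \<Longrightarrow> d1 x i = (\<Sum>e\<in>EE x. scale (co e (d1 x i)) e)"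
  by (rule co_expand) (auto simp: EE_def)

lemma SS_bb:
  assumes "k.bilin f"
  shows "SS f x = (\<Sum>e\<in>EE x. f e (bb x e))"
proof -
  have "SS f x = (\<Sum>i<N x. f (\<Sum>e\<in>EE x. scale (co e (d1 x i)) e) (d2 x i))"
    unfolding SS_def by (rule sum.cong[OF refl]) (simp flip: d1_expand)
  also have "\<dots> = (\<Sum>i<N x. \<Sum>e\<in>EE x. co e (d1 x i) * f e (d2 x i))"
    by (simp add: k.lin_sum[OF k.bilinD(1)[OF assms]] k.linD(2)[OF k.bilinD(1)[OF assms]])
  also have "\<dots> = (\<Sum>e\<in>EE x. \<Sum>i<N x. co e (d1 x i) * f e (d2 x i))"
    by (rule sum.swap)
  finally show ?thesis
    by (simp add: bb_def k.lin_sum[OF k.bilinD(2)[OF assms]] k.linD(2)[OF k.bilinD(2)[OF assms]])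
qed

text \<open>The counit on the first leg recovers x from the vectors \<open>bb x e\<close>. Together
  with \<open>SS_bb_bb\<close> this puts every element of H into a finite-dimensional left
  coideal.\<close>

lemma counit_bb: "x = (\<Sum>e\<in>EE x. scale (\<epsilon> e) (bb x e))"
proof -
  have "x = SS (\<lambda>p q. scale (\<epsilon> p) q) x"
    by (rule counit_left_SS[symmetric])
  also have "\<dots> = (\<Sum>i<N x. scale (\<Sum>e\<in>EE x. co e (d1 x i) * \<epsilon> e) (d2 x i))"
    unfolding SS_def
  proof (rule sum.cong[OF refl])
    fix i assume "i \<in> {..<N x}"
    then have "\<epsilon> (d1 x i) = \<epsilon> (\<Sum>e\<in>EE x. scale (co e (d1 x i)) e)"
      by (intro arg_cong[where f = \<epsilon>] d1_expand) simp
    also have "\<dots> = (\<Sum>e\<in>EE x. co e (d1 x i) * \<epsilon> e)"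
      using k.lin_sum[OF lin_counit, of "\<lambda>e. scale (co e (d1 x i)) e" "EE x"] by (simp add: counit_scale)
    finally show "scale (\<epsilon> (d1 x i)) (d2 x i) = scale (\<Sum>e\<in>EE x. co e (d1 x i) * \<epsilon> e) (d2 x i)"
      by simp
  qed
  also have "\<dots> = (\<Sum>i<N x. \<Sum>e\<in>EE x. scale (\<epsilon> e) (scale (co e (d1 x i)) (d2 x i)))"
    by (simp add: scale_sum_left mult.commute)
  also have "\<dots> = (\<Sum>e\<in>EE x. scale (\<epsilon> e) (bb x e))"
    unfolding bb_def scale_sum_right by (rule sum.swap)
  finally show ?thesis .
qed

text \<open>Coassociativity with the coordinate function of e applied to the first leg: \<Delta>
  (\<open>bb x e\<close>) is the sum of \<open>bb e' e\<close> \<otimes> \<open>bb x e'\<close>, so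
  its second factors stay among the vectors \<open>bb x e'\<close>.\<close>

lemma SS_bb_bb:
  assumes f: "k.bilin f"
  shows "SS f (bb x e) = (\<Sum>e'\<in>EE x. f (bb e' e) (bb x e'))"
proof -
  note linear_form = k.bilinD[OF f]
  have e1: "SS (\<lambda>r s. co e r * f s z) e' = f (bb e' e) z" for e' z
    unfolding bb_def by (simp add: k.lin_sum[OF linear_form(1)] k.linD(2)[OF linear_form(1)] SS_def)
  have "SS f (bb x e) = SS (\<lambda>p q. co e p * SS f q) x"
    unfolding bb_def by (simp add: k.lin_sum[OF k.SS_lin[OF f]] k.linD(2)[OF k.SS_lin[OF f]] SS_def[of "\<lambda>p q. co e p * SS f q"])
  also have "\<dots> = SS (\<lambda>p q. SS (\<lambda>r s. co e p * f r s) q) x"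
    by (simp add: k.SS_times)
  also have "\<dots> = SS (\<lambda>p q. SS (\<lambda>r s. co e r * f s q) p) x"
    by (rule k.SS_coassoc[where f = "\<lambda>p r s. co e p * f r s", symmetric]) (intro k.lin_times linear_form lin_co)+
  also have "\<dots> = (\<Sum>e'\<in>EE x. SS (\<lambda>r s. co e r * f s (bb x e')) e')"
  proof (rule SS_bb)
    have b: "k.bilin (\<lambda>r s. co e r * f s q)" for q
      by (rule k.bilinI) (intro k.lin_times linear_form lin_co)+
    show "k.bilin (\<lambda>p q. SS (\<lambda>r s. co e r * f s q) p)"
      by (rule k.bilinI) (intro k.SS_lin b, intro k.SS_lin_param k.lin_times linear_form)
  qed
  finally show ?thesis
    unfolding e1 .
qed

end

context hopf_algebra
begin

interpretation k: hopf_field scale \<Delta> \<epsilon> "id :: 'k \<Rightarrow> 'k"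
  by unfold_locales (rule ring_hom_memI; simp)

text \<open>Tested on bilinear forms: \<open>\<Delta> g \<in> H \<otimes> span G\<close> for all \<open>g \<in> G\<close>.\<close>

definition left_coideal :: "'h set \<Rightarrow> bool" where
  "left_coideal G \<longleftrightarrow> finite G \<and> (\<forall>g\<in>G. \<exists>d. \<forall>f. k.bilin f \<longrightarrow> SS f g = (\<Sum>g'\<in>G. f (d g') g'))"

lemma left_coideal_bb: "left_coideal (bb x ` EE x)"
  unfolding left_coideal_def
proof (intro conjI ballI)
  fix g assume "g \<in> bb x ` EE x"
  then obtain e where e: "g = bb x e"
    by blast
  show "\<exists>d. \<forall>f. k.bilin f \<longrightarrow> SS f g = (\<Sum>g'\<in>bb x ` EE x. f (d g') g')"
  proof (intro exI allI impI)
    fix f assume f: "k.bilin f"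
    \<comment> \<open>\<open>bb x\<close> may take the same value at several e', so the terms with
      equal second factor are collected first.\<close>
    have "SS f g = (\<Sum>g'\<in>bb x ` EE x. \<Sum>e' | e' \<in> EE x \<and> bb x e' = g'. f (bb e' e) (bb x e'))"
      unfolding e SS_bb_bb[OF f] by (rule sum.image_gen) simp
    also have "\<dots> = (\<Sum>g'\<in>bb x ` EE x. f (\<Sum>e' | e' \<in> EE x \<and> bb x e' = g'. bb e' e) g')"
      by (simp add: k.lin_sum[OF k.bilinD(1)[OF f]])
    finally show "SS f g = (\<Sum>g'\<in>bb x ` EE x. f (\<Sum>e' | e' \<in> EE x \<and> bb x e' = g'. bb e' e) g')" .
  qed
qed simp

text \<open>The coefficients of an element of one coideal are extended by zero to the union.\<close>

lemma left_coideal_Un: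
  assumes G: "left_coideal G" and G': "left_coideal G'"
  shows "left_coideal (G \<union> G')"
proof -
  have *: "\<exists>d. \<forall>f. k.bilin f \<longrightarrow> SS f g = (\<Sum>g'\<in>G2. f (d g') g')"
    if G1: "left_coideal G1" "g \<in> G1" and sub: "G1 \<subseteq> G2" "finite G2" for G1 G2 g
  proof -
    obtain d where d: "k.bilin f \<Longrightarrow> SS f g = (\<Sum>g'\<in>G1. f (d g') g')" for f
      using G1 unfolding left_coideal_def by blast
    show ?thesis
    proof (intro exI allI impI)
      fix f assume f: "k.bilin f"
      show "SS f g = (\<Sum>g'\<in>G2. f (if g' \<in> G1 then d g' else 0) g')"
        unfolding d[OF f] using sub
        by (intro sum.mono_neutral_cong_left) (auto simp: k.lin_zero[OF k.bilinD(1)[OF f]])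
    qed
  qed
  have fin: "finite (G \<union> G')"
    using assms by (simp add: left_coideal_def)
  show ?thesis
    unfolding left_coideal_def using fin *[OF G _ _ fin] *[OF G' _ _ fin] by blast
qed

text \<open>\<open>\<Delta> (v\<^sub>i) = \<Sum>\<^sub>j d\<^sub>i\<^sub>j \<otimes> v\<^sub>j\<close>, so that \<open>d\<close> is a matrix with \<open>\<Delta> (d\<^sub>i\<^sub>m) = \<Sum>\<^sub>l d\<^sub>i\<^sub>l \<otimes> d\<^sub>l\<^sub>m\<close>.\<close>

definition coideal_basis :: "nat \<Rightarrow> (nat \<Rightarrow> 'h) \<Rightarrow> (nat \<Rightarrow> nat \<Rightarrow> 'h) \<Rightarrow> bool" where
  "coideal_basis n v d \<longleftrightarrow> inj_on v {..<n} \<and> independent (v ` {..<n}) \<and>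
    (\<forall>i<n. \<forall>f. k.bilin f \<longrightarrow> SS f (v i) = (\<Sum>j<n. f (d i j) (v j)))"

text \<open>\<open>I\<close> is an independent subset of \<open>G\<close> with the same span.
  Expanding the second factors in \<open>I\<close> and collecting terms defines the new coefficients
  \<open>d i j\<close>.\<close>

lemma left_coideal_coideal_basis:
  assumes G: "left_coideal G"
  shows "\<exists>n v d. coideal_basis n v d \<and> G \<subseteq> span (v ` {..<n})"
proof -
  have fin: "finite G"
    using G by (simp add: left_coideal_def)
  obtain I where I: "I \<subseteq> G" "independent I" "G \<subseteq> span I"
    using maximal_independent_subset[of G] by blast
  have finI: "finite I"
    by (rule finite_subset[OF I(1) fin])
  from ex_bij_betw_nat_finite[OF finI] obtain v where v: "bij_betw v {..<card I} I"
    unfolding atLeast0LessThan by blast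
  from G obtain dd where dd: "g \<in> G \<Longrightarrow> k.bilin f \<Longrightarrow> SS f g = (\<Sum>g'\<in>G. f (dd g g') g')" for g f
    unfolding left_coideal_def by metis
  define d where "d i j = (\<Sum>g'\<in>G. scale (representation I g' (v j)) (dd (v i) g'))" for i j
  have im: "v ` {..<card I} = I"
    using v by (simp add: bij_betw_def)
  have "SS f (v i) = (\<Sum>j<card I. f (d i j) (v j))" if i: "i < card I" and f: "k.bilin f" for i f
  proof -
    have vG: "v i \<in> G"
      using im I(1) i by blast
    have ex: "g' = (\<Sum>j<card I. scale (representation I g' (v j)) (v j))" if "g' \<in> G" for g'
    proof -
      have "g' = (\<Sum>b\<in>I. scale (representation I g' b) b)"
        using sum_representation_eq[OF I(2) _ finI order_refl, of g'] I(3) that by auto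
      also have "\<dots> = (\<Sum>j<card I. scale (representation I g' (v j)) (v j))"
        by (rule sum.reindex_bij_betw[OF v, symmetric])
      finally show ?thesis .
    qed
    have "SS f (v i) = (\<Sum>g'\<in>G. f (dd (v i) g') (\<Sum>j<card I. scale (representation I g' (v j)) (v j)))"
      unfolding dd[OF vG f] by (rule sum.cong[OF refl]) (simp flip: ex)
    also have "\<dots> = (\<Sum>g'\<in>G. \<Sum>j<card I. representation I g' (v j) * f (dd (v i) g') (v j))"
      by (simp add: k.lin_sum[OF k.bilinD(2)[OF f]] k.linD(2)[OF k.bilinD(2)[OF f]])
    also have "\<dots> = (\<Sum>j<card I. \<Sum>g'\<in>G. representation I g' (v j) * f (dd (v i) g') (v j))"
      by (rule sum.swap)
    also have "\<dots> = (\<Sum>j<card I. f (d i j) (v j))"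
      by (simp add: d_def k.lin_sum[OF k.bilinD(1)[OF f]] k.linD(2)[OF k.bilinD(1)[OF f]])
    finally show ?thesis .
  qed
  then have "coideal_basis (card I) v d"
    unfolding coideal_basis_def im using v I(2) by (simp add: bij_betw_def)
  moreover have "G \<subseteq> span (v ` {..<card I})"
    unfolding im by (rule I(3))
  ultimately show ?thesis
    by blast
qed

text \<open>Two elements are accommodated at once because additivity of the glued convolution
  inverse compares its values at x, y and x + y on a single coideal.\<close>

lemma ex_coideal_basis: "\<exists>n v d. coideal_basis n v d \<and> x \<in> span (v ` {..<n}) \<and> y \<in> span (v ` {..<n})"
proof -
  obtain n v d where s: "coideal_basis n v d" "bb x ` EE x \<union> bb y ` EE y \<subseteq> span (v ` {..<n})"
    using left_coideal_coideal_basis[OF left_coideal_Un[OF left_coideal_bb[of x] left_coideal_bb[of y]]] by blast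
  have *: "(\<Sum>e\<in>EE z. scale (\<epsilon> e) (bb z e)) \<in> span (v ` {..<n})" if "bb z ` EE z \<subseteq> span (v ` {..<n})" for z
    by (intro span_sum span_scale) (use that in blast)
  show ?thesis
    using s *[of x, folded counit_bb] *[of y, folded counit_bb] by (metis Un_subset_iff)
qed

end

context hopf_algebra
begin

interpretation k: hopf_field scale \<Delta> \<epsilon> "id :: 'k \<Rightarrow> 'k"
  by unfold_locales (rule ring_hom_memI; simp)

text \<open>The functionals dual to the v, extended to all of H by completing the v to a basis. They
  serve to compare coefficients in the coideal relation.\<close>

lemma coideal_basis_coord:
  assumes "coideal_basis n v d" "m < n"
  obtains \<eta> where "k.lin \<eta>" "\<And>j. j < n \<Longrightarrow> \<eta> (v j) = (if j = m then 1 else 0)"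
proof -
  let ?I = "v ` {..<n}"
  have I: "independent ?I" and inj: "inj_on v {..<n}"
    using assms by (simp_all add: coideal_basis_def)
  let ?B = "extend_basis ?I"
  have B: "independent ?B" "span ?B = UNIV" "?I \<subseteq> ?B"
    using independent_extend_basis[OF I] span_extend_basis[OF I] extend_basis_superset[OF I] by auto
  show thesis
  proof
    show "k.lin (\<lambda>x. representation ?B x (v m))"
    proof (rule k.linI)
      show "representation ?B (x + y) (v m) = representation ?B x (v m) + representation ?B y (v m)" for x y
        using representation_add[OF B(1), of y x] by (simp add: B(2))
      show "representation ?B (scale a x) (v m) = id a * representation ?B x (v m)" for a x
        using representation_scale[OF B(1), of x a] by (simp add: B(2))
    qed
    show "representation ?B (v j) (v m) = (if j = m then 1 else 0)" if "j < n" for j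
    proof -
      have "v j \<in> ?B"
        using that B(3) by blast
      then show ?thesis
        using representation_basis[OF B(1)] inj that assms(2) by (auto simp: inj_on_def)
    qed
  qed
qed

lemma coideal_basis_v: "coideal_basis n v d \<Longrightarrow> i < n \<Longrightarrow> k.bilin f \<Longrightarrow> SS f (v i) = (\<Sum>j<n. f (d i j) (v j))"
  by (simp add: coideal_basis_def)

text \<open>Coassociativity at \<open>v i\<close> with the functional dual to \<open>v m\<close> on
  the third leg. Independence of the v separates the coefficients, and the d become the entries of a
  matrix coalgebra.\<close>

lemma coideal_basis_d_k:
  assumes s: "coideal_basis n v d" and i: "i < n" and m: "m < n" and f: "k.bilin f"
  shows "SS f (d i m) = (\<Sum>l<n. f (d i l) (d l m))"
proof -
  note linear_form = k.bilinD[OF f]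
  obtain \<eta> where \<eta>: "k.lin \<eta>" "\<And>j. j < n \<Longrightarrow> \<eta> (v j) = (if j = m then 1 else 0)"
    using coideal_basis_coord[OF s m] by metis
  have b: "k.bilin (\<lambda>r s. f r s * c)" "k.bilin (\<lambda>r s. f c' r * \<eta> s)" for c c'
    by (rule k.bilinI; intro k.lin_times linear_form \<eta>(1))+
  have c: "k.bilin (\<lambda>p q. SS (\<lambda>r s. f r s * \<eta> q) p)" "k.bilin (\<lambda>p q. SS (\<lambda>r s. f p r * \<eta> s) q)"
    by (rule k.bilinI, intro k.SS_lin b, intro k.SS_lin_param k.lin_times \<eta>(1))
      (rule k.bilinI, intro k.SS_lin_param k.lin_times linear_form, intro k.SS_lin b)
  have "SS f (d i m) = (\<Sum>j<n. SS (\<lambda>r s. f r s * \<eta> (v j)) (d i j))"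
  proof -
    have "(\<Sum>j<n. SS (\<lambda>r s. f r s * \<eta> (v j)) (d i j)) = (\<Sum>j<n. if j = m then SS f (d i j) else 0)"
      unfolding k.SS_times(2)[symmetric] by (rule sum.cong[OF refl]) (simp add: \<eta>(2))
    then show ?thesis
      using m by simp
  qed
  also have "\<dots> = SS (\<lambda>p q. SS (\<lambda>r s. f r s * \<eta> q) p) (v i)"
    by (rule coideal_basis_v[OF s i c(1), symmetric])
  also have "\<dots> = SS (\<lambda>p q. SS (\<lambda>r s. f p r * \<eta> s) q) (v i)"
    by (rule k.SS_coassoc[where f = "\<lambda>p q r. f p q * \<eta> r"]) (intro k.lin_times linear_form \<eta>(1))+
  also have "\<dots> = (\<Sum>l<n. SS (\<lambda>r s. f (d i l) r * \<eta> s) (v l))"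
    by (rule coideal_basis_v[OF s i c(2)])
  also have "\<dots> = (\<Sum>l<n. \<Sum>j<n. f (d i l) (d l j) * \<eta> (v j))"
    by (rule sum.cong[OF refl]) (rule coideal_basis_v[OF s _ b(2)], simp)
  also have "\<dots> = (\<Sum>l<n. f (d i l) (d l m))"
  proof (rule sum.cong[OF refl])
    fix l
    have "(\<Sum>j<n. f (d i l) (d l j) * \<eta> (v j)) = (\<Sum>j<n. if j = m then f (d i l) (d l j) else 0)"
      by (rule sum.cong[OF refl]) (simp add: \<eta>(2))
    then show "(\<Sum>j<n. f (d i l) (d l j) * \<eta> (v j)) = f (d i l) (d l m)"
      using m by simp
  qed
  finally show ?thesis .
qed

text \<open>The left counit axiom at \<open>v i\<close>, compared in the coordinate of
  \<open>v m\<close>. Hence multiplicative identities for convolution turn into matrix identities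
  with unit matrix on the right.\<close>

lemma coideal_basis_\<epsilon>:
  assumes s: "coideal_basis n v d" and i: "i < n" and m: "m < n"
  shows "\<epsilon> (d i m) = (if i = m then 1 else 0)"
proof -
  obtain \<eta> where \<eta>: "k.lin \<eta>" "\<And>j. j < n \<Longrightarrow> \<eta> (v j) = (if j = m then 1 else 0)"
    using coideal_basis_coord[OF s m] by metis
  have b: "k.bilin (\<lambda>p q. \<epsilon> p * \<eta> q)"
    by (rule k.bilinI) (intro k.lin_times \<eta>(1) lin_counit)+
  have "\<eta> (v i) = (\<Sum>j<n. \<epsilon> (d i j) * \<eta> (v j))"
    using k.SS_counit_left[OF \<eta>(1), of "v i"] coideal_basis_v[OF s i b] by simp
  also have "\<dots> = (\<Sum>j<n. if j = m then \<epsilon> (d i j) else 0)"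
    by (rule sum.cong[OF refl]) (simp add: \<eta>(2))
  finally show ?thesis
    using m \<eta>(2)[OF i] by simp
qed

end

context hopf_field
begin

lemma coideal_basis_SS_v:
  assumes s: "coideal_basis n v d" and i: "i < n" and f: "bilin f"
  shows "SS f (v i) = (\<Sum>j<n. f (d i j) (v j))"
  unfolding SS_def
  by (rule bilinear_transfer[OF _ _ _ f]) (simp_all add: coideal_basis_v[OF s i, unfolded SS_def])

lemma coideal_basis_SS_d:
  assumes s: "coideal_basis n v d" and i: "i < n" "m < n" and f: "bilin f"
  shows "SS f (d i m) = (\<Sum>l<n. f (d i l) (d l m))"
  unfolding SS_def
  by (rule bilinear_transfer[OF _ _ _ f]) (simp_all add: coideal_basis_d_k[OF s i, unfolded SS_def])

text \<open>By the right counit axiom the vectors \<open>v i\<close> are combinations of the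
  coefficients \<open>d i j\<close>, so a linear map known on the d is known on the coideal.\<close>

lemma coideal_basis_v_expand:
  assumes s: "coideal_basis n v d" and i: "i < n" and g: "lin g"
  shows "g (v i) = (\<Sum>j<n. \<iota> (\<epsilon> (v j)) * g (d i j))"
proof -
  have "bilin (\<lambda>p q. \<iota> (\<epsilon> q) * g p)"
    by (rule bilinI) (intro lin_times g lin_\<epsilon>)+
  from coideal_basis_SS_v[OF s i this] show ?thesis
    using SS_counit_right[OF g, of "v i"] by simp
qed

end

section \<open>Evaluation of polynomials\<close>

lemma poly_mapping_add_induct [case_names single add]:
  fixes p :: "'a \<Rightarrow>\<^sub>0 'b::monoid_add"
  assumes single: "\<And>m c. P (Poly_Mapping.single m c)" and add: "\<And>p q. P p \<Longrightarrow> P q \<Longrightarrow> P (p + q)"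
  shows "P p"
proof (induction p rule: update_induct)
  case const
  show ?case
    using single[of undefined 0] by simp
next
  case (update f a b)
  have "Poly_Mapping.update a b f = f + Poly_Mapping.single a b"
    using update(1) by (intro poly_mapping_eqI) (auto simp: lookup_update lookup_add lookup_single in_keys_iff)
  then show ?case
    using add[OF update(3) single] by simp
qed

definition mon :: "('a \<Rightarrow> 'r::comm_ring_1) \<Rightarrow> ('a \<Rightarrow>\<^sub>0 nat) \<Rightarrow> 'r" where
  "mon s m = (\<Prod>x\<in>Poly_Mapping.keys m. s x ^ Poly_Mapping.lookup m x)"

lemma mon_superset:
  assumes "finite C" "Poly_Mapping.keys m \<subseteq> C"
  shows "mon s m = (\<Prod>x\<in>C. s x ^ Poly_Mapping.lookup m x)"
  unfolding mon_def by (rule prod.mono_neutral_left) (use assms in \<open>auto simp: in_keys_iff\<close>)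

lemma mon_add: "mon s (m + n) = mon s m * mon s n"
proof -
  let ?C = "Poly_Mapping.keys m \<union> Poly_Mapping.keys n"
  have "mon s (m + n) = (\<Prod>x\<in>?C. s x ^ Poly_Mapping.lookup (m + n) x)"
    by (rule mon_superset) (simp_all add: keys_add)
  also have "\<dots> = (\<Prod>x\<in>?C. s x ^ Poly_Mapping.lookup m x) * (\<Prod>x\<in>?C. s x ^ Poly_Mapping.lookup n x)"
    by (simp add: lookup_add power_add prod.distrib)
  also have "\<dots> = mon s m * mon s n"
    by (subst (1 2) mon_superset[of ?C]) auto
  finally show ?thesis .
qed

lemma mon_zero [simp]: "mon s 0 = 1"
  by (simp add: mon_def)

lemma mon_single: "mon s (Poly_Mapping.single x 1) = s x"
  by (simp add: mon_def)

text \<open>Used for the map \<open>rho\<close> to a polynomial ring in linearly ordered variables,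
  for the map \<open>sec\<close> back, and for the evaluation at a linear map m.\<close>

locale poly_eval =
  fixes \<phi> :: "'k::field \<Rightarrow> 'r::comm_ring_1" and s :: "'a \<Rightarrow> 'r"
  assumes \<phi>_add: "\<phi> (a + b) = \<phi> a + \<phi> b" and \<phi>_mult: "\<phi> (a * b) = \<phi> a * \<phi> b" and \<phi>_one: "\<phi> 1 = 1"
begin

definition evp :: "(('a \<Rightarrow>\<^sub>0 nat) \<Rightarrow>\<^sub>0 'k) \<Rightarrow> 'r" where
  "evp p = (\<Sum>m\<in>Poly_Mapping.keys p. \<phi> (Poly_Mapping.lookup p m) * mon s m)"

lemma \<phi>_zero: "\<phi> 0 = 0"
  using \<phi>_add[of 0 0] by (simp only: add_0_left add_cancel_right_right)

lemma evp_superset: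
  assumes "finite C" "Poly_Mapping.keys p \<subseteq> C"
  shows "evp p = (\<Sum>m\<in>C. \<phi> (Poly_Mapping.lookup p m) * mon s m)"
  unfolding evp_def by (rule sum.mono_neutral_left) (use assms in \<open>auto simp: in_keys_iff \<phi>_zero\<close>)

lemma evp_add: "evp (p + q) = evp p + evp q"
proof -
  let ?C = "Poly_Mapping.keys p \<union> Poly_Mapping.keys q"
  have "evp (p + q) = (\<Sum>m\<in>?C. \<phi> (Poly_Mapping.lookup (p + q) m) * mon s m)"
    by (rule evp_superset) (simp_all add: keys_add)
  also have "\<dots> = (\<Sum>m\<in>?C. \<phi> (Poly_Mapping.lookup p m) * mon s m) + (\<Sum>m\<in>?C. \<phi> (Poly_Mapping.lookup q m) * mon s m)"
    by (simp add: lookup_add \<phi>_add distrib_right sum.distrib)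
  also have "\<dots> = evp p + evp q"
    by (subst (1 2) evp_superset[of ?C]) auto
  finally show ?thesis .
qed

lemma evp_single: "evp (Poly_Mapping.single m c) = \<phi> c * mon s m"
  by (simp add: evp_def \<phi>_zero)

lemma evp_mult: "evp (p * q) = evp p * evp q"
proof (induction p rule: poly_mapping_add_induct)
  case (single m c)
  show ?case
  proof (induction q rule: poly_mapping_add_induct)
    case (single n d)
    show ?case
      by (simp add: mult_single evp_single mon_add \<phi>_mult ac_simps)
  next
    case (add p q)
    then show ?case
      by (simp add: distrib_left evp_add)
  qed
next
  case (add p q)
  then show ?case
    by (simp add: distrib_right evp_add)
qed

lemma evp_const: "evp (Poly_Mapping.single 0 c) = \<phi> c"
  by (simp add: evp_single)

lemma evp_one: "evp 1 = 1"
  using evp_const[of 1] by (simp add: \<phi>_one flip: single_one)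

lemma evp_zero: "evp 0 = 0"
  by (simp add: evp_def)

lemma evp_var: "evp (Poly_Mapping.single (Poly_Mapping.single x 1) 1) = s x"
  by (simp only: evp_single mon_single \<phi>_one mult_1_left)

lemma evp_minus: "evp (p - q) = evp p - evp q"
  using evp_add[of "p - q" q] by simp

end

lemma poly_closed_induct:
  fixes p :: "('a \<Rightarrow>\<^sub>0 nat) \<Rightarrow>\<^sub>0 'k::field"
  assumes const: "\<And>c. P (Poly_Mapping.single 0 c)" and var: "\<And>x. P (Poly_Mapping.single (Poly_Mapping.single x 1) 1)"
    and add: "\<And>p q. P p \<Longrightarrow> P q \<Longrightarrow> P (p + q)" and mult: "\<And>p q. P p \<Longrightarrow> P q \<Longrightarrow> P (p * q)"
  shows "P p"
proof (induction p rule: poly_mapping_add_induct)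
  case (single m c)
  have pow: "P (Poly_Mapping.single (Poly_Mapping.single x n) 1)" for x n
  proof (induction n)
    case 0
    show ?case
      using const[of 1] by simp
  next
    case (Suc n)
    have "Poly_Mapping.single (Poly_Mapping.single x (Suc n)) 1 =
        Poly_Mapping.single (Poly_Mapping.single x 1) 1 * Poly_Mapping.single (Poly_Mapping.single x n) (1::'k)"
      by (simp add: mult_single flip: single_add)
    then show ?case
      using mult[OF var[of x] Suc] by simp
  qed
  have "P (Poly_Mapping.single m 1)"
  proof (induction m rule: poly_mapping_add_induct)
    case (single x n)
    show ?case by (rule pow)
  next
    case (add m n)
    have "Poly_Mapping.single (m + n) 1 = Poly_Mapping.single m 1 * Poly_Mapping.single n (1::'k)"
      by (simp add: mult_single)
    then show ?case
      using mult[OF add] by simp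
  qed
  from mult[OF const[of c] this] show ?case
    by (simp add: mult_single)
qed (rule add)

section \<open>A linearly ordered copy of a type\<close>

text \<open>
  The library proves that polynomials over a field form an integral domain only for linearly
  ordered sets of variables.
\<close>

typedef 'a lcopy = "UNIV :: 'a set" morphisms of_lcopy to_lcopy
  by blast

definition lcopy_rel :: "'a lcopy rel" where
  "lcopy_rel = (SOME r. well_order_on UNIV r)"

lemma lcopy_rel:
  "refl (lcopy_rel :: 'a lcopy rel)" "trans (lcopy_rel :: 'a lcopy rel)"
  "antisym (lcopy_rel :: 'a lcopy rel)" "total (lcopy_rel :: 'a lcopy rel)"
proof -
  have "well_order_on UNIV (lcopy_rel :: 'a lcopy rel)"
    unfolding lcopy_rel_def by (rule someI_ex) (rule well_order_on)
  then show "refl (lcopy_rel :: 'a lcopy rel)" "trans (lcopy_rel :: 'a lcopy rel)"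
    "antisym (lcopy_rel :: 'a lcopy rel)" "total (lcopy_rel :: 'a lcopy rel)"
    by (auto simp: well_order_on_def linear_order_on_def partial_order_on_def preorder_on_def)
qed

instantiation lcopy :: (type) linorder
begin

definition "less_eq_lcopy x y \<longleftrightarrow> (x, y) \<in> lcopy_rel"

definition "less_lcopy x y \<longleftrightarrow> (x, y) \<in> lcopy_rel \<and> x \<noteq> (y :: 'a lcopy)"

instance
proof (intro_classes, goal_cases)
  case (1 x y)
  show ?case
    using antisymD[OF lcopy_rel(3), of x y] by (auto simp: less_eq_lcopy_def less_lcopy_def refl_onD[OF lcopy_rel(1)])
next
  case (2 x)
  show ?case
    by (simp add: less_eq_lcopy_def refl_onD[OF lcopy_rel(1)])
next
  case (3 x y z)
  then show ?case
    using transD[OF lcopy_rel(2), of x y z] by (simp add: less_eq_lcopy_def)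
next
  case (4 x y)
  then show ?case
    using antisymD[OF lcopy_rel(3), of x y] by (simp add: less_eq_lcopy_def)
next
  case (5 x y)
  show ?case
    using lcopy_rel(4) refl_onD[OF lcopy_rel(1), of x] by (cases "x = y") (auto simp: less_eq_lcopy_def total_on_def)
qed

end

section \<open>The symmetric algebra as a polynomial ring\<close>

context hopf_algebra
begin

interpretation k: hopf_field scale \<Delta> \<epsilon> "id :: 'k \<Rightarrow> 'k"
  by unfold_locales (rule ring_hom_memI; simp)

definition Yv :: "'h \<Rightarrow> ('h lcopy \<Rightarrow>\<^sub>0 nat) \<Rightarrow>\<^sub>0 'k" where
  "Yv e = Poly_Mapping.single (Poly_Mapping.single (to_lcopy e) 1) 1"

abbreviation cst :: "'k \<Rightarrow> ('b \<Rightarrow>\<^sub>0 nat) \<Rightarrow>\<^sub>0 'k" where "cst \<equiv> Poly_Mapping.single 0"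

text \<open>The target ring has a variable for every element of H, but \<open>co e h\<close>
  vanishes unless e lies in \<open>BB\<close>; only variables of basis vectors occur. Choosing a
  basis thus presents the symmetric algebra as polynomials in the basis vectors.\<close>

definition linear_form :: "'h \<Rightarrow> ('h lcopy \<Rightarrow>\<^sub>0 nat) \<Rightarrow>\<^sub>0 'k" where
  "linear_form h = (\<Sum>e\<in>supp h. cst (co e h) * Yv e)"

lemma cst_simps: "cst (a + b) = cst a + cst b" "cst (a * b) = cst a * cst b" "cst 1 = 1" "cst 0 = 0"
  by (simp_all add: single_add mult_single)

sublocale rho: poly_eval "cst :: 'k \<Rightarrow> ('h lcopy \<Rightarrow>\<^sub>0 nat) \<Rightarrow>\<^sub>0 'k" linear_form
  by unfold_locales (rule cst_simps)+

text \<open>Sends the variable of e back to its variable in the presentation of the symmetric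
  algebra; \<open>sec_rho\<close> shows that this undoes \<open>rho\<close> modulo the
  ideal.\<close>

sublocale sec: poly_eval "cst :: 'k \<Rightarrow> ('k, 'h) poly_in" "\<lambda>w. poly_var (of_lcopy w)"
  by unfold_locales (rule cst_simps)+

abbreviation "rho \<equiv> rho.evp"

lemma linear_form_superset:
  assumes "finite C" "supp h \<subseteq> C"
  shows "linear_form h = (\<Sum>e\<in>C. cst (co e h) * Yv e)"
  unfolding linear_form_def by (rule sum.mono_neutral_left) (use assms in \<open>auto simp: supp_def\<close>)

lemma linear_form_add: "linear_form (x + y) = linear_form x + linear_form y"
proof -
  let ?C = "supp (x + y) \<union> supp x \<union> supp y"
  have C: "finite ?C"
    by simp
  have "linear_form (x + y) = (\<Sum>e\<in>?C. cst (co e (x + y)) * Yv e)"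
    by (rule linear_form_superset[OF C]) auto
  also have "\<dots> = (\<Sum>e\<in>?C. cst (co e x) * Yv e) + (\<Sum>e\<in>?C. cst (co e y) * Yv e)"
    by (simp only: k.linD(1)[OF lin_co] cst_simps distrib_right sum.distrib)
  also have "\<dots> = linear_form x + linear_form y"
    by (subst (1 2) linear_form_superset[OF C]) auto
  finally show ?thesis .
qed

lemma linear_form_scale: "linear_form (scale a x) = cst a * linear_form x"
proof -
  let ?C = "supp (scale a x) \<union> supp x"
  have C: "finite ?C"
    by simp
  have "linear_form (scale a x) = (\<Sum>e\<in>?C. cst (co e (scale a x)) * Yv e)"
    by (rule linear_form_superset[OF C]) auto
  also have "\<dots> = cst a * (\<Sum>e\<in>?C. cst (co e x) * Yv e)"
    by (simp only: k.linD(2)[OF lin_co] id_apply cst_simps sum_distrib_left mult.assoc)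
  also have "\<dots> = cst a * linear_form x"
    by (subst linear_form_superset[OF C]) auto
  finally show ?thesis .
qed

lemma rho_var: "rho (poly_var h) = linear_form h"
  unfolding poly_var_def by (rule rho.evp_var)

lemma rho_const: "rho (poly_const a) = cst a"
  unfolding poly_const_def by (rule rho.evp_const)

abbreviation "PR \<equiv> ring_of_type_algebra :: ('k, 'h) poly_in ring"
abbreviation "SI \<equiv> sym_ideal scale"

definition sgens :: "('k, 'h) poly_in set" where
  "sgens = {poly_var (scale a x + scale b y) - (poly_const a * poly_var x + poly_const b * poly_var y) | a b x y. True}"

lemma SI_gens: "SI = genideal PR sgens"
  by (simp add: sym_ideal_def sgens_def)

lemma ring_PR: "ring PR" and cring_PR: "cring PR"
  by (rule ring_from_type_algebra cring_from_type_algebra)+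

lemma ideal_SI: "ideal SI PR"
  unfolding SI_gens by (rule ring.genideal_ideal[OF ring_PR]) simp

lemma SI_add: "p \<in> SI \<Longrightarrow> q \<in> SI \<Longrightarrow> p + q \<in> SI"
  using additive_subgroup.a_closed[OF ideal.axioms(1)[OF ideal_SI]] by simp

lemma SI_mult: "p \<in> SI \<Longrightarrow> q * p \<in> SI"
  using ideal.I_l_closed[OF ideal_SI, of p q] by simp

lemma SI_gen: "poly_var (scale a x + scale b y) - (poly_const a * poly_var x + poly_const b * poly_var y) \<in> SI"
proof -
  have "poly_var (scale a x + scale b y) - (poly_const a * poly_var x + poly_const b * poly_var y) \<in> sgens"
    unfolding sgens_def by blast
  then show ?thesis
    unfolding SI_gens using ring.genideal_self[OF ring_PR, of sgens] by auto
qed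

lemma rho_SI:
  assumes "p \<in> SI" shows "rho p = 0"
proof -
  have "ideal {p. rho p = 0} PR"
  proof (rule idealI[OF ring_PR])
    show "subgroup {p. rho p = 0} (add_monoid PR)"
    proof
      show "inv\<^bsub>add_monoid PR\<^esub> p \<in> {p. rho p = 0}" if "p \<in> {p. rho p = 0}" for p
      proof -
        interpret PR: ring PR by (rule ring_PR)
        have "\<ominus>\<^bsub>PR\<^esub> p = - p"
          by (rule PR.minus_equality) simp_all
        then show ?thesis
          using that rho.evp_minus[of 0 p] by (simp add: a_inv_def rho.evp_zero)
      qed
    qed (simp_all add: rho.evp_add rho.evp_zero)
  qed (simp_all add: rho.evp_mult)
  moreover have "sgens \<subseteq> {p. rho p = 0}"
    by (auto simp: sgens_def rho.evp_minus rho.evp_add rho.evp_mult rho_var rho_const linear_form_add linear_form_scale)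
  ultimately have "SI \<subseteq> {p. rho p = 0}"
    unfolding SI_gens by (rule ring.genideal_minimal[OF ring_PR])
  then show ?thesis
    using assms by blast
qed

lemma poly_var_zero: "poly_var 0 \<in> SI"
  using SI_gen[of 0 0 0 0] by (simp add: poly_const_def)

lemma poly_var_sum:
  assumes "finite C"
  shows "poly_var (\<Sum>e\<in>C. scale (c e) e) - (\<Sum>e\<in>C. poly_const (c e) * poly_var e) \<in> SI"
  using assms
proof (induction C rule: finite_induct)
  case empty
  show ?case
    using poly_var_zero by simp
next
  case (insert e C)
  let ?s = "\<Sum>e\<in>C. scale (c e) e" and ?t = "\<Sum>e\<in>C. poly_const (c e) * poly_var e"
  have "(poly_var (scale (c e) e + scale 1 ?s) - (poly_const (c e) * poly_var e + poly_const 1 * poly_var ?s)) +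
      (poly_var ?s - ?t) \<in> SI"
    by (rule SI_add[OF SI_gen insert.IH])
  then show ?case
    using insert.hyps by (simp add: poly_const_def algebra_simps)
qed

text \<open>On a variable the round trip replaces h by its expansion in basis vectors, and the
  difference is a consequence of the linearity relations (\<open>poly_var_sum\<close>). The ideal
  absorbs the rest of a product.\<close>

lemma sec_rho: "p - sec.evp (rho p) \<in> SI"
proof (induction p rule: poly_closed_induct)
  case (1 c)
  show ?case
    using SI_mult[OF poly_var_zero, of 0] by (simp add: rho.evp_const sec.evp_const)
next
  case (2 h)
  have s0: "sec.evp (sum g C) = (\<Sum>e\<in>C. sec.evp (g e))" for g and C :: "'h set"
    by (induction C rule: infinite_finite_induct) (simp_all add: sec.evp_zero sec.evp_add)
  have Y: "sec.evp (Yv e) = poly_var e" for e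
    unfolding Yv_def sec.evp_var by (simp add: to_lcopy_inverse)
  have "sec.evp (linear_form h) = (\<Sum>e\<in>supp h. poly_const (co e h) * poly_var e)"
    unfolding linear_form_def s0 sec.evp_mult sec.evp_const Y poly_const_def by (rule refl)
  then have "poly_var h - sec.evp (linear_form h) \<in> SI"
    using poly_var_sum[OF finite_supp[of h], of "\<lambda>e. co e h", folded co_expand[OF finite_supp order_refl]] by simp
  then show ?case
    unfolding poly_var_def[symmetric] rho_var .
next
  case (3 p q)
  then show ?case
    using SI_add[OF 3] by (simp add: rho.evp_add sec.evp_add algebra_simps)
next
  case (4 p q)
  have "p * q - sec.evp (rho (p * q)) = q * (p - sec.evp (rho p)) + sec.evp (rho p) * (q - sec.evp (rho q))"
    by (simp add: rho.evp_mult sec.evp_mult algebra_simps)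
  then show ?case
    using SI_add[OF SI_mult[OF 4(1)] SI_mult[OF 4(2)]] by simp
qed

text \<open>The relations are exactly the kernel of \<open>rho\<close>. Therefore the symmetric
  algebra sits inside a polynomial ring over a field, and equalities and zero tests in it may be
  made on \<open>rho\<close>.\<close>

lemma SI_iff: "p \<in> SI \<longleftrightarrow> rho p = 0"
proof
  assume "rho p = 0"
  then show "p \<in> SI"
    using sec_rho[of p] by (simp add: sec.evp_zero)
qed (rule rho_SI)

section \<open>The field of fractions\<close>

abbreviation "SA \<equiv> sym_algebra scale"
abbreviation "cl p \<equiv> SI +>\<^bsub>PR\<^esub> p"
abbreviation "KK \<equiv> KH scale"

lemma SA_eq: "SA = PR Quot SI"
  by (simp add: sym_algebra_def)

lemma cl_hom: "cl \<in> ring_hom PR SA"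
  unfolding SA_eq by (rule ideal.rcos_ring_hom[OF ideal_SI])

lemma cl_simps: "cl p \<otimes>\<^bsub>SA\<^esub> cl q = cl (p * q)" "cl p \<oplus>\<^bsub>SA\<^esub> cl q = cl (p + q)"
  "\<one>\<^bsub>SA\<^esub> = cl 1"
  using ring_hom_mult[OF cl_hom, of p q] ring_hom_add[OF cl_hom, of p q] ring_hom_one[OF cl_hom] by simp_all

lemma cl_zero: "\<zero>\<^bsub>SA\<^esub> = cl 0"
proof -
  interpret I: ideal SI PR by (rule ideal_SI)
  have "SI = cl 0"
    using I.a_rcos_const[of 0] additive_subgroup.zero_closed[OF ideal.axioms(1)[OF ideal_SI]] by simp
  then show ?thesis
    by (simp add: SA_eq FactRing_def)
qed

lemma carrier_SA: "carrier SA = range cl"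
  unfolding SA_eq FactRing_def A_RCOSETS_def' by auto

lemma cl_eq_iff: "cl p = cl q \<longleftrightarrow> rho p = rho q"
proof -
  have cl: "cl q = {p. rho p = rho q}" for q
  proof -
    have "p \<in> cl q \<longleftrightarrow> (\<exists>h\<in>SI. p = h + q)" for p
      by (simp add: a_r_coset_def')
    also have "(\<exists>h\<in>SI. p = h + q) \<longleftrightarrow> p - q \<in> SI" for p
      by (auto intro!: bexI[of _ "p - q"])
    finally show ?thesis
      by (auto simp: SI_iff rho.evp_minus)
  qed
  show ?thesis
    unfolding cl by auto
qed

text \<open>\<open>big_frac p q\<close> is the fraction \<open>p / q\<close> in the big field; \<open>KH_frac p q\<close> is its counterpart in \<open>K\<^sub>H\<close>.\<close>

definition big_frac :: "('k, 'h) poly_in \<Rightarrow> ('k, 'h) poly_in \<Rightarrow> (('h lcopy \<Rightarrow>\<^sub>0 nat) \<Rightarrow>\<^sub>0 'k) fract" where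
  "big_frac p q = Fract (rho p) (rho q)"

definition KH_frac :: "('k, 'h) poly_in \<Rightarrow> ('k, 'h) poly_in \<Rightarrow> ('k, 'h) sym_frac" where
  "KH_frac p q = fraction SA (cl p) (cl q)"

lemma cl_nonzero: "cl q \<noteq> \<zero>\<^bsub>SA\<^esub> \<longleftrightarrow> rho q \<noteq> 0"
  using cl_eq_iff[of q 0] by (simp add: cl_zero rho.evp_zero)

lemma mem_KH_frac: "(cl r, cl s) \<in> KH_frac p q \<longleftrightarrow> rho s \<noteq> 0 \<and> rho p * rho s = rho r * rho q"
  by (simp add: KH_frac_def fraction_def carrier_SA cl_nonzero cl_simps cl_eq_iff rho.evp_mult)

lemma KH_frac_elim:
  assumes "(a, b) \<in> KH_frac p q"
  obtains r s where "a = cl r" "b = cl s" "rho s \<noteq> 0" "rho p * rho s = rho r * rho q"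
proof -
  have "a \<in> carrier SA" "b \<in> carrier SA"
    using assms by (auto simp: KH_frac_def fraction_def)
  then obtain r s where "a = cl r" "b = cl s"
    by (auto simp: carrier_SA)
  then show thesis
    using assms that mem_KH_frac by blast
qed

lemma KH_frac_eq_iff:
  assumes "rho q \<noteq> 0" "rho s \<noteq> 0"
  shows "KH_frac p q = KH_frac r s \<longleftrightarrow> big_frac p q = big_frac r s"
proof
  assume "KH_frac p q = KH_frac r s"
  moreover have "(cl p, cl q) \<in> KH_frac p q"
    using assms by (simp add: mem_KH_frac)
  ultimately have "(cl p, cl q) \<in> KH_frac r s"
    by simp
  then show "big_frac p q = big_frac r s"
    using assms by (simp add: mem_KH_frac big_frac_def eq_fract mult.commute)
next
  assume "big_frac p q = big_frac r s"
  then have e: "rho p * rho s = rho r * rho q"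
    using assms by (simp add: big_frac_def eq_fract)
  have "(a, b) \<in> KH_frac p q \<longleftrightarrow> (a, b) \<in> KH_frac r s" if aS: "a \<in> carrier SA" and bS: "b \<in> carrier SA" for a b
  proof -
    obtain u v where uv: "a = cl u" "b = cl v"
      using aS bS unfolding carrier_SA by blast
    have "rho p * rho v = rho u * rho q \<longleftrightarrow> rho r * rho v = rho u * rho s"
    proof -
      have "rho p * rho v = rho u * rho q \<longleftrightarrow> (rho p * rho v) * rho s = (rho u * rho q) * rho s"
        using assms(2) by simp
      also have "(rho p * rho v) * rho s = (rho r * rho v) * rho q"
      proof -
        have "(rho p * rho v) * rho s = (rho p * rho s) * rho v"
          by (simp only: ac_simps)
        also have "\<dots> = (rho r * rho v) * rho q"
          unfolding e by (simp only: ac_simps)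
        finally show ?thesis .
      qed
      also have "(rho u * rho q) * rho s = (rho u * rho s) * rho q"
        by (simp add: ac_simps)
      also have "(rho r * rho v) * rho q = (rho u * rho s) * rho q \<longleftrightarrow> rho r * rho v = rho u * rho s"
        using assms(1) by simp
      finally show ?thesis .
    qed
    then show ?thesis
      unfolding uv mem_KH_frac by simp
  qed
  moreover have "KH_frac p q \<subseteq> carrier SA \<times> carrier SA" "KH_frac r s \<subseteq> carrier SA \<times> carrier SA"
    by (auto simp: KH_frac_def fraction_def)
  ultimately show "KH_frac p q = KH_frac r s"
    by blast
qed

lemma carrier_KK: "carrier KK = {KH_frac p q | p q. rho q \<noteq> 0}"
proof -
  have "carrier KK = {fraction SA a s | a s. a \<in> carrier SA \<and> s \<in> carrier SA - {\<zero>\<^bsub>SA\<^esub>}}"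
    by (simp add: KH_def fraction_field_def)
  also have "\<dots> = {KH_frac p q | p q. rho q \<noteq> 0}"
  proof (intro equalityI subsetI)
    fix x assume "x \<in> {fraction SA a s | a s. a \<in> carrier SA \<and> s \<in> carrier SA - {\<zero>\<^bsub>SA\<^esub>}}"
    then obtain a s where as: "x = fraction SA a s" "a \<in> carrier SA" "s \<in> carrier SA" "s \<noteq> \<zero>\<^bsub>SA\<^esub>"
      by blast
    then obtain p q where "a = cl p" "s = cl q"
      unfolding carrier_SA by blast
    then show "x \<in> {KH_frac p q | p q. rho q \<noteq> 0}"
      using as(1,4) cl_nonzero[of q] unfolding KH_frac_def by blast
  next
    fix x assume "x \<in> {KH_frac p q | p q. rho q \<noteq> 0}"
    then obtain p q where "x = fraction SA (cl p) (cl q)" "rho q \<noteq> 0"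
      unfolding KH_frac_def by blast
    then show "x \<in> {fraction SA a s | a s. a \<in> carrier SA \<and> s \<in> carrier SA - {\<zero>\<^bsub>SA\<^esub>}}"
      using cl_nonzero[of q] unfolding carrier_SA by blast
  qed
  finally show ?thesis .
qed

lemma KH_frac_closed: "rho q \<noteq> 0 \<Longrightarrow> KH_frac p q \<in> carrier KK"
  unfolding carrier_KK by blast

text \<open>The operations of \<open>fraction_field\<close> are unions over all pairs of
  representatives. By \<open>cong\<close>, verified in the big field, all members of the union are
  one and the same fraction; the union is nonempty because a fraction contains its own numerator and
  denominator.\<close>

lemma KH_frac_op:
  assumes q: "rho q \<noteq> 0" and s: "rho s \<noteq> 0"
    and num: "\<And>a b c d. G (cl a) (cl b) (cl c) (cl d) = cl (g a b c d)"
    and cong: "\<And>a b c d. rho b \<noteq> 0 \<Longrightarrow> rho d \<noteq> 0 \<Longrightarrow> big_frac a b = big_frac p q \<Longrightarrow> big_frac c d = big_frac r s \<Longrightarrow>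
      big_frac (g a b c d) (b * d) = big_frac (g p q r s) (q * s)"
  shows "(\<Union>(a, b)\<in>KH_frac p q. \<Union>(c, d)\<in>KH_frac r s. fraction SA (G a b c d) (b \<otimes>\<^bsub>SA\<^esub> d)) = KH_frac (g p q r s) (q * s)"
proof -
  have eq: "fraction SA (G a b c d) (b \<otimes>\<^bsub>SA\<^esub> d) = KH_frac (g p q r s) (q * s)"
    if ab: "(a, b) \<in> KH_frac p q" and cd: "(c, d) \<in> KH_frac r s" for a b c d
  proof -
    obtain a' b' where ab': "a = cl a'" "b = cl b'" "rho b' \<noteq> 0" "rho p * rho b' = rho a' * rho q"
      using ab by (rule KH_frac_elim)
    obtain c' d' where cd': "c = cl c'" "d = cl d'" "rho d' \<noteq> 0" "rho r * rho d' = rho c' * rho s"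
      using cd by (rule KH_frac_elim)
    have "big_frac a' b' = big_frac p q" "big_frac c' d' = big_frac r s"
      using ab' cd' q s by (simp_all add: big_frac_def eq_fract)
    from cong[OF ab'(3) cd'(3) this] show ?thesis
      unfolding ab' cd' num cl_simps KH_frac_def[symmetric] using q s ab'(3) cd'(3)
      by (subst KH_frac_eq_iff) (simp_all add: rho.evp_mult)
  qed
  have "(cl p, cl q) \<in> KH_frac p q" "(cl r, cl s) \<in> KH_frac r s"
    using q s by (simp_all add: mem_KH_frac)
  note m = this
  show ?thesis
  proof (intro equalityI subsetI)
    fix x assume "x \<in> (\<Union>(a, b)\<in>KH_frac p q. \<Union>(c, d)\<in>KH_frac r s. fraction SA (G a b c d) (b \<otimes>\<^bsub>SA\<^esub> d))"
    then obtain a b c d where "(a, b) \<in> KH_frac p q" "(c, d) \<in> KH_frac r s" "x \<in> fraction SA (G a b c d) (b \<otimes>\<^bsub>SA\<^esub> d)"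
      by blast
    then show "x \<in> KH_frac (g p q r s) (q * s)"
      using eq[of a b c d] by simp
  next
    fix x assume "x \<in> KH_frac (g p q r s) (q * s)"
    then have "x \<in> fraction SA (G (cl p) (cl q) (cl r) (cl s)) (cl q \<otimes>\<^bsub>SA\<^esub> cl s)"
      using eq[OF m] by simp
    then show "x \<in> (\<Union>(a, b)\<in>KH_frac p q. \<Union>(c, d)\<in>KH_frac r s. fraction SA (G a b c d) (b \<otimes>\<^bsub>SA\<^esub> d))"
      using m by blast
  qed
qed

lemma KK_mult:
  assumes "rho q \<noteq> 0" "rho s \<noteq> 0"
  shows "KH_frac p q \<otimes>\<^bsub>KK\<^esub> KH_frac r s = KH_frac (p * r) (q * s)"
proof -
  have "KH_frac p q \<otimes>\<^bsub>KK\<^esub> KH_frac r s = (\<Union>(a, b)\<in>KH_frac p q. \<Union>(c, d)\<in>KH_frac r s. fraction SA (a \<otimes>\<^bsub>SA\<^esub> c) (b \<otimes>\<^bsub>SA\<^esub> d))"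
    by (simp add: KH_def fraction_field_def)
  also have "\<dots> = KH_frac (p * r) (q * s)"
    by (rule KH_frac_op[where G = "\<lambda>a b c d. a \<otimes>\<^bsub>SA\<^esub> c" and g = "\<lambda>a b c d. a * c", OF assms])
      (simp_all only: cl_simps big_frac_def rho.evp_mult mult_fract[symmetric])
  finally show ?thesis .
qed

lemma KK_add:
  assumes "rho q \<noteq> 0" "rho s \<noteq> 0"
  shows "KH_frac p q \<oplus>\<^bsub>KK\<^esub> KH_frac r s = KH_frac (p * s + r * q) (q * s)"
proof -
  have "KH_frac p q \<oplus>\<^bsub>KK\<^esub> KH_frac r s = (\<Union>(a, b)\<in>KH_frac p q. \<Union>(c, d)\<in>KH_frac r s.
      fraction SA ((a \<otimes>\<^bsub>SA\<^esub> d) \<oplus>\<^bsub>SA\<^esub> (c \<otimes>\<^bsub>SA\<^esub> b)) (b \<otimes>\<^bsub>SA\<^esub> d))"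
    by (simp add: KH_def fraction_field_def)
  also have "\<dots> = KH_frac (p * s + r * q) (q * s)"
  proof (rule KH_frac_op[where G = "\<lambda>a b c d. (a \<otimes>\<^bsub>SA\<^esub> d) \<oplus>\<^bsub>SA\<^esub> (c \<otimes>\<^bsub>SA\<^esub> b)" and g = "\<lambda>a b c d. a * d + c * b", OF assms])
    fix a b c d assume "rho b \<noteq> 0" "rho d \<noteq> 0" "big_frac a b = big_frac p q" "big_frac c d = big_frac r s"
    moreover have "big_frac (a * d + c * b) (b * d) = big_frac a b + big_frac c d" if "rho b \<noteq> 0" "rho d \<noteq> 0" for a b c d
      using that by (simp add: big_frac_def rho.evp_add rho.evp_mult)
    ultimately show "big_frac (a * d + c * b) (b * d) = big_frac (p * s + r * q) (q * s)"
      using assms by simp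
  qed (simp only: cl_simps)
  finally show ?thesis .
qed

text \<open>The inclusion of \<open>K\<^sub>H\<close> in the big field. It is well defined and
  injective by \<open>KH_frac_eq_iff\<close>.\<close>

definition frac_embed :: "('k, 'h) sym_frac \<Rightarrow> (('h lcopy \<Rightarrow>\<^sub>0 nat) \<Rightarrow>\<^sub>0 'k) fract" where
  "frac_embed z = (THE w. \<exists>p q. rho q \<noteq> 0 \<and> z = KH_frac p q \<and> w = big_frac p q)"

lemma frac_embed_KH_frac:
  assumes "rho q \<noteq> 0" shows "frac_embed (KH_frac p q) = big_frac p q"
  unfolding frac_embed_def by (rule the_equality) (use assms KH_frac_eq_iff in blast)+

lemma KK_cases:
  assumes "z \<in> carrier KK" obtains p q where "rho q \<noteq> 0" "z = KH_frac p q" "frac_embed z = big_frac p q"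
proof -
  obtain p q where "rho q \<noteq> 0" "z = KH_frac p q"
    using assms unfolding carrier_KK by blast
  then show thesis
    using that frac_embed_KH_frac by blast
qed

lemma frac_embed_inj:
  assumes z: "z \<in> carrier KK" and w: "w \<in> carrier KK" and eq: "frac_embed z = frac_embed w"
  shows "z = w"
proof -
  obtain p q where pq: "rho q \<noteq> 0" "z = KH_frac p q" "frac_embed z = big_frac p q"
    using z by (rule KK_cases)
  obtain r s where rs: "rho s \<noteq> 0" "w = KH_frac r s" "frac_embed w = big_frac r s"
    using w by (rule KK_cases)
  show ?thesis
    using KH_frac_eq_iff[OF pq(1) rs(1), of p r] pq rs eq by metis
qed

lemma rho_one: "rho 1 = 1"
  by (rule rho.evp_one)

lemma KK_one: "\<one>\<^bsub>KK\<^esub> = KH_frac 1 1"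
  by (simp add: KH_def fraction_field_def KH_frac_def cl_simps)

lemma KK_zero: "\<zero>\<^bsub>KK\<^esub> = KH_frac 0 1"
  by (simp add: KH_def fraction_field_def KH_frac_def cl_simps cl_zero)

lemma KK_mult_frac_embed:
  assumes z: "z \<in> carrier KK" and w: "w \<in> carrier KK"
  shows "z \<otimes>\<^bsub>KK\<^esub> w \<in> carrier KK" "frac_embed (z \<otimes>\<^bsub>KK\<^esub> w) = frac_embed z * frac_embed w"
    "z \<oplus>\<^bsub>KK\<^esub> w \<in> carrier KK" "frac_embed (z \<oplus>\<^bsub>KK\<^esub> w) = frac_embed z + frac_embed w"
proof -
  obtain p q where pq: "rho q \<noteq> 0" "z = KH_frac p q" "frac_embed z = big_frac p q"
    using z by (rule KK_cases)
  obtain r s where rs: "rho s \<noteq> 0" "w = KH_frac r s" "frac_embed w = big_frac r s"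
    using w by (rule KK_cases)
  have qs: "rho (q * s) \<noteq> 0"
    using pq(1) rs(1) by (simp add: rho.evp_mult)
  have m: "z \<otimes>\<^bsub>KK\<^esub> w = KH_frac (p * r) (q * s)" and a: "z \<oplus>\<^bsub>KK\<^esub> w = KH_frac (p * s + r * q) (q * s)"
    unfolding pq(2) rs(2) by (rule KK_mult[OF pq(1) rs(1)] KK_add[OF pq(1) rs(1)])+
  show "z \<otimes>\<^bsub>KK\<^esub> w \<in> carrier KK" "z \<oplus>\<^bsub>KK\<^esub> w \<in> carrier KK"
    unfolding m a by (rule KH_frac_closed[OF qs])+
  show "frac_embed (z \<otimes>\<^bsub>KK\<^esub> w) = frac_embed z * frac_embed w"
    unfolding m frac_embed_KH_frac[OF qs] pq(3) rs(3) by (simp add: big_frac_def rho.evp_mult)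
  show "frac_embed (z \<oplus>\<^bsub>KK\<^esub> w) = frac_embed z + frac_embed w"
    unfolding a frac_embed_KH_frac[OF qs] pq(3) rs(3) using pq(1) rs(1) by (simp add: big_frac_def rho.evp_mult rho.evp_add)
qed

lemma KK_consts: "\<one>\<^bsub>KK\<^esub> \<in> carrier KK" "\<zero>\<^bsub>KK\<^esub> \<in> carrier KK" "frac_embed \<one>\<^bsub>KK\<^esub> = 1" "frac_embed \<zero>\<^bsub>KK\<^esub> = 0"
proof -
  have nz: "rho 1 \<noteq> 0"
    unfolding rho_one by simp
  show "\<one>\<^bsub>KK\<^esub> \<in> carrier KK" "\<zero>\<^bsub>KK\<^esub> \<in> carrier KK"
    unfolding KK_one KK_zero by (rule KH_frac_closed[OF nz])+
  show "frac_embed \<one>\<^bsub>KK\<^esub> = 1"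
    unfolding KK_one frac_embed_KH_frac[OF nz] by (simp add: big_frac_def rho_one One_fract_def)
  show "frac_embed \<zero>\<^bsub>KK\<^esub> = 0"
    unfolding KK_zero frac_embed_KH_frac[OF nz] by (simp add: big_frac_def rho_one rho.evp_zero Zero_fract_def)
qed

lemmas KK_closed = KK_mult_frac_embed(1,3) KK_consts(1,2)
lemmas frac_embed_simps = KK_mult_frac_embed(2,4) KK_consts(3,4)

text \<open>The ring laws are pulled back along the injection \<open>frac_embed\<close>, which
  respects addition and multiplication; negatives are given by negating numerators.\<close>

lemma cring_KK: "cring KK"
proof (rule cringI)
  show "abelian_group KK"
  proof (rule abelian_groupI)
    fix z assume z: "z \<in> carrier KK"
    then obtain p q where pq: "rho q \<noteq> 0" "z = KH_frac p q"
      by (rule KK_cases)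
    show "\<exists>w\<in>carrier KK. w \<oplus>\<^bsub>KK\<^esub> z = \<zero>\<^bsub>KK\<^esub>"
    proof
      show c: "KH_frac (- p) q \<in> carrier KK"
        by (rule KH_frac_closed[OF pq(1)])
      have "rho (- p) = - rho p"
        using rho.evp_minus[of 0 p] by (simp add: rho.evp_zero)
      then have "frac_embed (KH_frac (- p) q) + frac_embed z = 0"
        using pq by (simp add: frac_embed_KH_frac big_frac_def eq_fract Zero_fract_def)
      then show "KH_frac (- p) q \<oplus>\<^bsub>KK\<^esub> z = \<zero>\<^bsub>KK\<^esub>"
        by (intro frac_embed_inj KK_closed c z) (simp add: frac_embed_simps c z)
    qed
  qed (simp_all add: KK_closed, (rule frac_embed_inj; simp add: frac_embed_simps KK_closed ac_simps)+)
  show "Group.comm_monoid KK"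
    by (rule comm_monoidI) (simp_all add: KK_closed, (rule frac_embed_inj; simp add: frac_embed_simps KK_closed ac_simps)+)
qed (rule frac_embed_inj; simp add: frac_embed_simps KK_closed distrib_right)

lemma KH_of_poly_KH_frac: "KH_of_poly scale p = KH_frac p 1"
  by (simp add: KH_of_poly_def KH_frac_def cl_simps)

lemma frac_embed_of_poly: "KH_of_poly scale p \<in> carrier KK" "frac_embed (KH_of_poly scale p) = Fract (rho p) 1"
  unfolding KH_of_poly_KH_frac by (simp_all add: KH_frac_closed rho_one frac_embed_KH_frac) (simp add: big_frac_def rho_one)

end

section \<open>Convolution inverses of linear maps\<close>

context hopf_algebra
begin

interpretation k: hopf_field scale \<Delta> \<epsilon> "id :: 'k \<Rightarrow> 'k"
  by unfold_locales (rule ring_hom_memI; simp)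

lemma coideal_basis_left_coideal:
  assumes s: "coideal_basis n v d"
  shows "left_coideal (v ` {..<n})"
  unfolding left_coideal_def
proof (intro conjI ballI)
  have inj: "inj_on v {..<n}"
    using s by (simp add: coideal_basis_def)
  fix g assume "g \<in> v ` {..<n}"
  then obtain i where i: "i < n" "g = v i"
    by auto
  show "\<exists>d. \<forall>f. k.bilin f \<longrightarrow> SS f g = (\<Sum>g'\<in>v ` {..<n}. f (d g') g')"
  proof (intro exI allI impI)
    fix f assume f: "k.bilin f"
    have "SS f g = (\<Sum>j<n. f (d i j) (v j))"
      unfolding i(2) by (rule coideal_basis_v[OF s i(1) f])
    also have "\<dots> = (\<Sum>j<n. f (d i (inv_into {..<n} v (v j))) (v j))"
      by (rule sum.cong[OF refl]) (simp add: inv_into_f_f[OF inj])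
    also have "\<dots> = (\<Sum>g'\<in>v ` {..<n}. f (d i (inv_into {..<n} v g')) g')"
      by (simp add: sum.reindex[OF inj])
    finally show "SS f g = (\<Sum>g'\<in>v ` {..<n}. f (d i (inv_into {..<n} v g')) g')" .
  qed
qed simp

text \<open>Coideals form a directed family, since the union of two spans a coideal again; this is
  what allows local solutions to be compared.\<close>

lemma coideal_basis_join:
  assumes "coideal_basis n v d" "coideal_basis n' v' d'"
  shows "\<exists>n'' v'' d''. coideal_basis n'' v'' d'' \<and> v ` {..<n} \<subseteq> span (v'' ` {..<n''}) \<and> v' ` {..<n'} \<subseteq> span (v'' ` {..<n''})"
  using left_coideal_coideal_basis[OF left_coideal_Un[OF coideal_basis_left_coideal[OF assms(1)] coideal_basis_left_coideal[OF assms(2)]]] by (metis Un_subset_iff)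

end

context hopf_field
begin

lemma lin_eq_on_span:
  assumes "lin g" "lin h" "x \<in> span S" "\<And>s. s \<in> S \<Longrightarrow> g s = h s"
  shows "g x = h x"
  using assms(3)
proof (induction rule: span_induct_alt)
  case base
  show ?case
    by (simp add: lin_zero assms(1,2))
next
  case (step c s y)
  then show ?case
    by (simp add: linD[OF assms(1)] linD[OF assms(2)] assms(4))
qed

text \<open>The computation g = g * (T * g') = (g * T) * g' = g' for convolution, with the counit
  axioms at both ends and coassociativity in the middle.\<close>

lemma conv_unique:
  assumes T: "lin T" and g: "lin g" "lin g'"
    and l: "\<And>x. SS (\<lambda>p q. g p * T q) x = \<iota> (\<epsilon> x)" and r: "\<And>x. SS (\<lambda>p q. T p * g' q) x = \<iota> (\<epsilon> x)"
  shows "g x = g' x"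
proof -
  have "g x = SS (\<lambda>p q. \<iota> (\<epsilon> q) * g p) x"
    by (rule SS_counit_right[OF g(1), symmetric])
  also have "\<dots> = SS (\<lambda>p q. SS (\<lambda>r s. g p * T r * g' s) q) x"
    unfolding r[symmetric] SS_times by (simp only: ac_simps)
  also have "\<dots> = SS (\<lambda>p q. SS (\<lambda>r s. g r * T s * g' q) p) x"
    by (rule SS_coassoc[where f = "\<lambda>p q r. g p * T q * g' r", symmetric]) (intro lin_times T g)+
  also have "\<dots> = SS (\<lambda>p q. \<iota> (\<epsilon> p) * g' q) x"
    unfolding l[symmetric] SS_times by (rule refl)
  also have "\<dots> = g' x"
    by (rule SS_counit_left[OF g(2)])
  finally show ?thesis .
qed

text \<open>A right convolution inverse of T on the coideal spanned by the v; outside this span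
  \<open>g\<close> is any linear extension.\<close>

definition solves :: "('h \<Rightarrow> 'f) \<Rightarrow> nat \<Rightarrow> (nat \<Rightarrow> 'h) \<Rightarrow> ('h \<Rightarrow> 'f) \<Rightarrow> bool" where
  "solves T n v g \<longleftrightarrow> lin g \<and> (\<forall>m<n. SS (\<lambda>p q. T p * g q) (v m) = \<iota> (\<epsilon> (v m)))"

definition inv_mat :: "('h \<Rightarrow> 'f) \<Rightarrow> nat \<Rightarrow> (nat \<Rightarrow> nat \<Rightarrow> 'h) \<Rightarrow> (nat \<Rightarrow> nat \<Rightarrow> 'f) \<Rightarrow> bool" where
  "inv_mat T n d M \<longleftrightarrow> (\<forall>i<n. \<forall>j<n. (\<Sum>l<n. T (d i l) * M l j) = (if i = j then 1 else 0)) \<and>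
    (\<forall>i<n. \<forall>j<n. (\<Sum>l<n. M i l * T (d l j)) = (if i = j then 1 else 0))"

lemma sum_delta:
  fixes i n :: nat
  shows "i < n \<Longrightarrow> (\<Sum>j<n. (if i = j then 1 else 0) * w j) = (w i :: 'f)"
  "i < n \<Longrightarrow> (\<Sum>j<n. w j * (if j = i then 1 else 0)) = (w i :: 'f)"
proof -
  have "(\<Sum>j<n. (if i = j then 1 else 0) * w j) = (\<Sum>j<n. if i = j then w j else 0)"
    by (rule sum.cong) auto
  then show "i < n \<Longrightarrow> (\<Sum>j<n. (if i = j then 1 else 0) * w j) = w i"
    by simp
  have "(\<Sum>j<n. w j * (if j = i then 1 else 0)) = (\<Sum>j<n. if j = i then w j else 0)"
    by (rule sum.cong) auto
  then show "i < n \<Longrightarrow> (\<Sum>j<n. w j * (if j = i then 1 else 0)) = w i"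
    by simp
qed

lemma solve_matrix:
  assumes "inv_mat T n d M" and eq: "\<And>m. m < n \<Longrightarrow> (\<Sum>j<n. T (d m j) * x j) = y m" and i: "i < n"
  shows "x i = (\<Sum>m<n. M i m * y m)"
proof -
  have "(\<Sum>m<n. M i m * y m) = (\<Sum>m<n. \<Sum>j<n. M i m * T (d m j) * x j)"
    by (rule sum.cong[OF refl]) (simp add: eq[symmetric] sum_distrib_left mult.assoc)
  also have "\<dots> = (\<Sum>j<n. \<Sum>m<n. M i m * T (d m j) * x j)"
    by (rule sum.swap)
  also have "\<dots> = (\<Sum>j<n. (\<Sum>m<n. M i m * T (d m j)) * x j)"
    by (simp only: sum_distrib_right)
  also have "\<dots> = (\<Sum>j<n. (if i = j then 1 else 0) * x j)"
    by (rule sum.cong[OF refl]) (use assms(1) i in \<open>simp add: inv_mat_def\<close>)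
  also have "\<dots> = x i"
    by (rule sum_delta(1)[OF i])
  finally show ?thesis ..
qed

lemma bilin_prod: "lin f \<Longrightarrow> lin g \<Longrightarrow> bilin (\<lambda>p q. f p * g q)"
  by (rule bilinI) (rule lin_times, assumption)+

text \<open>The coideal relation keeps the second factors among the v, so the equations close up: a
  square linear system with matrix T(d m j) in the unknowns g(v j).\<close>

lemma solves_coideal_basis:
  assumes T: "lin T" and s: "coideal_basis n v d" and g: "lin g"
  shows "solves T n v g \<longleftrightarrow> (\<forall>m<n. (\<Sum>j<n. T (d m j) * g (v j)) = \<iota> (\<epsilon> (v m)))"
  using coideal_basis_SS_v[OF s _ bilin_prod[OF T g]] g by (simp add: solves_def)

lemma solves_unique:
  assumes T: "lin T" and s: "coideal_basis n v d" and M: "inv_mat T n d M" and g: "solves T n v g"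
    and i: "i < n"
  shows "g (v i) = (\<Sum>m<n. M i m * \<iota> (\<epsilon> (v m)))"
proof (rule solve_matrix[OF M _ i])
  have "lin g"
    using g by (simp add: solves_def)
  then show "(\<Sum>j<n. T (d m j) * g (v j)) = \<iota> (\<epsilon> (v m))" if "m < n" for m
    using solves_coideal_basis[OF T s] g that by blast
qed

text \<open>The inverse matrix determines the values \<open>w\<close> at the basis vectors; the dual
  functionals extend them to a linear map on all of H.\<close>

lemma solves_exists:
  assumes T: "lin T" and s: "coideal_basis n v d" and M: "inv_mat T n d M"
  shows "\<exists>g. solves T n v g"
proof -
  have "\<forall>m. \<exists>\<eta>. m < n \<longrightarrow> hopf_field.lin scale (id :: 'k \<Rightarrow> 'k) \<eta> \<and> (\<forall>j<n. \<eta> (v j) = (if j = m then 1 else 0))"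
    using coideal_basis_coord[OF s] by metis
  then obtain \<eta> where \<eta>: "\<And>m. m < n \<Longrightarrow> hopf_field.lin scale (id :: 'k \<Rightarrow> 'k) (\<eta> m)"
    "\<And>m j. m < n \<Longrightarrow> j < n \<Longrightarrow> \<eta> m (v j) = (if j = m then 1 else (0::'k))"
    by metis
  interpret k: hopf_field scale \<Delta> \<epsilon> "id :: 'k \<Rightarrow> 'k"
    by unfold_locales (rule ring_hom_memI; simp)
  define w where "w i = (\<Sum>m<n. M i m * \<iota> (\<epsilon> (v m)))" for i
  define g where "g x = (\<Sum>i<n. \<iota> (\<eta> i x) * w i)" for x
  have g: "lin g"
    unfolding g_def[abs_def]
  proof (intro lin_setsum lin_times(2) linI)
    show "\<iota> (\<eta> i (x + y)) = \<iota> (\<eta> i x) + \<iota> (\<eta> i y)" if "i \<in> {..<n}" for i x y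
      using k.linD(1)[OF \<eta>(1)] that by simp
    show "\<iota> (\<eta> i (scale a x)) = \<iota> a * \<iota> (\<eta> i x)" if "i \<in> {..<n}" for i a x
      using k.linD(2)[OF \<eta>(1)] that by simp
  qed
  have gv: "g (v j) = w j" if j: "j < n" for j
  proof -
    have "g (v j) = (\<Sum>i<n. (if j = i then 1 else 0) * w i)"
      unfolding g_def by (rule sum.cong[OF refl]) (simp add: \<eta>(2)[OF _ j])
    then show ?thesis
      by (simp only: sum_delta(1)[OF j])
  qed
  have "(\<Sum>j<n. T (d m j) * g (v j)) = \<iota> (\<epsilon> (v m))" if m: "m < n" for m
  proof -
    have "(\<Sum>j<n. T (d m j) * g (v j)) = (\<Sum>j<n. \<Sum>l<n. T (d m j) * M j l * \<iota> (\<epsilon> (v l)))"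
      by (rule sum.cong[OF refl]) (simp add: gv w_def sum_distrib_left mult.assoc)
    also have "\<dots> = (\<Sum>l<n. \<Sum>j<n. T (d m j) * M j l * \<iota> (\<epsilon> (v l)))"
      by (rule sum.swap)
    also have "\<dots> = (\<Sum>l<n. (\<Sum>j<n. T (d m j) * M j l) * \<iota> (\<epsilon> (v l)))"
      by (simp only: sum_distrib_right)
    also have "\<dots> = (\<Sum>l<n. (if m = l then 1 else 0) * \<iota> (\<epsilon> (v l)))"
      by (rule sum.cong[OF refl]) (use M m in \<open>simp add: inv_mat_def\<close>)
    also have "\<dots> = \<iota> (\<epsilon> (v m))"
      by (rule sum_delta(1)[OF m])
    finally show ?thesis .
  qed
  then have "solves T n v g"
    using solves_coideal_basis[OF T s g] by blast
  then show ?thesis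
    by blast
qed

lemma solves_span:
  assumes T: "lin T" and g: "solves T n v g" and x: "x \<in> span (v ` {..<n})"
  shows "SS (\<lambda>p q. T p * g q) x = \<iota> (\<epsilon> x)"
proof (rule lin_eq_on_span[OF _ _ x])
  show "lin (SS (\<lambda>p q. T p * g q))"
    using g T by (intro SS_lin bilin_prod) (simp_all add: solves_def)
  show "lin (\<lambda>x. \<iota> (\<epsilon> x))"
    by (rule lin_\<epsilon>)
qed (use g in \<open>auto simp: solves_def\<close>)

text \<open>On each coideal the values of a right inverse are the unique solution of a linear
  system, and any two coideals lie in a third, so the local solutions glue. The set V keeps track of
  where the values lie: they are combinations, with coefficients from k, of entries of the inverse
  matrices. It is later the local ring of a point.\<close>

theorem conv_inverse_exists:
  assumes T: "lin T"
    and M: "\<And>n v d. coideal_basis n v d \<Longrightarrow> \<exists>M. inv_mat T n d M \<and> (\<forall>i j. M i j \<in> V)"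
    and V: "\<And>x y. x \<in> V \<Longrightarrow> y \<in> V \<Longrightarrow> x + y \<in> V" "\<And>x y. x \<in> V \<Longrightarrow> y \<in> V \<Longrightarrow> x * y \<in> V" "\<And>a. \<iota> a \<in> V"
  shows "\<exists>g. lin g \<and> (\<forall>x. SS (\<lambda>p q. T p * g q) x = \<iota> (\<epsilon> x)) \<and> (\<forall>x. SS (\<lambda>p q. g p * T q) x = \<iota> (\<epsilon> x)) \<and>
    (\<forall>x. g x \<in> V)"
proof -
  \<comment> \<open>z is the value at x of a solution on some coideal containing x;
    \<open>agree\<close> and \<open>unique\<close> show that z is determined by x.\<close>
  define good where "good x z \<longleftrightarrow> (\<exists>n v d g. coideal_basis n v d \<and> x \<in> span (v ` {..<n}) \<and> solves T n v g \<and> z = g x)" for x z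
  have agree: "g x = g' x"
    if s: "coideal_basis n v d" and s': "coideal_basis n' v' d'" and sub: "v ` {..<n} \<subseteq> span (v' ` {..<n'})"
      and g: "solves T n v g" and g': "solves T n' v' g'" and x: "x \<in> span (v ` {..<n})"
    for n v d n' v' d' g g' x
  proof (rule lin_eq_on_span[OF _ _ x])
    show "lin g" "lin g'"
      using g g' by (simp_all add: solves_def)
    obtain M where M': "inv_mat T n d M"
      using M[OF s] by blast
    \<comment> \<open>A solution on the larger coideal restricts to one on the smaller, and there
      solutions are unique.\<close>
    have "solves T n v g'"
      unfolding solves_def using \<open>lin g'\<close> solves_span[OF T g'] sub by auto
    then show "g y = g' y" if "y \<in> v ` {..<n}" for y
      using that solves_unique[OF T s M' g] solves_unique[OF T s M', of g'] by auto
  qed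
  have unique: "z = z'" if "good x z" "good x z'" for x z z'
  proof -
    obtain n v d g where 1: "coideal_basis n v d" "x \<in> span (v ` {..<n})" "solves T n v g" "z = g x"
      using \<open>good x z\<close> unfolding good_def by blast
    obtain n' v' d' g' where 2: "coideal_basis n' v' d'" "x \<in> span (v' ` {..<n'})" "solves T n' v' g'" "z' = g' x"
      using \<open>good x z'\<close> unfolding good_def by blast
    obtain n'' v'' d'' where 3: "coideal_basis n'' v'' d''" "v ` {..<n} \<subseteq> span (v'' ` {..<n''})" "v' ` {..<n'} \<subseteq> span (v'' ` {..<n''})"
      using coideal_basis_join[OF 1(1) 2(1)] by blast
    obtain M'' where "inv_mat T n'' d'' M''"
      using M[OF 3(1)] by blast
    then obtain g'' where "solves T n'' v'' g''"
      using solves_exists[OF T 3(1)] by blast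
    then show ?thesis
      unfolding 1(4) 2(4) using agree[OF 1(1) 3(1,2) 1(3) _ 1(2)] agree[OF 2(1) 3(1,3) 2(3) _ 2(2)] by metis
  qed
  have local: "\<exists>n v d g. coideal_basis n v d \<and> x \<in> span (v ` {..<n}) \<and> y \<in> span (v ` {..<n}) \<and> solves T n v g" for x y
    using ex_coideal_basis[of x y] M solves_exists[OF T] by metis
  define G where "G x = (THE z. good x z)" for x
  have G: "G x = g x" if "coideal_basis n v d" "x \<in> span (v ` {..<n})" "solves T n v g" for n v d g x
    unfolding G_def
  proof (rule the_equality)
    show "good x (g x)"
      using that unfolding good_def by blast
    then show "good x z \<Longrightarrow> z = g x" for z
      using unique by blast
  qed
  have linG: "lin G"
  proof (rule linI)
    show "G (x + y) = G x + G y" for x y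
    proof -
      obtain n v d g where s: "coideal_basis n v d" "x \<in> span (v ` {..<n})" "y \<in> span (v ` {..<n})" "solves T n v g"
        using local[of x y] by blast
      have "lin g"
        using s(4) by (simp add: solves_def)
      then show ?thesis
        unfolding G[OF s(1) s(2) s(4)] G[OF s(1) s(3) s(4)] G[OF s(1) span_add[OF s(2,3)] s(4)] by (rule linD)
    qed
    show "G (scale a x) = \<iota> a * G x" for a x
    proof -
      obtain n v d g where s: "coideal_basis n v d" "x \<in> span (v ` {..<n})" "solves T n v g"
        using local[of x x] by blast
      have "lin g"
        using s(3) by (simp add: solves_def)
      then show ?thesis
        unfolding G[OF s(1) s(2) s(3)] G[OF s(1) span_scale[OF s(2)] s(3)] by (rule linD)
    qed
  qed
  have solG: "solves T n v G" if s: "coideal_basis n v d" for n v d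
  proof -
    obtain M' where "inv_mat T n d M'"
      using M[OF s] by blast
    then obtain g where g: "solves T n v g"
      using solves_exists[OF T s] by blast
    have "lin g"
      using g by (simp add: solves_def)
    have e: "G (v j) = g (v j)" if "j < n" for j
      by (rule G[OF s _ g]) (use that in \<open>auto intro: span_base\<close>)
    show ?thesis
      unfolding solves_coideal_basis[OF T s linG] using g[unfolded solves_coideal_basis[OF T s \<open>lin g\<close>]] e by simp
  qed
  have TG: "SS (\<lambda>p q. T p * G q) x = \<iota> (\<epsilon> x)" for x
  proof -
    obtain n v d where s: "coideal_basis n v d" "x \<in> span (v ` {..<n})"
      using ex_coideal_basis[of x x] by blast
    show ?thesis
      by (rule solves_span[OF T solG[OF s(1)] s(2)])
  qed
  \<comment> \<open>Being a right inverse, G has on the matrix coefficients the values of the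
    inverse matrix: G(d i j) = M' i j. A matrix inverse is two-sided, which gives the left relation
    on the d, and the v are combinations of the d.\<close>
  have GT: "SS (\<lambda>p q. G p * T q) x = \<iota> (\<epsilon> x)" for x
  proof -
    obtain n v d where s: "coideal_basis n v d" "x \<in> span (v ` {..<n})"
      using ex_coideal_basis[of x x] by blast
    obtain M' where M': "inv_mat T n d M'"
      using M[OF s(1)] by blast
    have b: "bilin (\<lambda>p q. G p * T q)"
      by (rule bilin_prod[OF linG T])
    have Gd: "G (d i j) = M' i j" if i: "i < n" and j: "j < n" for i j
    proof -
      have "(\<Sum>l<n. T (d m l) * G (d l j)) = (if m = j then 1 else 0)" if m: "m < n" for m
        using TG[of "d m j"] coideal_basis_SS_d[OF s(1) m j bilin_prod[OF T linG]] coideal_basis_\<epsilon>[OF s(1) m j] by simp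
      from solve_matrix[OF M' this i] show ?thesis
        by (simp only: sum_delta(2)[OF j])
    qed
    have d: "SS (\<lambda>p q. G p * T q) (d i j) = (if i = j then 1 else 0)" if i: "i < n" and j: "j < n" for i j
    proof -
      have "SS (\<lambda>p q. G p * T q) (d i j) = (\<Sum>l<n. G (d i l) * T (d l j))"
        by (rule coideal_basis_SS_d[OF s(1) i j b])
      also have "\<dots> = (\<Sum>l<n. M' i l * T (d l j))"
        by (rule sum.cong[OF refl]) (simp add: Gd[OF i])
      finally show ?thesis
        using M' i j by (simp add: inv_mat_def)
    qed
    show ?thesis
    proof (rule lin_eq_on_span[OF SS_lin[OF b] lin_\<epsilon> s(2)])
      fix y assume "y \<in> v ` {..<n}"
      then obtain i where i: "i < n" "y = v i"
        by auto
      have "SS (\<lambda>p q. G p * T q) (v i) = (\<Sum>j<n. \<iota> (\<epsilon> (v j)) * SS (\<lambda>p q. G p * T q) (d i j))"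
        by (rule coideal_basis_v_expand[OF s(1) i(1) SS_lin[OF b]])
      also have "\<dots> = (\<Sum>j<n. \<iota> (\<epsilon> (v j)) * (if j = i then 1 else 0))"
        by (rule sum.cong[OF refl]) (auto simp: d[OF i(1)])
      also have "\<dots> = \<iota> (\<epsilon> (v i))"
        by (rule sum_delta(2)[OF i(1)])
      finally show "SS (\<lambda>p q. G p * T q) y = \<iota> (\<epsilon> y)"
        unfolding i(2) .
    qed
  qed
  have V0: "0 \<in> V"
    using V(3)[of 0] by simp
  have Vs: "sum u B \<in> V" if "\<And>b. b \<in> B \<Longrightarrow> u b \<in> V" for u and B :: "nat set"
    using that by (induction B rule: infinite_finite_induct) (auto intro: V(1) V0)
  have GV: "G x \<in> V" for x
  proof -
    obtain n v d where s: "coideal_basis n v d" "x \<in> span (v ` {..<n})"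
      using ex_coideal_basis[of x x] by blast
    obtain M' where M': "inv_mat T n d M'" "\<And>i j. M' i j \<in> V"
      using M[OF s(1)] by blast
    have Gv: "G (v i) \<in> V" if "i < n" for i
      unfolding solves_unique[OF T s(1) M'(1) solG[OF s(1)] that] by (intro Vs V(2) V(3) M'(2))
    show ?thesis
      using s(2)
    proof (induction rule: span_induct_alt)
      case base
      show ?case
        by (simp add: lin_zero[OF linG] V0)
    next
      case (step c y z)
      then show ?case
        using Gv by (auto simp: linD[OF linG] intro!: V)
    qed
  qed
  show ?thesis
    using linG TG GT GV by blast
qed

section \<open>Specialisation of the universal cocycle\<close>

text \<open>Evaluation passes through \<open>rho\<close> and so depends only on the class in the
  symmetric algebra. Variables of all elements of H receive a value, though only those of basis
  vectors occur in \<open>rho p\<close>.\<close>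

definition eval_at :: "('h \<Rightarrow> 'f) \<Rightarrow> ('k, 'h) poly_in \<Rightarrow> 'f" where
  "eval_at m p = poly_eval.evp \<iota> (\<lambda>w. m (of_lcopy w)) (rho p)"

lemma poly_eval_\<iota>: "poly_eval \<iota>"
  by unfold_locales simp_all

lemma eval_at_add: "eval_at m (p + q) = eval_at m p + eval_at m q"
  and eval_at_mult: "eval_at m (p * q) = eval_at m p * eval_at m q"
  and eval_at_one: "eval_at m 1 = 1" and eval_at_zero: "eval_at m 0 = 0"
  and eval_at_const: "eval_at m (poly_const a) = \<iota> a"
proof -
  interpret e: poly_eval \<iota> "\<lambda>w. m (of_lcopy w)"
    by (rule poly_eval_\<iota>)
  show "eval_at m (p + q) = eval_at m p + eval_at m q" "eval_at m (p * q) = eval_at m p * eval_at m q" "eval_at m 1 = 1" "eval_at m 0 = 0"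
    "eval_at m (poly_const a) = \<iota> a"
    unfolding eval_at_def rho_const by (simp_all add: rho.evp_add rho.evp_mult rho.evp_one rho.evp_zero
        e.evp_add e.evp_mult e.evp_one e.evp_zero e.evp_const)
qed

text \<open>\<open>rho\<close> expands the variable of h in the basis, and the evaluation sees m on
  basis vectors only; linearity of m reassembles m h.\<close>

lemma eval_at_var:
  assumes m: "lin m" shows "eval_at m (poly_var h) = m h"
proof -
  interpret e: poly_eval \<iota> "\<lambda>w. m (of_lcopy w)"
    by (rule poly_eval_\<iota>)
  have s0: "e.evp (sum g C) = (\<Sum>b\<in>C. e.evp (g b))" for g and C :: "'h set"
    by (induction C rule: infinite_finite_induct) (simp_all add: e.evp_zero e.evp_add)
  have Y: "e.evp (Yv b) = m b" for b
    unfolding Yv_def e.evp_var by (simp add: to_lcopy_inverse)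
  have "eval_at m (poly_var h) = (\<Sum>b\<in>supp h. \<iota> (co b h) * m b)"
    unfolding eval_at_def rho_var linear_form_def s0 e.evp_mult e.evp_const Y by (rule refl)
  also have "\<dots> = m (\<Sum>b\<in>supp h. scale (co b h) b)"
    by (simp add: lin_sum[OF m] linD(2)[OF m])
  also have "(\<Sum>b\<in>supp h. scale (co b h) b) = h"
    by (rule co_expand[OF finite_supp order_refl, symmetric])
  finally show ?thesis .
qed

lemma eval_at_cong: "rho p = rho q \<Longrightarrow> eval_at m p = eval_at m q"
  by (simp add: eval_at_def)

lemma eval_at_nz: "eval_at m q \<noteq> 0 \<Longrightarrow> rho q \<noteq> 0"
  using eval_at_cong[of q 0 m] by (auto simp: eval_at_zero rho.evp_zero)

text \<open>
  A linear map \<open>m\<close> is a point of the spectrum of \<open>S(t\<^sub>H)\<close>; \<open>local_ring m\<close> is the local ring of that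
  point inside \<open>K\<^sub>H\<close> and \<open>specialise m\<close> is the evaluation there.
\<close>

definition local_ring :: "('h \<Rightarrow> 'f) \<Rightarrow> ('k, 'h) sym_frac set" where
  "local_ring m = {KH_frac p q | p q. eval_at m q \<noteq> 0}"

definition specialise :: "('h \<Rightarrow> 'f) \<Rightarrow> ('k, 'h) sym_frac \<Rightarrow> 'f" where
  "specialise m z = (THE w. \<exists>p q. eval_at m q \<noteq> 0 \<and> z = KH_frac p q \<and> w = eval_at m p / eval_at m q)"

lemma locKI: "eval_at m q \<noteq> 0 \<Longrightarrow> KH_frac p q \<in> local_ring m"
  unfolding local_ring_def by blast

text \<open>Two presentations of a fraction become equal after cross-multiplication under
  \<open>rho\<close>, hence also under evaluation, where both denominators can be divided
  out.\<close>

lemma specialise_KH_frac: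
  assumes q: "eval_at m q \<noteq> 0"
  shows "specialise m (KH_frac p q) = eval_at m p / eval_at m q"
  unfolding specialise_def
proof (rule the_equality)
  show "\<exists>p' q'. eval_at m q' \<noteq> 0 \<and> KH_frac p q = KH_frac p' q' \<and> eval_at m p / eval_at m q = eval_at m p' / eval_at m q'"
    using q by blast
  fix w assume "\<exists>p' q'. eval_at m q' \<noteq> 0 \<and> KH_frac p q = KH_frac p' q' \<and> w = eval_at m p' / eval_at m q'"
  then obtain r s where rs: "eval_at m s \<noteq> 0" "KH_frac p q = KH_frac r s" "w = eval_at m r / eval_at m s"
    by blast
  have "big_frac p q = big_frac r s"
    using KH_frac_eq_iff[OF eval_at_nz[OF q] eval_at_nz[OF rs(1)]] rs(2) by simp
  then have "rho (p * s) = rho (r * q)"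
    using eval_at_nz[OF q] eval_at_nz[OF rs(1)] by (simp add: big_frac_def eq_fract rho.evp_mult)
  then have "eval_at m p * eval_at m s = eval_at m r * eval_at m q"
    using eval_at_cong[of "p * s" "r * q" m] by (simp only: eval_at_mult)
  then show "w = eval_at m p / eval_at m q"
    unfolding rs(3) using q rs(1) by (simp add: field_simps)
qed

lemma local_ring_cases:
  assumes "z \<in> local_ring m" obtains p q where "eval_at m q \<noteq> 0" "rho q \<noteq> 0" "z = KH_frac p q" "specialise m z = eval_at m p / eval_at m q"
proof -
  obtain p q where pq: "eval_at m q \<noteq> 0" "z = KH_frac p q"
    using assms unfolding local_ring_def by blast
  show thesis
    by (rule that[OF pq(1) eval_at_nz[OF pq(1)] pq(2)]) (simp only: pq(2) specialise_KH_frac[OF pq(1)])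
qed

lemma local_ring_carrier: "z \<in> local_ring m \<Longrightarrow> z \<in> carrier KK"
  by (erule local_ring_cases) (simp add: KH_frac_closed)

lemma local_ring_ops:
  assumes z: "z \<in> local_ring m" and w: "w \<in> local_ring m"
  shows "z \<otimes>\<^bsub>KK\<^esub> w \<in> local_ring m" "specialise m (z \<otimes>\<^bsub>KK\<^esub> w) = specialise m z * specialise m w"
    "z \<oplus>\<^bsub>KK\<^esub> w \<in> local_ring m" "specialise m (z \<oplus>\<^bsub>KK\<^esub> w) = specialise m z + specialise m w"
proof -
  obtain p q where pq: "eval_at m q \<noteq> 0" "rho q \<noteq> 0" "z = KH_frac p q" "specialise m z = eval_at m p / eval_at m q"
    using z by (rule local_ring_cases)
  obtain r s where rs: "eval_at m s \<noteq> 0" "rho s \<noteq> 0" "w = KH_frac r s" "specialise m w = eval_at m r / eval_at m s"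
    using w by (rule local_ring_cases)
  have qs: "eval_at m (q * s) \<noteq> 0"
    using pq(1) rs(1) by (simp add: eval_at_mult)
  have mm: "z \<otimes>\<^bsub>KK\<^esub> w = KH_frac (p * r) (q * s)" and aa: "z \<oplus>\<^bsub>KK\<^esub> w = KH_frac (p * s + r * q) (q * s)"
    unfolding pq(3) rs(3) by (rule KK_mult[OF pq(2) rs(2)] KK_add[OF pq(2) rs(2)])+
  show "z \<otimes>\<^bsub>KK\<^esub> w \<in> local_ring m" "z \<oplus>\<^bsub>KK\<^esub> w \<in> local_ring m"
    unfolding mm aa by (rule locKI[OF qs])+
  show "specialise m (z \<otimes>\<^bsub>KK\<^esub> w) = specialise m z * specialise m w"
    unfolding mm specialise_KH_frac[OF qs] pq(4) rs(4) by (simp add: eval_at_mult)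
  show "specialise m (z \<oplus>\<^bsub>KK\<^esub> w) = specialise m z + specialise m w"
    unfolding aa specialise_KH_frac[OF qs] pq(4) rs(4) using pq(1) rs(1) by (simp add: eval_at_mult eval_at_add field_simps)
qed

lemma local_ring_of_poly: "KH_of_poly scale p \<in> local_ring m" "specialise m (KH_of_poly scale p) = eval_at m p"
proof -
  have "eval_at m 1 \<noteq> 0"
    by (simp add: eval_at_one)
  then show "KH_of_poly scale p \<in> local_ring m" "specialise m (KH_of_poly scale p) = eval_at m p"
    unfolding KH_of_poly_KH_frac by (simp_all add: locKI specialise_KH_frac eval_at_one)
qed

lemma KK_one_poly: "\<one>\<^bsub>KK\<^esub> = KH_of_poly scale 1" and KK_zero_poly: "\<zero>\<^bsub>KK\<^esub> = KH_of_poly scale 0"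
  by (simp_all add: KK_one KK_zero KH_of_poly_KH_frac)

lemma local_ring_minus:
  assumes z: "z \<in> local_ring m"
  shows "\<ominus>\<^bsub>KK\<^esub> z \<in> local_ring m" "specialise m (\<ominus>\<^bsub>KK\<^esub> z) = - specialise m z"
proof -
  interpret K: cring KK by (rule cring_KK)
  obtain p q where pq: "eval_at m q \<noteq> 0" "rho q \<noteq> 0" "z = KH_frac p q" "specialise m z = eval_at m p / eval_at m q"
    using z by (rule local_ring_cases)
  have w: "KH_frac (- p) q \<in> local_ring m"
    by (rule locKI[OF pq(1)])
  have nz: "eval_at m (- p) = - eval_at m p"
    using eval_at_add[of m p "- p"] by (simp add: eval_at_zero eq_neg_iff_add_eq_0 add.commute)
  have rn: "rho (- p) = - rho p"
    using rho.evp_add[of p "- p"] by (simp add: rho.evp_zero eq_neg_iff_add_eq_0 add.commute)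
  have "KH_frac (- p) q \<oplus>\<^bsub>KK\<^esub> z = \<zero>\<^bsub>KK\<^esub>"
  proof (rule frac_embed_inj)
    show "frac_embed (KH_frac (- p) q \<oplus>\<^bsub>KK\<^esub> z) = frac_embed \<zero>\<^bsub>KK\<^esub>"
      using pq(2) local_ring_carrier[OF w] local_ring_carrier[OF z]
      by (simp add: frac_embed_simps) (simp add: pq(3) frac_embed_KH_frac big_frac_def rn Zero_fract_def eq_fract)
  qed (simp_all add: KK_closed local_ring_carrier[OF w] local_ring_carrier[OF z])
  then have "\<ominus>\<^bsub>KK\<^esub> z = KH_frac (- p) q"
    by (rule K.minus_equality[OF _ local_ring_carrier[OF z] local_ring_carrier[OF w]])
  then show "\<ominus>\<^bsub>KK\<^esub> z \<in> local_ring m" "specialise m (\<ominus>\<^bsub>KK\<^esub> z) = - specialise m z"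
    using w by (simp_all add: specialise_KH_frac[OF pq(1)] pq(4) nz)
qed

text \<open>The local ring and its evaluation, transported to the big field, where the general facts
  of \<open>hopf_field\<close> on sums and convolutions apply.\<close>

definition local_big :: "('h \<Rightarrow> 'f) \<Rightarrow> (('h lcopy \<Rightarrow>\<^sub>0 nat) \<Rightarrow>\<^sub>0 'k) fract set" where
  "local_big m = frac_embed ` local_ring m"

definition specialise_big :: "('h \<Rightarrow> 'f) \<Rightarrow> (('h lcopy \<Rightarrow>\<^sub>0 nat) \<Rightarrow>\<^sub>0 'k) fract \<Rightarrow> 'f" where
  "specialise_big m w = specialise m (inv_into (local_ring m) frac_embed w)"

lemma inj_frac_embed: "inj_on frac_embed (local_ring m)"
  by (rule inj_onI) (rule frac_embed_inj[OF local_ring_carrier local_ring_carrier])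

lemma specialise_big_frac_embed: "z \<in> local_ring m \<Longrightarrow> specialise_big m (frac_embed z) = specialise m z"
  unfolding specialise_big_def by (simp add: inv_into_f_f[OF inj_frac_embed])

lemma local_big_ops:
  assumes "v \<in> local_big m" "w \<in> local_big m"
  shows "v + w \<in> local_big m" "v * w \<in> local_big m" "specialise_big m (v + w) = specialise_big m v + specialise_big m w" "specialise_big m (v * w) = specialise_big m v * specialise_big m w"
proof -
  obtain z where z: "z \<in> local_ring m" "v = frac_embed z"
    using assms(1) unfolding local_big_def by blast
  obtain y where y: "y \<in> local_ring m" "w = frac_embed y"
    using assms(2) unfolding local_big_def by blast
  have e: "v + w = frac_embed (z \<oplus>\<^bsub>KK\<^esub> y)" "v * w = frac_embed (z \<otimes>\<^bsub>KK\<^esub> y)"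
    unfolding z(2) y(2) by (simp_all add: frac_embed_simps local_ring_carrier[OF z(1)] local_ring_carrier[OF y(1)])
  note o = local_ring_ops[OF z(1) y(1)]
  show "v + w \<in> local_big m" "v * w \<in> local_big m"
    unfolding e local_big_def using o(1,3) by blast+
  have "specialise_big m v = specialise m z" "specialise_big m w = specialise m y"
    using specialise_big_frac_embed[OF z(1)] specialise_big_frac_embed[OF y(1)] z(2) y(2) by simp_all
  then show "specialise_big m (v + w) = specialise_big m v + specialise_big m w" "specialise_big m (v * w) = specialise_big m v * specialise_big m w"
    unfolding e specialise_big_frac_embed[OF o(1)] specialise_big_frac_embed[OF o(3)] o by simp_all
qed

lemma frac_embed_local_ring: "z \<in> carrier KK \<Longrightarrow> frac_embed z \<in> local_big m \<Longrightarrow> z \<in> local_ring m"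
  unfolding local_big_def using frac_embed_inj local_ring_carrier by blast

text \<open>\<open>\<iota>Q\<close> and the map \<open>TQ\<close> below are the images in the big
  field of the constants and of h \<mapsto> t_h: a structure map over k and the generic linear
  map.\<close>

definition \<iota>Q :: "'k \<Rightarrow> (('h lcopy \<Rightarrow>\<^sub>0 nat) \<Rightarrow>\<^sub>0 'k) fract" where "\<iota>Q a = Fract (cst a) 1"

definition TQ :: "'h \<Rightarrow> (('h lcopy \<Rightarrow>\<^sub>0 nat) \<Rightarrow>\<^sub>0 'k) fract" where "TQ h = Fract (linear_form h) 1"

lemma const_facts: "KH_const scale a \<in> local_ring m" "specialise m (KH_const scale a) = \<iota> a"
    "KH_const scale a \<in> carrier KK" "frac_embed (KH_const scale a) = \<iota>Q a"
  unfolding KH_const_def using local_ring_of_poly by (simp_all add: eval_at_const frac_embed_of_poly rho_const \<iota>Q_def)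

lemma gen_facts: "t_gen scale h \<in> local_ring m" "lin m \<Longrightarrow> specialise m (t_gen scale h) = m h"
    "t_gen scale h \<in> carrier KK" "frac_embed (t_gen scale h) = TQ h"
  unfolding t_gen_def using local_ring_of_poly by (simp_all add: eval_at_var frac_embed_of_poly rho_var TQ_def)

lemma local_big_\<iota>Q: "\<iota>Q a \<in> local_big m" "specialise_big m (\<iota>Q a) = \<iota> a"
proof -
  have "frac_embed (KH_const scale a) \<in> local_big m"
    unfolding local_big_def using const_facts(1) by blast
  then show "\<iota>Q a \<in> local_big m"
    by (simp only: const_facts(4))
  show "specialise_big m (\<iota>Q a) = \<iota> a"
    using specialise_big_frac_embed[OF const_facts(1)[where m = m and a = a]] by (simp only: const_facts(2,4))
qed

lemma local_big_TQ: "TQ h \<in> local_big m" "lin m \<Longrightarrow> specialise_big m (TQ h) = m h"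
proof -
  have "frac_embed (t_gen scale h) \<in> local_big m"
    unfolding local_big_def using gen_facts(1) by blast
  then show "TQ h \<in> local_big m"
    by (simp only: gen_facts(4))
  show "lin m \<Longrightarrow> specialise_big m (TQ h) = m h"
    using specialise_big_frac_embed[OF gen_facts(1)[where m = m and h = h]] by (simp only: gen_facts(2,4))
qed

lemma specialise_big_sum:
  assumes "\<And>b. b \<in> B \<Longrightarrow> u b \<in> local_big m"
  shows "sum u B \<in> local_big m" "specialise_big m (sum u B) = (\<Sum>b\<in>B. specialise_big m (u b))"
proof -
  have z: "0 \<in> local_big m" "specialise_big m 0 = 0"
  proof -
    have "\<iota>Q 0 = 0"
      by (simp add: \<iota>Q_def Zero_fract_def cst_simps)
    then show "0 \<in> local_big m" "specialise_big m 0 = 0"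
      using local_big_\<iota>Q[where a = 0 and m = m] by simp_all
  qed
  have "sum u B \<in> local_big m \<and> specialise_big m (sum u B) = (\<Sum>b\<in>B. specialise_big m (u b))"
    using assms by (induction B rule: infinite_finite_induct) (simp_all add: z local_big_ops)
  then show "sum u B \<in> local_big m" "specialise_big m (sum u B) = (\<Sum>b\<in>B. specialise_big m (u b))"
    by simp_all
qed

lemma specialise_big_SS:
  assumes "\<And>p q. f p q \<in> local_big m"
  shows "SS f x \<in> local_big m" "specialise_big m (SS f x) = SS (\<lambda>p q. specialise_big m (f p q)) x"
  unfolding SS_def by (rule specialise_big_sum[OF assms])+

lemma hopf_field_Q: "hopf_field scale \<Delta> \<epsilon> \<iota>Q"
proof (unfold_locales, rule ring_hom_memI)
  show "\<iota>Q (a \<otimes>\<^bsub>kk\<^esub> b) = \<iota>Q a \<otimes>\<^bsub>ring_of_type_algebra\<^esub> \<iota>Q b" for a b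
    by (simp add: \<iota>Q_def cst_simps)
  show "\<iota>Q (a \<oplus>\<^bsub>kk\<^esub> b) = \<iota>Q a \<oplus>\<^bsub>ring_of_type_algebra\<^esub> \<iota>Q b" for a b
    by (simp add: \<iota>Q_def cst_simps)
  show "\<iota>Q \<one>\<^bsub>kk\<^esub> = \<one>\<^bsub>ring_of_type_algebra\<^esub>"
    by (simp add: \<iota>Q_def cst_simps One_fract_def)
qed simp

text \<open>The universal cocycle and its inverse sum over the three legs of x outside and those of
  y inside. Exchanging the sums pairs the legs, and an iterated convolution appears.\<close>

lemma SS_cv3:
  "SS (\<lambda>x1 t. SS (\<lambda>x2 x3. SS (\<lambda>y1 u. SS (\<lambda>y2 y3. a x1 y1 * b x2 y2 * c x3 y3) u) y) t) x =
    conv a (conv b c) x y"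
proof -
  have "SS (\<lambda>x2 x3. SS (\<lambda>y1 u. SS (\<lambda>y2 y3. a x1 y1 * b x2 y2 * c x3 y3) u) y) t =
    SS (\<lambda>y1 u. a x1 y1 * SS (\<lambda>x2 x3. SS (\<lambda>y2 y3. b x2 y2 * c x3 y3) u) t) y" for x1 t
    unfolding SS_swap[of _ y t] by (simp only: SS_times mult.assoc)
  then show ?thesis
    unfolding conv_def by simp
qed

end

section \<open>The generic matrix, and Sweedler sums with values in the field of fractions\<close>

context hopf_field
begin

interpretation Q: hopf_field scale \<Delta> \<epsilon> \<iota>Q
  by (rule hopf_field_Q)

lemma lin_TQ: "Q.lin TQ"
  by (rule Q.linI) (simp_all add: TQ_def \<iota>Q_def linear_form_add linear_form_scale)

lemma Fract_sum:
  assumes "q \<noteq> 0" shows "(\<Sum>b\<in>B. Fract (u b) q) = Fract (\<Sum>b\<in>B. u b) q"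
  by (induction B rule: infinite_finite_induct)
    (use assms in \<open>simp_all add: Zero_fract_def eq_fract algebra_simps\<close>)

lemma inv_mat_TQ:
  assumes m: "lin m" and n0: "lin n0" and inv: "\<And>x. SS (\<lambda>p q. n0 p * m q) x = \<iota> (\<epsilon> x)" and s: "coideal_basis n v d"
  shows "\<exists>M. Q.inv_mat TQ n d M \<and> (\<forall>i j. M i j \<in> local_big m)"
proof -
  \<comment> \<open>The generic matrix is taken in the free polynomial ring, so that one determinant
    and one adjugate can be mapped both by \<open>rho\<close> to the big field and by
    \<open>eval_at m\<close> to the values at m.\<close>
  define P where "P = mat n n (\<lambda>(i, j). poly_var (d i j) :: ('k, 'h) poly_in)"
  have P: "P \<in> carrier_mat n n"
    by (simp add: P_def)
  define A where "A = mat n n (\<lambda>(i, j). m (d i j))"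
  define B where "B = mat n n (\<lambda>(i, j). n0 (d i j))"
  have AB: "A \<in> carrier_mat n n" "B \<in> carrier_mat n n"
    by (simp_all add: A_def B_def)
  define q where "q = det P"
  interpret eval_at: comm_ring_hom "eval_at m"
    by unfold_locales (simp_all add: eval_at_add eval_at_mult eval_at_one eval_at_zero)
  have "map_mat (eval_at m) P = A"
    by (rule eq_matI) (simp_all add: P_def A_def eval_at_var[OF m])
  then have eq: "eval_at m q = det A"
    unfolding q_def using eval_at.hom_det[of P] by simp
  \<comment> \<open>The entries d form a matrix coalgebra, so the relation \<open>n0 * m\<close> =
    \<epsilon> at \<open>d i j\<close> is the (i, j) entry of this matrix identity.\<close>
  have "B * A = 1\<^sub>m n"
  proof (rule eq_matI)
    fix i j assume "i < dim_row (1\<^sub>m n :: 'f mat)" "j < dim_col (1\<^sub>m n :: 'f mat)"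
    then have ij: "i < n" "j < n" by simp_all
    have "(B * A) $$ (i, j) = (\<Sum>l<n. n0 (d i l) * m (d l j))"
      using ij by (simp add: A_def B_def scalar_prod_def lessThan_atLeast0)
    also have "\<dots> = \<iota> (\<epsilon> (d i j))"
      using coideal_basis_SS_d[OF s ij bilin_prod[OF n0 m]] inv by simp
    finally show "(B * A) $$ (i, j) = 1\<^sub>m n $$ (i, j)"
      using ij by (simp add: coideal_basis_\<epsilon>[OF s ij])
  qed (use AB in simp_all)
  then have "det B * det A = 1"
    using det_mult[OF AB(2,1)] by simp
  then have q1: "eval_at m q \<noteq> 0"
    unfolding eq by auto
  note q = q1 eval_at_nz[OF q1]
  \<comment> \<open>The adjugate divided by the determinant. The denominator is q for all indices,
    in range or not, so every entry lies in the local ring of m.\<close>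
  define M where "M i j = frac_embed (KH_frac (adj_mat P $$ (i, j)) q)" for i j
  have M: "M i j = Fract (rho (adj_mat P $$ (i, j))) (rho q)" for i j
    unfolding M_def frac_embed_KH_frac[OF q(2)] big_frac_def ..
  have V: "M i j \<in> local_big m" for i j
    unfolding M_def local_big_def using locKI[OF q(1)] by blast
  note adj = adj_mat[OF P]
  have rs: "rho (sum u C) = (\<Sum>c\<in>C. rho (u c))" for u and C :: "nat set"
    by (induction C rule: infinite_finite_induct) (simp_all add: rho.evp_add rho.evp_zero)
  have 1: "(\<Sum>l<n. TQ (d i l) * M l j) = (if i = j then 1 else 0)" if ij: "i < n" "j < n" for i j
  proof -
    have "(P * adj_mat P) $$ (i, j) = (\<Sum>l<n. poly_var (d i l) * adj_mat P $$ (l, j))"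
      using ij adj(1) by (simp add: P_def scalar_prod_def lessThan_atLeast0)
    then have "(\<Sum>l<n. poly_var (d i l) * adj_mat P $$ (l, j)) = (if i = j then q else 0)"
      using ij by (cases "i = j") (simp_all add: adj(2) q_def)
    then have "rho (\<Sum>l<n. poly_var (d i l) * adj_mat P $$ (l, j)) = (if i = j then rho q else 0)"
      by (simp add: rho.evp_zero)
    then have "(\<Sum>l<n. TQ (d i l) * M l j) = Fract (if i = j then rho q else 0) (rho q)"
      using Fract_sum[OF q(2), of "\<lambda>l. linear_form (d i l) * rho (adj_mat P $$ (l, j))" "{..<n}"] q(2)
      by (simp add: M TQ_def rs rho.evp_mult rho_var)
    then show ?thesis
      using q(2) by (auto simp: One_fract_def Zero_fract_def eq_fract)
  qed
  have 2: "(\<Sum>l<n. M i l * TQ (d l j)) = (if i = j then 1 else 0)" if ij: "i < n" "j < n" for i j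
  proof -
    have "(adj_mat P * P) $$ (i, j) = (\<Sum>l<n. adj_mat P $$ (i, l) * poly_var (d l j))"
      using ij adj(1) by (simp add: P_def scalar_prod_def lessThan_atLeast0)
    then have "(\<Sum>l<n. adj_mat P $$ (i, l) * poly_var (d l j)) = (if i = j then q else 0)"
      using ij by (cases "i = j") (simp_all add: adj(3) q_def)
    then have "rho (\<Sum>l<n. adj_mat P $$ (i, l) * poly_var (d l j)) = (if i = j then rho q else 0)"
      by (simp add: rho.evp_zero)
    then have "(\<Sum>l<n. M i l * TQ (d l j)) = Fract (if i = j then rho q else 0) (rho q)"
      using Fract_sum[OF q(2), of "\<lambda>l. rho (adj_mat P $$ (i, l)) * linear_form (d l j)" "{..<n}"] q(2)
      by (simp add: M TQ_def rs rho.evp_mult rho_var)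
    then show ?thesis
      using q(2) by (auto simp: One_fract_def Zero_fract_def eq_fract)
  qed
  show ?thesis
    using 1 2 V unfolding Q.inv_mat_def by blast
qed

abbreviation "actK \<equiv> (\<lambda>a z. KH_const scale a \<otimes>\<^bsub>KK\<^esub> z)"

lemma abelian_KK: "abelian_group KK"
  using cring_KK by (simp add: cring_def ring_def)

lemma klin_frac_embed: "klin KK actK g \<longleftrightarrow> (\<forall>x. g x \<in> carrier KK) \<and> Q.lin (\<lambda>x. frac_embed (g x))"
proof
  assume g: "klin KK actK g"
  then show "(\<forall>x. g x \<in> carrier KK) \<and> Q.lin (\<lambda>x. frac_embed (g x))"
    by (simp add: klinD Q.linI frac_embed_simps const_facts)
next
  assume g: "(\<forall>x. g x \<in> carrier KK) \<and> Q.lin (\<lambda>x. frac_embed (g x))"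
  show "klin KK actK g"
  proof (rule klinI)
    show "g x \<in> carrier KK" for x
      using g by simp
    show "g (x + y) = g x \<oplus>\<^bsub>KK\<^esub> g y" for x y
      by (rule frac_embed_inj) (use g Q.linD(1)[where g = "\<lambda>x. frac_embed (g x)"] in \<open>simp_all add: KK_closed frac_embed_simps\<close>)
    show "g (scale a x) = actK a (g x)" for a x
      by (rule frac_embed_inj) (use g Q.linD(2)[where g = "\<lambda>x. frac_embed (g x)"] in \<open>simp_all add: KK_closed frac_embed_simps const_facts\<close>)
  qed
qed

lemma frac_embed_sw:
  assumes c: "\<And>p q. f p q \<in> carrier KK" and b: "Q.bilin (\<lambda>p q. frac_embed (f p q))"
  shows "sweedler KK \<Delta> f x \<in> carrier KK" "frac_embed (sweedler KK \<Delta> f x) = SS (\<lambda>p q. frac_embed (f p q)) x"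
proof -
  have "kbilin KK actK f"
    by (rule kbilinI) (use c Q.bilinD[OF b] in \<open>simp_all add: klin_frac_embed\<close>)
  note b' = kbilin_bal[OF this]
  show "sweedler KK \<Delta> f x \<in> carrier KK"
    by (rule sw_closed[OF abelian_KK b'])
  have "frac_embed \<in> addhom KK Q.F"
    by (rule addhomI) (simp_all add: frac_embed_simps)
  then show "frac_embed (sweedler KK \<Delta> f x) = SS (\<lambda>p q. frac_embed (f p q)) x"
    using sw_map[OF abelian_KK b' Q.abelian_F] Q.sw_F[OF b] by simp
qed

lemma frac_embed_sw3:
  assumes c: "\<And>p q r. f p q r \<in> carrier KK" and l1: "\<And>q r. Q.lin (\<lambda>p. frac_embed (f p q r))"
    and l2: "\<And>p r. Q.lin (\<lambda>q. frac_embed (f p q r))" and l3: "\<And>p q. Q.lin (\<lambda>r. frac_embed (f p q r))"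
  shows "sweedler3 KK \<Delta> f x \<in> carrier KK"
    "frac_embed (sweedler3 KK \<Delta> f x) = SS (\<lambda>p t. SS (\<lambda>q r. frac_embed (f p q r)) t) x"
proof -
  have b: "Q.bilin (\<lambda>q r. frac_embed (f p q r))" for p
    by (rule Q.bilinI) (rule l2 l3)+
  have i: "sweedler KK \<Delta> (\<lambda>q r. f p q r) t \<in> carrier KK"
    "frac_embed (sweedler KK \<Delta> (\<lambda>q r. f p q r) t) = SS (\<lambda>q r. frac_embed (f p q r)) t" for p t
    by (rule frac_embed_sw[where f = "\<lambda>q r. f p q r", OF c b])+
  have o: "Q.bilin (\<lambda>p t. frac_embed (sweedler KK \<Delta> (\<lambda>q r. f p q r) t))"
    unfolding i(2) by (rule Q.bilinI) (rule Q.SS_lin_param[OF l1] Q.SS_lin[OF b])+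
  show "sweedler3 KK \<Delta> f x \<in> carrier KK"
    "frac_embed (sweedler3 KK \<Delta> f x) = SS (\<lambda>p t. SS (\<lambda>q r. frac_embed (f p q r)) t) x"
    unfolding sweedler3_def
    using frac_embed_sw[where f = "\<lambda>p t. sweedler KK \<Delta> (\<lambda>q r. f p q r) t", OF i(1) o, of x] unfolding i(2) by simp_all
qed

text \<open>The common shape of \<sigma> and of its inverse: a product of three bilinear factors,
  the i-th in the i-th legs of x and y, hence a convolution of three bilinear maps in the big
  field.\<close>

lemma frac_embed_sw33:
  assumes c: "\<And>x1 x2 x3 y1 y2 y3. w x1 x2 x3 y1 y2 y3 \<in> carrier KK"
    and e: "\<And>x1 x2 x3 y1 y2 y3. frac_embed (w x1 x2 x3 y1 y2 y3) = A x1 y1 * B x2 y2 * C x3 y3"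
    and A: "Q.bilin A" and B: "Q.bilin B" and C: "Q.bilin C"
  shows "sweedler3 KK \<Delta> (\<lambda>x1 x2 x3. sweedler3 KK \<Delta> (\<lambda>y1 y2 y3. w x1 x2 x3 y1 y2 y3) y) x \<in> carrier KK"
    "frac_embed (sweedler3 KK \<Delta> (\<lambda>x1 x2 x3. sweedler3 KK \<Delta> (\<lambda>y1 y2 y3. w x1 x2 x3 y1 y2 y3) y) x) =
      Q.conv A (Q.conv B C) x y"
proof -
  note lins = Q.lin_times Q.bilinD[OF A] Q.bilinD[OF B] Q.bilinD[OF C]
  have l: "Q.lin (\<lambda>x1. A x1 y1 * B x2 y2 * C x3 y3)" "Q.lin (\<lambda>x2. A x1 y1 * B x2 y2 * C x3 y3)"
    "Q.lin (\<lambda>x3. A x1 y1 * B x2 y2 * C x3 y3)" "Q.lin (\<lambda>y1. A x1 y1 * B x2 y2 * C x3 y3)"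
    "Q.lin (\<lambda>y2. A x1 y1 * B x2 y2 * C x3 y3)" "Q.lin (\<lambda>y3. A x1 y1 * B x2 y2 * C x3 y3)" for x1 x2 x3 y1 y2 y3
    by (intro lins)+
  have i: "sweedler3 KK \<Delta> (\<lambda>y1 y2 y3. w x1 x2 x3 y1 y2 y3) y \<in> carrier KK"
    "frac_embed (sweedler3 KK \<Delta> (\<lambda>y1 y2 y3. w x1 x2 x3 y1 y2 y3) y) =
      SS (\<lambda>y1 u. SS (\<lambda>y2 y3. A x1 y1 * B x2 y2 * C x3 y3) u) y" for x1 x2 x3 y
    by (rule frac_embed_sw3[where f = "\<lambda>y1 y2 y3. w x1 x2 x3 y1 y2 y3", unfolded e, OF c l(4) l(5) l(6)])+
  have o: "Q.lin (\<lambda>x1. SS (\<lambda>y1 u. SS (\<lambda>y2 y3. A x1 y1 * B x2 y2 * C x3 y3) u) y)"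
    "Q.lin (\<lambda>x2. SS (\<lambda>y1 u. SS (\<lambda>y2 y3. A x1 y1 * B x2 y2 * C x3 y3) u) y)"
    "Q.lin (\<lambda>x3. SS (\<lambda>y1 u. SS (\<lambda>y2 y3. A x1 y1 * B x2 y2 * C x3 y3) u) y)" for x1 x2 x3
    by (rule Q.SS_lin_param, rule Q.SS_lin_param, rule l)+
  note u = frac_embed_sw3[where f = "\<lambda>x1 x2 x3. sweedler3 KK \<Delta> (\<lambda>y1 y2 y3. w x1 x2 x3 y1 y2 y3) y" and x = x,
        unfolded i(2), OF i(1) o(1) o(2) o(3)]
  show "sweedler3 KK \<Delta> (\<lambda>x1 x2 x3. sweedler3 KK \<Delta> (\<lambda>y1 y2 y3. w x1 x2 x3 y1 y2 y3) y) x \<in> carrier KK"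
    by (rule u(1))
  show "frac_embed (sweedler3 KK \<Delta> (\<lambda>x1 x2 x3. sweedler3 KK \<Delta> (\<lambda>y1 y2 y3. w x1 x2 x3 y1 y2 y3) y) x) =
      Q.conv A (Q.conv B C) x y"
    unfolding u(2) by (rule Q.SS_cv3)
qed

lemma specialise_big_conv:
  assumes "\<And>x y. A x y \<in> local_big m" "\<And>x y. B x y \<in> local_big m"
  shows "Q.conv A B x y \<in> local_big m" "specialise_big m (Q.conv A B x y) = conv (\<lambda>x y. specialise_big m (A x y)) (\<lambda>x y. specialise_big m (B x y)) x y"
proof -
  have i: "SS (\<lambda>r s. A p r * B q s) y \<in> local_big m"
    "specialise_big m (SS (\<lambda>r s. A p r * B q s) y) = SS (\<lambda>r s. specialise_big m (A p r) * specialise_big m (B q s)) y" for p q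
    using specialise_big_SS[where f = "\<lambda>r s. A p r * B q s", OF local_big_ops(2)[OF assms]]
    unfolding local_big_ops(4)[OF assms] by blast+
  show "Q.conv A B x y \<in> local_big m" "specialise_big m (Q.conv A B x y) = conv (\<lambda>x y. specialise_big m (A x y)) (\<lambda>x y. specialise_big m (B x y)) x y"
    unfolding Q.conv_def conv_def using specialise_big_SS[where f = "\<lambda>p q. SS (\<lambda>r s. A p r * B q s) y", OF i(1)]
    unfolding i(2) by blast+
qed

lemma bilinear_to_bilin: "bilinear_to scale F \<iota> f \<longleftrightarrow> bilin f"
  unfolding bilinear_to_def linear_to_def bilin_def lin_def by auto

lemma convolution_conv:
  assumes f: "bilin f" and g: "bilin g"
  shows "convolution \<Delta> F f g x y = conv f g x y"
proof -
  have b: "bilin (\<lambda>y1 y2. f x1 y1 * g x2 y2)" for x1 x2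
    by (rule bilin_prod[OF bilinD(2)[OF f] bilinD(2)[OF g]])
  have "bilin (\<lambda>x1 x2. SS (\<lambda>y1 y2. f x1 y1 * g x2 y2) y)"
    by (rule bilinI; rule SS_lin_param) (rule lin_times bilinD[OF f] bilinD[OF g])+
  from sw_F[OF this] show ?thesis
    unfolding convolution_def conv_def using sw_F[OF b] by simp
qed

lemma is_conv_inverse_conv:
  assumes f: "bilin f"
  shows "is_conv_inverse scale \<Delta> \<epsilon> F \<iota> f g \<longleftrightarrow> bilin g \<and> conv f g = conv_counit \<and> conv g f = conv_counit"
  unfolding is_conv_inverse_def bilinear_to_bilin
  using convolution_conv[OF f] convolution_conv[OF _ f] by (auto simp: fun_eq_iff conv_counit_def)

text \<open>Two-sided convolution inverses are unique by associativity, so the definite description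
  returns the inverse whose existence is assumed.\<close>

lemma conv_inverse_is_inverse:
  assumes f: "bilin f" and ex: "\<exists>g. is_conv_inverse scale \<Delta> \<epsilon> F \<iota> f g"
  defines "f' \<equiv> conv_inverse scale \<Delta> \<epsilon> F \<iota> f"
  shows "bilin f'" "conv f f' = conv_counit" "conv f' f = conv_counit"
proof -
  obtain g where g: "is_conv_inverse scale \<Delta> \<epsilon> F \<iota> f g"
    using ex by blast
  have "f' = g"
    unfolding f'_def conv_inverse_def
    by (rule the_equality, rule g)
      (use g conv_inverse_unique[OF f] in \<open>simp add: is_conv_inverse_conv[OF f]\<close>)
  then show "bilin f'" "conv f f' = conv_counit" "conv f' f = conv_counit"
    using g by (simp_all add: is_conv_inverse_conv[OF f])
qed

lemma conv_one:
  assumes f: "bilin f" and g: "bilin g"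
  shows "conv f g 1 1 = f 1 1 * g 1 1"
proof -
  have b: "bilin (\<lambda>y1 y2. f x1 y1 * g x2 y2)" for x1 x2
    by (rule bilin_prod[OF bilinD(2)[OF f] bilinD(2)[OF g]])
  have "bilin (\<lambda>x1 x2. f x1 1 * g x2 1)"
    by (rule bilin_prod[OF bilinD(1)[OF f] bilinD(1)[OF g]])
  then show ?thesis
    unfolding conv_def SS_one[OF b] by (rule SS_one)
qed

end

section \<open>The universal cocycle at a convolution-invertible point\<close>

locale specialised_cocycle = hopf_field scale \<Delta> \<epsilon> \<iota>
  for scale :: "'k::field \<Rightarrow> 'h::ring_1 \<Rightarrow> 'h" and \<Delta> :: "'h \<Rightarrow> ('h, 'h) tensor" and \<epsilon> :: "'h \<Rightarrow> 'k"
    and \<iota> :: "'k \<Rightarrow> 'f::field" +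
  fixes m n\<^sub>0 :: "'h \<Rightarrow> 'f" and \<alpha> :: "'h \<Rightarrow> 'h \<Rightarrow> 'k"
  assumes lin_m: "lin m" and lin_n\<^sub>0: "lin n\<^sub>0" and n\<^sub>0_m: "SS (\<lambda>p q. n\<^sub>0 p * m q) x = \<iota> (\<epsilon> x)"
    and cocycle: "normalized_invertible_cocycle scale \<Delta> \<epsilon> kk id \<alpha>"
begin

interpretation Q: hopf_field scale \<Delta> \<epsilon> \<iota>Q
  by (rule hopf_field_Q)

interpretation k: hopf_field scale \<Delta> \<epsilon> "id :: 'k \<Rightarrow> 'k"
  by unfold_locales (rule ring_hom_memI; simp)

abbreviation "ti \<equiv> t_inv scale \<Delta> \<epsilon>"
abbreviation "\<alpha>' \<equiv> conv_inverse scale \<Delta> \<epsilon> kk id \<alpha>"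
abbreviation "\<sigma> \<equiv> univ_cocycle scale \<Delta> \<epsilon> \<alpha>"
abbreviation "\<sigma>' \<equiv> univ_cocycle_inv scale \<Delta> \<epsilon> \<alpha>"

text \<open>\<open>conv_inverse_exists\<close> is applied to the generic map \<open>TQ\<close> with
  V the image of the local ring of m. Its values therefore come from elements of
  \<open>K\<^sub>H\<close> regular at m; pulled back, they satisfy the description of
  \<open>t_inv\<close>, and \<open>conv_unique\<close> shows that nothing else does.\<close>

lemma t_inv_facts:
  shows t_inv_local_ring: "ti h \<in> local_ring m" and t_inv_lin: "Q.lin (\<lambda>h. frac_embed (ti h))"
    and t_inv_right: "SS (\<lambda>p q. TQ p * frac_embed (ti q)) x = \<iota>Q (\<epsilon> x)"
    and t_inv_left: "SS (\<lambda>p q. frac_embed (ti p) * TQ q) x = \<iota>Q (\<epsilon> x)"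
proof -
  define spec where "spec g \<longleftrightarrow> linear_to scale KK (KH_const scale) g \<and>
    (\<forall>h. sweedler KK \<Delta> (\<lambda>h1 h2. t_gen scale h1 \<otimes>\<^bsub>KK\<^esub> g h2) h = KH_const scale (\<epsilon> h) \<and>
         sweedler KK \<Delta> (\<lambda>h1 h2. g h1 \<otimes>\<^bsub>KK\<^esub> t_gen scale h2) h = KH_const scale (\<epsilon> h))" for g
  \<comment> \<open>The description of \<open>t_inv\<close>, transported to the big field. If g is
    not a linear map into \<open>KK\<close>, both sides are false.\<close>
  have spec: "spec g \<longleftrightarrow> (\<forall>x. g x \<in> carrier KK) \<and> Q.lin (\<lambda>x. frac_embed (g x)) \<and>
      (\<forall>x. SS (\<lambda>p q. TQ p * frac_embed (g q)) x = \<iota>Q (\<epsilon> x) \<and> SS (\<lambda>p q. frac_embed (g p) * TQ q) x = \<iota>Q (\<epsilon> x))" for g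
  proof (cases "(\<forall>x. g x \<in> carrier KK) \<and> Q.lin (\<lambda>x. frac_embed (g x))")
    case False
    then show ?thesis
      unfolding spec_def linear_to_klin klin_frac_embed by blast
  next
    case True
    then have c: "g x \<in> carrier KK" and l: "Q.lin (\<lambda>x. frac_embed (g x))" for x
      by simp_all
    have e: "frac_embed (t_gen scale p \<otimes>\<^bsub>KK\<^esub> g q) = TQ p * frac_embed (g q)" "frac_embed (g p \<otimes>\<^bsub>KK\<^esub> t_gen scale q) = frac_embed (g p) * TQ q"
      "t_gen scale p \<otimes>\<^bsub>KK\<^esub> g q \<in> carrier KK" "g p \<otimes>\<^bsub>KK\<^esub> t_gen scale q \<in> carrier KK" for p q
      by (simp_all add: frac_embed_simps KK_closed gen_facts c)
    note s = frac_embed_sw[OF e(3), unfolded e, OF Q.bilin_prod[OF lin_TQ l]]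
      frac_embed_sw[OF e(4), unfolded e, OF Q.bilin_prod[OF l lin_TQ]]
    have "sweedler KK \<Delta> (\<lambda>h1 h2. t_gen scale h1 \<otimes>\<^bsub>KK\<^esub> g h2) h = KH_const scale (\<epsilon> h) \<longleftrightarrow>
        SS (\<lambda>p q. TQ p * frac_embed (g q)) h = \<iota>Q (\<epsilon> h)"
      "sweedler KK \<Delta> (\<lambda>h1 h2. g h1 \<otimes>\<^bsub>KK\<^esub> t_gen scale h2) h = KH_const scale (\<epsilon> h) \<longleftrightarrow>
        SS (\<lambda>p q. frac_embed (g p) * TQ q) h = \<iota>Q (\<epsilon> h)" for h
      using frac_embed_inj[OF s(1) const_facts(3)] frac_embed_inj[OF s(3) const_facts(3)] s(2,4)
      by (metis const_facts(4))+
    with True show ?thesis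
      unfolding spec_def linear_to_klin klin_frac_embed by simp
  qed
  obtain gQ where gQ: "Q.lin gQ" "\<And>x. SS (\<lambda>p q. TQ p * gQ q) x = \<iota>Q (\<epsilon> x)"
      "\<And>x. SS (\<lambda>p q. gQ p * TQ q) x = \<iota>Q (\<epsilon> x)" "\<And>x. gQ x \<in> local_big m"
  proof -
    have "\<exists>g. Q.lin g \<and> (\<forall>x. SS (\<lambda>p q. TQ p * g q) x = \<iota>Q (\<epsilon> x)) \<and>
        (\<forall>x. SS (\<lambda>p q. g p * TQ q) x = \<iota>Q (\<epsilon> x)) \<and> (\<forall>x. g x \<in> local_big m)"
      by (rule Q.conv_inverse_exists[OF lin_TQ]) (rule inv_mat_TQ[OF lin_m lin_n\<^sub>0 n\<^sub>0_m] local_big_ops local_big_\<iota>Q; assumption?)+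
    then show thesis
      using that by blast
  qed
  define g where "g h = inv_into (local_ring m) frac_embed (gQ h)" for h
  have g: "g h \<in> local_ring m" "frac_embed (g h) = gQ h" for h
    using gQ(4)[of h] unfolding g_def local_big_def by (rule inv_into_into f_inv_into_f)+
  have sg: "spec g"
    unfolding spec g(2) using g(1) local_ring_carrier gQ by blast
  have "ti = g"
    unfolding t_inv_def spec_def[symmetric]
  proof (rule the_equality[of spec, OF sg])
    fix g' assume "spec g'"
    then have g': "\<And>x. g' x \<in> carrier KK" "Q.lin (\<lambda>x. frac_embed (g' x))" "\<And>x. SS (\<lambda>p q. frac_embed (g' p) * TQ q) x = \<iota>Q (\<epsilon> x)"
      unfolding spec by simp_all
    have "frac_embed (g' x) = frac_embed (g x)" for x
      unfolding g(2) by (rule Q.conv_unique[OF lin_TQ g'(2) gQ(1) g'(3) gQ(2)])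
    then show "g' = g"
      using frac_embed_inj[OF g'(1) local_ring_carrier[OF g(1)]] by blast
  qed
  then show "ti h \<in> local_ring m" "Q.lin (\<lambda>h. frac_embed (ti h))" "SS (\<lambda>p q. TQ p * frac_embed (ti q)) x = \<iota>Q (\<epsilon> x)"
    "SS (\<lambda>p q. frac_embed (ti p) * TQ q) x = \<iota>Q (\<epsilon> x)"
    using g gQ by simp_all
qed

abbreviation "G h \<equiv> frac_embed (ti h)"

lemma G_local_big: "G h \<in> local_big m"
  unfolding local_big_def using t_inv_local_ring by blast

text \<open>The convolution inverse of m. Specialising the two relations that define
  \<open>t\<^sup>-\<^sup>1\<close> yields both one-sided relations, whereas only one was known for
  \<open>n\<^sub>0\<close>.\<close>

definition \<nu> :: "'h \<Rightarrow> 'f" where "\<nu> h = specialise_big m (G h)"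

lemma lin_\<nu>: "lin \<nu>"
proof (rule linI)
  show "\<nu> (x + y) = \<nu> x + \<nu> y" for x y
    unfolding \<nu>_def Q.linD(1)[OF t_inv_lin] by (rule local_big_ops[OF G_local_big G_local_big])
  show "\<nu> (scale a x) = \<iota> a * \<nu> x" for a x
    unfolding \<nu>_def Q.linD(2)[OF t_inv_lin] using local_big_ops(4)[OF local_big_\<iota>Q(1) G_local_big] by (simp add: local_big_\<iota>Q)
qed

lemma m_\<nu>: "SS (\<lambda>p q. m p * \<nu> q) x = \<iota> (\<epsilon> x)" and \<nu>_m: "SS (\<lambda>p q. \<nu> p * m q) x = \<iota> (\<epsilon> x)"
proof -
  have "specialise_big m (SS (\<lambda>p q. TQ p * G q) x) = SS (\<lambda>p q. m p * \<nu> q) x"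
    using specialise_big_SS(2)[of "\<lambda>p q. TQ p * G q", OF local_big_ops(2)[OF local_big_TQ(1) G_local_big]]
    by (simp add: local_big_ops(4)[OF local_big_TQ(1) G_local_big] local_big_TQ(2)[OF lin_m] \<nu>_def)
  then show "SS (\<lambda>p q. m p * \<nu> q) x = \<iota> (\<epsilon> x)"
    by (simp add: t_inv_right local_big_\<iota>Q)
  have "specialise_big m (SS (\<lambda>p q. G p * TQ q) x) = SS (\<lambda>p q. \<nu> p * m q) x"
    using specialise_big_SS(2)[of "\<lambda>p q. G p * TQ q", OF local_big_ops(2)[OF G_local_big local_big_TQ(1)]]
    by (simp add: local_big_ops(4)[OF G_local_big local_big_TQ(1)] local_big_TQ(2)[OF lin_m] \<nu>_def)
  then show "SS (\<lambda>p q. \<nu> p * m q) x = \<iota> (\<epsilon> x)"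
    by (simp add: t_inv_left local_big_\<iota>Q)
qed

lemma \<alpha>_facts: "k.bilin \<alpha>" "k.bilin \<alpha>'" "k.conv \<alpha> \<alpha>' = k.conv_counit" "k.conv \<alpha>' \<alpha> = k.conv_counit"
proof -
  show \<alpha>: "k.bilin \<alpha>"
    using cocycle by (simp add: normalized_invertible_cocycle_def two_cocycle_def k.bilinear_to_bilin)
  have "\<exists>g. is_conv_inverse scale \<Delta> \<epsilon> kk id \<alpha> g"
    using cocycle by (simp add: normalized_invertible_cocycle_def)
  then show "k.bilin \<alpha>'" "k.conv \<alpha> \<alpha>' = k.conv_counit" "k.conv \<alpha>' \<alpha> = k.conv_counit"
    by (rule k.conv_inverse_is_inverse[OF \<alpha>])+
qed

lemma bilin_\<iota>Q: "k.bilin f \<Longrightarrow> Q.bilin (\<lambda>x y. \<iota>Q (f x y))"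
  unfolding k.bilin_def k.lin_def Q.bilin_def Q.lin_def by simp

lemma \<sigma>_frac_embed: "\<sigma> x y \<in> carrier KK" "frac_embed (\<sigma> x y) = Q.conv (Q.tensor_square TQ) (Q.conv (\<lambda>x y. \<iota>Q (\<alpha> x y)) (Q.of_product G)) x y"
  unfolding univ_cocycle_def
  by (rule frac_embed_sw33; use Q.bilin_tensor_square[OF lin_TQ] Q.bilin_of_product[OF t_inv_lin] bilin_\<iota>Q[OF \<alpha>_facts(1)] local_ring_carrier[OF t_inv_local_ring] in
    \<open>simp add: KK_closed frac_embed_simps gen_facts const_facts Q.tensor_square_def Q.of_product_def\<close>)+

lemma \<sigma>'_frac_embed: "\<sigma>' x y \<in> carrier KK" "frac_embed (\<sigma>' x y) = Q.conv (Q.of_product TQ) (Q.conv (\<lambda>x y. \<iota>Q (\<alpha>' x y)) (Q.tensor_square G)) x y"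
  unfolding univ_cocycle_inv_def
  by (rule frac_embed_sw33; use Q.bilin_of_product[OF lin_TQ] Q.bilin_tensor_square[OF t_inv_lin] bilin_\<iota>Q[OF \<alpha>_facts(2)] local_ring_carrier[OF t_inv_local_ring] in
    \<open>simp add: KK_closed frac_embed_simps gen_facts const_facts Q.tensor_square_def Q.of_product_def mult.assoc\<close>)+

end

context specialised_cocycle
begin

interpretation Q: hopf_field scale \<Delta> \<epsilon> \<iota>Q
  by (rule hopf_field_Q)

interpretation k: hopf_field scale \<Delta> \<epsilon> "id :: 'k \<Rightarrow> 'k"
  by unfold_locales (rule ring_hom_memI; simp)

lemma local_big_tensor_square_of_product:
  assumes "\<And>h. g h \<in> local_big m"
  shows local_big_tensor_square: "Q.tensor_square g x y \<in> local_big m" "specialise_big m (Q.tensor_square g x y) = tensor_square (\<lambda>h. specialise_big m (g h)) x y"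
    and local_big_of_product: "Q.of_product g x y \<in> local_big m" "specialise_big m (Q.of_product g x y) = of_product (\<lambda>h. specialise_big m (g h)) x y"
  unfolding Q.tensor_square_def tensor_square_def Q.of_product_def of_product_def by (simp_all add: local_big_ops assms)

lemma specialise_frac_embed:
  assumes "z \<in> carrier KK" "frac_embed z = w" "w \<in> local_big m" "specialise_big m w = u"
  shows "z \<in> local_ring m" "specialise m z = u"
proof -
  show z: "z \<in> local_ring m"
    by (rule frac_embed_local_ring) (use assms in simp_all)
  show "specialise m z = u"
    using specialise_big_frac_embed[OF z] assms by simp
qed

lemma specialise_big_gens: "(\<lambda>h. specialise_big m (TQ h)) = m" "(\<lambda>h. specialise_big m (G h)) = \<nu>" "(\<lambda>x y. specialise_big m (\<iota>Q (f x y))) = (\<lambda>x y. \<iota> (f x y))"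
  by (simp_all add: local_big_TQ(2)[OF lin_m] \<nu>_def[abs_def] local_big_\<iota>Q)

text \<open>Specialisation respects sums and products on the local ring, so it carries the triple
  convolution that describes \<sigma> to the same expression with t replaced by m and its inverse by
  \<nu>.\<close>

lemma \<sigma>_local_ring: "\<sigma> x y \<in> local_ring m" "specialise m (\<sigma> x y) = conv (tensor_square m) (conv (\<lambda>x y. \<iota> (\<alpha> x y)) (of_product \<nu>)) x y"
proof -
  note c = specialise_big_conv[of "\<lambda>x y. \<iota>Q (\<alpha> x y)" m "Q.of_product G", OF local_big_\<iota>Q(1) local_big_of_product(1)[OF G_local_big]]
  have c2: "(\<lambda>x y. specialise_big m (Q.conv (\<lambda>x y. \<iota>Q (\<alpha> x y)) (Q.of_product G) x y)) = conv (\<lambda>x y. \<iota> (\<alpha> x y)) (of_product \<nu>)"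
    unfolding c(2) local_big_of_product(2)[OF G_local_big] specialise_big_gens by (rule refl)
  note t = specialise_big_conv[of "Q.tensor_square TQ" m, OF local_big_tensor_square(1)[OF local_big_TQ(1)] c(1)]
  show "\<sigma> x y \<in> local_ring m" "specialise m (\<sigma> x y) = conv (tensor_square m) (conv (\<lambda>x y. \<iota> (\<alpha> x y)) (of_product \<nu>)) x y"
    by (rule specialise_frac_embed[OF \<sigma>_frac_embed t(1)]; unfold t(2) c2 local_big_tensor_square(2)[OF local_big_TQ(1)] specialise_big_gens; rule refl)+
qed

lemma \<sigma>'_local_ring: "\<sigma>' x y \<in> local_ring m" "specialise m (\<sigma>' x y) = conv (of_product m) (conv (\<lambda>x y. \<iota> (\<alpha>' x y)) (tensor_square \<nu>)) x y"
proof -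
  note c = specialise_big_conv[of "\<lambda>x y. \<iota>Q (\<alpha>' x y)" m "Q.tensor_square G", OF local_big_\<iota>Q(1) local_big_tensor_square(1)[OF G_local_big]]
  have c2: "(\<lambda>x y. specialise_big m (Q.conv (\<lambda>x y. \<iota>Q (\<alpha>' x y)) (Q.tensor_square G) x y)) = conv (\<lambda>x y. \<iota> (\<alpha>' x y)) (tensor_square \<nu>)"
    unfolding c(2) local_big_tensor_square(2)[OF G_local_big] specialise_big_gens by (rule refl)
  note t = specialise_big_conv[of "Q.of_product TQ" m, OF local_big_of_product(1)[OF local_big_TQ(1)] c(1)]
  show "\<sigma>' x y \<in> local_ring m" "specialise m (\<sigma>' x y) = conv (of_product m) (conv (\<lambda>x y. \<iota> (\<alpha>' x y)) (tensor_square \<nu>)) x y"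
    by (rule specialise_frac_embed[OF \<sigma>'_frac_embed t(1)]; unfold t(2) c2 local_big_of_product(2)[OF local_big_TQ(1)] specialise_big_gens; rule refl)+
qed

text \<open>Since \<Delta> 1 = 1 \<otimes> 1, all Sweedler sums at (1, 1) have one term, and the
  claim reduces to the inverse relations for t and for \<alpha> at 1. It makes \<sigma>(1,1) a unit,
  as base change of the twisted algebra requires.\<close>

lemma \<sigma>_unit: "\<sigma> 1 1 \<otimes>\<^bsub>KK\<^esub> \<sigma>' 1 1 = \<one>\<^bsub>KK\<^esub>"
proof (rule frac_embed_inj)
  note b = Q.bilin_tensor_square[OF lin_TQ] Q.bilin_of_product[OF lin_TQ] Q.bilin_tensor_square[OF t_inv_lin] Q.bilin_of_product[OF t_inv_lin]
    bilin_\<iota>Q[OF \<alpha>_facts(1)] bilin_\<iota>Q[OF \<alpha>_facts(2)]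
  have e: "frac_embed (\<sigma> 1 1) = TQ 1 * TQ 1 * (\<iota>Q (\<alpha> 1 1) * G 1)" "frac_embed (\<sigma>' 1 1) = TQ 1 * (\<iota>Q (\<alpha>' 1 1) * (G 1 * G 1))"
    unfolding \<sigma>_frac_embed \<sigma>'_frac_embed by (simp_all add: Q.conv_one Q.bilin_conv b) (simp_all add: Q.tensor_square_def Q.of_product_def)
  have "TQ 1 * G 1 = \<iota>Q (\<epsilon> 1)"
    using t_inv_right[of 1] Q.SS_one[OF Q.bilin_prod[OF lin_TQ t_inv_lin]] by simp
  then have TG: "TQ 1 * G 1 = 1"
    by (simp add: counit_one)
  have "k.conv \<alpha> \<alpha>' 1 1 = k.conv_counit 1 1"
    by (simp add: \<alpha>_facts)
  then have "\<alpha> 1 1 * \<alpha>' 1 1 = 1"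
    by (simp add: k.conv_one \<alpha>_facts(1,2) k.conv_counit_def counit_one)
  then have a: "\<iota>Q (\<alpha> 1 1) * \<iota>Q (\<alpha>' 1 1) = 1"
    by (simp flip: Q.\<iota>_simps(2))
  have "frac_embed (\<sigma> 1 1) * frac_embed (\<sigma>' 1 1) = (TQ 1 * G 1) * (TQ 1 * G 1) * (TQ 1 * G 1) * (\<iota>Q (\<alpha> 1 1) * \<iota>Q (\<alpha>' 1 1))"
    unfolding e by (simp only: ac_simps)
  then show "frac_embed (\<sigma> 1 1 \<otimes>\<^bsub>KK\<^esub> \<sigma>' 1 1) = frac_embed \<one>\<^bsub>KK\<^esub>"
    by (simp add: frac_embed_simps \<sigma>_frac_embed(1) \<sigma>'_frac_embed(1) TG a)
qed (simp_all add: KK_closed \<sigma>_frac_embed(1) \<sigma>'_frac_embed(1))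

abbreviation "BR \<equiv> BH scale \<Delta> \<epsilon> \<alpha>"

abbreviation "bgens \<equiv> range (KH_const scale) \<union> {\<sigma> x y | x y. True} \<union> {\<sigma>' x y | x y. True}"

lemma bgens_KK: "bgens \<subseteq> carrier KK"
  using const_facts(3) \<sigma>_frac_embed(1) \<sigma>'_frac_embed(1) by blast

lemma BR_simps: "carrier BR = generate_ring KK bgens" "x \<otimes>\<^bsub>BR\<^esub> y = x \<otimes>\<^bsub>KK\<^esub> y" "x \<oplus>\<^bsub>BR\<^esub> y = x \<oplus>\<^bsub>KK\<^esub> y"
  "\<one>\<^bsub>BR\<^esub> = \<one>\<^bsub>KK\<^esub>" "\<zero>\<^bsub>BR\<^esub> = \<zero>\<^bsub>KK\<^esub>"
  by (simp_all add: BH_def)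

lemma BR_gens: "KH_const scale a \<in> carrier BR" "\<sigma> x y \<in> carrier BR" "\<sigma>' x y \<in> carrier BR"
  unfolding BR_simps by (rule generate_ring.incl; blast)+

lemma cring_BR: "cring BR"
proof -
  interpret K: cring KK by (rule cring_KK)
  have "subcring (generate_ring KK bgens) KK"
    by (rule K.subcringI'[OF K.generate_ring_is_subring[OF bgens_KK]])
  then show ?thesis
    unfolding BH_def using K.subcring_iff[OF K.generate_ring_incl[OF bgens_KK]] by simp
qed

lemma bilinear_\<sigma>: "bilinear_to scale BR (KH_const scale) \<sigma>"
proof -
  have b: "Q.bilin (Q.conv (Q.tensor_square TQ) (Q.conv (\<lambda>x y. \<iota>Q (\<alpha> x y)) (Q.of_product G)))"
    by (intro Q.bilin_conv Q.bilin_tensor_square Q.bilin_of_product lin_TQ t_inv_lin bilin_\<iota>Q \<alpha>_facts(1))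
  have "klin KK actK (\<lambda>y. \<sigma> x y)" "klin KK actK (\<lambda>x. \<sigma> x y)" for x y
    unfolding klin_frac_embed \<sigma>_frac_embed(2) using Q.bilinD[OF b] \<sigma>_frac_embed(1) by simp_all
  from klinD[OF this(1)] klinD[OF this(2)] show ?thesis
    unfolding bilinear_to_def linear_to_def by (simp add: BR_gens) (simp add: BR_simps)
qed

lemma \<sigma>_Unit: "\<sigma> 1 1 \<in> Units BR"
proof -
  interpret B: cring BR by (rule cring_BR)
  have "\<sigma> 1 1 \<otimes>\<^bsub>BR\<^esub> \<sigma>' 1 1 = \<one>\<^bsub>BR\<^esub>"
    using \<sigma>_unit by (simp add: BR_simps)
  then show ?thesis
    using B.m_comm[OF BR_gens(2) BR_gens(3)] BR_gens by (auto simp: Units_def intro!: bexI[of _ "\<sigma>' 1 1"])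
qed

text \<open>Being regular at m with value in the subfield \<open>range h\<close> is stable under the
  ring operations, so it has to be tested on the generators only: the constants and the values of
  \<sigma> and of its inverse.\<close>

lemma BR_local_ring:
  fixes h :: "'K::field \<Rightarrow> 'f"
  assumes h: "h \<in> ring_hom ring_of_type_algebra F" and \<iota>: "range \<iota> \<subseteq> range h"
    and \<sigma>: "\<And>x y. specialise m (\<sigma> x y) \<in> range h" and \<sigma>': "\<And>x y. specialise m (\<sigma>' x y) \<in> range h"
    and z: "z \<in> carrier BR"
  shows "z \<in> local_ring m \<and> specialise m z \<in> range h"
proof -
  have hs: "h (x + y) = h x + h y" "h (x * y) = h x * h y" "h 1 = 1" for x y
    using ring_hom_add[OF h, of x y] ring_hom_mult[OF h, of x y] ring_hom_one[OF h] by simp_all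
  have h0: "h 0 = 0"
    using hs(1)[of 0 0] by (metis add_0 add_right_cancel)
  have hm: "h (- x) = - h x" for x
    using hs(1)[of x "- x"] by (simp add: h0 eq_neg_iff_add_eq_0 add.commute)
  show ?thesis
    using z unfolding BR_simps
  proof (induction rule: generate_ring.induct)
    case one
    have "h 1 = specialise m \<one>\<^bsub>KK\<^esub>"
      unfolding KK_one_poly local_ring_of_poly eval_at_one hs(3) ..
    then show ?case
      using local_ring_of_poly(1)[of 1 m] unfolding KK_one_poly by (metis rangeI)
  next
    case (incl z)
    then consider a where "z = KH_const scale a" | x y where "z = \<sigma> x y" | x y where "z = \<sigma>' x y"
      by blast
    then show ?case
    proof cases
      case 1 then show ?thesis using \<iota> by (auto simp: const_facts(1,2))
    next
      case 2 then show ?thesis using \<sigma> \<sigma>_local_ring(1) by blast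
    next
      case 3 then show ?thesis using \<sigma>' \<sigma>'_local_ring(1) by blast
    qed
  next
    case (a_inv z)
    then show ?case
      by (auto simp: local_ring_minus hm[symmetric])
  next
    case (eng_add z w)
    then show ?case
      by (auto simp: local_ring_ops hs[symmetric])
  next
    case (eng_mult z w)
    then show ?case
      by (auto simp: local_ring_ops hs[symmetric])
  qed
qed

end

lemma field_hom_simps:
  fixes h :: "'a::field \<Rightarrow> 'b::field"
  assumes h: "h \<in> ring_hom ring_of_type_algebra ring_of_type_algebra"
  shows "h (x + y) = h x + h y" "h (x * y) = h x * h y" "h 1 = 1" "h 0 = 0" "inj h"
proof -
  show a: "h (x + y) = h x + h y" and m: "h (x * y) = h x * h y" and o: "h 1 = 1" for x y
    using ring_hom_add[OF h, of x y] ring_hom_mult[OF h, of x y] ring_hom_one[OF h] by simp_all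
  show z: "h 0 = 0"
    using a[of 0 0] by (metis add_0 add_right_cancel)
  show "inj h"
  proof (rule injI, rule ccontr)
    fix x y assume eq: "h x = h y" and "x \<noteq> y"
    have "h (x - y) = 0"
      using a[of "x - y" y] eq by simp
    moreover have "h (x - y) * h (inverse (x - y)) = 1"
      using m[of "x - y" "inverse (x - y)"] \<open>x \<noteq> y\<close> by (simp add: o)
    ultimately show False by simp
  qed
qed

section \<open>The linear map attached to a form\<close>

context hopf_algebra
begin

lemma hom_SS:
  fixes h :: "'a::field \<Rightarrow> 'b::field"
  assumes h: "h \<in> ring_hom ring_of_type_algebra ring_of_type_algebra"
  shows "h (SS f x) = SS (\<lambda>p q. h (f p q)) x"
proof -
  have "h (sum u B) = (\<Sum>b\<in>B. h (u b))" for u and B :: "nat set"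
    by (induction B rule: infinite_finite_induct) (simp_all add: field_hom_simps(1,4)[OF h])
  then show ?thesis
    by (simp add: SS_def)
qed

text \<open>\<open>m\<close> and \<open>n\<^sub>0\<close> are the functionals of the isomorphism
  over L and of its inverse, once both base changes are rewritten as twisted algebras over L.
  Normalisation of the cocycles supplies the units at (1, 1).\<close>

lemma form_gauge:
  fixes i :: "'k \<Rightarrow> 'K::field" and j :: "'K \<Rightarrow> 'L::field"
  assumes i: "i \<in> ring_hom kk ring_of_type_algebra"
    and \<alpha>: "normalized_invertible_cocycle scale \<Delta> \<epsilon> kk id \<alpha>"
    and \<beta>: "normalized_invertible_cocycle scale \<Delta> \<epsilon> ring_of_type_algebra i \<beta>"
    and form: "is_form_via scale \<Delta> i j \<alpha> \<beta>"
  obtains m n\<^sub>0 where "hopf_field.lin scale (j \<circ> i) m" "hopf_field.lin scale (j \<circ> i) n\<^sub>0"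
    "\<And>x. SS (\<lambda>p q. n\<^sub>0 p * m q) x = (j \<circ> i) (\<epsilon> x)"
    "\<And>x y. SS (\<lambda>x1 x2. SS (\<lambda>y1 y2. m x1 * m y1 * j (i (\<alpha> x2 y2))) y) x =
      SS (\<lambda>x1 x2. SS (\<lambda>y1 y2. j (\<beta> x1 y1) * m (x2 * y2)) y) x"
proof -
  let ?K = "ring_of_type_algebra :: 'K ring" and ?L = "ring_of_type_algebra :: 'L ring"
  have j: "j \<in> ring_hom ?K ?L"
    using form by (simp add: is_form_via_def Let_def)
  have ji: "j \<circ> i \<in> ring_hom kk ?L"
    by (rule ring_hom_trans[OF i j])
  interpret k: hopf_field scale \<Delta> \<epsilon> "id :: 'k \<Rightarrow> 'k"
    by unfold_locales (rule ring_hom_memI; simp)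
  interpret K: hopf_field scale \<Delta> \<epsilon> i
    by unfold_locales (rule i)
  interpret L: hopf_field scale \<Delta> \<epsilon> "j \<circ> i"
    by unfold_locales (rule ji)
  interpret CL: cring ?L by (rule cring_from_type_algebra)
  interpret CK: cring ?K by (rule cring_from_type_algebra)
  interpret Ck: cring kk by (rule cring_from_type_algebra)
  note hs = field_hom_simps[OF j] field_hom_simps[OF i] field_hom_simps[OF ji]
  define \<gamma> where "\<gamma> x y = j (\<beta> x y)" for x y
  define \<delta> where "\<delta> x y = (j \<circ> i) (\<alpha> x y)" for x y
  have b: "bilinear_to scale ?K i \<beta>" "bilinear_to scale kk id \<alpha>"
    using \<alpha> \<beta> by (simp_all add: normalized_invertible_cocycle_def two_cocycle_def)
  have u: "\<beta> 1 1 = 1" "\<alpha> 1 1 = 1"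
    using \<alpha> \<beta> by (simp_all add: normalized_invertible_cocycle_def normalized_def counit_one hs)
  have bl: "L.bilin \<gamma>" "L.bilin \<delta>"
    using b unfolding \<gamma>_def[abs_def] \<delta>_def[abs_def] K.bilinear_to_bilin k.bilinear_to_bilin
    by (simp_all add: K.bilin_def K.lin_def k.bilin_def k.lin_def L.bilin_def L.lin_def hs)
  have tK: "twisted_base_change scale \<Delta> \<epsilon> ?K i \<beta> ?L j"
    by unfold_locales (use b(1) j CK.Units_one_closed in \<open>simp_all add: u\<close>)
  have tk: "twisted_base_change scale \<Delta> \<epsilon> kk id \<alpha> ?L (j \<circ> i)"
    by unfold_locales (use b(2) ji Ck.Units_one_closed in \<open>simp_all add: u\<close>)
  have u': "\<gamma> 1 1 \<in> Units ?L" "\<delta> 1 1 \<in> Units ?L"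
    using CL.Units_one_closed by (simp_all add: \<gamma>_def \<delta>_def u hs)
  have t\<gamma>: "twisted_hom_data scale \<Delta> \<epsilon> ?L (j \<circ> i) \<gamma>" and t\<delta>: "twisted_hom_data scale \<Delta> \<epsilon> ?L (j \<circ> i) \<delta>"
    by (unfold_locales; use ji bl in \<open>simp add: L.bilinear_to_bilin\<close>)+
  note ok\<gamma> = twisted_data.comod_ok_A[OF twisted_hom_data.axioms(1)[OF t\<gamma>] u'(1)]
  note ok\<delta> = twisted_data.comod_ok_A[OF twisted_hom_data.axioms(1)[OF t\<delta>] u'(2)]
  note okK = twisted_base_change.comod_ok_BC[OF tK] and okk = twisted_base_change.comod_ok_BC[OF tk, unfolded comp_id]
  note isoK = twisted_base_change.base_change_iso[OF tK, folded \<gamma>_def]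
  note isok = twisted_base_change.base_change_iso[OF tk, unfolded comp_id, folded \<delta>_def]
  obtain \<Phi> where "comodule_algebra_iso scale ?L (j \<circ> i) (base_change scale ?K i ?L j (twisted_algebra scale \<Delta> ?K i \<beta>))
      (base_change scale kk id ?L (j \<circ> i) (twisted_algebra scale \<Delta> kk id \<alpha>)) \<Phi>"
    using form unfolding is_form_via_def Let_def by blast
  \<comment> \<open>From the twisted algebra of \<gamma> back to the base change of K \<otimes>
    \<open>\<^sup>\<beta>H\<close>, then through the form isomorphism, then to the twisted algebra
    of \<delta>.\<close>
  from iso_trans[OF ok\<gamma> okK ok\<delta> iso_sym[OF okK ok\<gamma> isoK] iso_trans[OF okK okk ok\<delta> this isok]]
  obtain \<Theta> where \<Theta>: "comodule_algebra_iso scale ?L (j \<circ> i) (twisted_algebra scale \<Delta> ?L (j \<circ> i) \<gamma>)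
      (twisted_algebra scale \<Delta> ?L (j \<circ> i) \<delta>) \<Theta>"
    by blast
  define \<Xi> where "\<Xi> = inv_into (carrier (twisted_algebra scale \<Delta> ?L (j \<circ> i) \<gamma>)) \<Theta>"
  have \<Theta>\<Xi>: "\<Theta> (\<Xi> P) = P" if "P \<in> carrier (twisted_algebra scale \<Delta> ?L (j \<circ> i) \<delta>)" for P
    using iso_facts(3)[OF ok\<gamma> ok\<delta> \<Theta>] that unfolding \<Xi>_def bij_betw_def by (simp add: f_inv_into_f)
  have \<Xi>: "comodule_algebra_iso scale ?L (j \<circ> i) (twisted_algebra scale \<Delta> ?L (j \<circ> i) \<delta>)
      (twisted_algebra scale \<Delta> ?L (j \<circ> i) \<gamma>) \<Xi>"
    unfolding \<Xi>_def by (rule iso_sym[OF ok\<gamma> ok\<delta> \<Theta>])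
  interpret M: colinear_inverse scale \<Delta> \<epsilon> ?L "j \<circ> i" \<gamma> \<delta> \<Theta> \<Xi>
    by (intro colinear_inverse.intro colinear_map.intro colinear_map_axioms.intro colinear_inverse_axioms.intro
        t\<gamma> t\<delta> \<Theta> \<Xi> u' \<Theta>\<Xi>)
  have m: "L.lin M.mu" "L.lin M.I.mu"
    using M.klin_mu M.I.klin_mu by (simp_all flip: L.klin_lin)
  have "SS (\<lambda>p q. M.I.mu p * M.mu q) x = (j \<circ> i) (\<epsilon> x)" for x
    using M.mu_inv[of x] L.sw_F[OF L.bilin_prod[OF m(2,1)], of x] by simp
  moreover have "SS (\<lambda>x1 x2. SS (\<lambda>y1 y2. M.mu x1 * M.mu y1 * j (i (\<alpha> x2 y2))) y) x =
      SS (\<lambda>x1 x2. SS (\<lambda>y1 y2. j (\<beta> x1 y1) * M.mu (x2 * y2)) y) x" for x y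
  proof -
    have "convolution \<Delta> ?L (L.tensor_square M.mu) \<delta> x y = convolution \<Delta> ?L \<gamma> (L.of_product M.mu) x y"
      using M.mu_mult[of y x] by (simp add: convolution_def L.tensor_square_def L.of_product_def)
    then show ?thesis
      unfolding L.convolution_conv[OF L.bilin_tensor_square[OF m(1)] bl(2)] L.convolution_conv[OF bl(1) L.bilin_of_product[OF m(1)]]
      by (simp add: L.conv_def L.tensor_square_def L.of_product_def \<gamma>_def \<delta>_def)
  qed
  ultimately show thesis
    using that m by blast
qed

end

section \<open>Descent of the specialisation from L to K\<close>

theorem theorem7p1:
  fixes scale :: "'k::field \<Rightarrow> 'h::ring_1 \<Rightarrow> 'h"
    and \<Delta> :: "'h \<Rightarrow> ('h, 'h) tensor"
    and \<epsilon> :: "'h \<Rightarrow> 'k"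
    and \<alpha> :: "'h \<Rightarrow> 'h \<Rightarrow> 'k"
    and i :: "'k \<Rightarrow> 'K::field"
    and \<beta> :: "'h \<Rightarrow> 'h \<Rightarrow> 'K"
    and j :: "'K \<Rightarrow> 'L::field"
  assumes "hopf_algebra scale \<Delta> \<epsilon>"
    and "normalized_invertible_cocycle scale \<Delta> \<epsilon> (ring_of_type_algebra :: 'k ring) id \<alpha>"
    and "i \<in> ring_hom (ring_of_type_algebra :: 'k ring) (ring_of_type_algebra :: 'K ring)"
    and "normalized_invertible_cocycle scale \<Delta> \<epsilon> (ring_of_type_algebra :: 'K ring) i \<beta>"
    and "is_form_via scale \<Delta> i j \<alpha> \<beta>"
  shows "\<exists>lam \<in> ring_hom (BH scale \<Delta> \<epsilon> \<alpha>) (ring_of_type_algebra :: 'K ring).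
    (\<forall>a. lam (KH_const scale a) = i a) \<and>
    (\<exists>\<Phi>. comodule_algebra_iso scale (ring_of_type_algebra :: 'K ring) i
      (base_change scale (BH scale \<Delta> \<epsilon> \<alpha>) (KH_const scale) (ring_of_type_algebra :: 'K ring) lam
        (AH scale \<Delta> \<epsilon> \<alpha>))
      (twisted_algebra scale \<Delta> (ring_of_type_algebra :: 'K ring) i \<beta>) \<Phi>)"
proof -
  interpret hopf_algebra scale \<Delta> \<epsilon> by (rule assms(1))
  note \<alpha> = assms(2) and i = assms(3) and \<beta> = assms(4) and form = assms(5)
  let ?K = "ring_of_type_algebra :: 'K ring" and ?L = "ring_of_type_algebra :: 'L ring"
  have j: "j \<in> ring_hom ?K ?L"
    using form by (simp add: is_form_via_def Let_def)
  have ji: "j \<circ> i \<in> ring_hom kk ?L"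
    by (rule ring_hom_trans[OF i j])
  interpret k: hopf_field scale \<Delta> \<epsilon> "id :: 'k \<Rightarrow> 'k"
    by unfold_locales (rule ring_hom_memI; simp)
  interpret K: hopf_field scale \<Delta> \<epsilon> i
    by unfold_locales (rule i)
  interpret L: hopf_field scale \<Delta> \<epsilon> "j \<circ> i"
    by unfold_locales (rule ji)
  note hs = field_hom_simps(1-4)[OF j] field_hom_simps(1-4)[OF i]
  obtain m n\<^sub>0 where m: "L.lin m" "L.lin n\<^sub>0" "\<And>x. SS (\<lambda>p q. n\<^sub>0 p * m q) x = (j \<circ> i) (\<epsilon> x)"
    and eq: "\<And>x y. SS (\<lambda>x1 x2. SS (\<lambda>y1 y2. m x1 * m y1 * j (i (\<alpha> x2 y2))) y) x =
      SS (\<lambda>x1 x2. SS (\<lambda>y1 y2. j (\<beta> x1 y1) * m (x2 * y2)) y) x"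
    by (rule form_gauge[OF i \<alpha> \<beta> form]) (rule that; (assumption | simp only:))
  interpret S: specialised_cocycle scale \<Delta> \<epsilon> "j \<circ> i" m n\<^sub>0 \<alpha>
    by unfold_locales (rule m \<alpha>)+
  define \<beta>' where "\<beta>' = conv_inverse scale \<Delta> \<epsilon> ?K i \<beta>"
  have b: "K.bilin \<beta>" and ex: "\<exists>g. is_conv_inverse scale \<Delta> \<epsilon> ?K i \<beta> g"
    using \<beta> by (simp_all add: normalized_invertible_cocycle_def two_cocycle_def K.bilinear_to_bilin)
  note b' = K.conv_inverse_is_inverse[OF b ex, folded \<beta>'_def]
  have bilin: "L.bilin (\<lambda>x y. j (f x y))" if "K.bilin f" for f
    using that by (simp add: K.bilin_def K.lin_def L.bilin_def L.lin_def hs)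
  have bilin': "L.bilin (\<lambda>x y. j (i (f x y)))" if "k.bilin f" for f
    using that by (simp add: k.bilin_def k.lin_def L.bilin_def L.lin_def hs)
  have inv: "L.conv (\<lambda>x y. j (f x y)) (\<lambda>x y. j (g x y)) = L.conv_counit" if "K.conv f g = K.conv_counit" for f g
  proof (intro ext)
    fix x y
    have "j (K.conv f g x y) = j (K.conv_counit x y)"
      using that by simp
    then show "L.conv (\<lambda>x y. j (f x y)) (\<lambda>x y. j (g x y)) x y = L.conv_counit x y"
      by (simp add: K.conv_def L.conv_def K.conv_counit_def L.conv_counit_def hom_SS[OF j] hs)
  qed
  have inv': "L.conv (\<lambda>x y. j (i (f x y))) (\<lambda>x y. j (i (g x y))) = L.conv_counit" if "k.conv f g = k.conv_counit" for f g
  proof (intro ext)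
    fix x y
    have "j (i (k.conv f g x y)) = j (i (k.conv_counit x y))"
      using that by simp
    then show "L.conv (\<lambda>x y. j (i (f x y))) (\<lambda>x y. j (i (g x y))) x y = L.conv_counit x y"
      by (simp add: k.conv_def L.conv_def k.conv_counit_def L.conv_counit_def hom_SS[OF j] hom_SS[OF i] hs)
  qed
  have eq': "L.conv (L.tensor_square m) (\<lambda>x y. j (i (\<alpha> x y))) = L.conv (\<lambda>x y. j (\<beta> x y)) (L.of_product m)"
    by (intro ext) (simp add: L.conv_def L.tensor_square_def L.of_product_def eq)
  note gauge = L.gauge[OF m(1) S.lin_\<nu> S.m_\<nu> S.\<nu>_m bilin[OF b] bilin[OF b'(1)] inv[OF b'(3)]
      bilin'[OF S.\<alpha>_facts(1)] bilin'[OF S.\<alpha>_facts(2)] inv'[OF S.\<alpha>_facts(3)] eq']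
  \<comment> \<open>The specialisations are the two expressions on the left of \<open>gauge\<close>
    with n = \<nu>. The second formula controls the inverse values, which are also among the
    generators of the subalgebra.\<close>
  have \<sigma>: "L.specialise m (S.\<sigma> x y) = j (\<beta> x y)" and \<sigma>': "L.specialise m (S.\<sigma>' x y) = j (\<beta>' x y)" for x y
    unfolding S.\<sigma>_local_ring(2) S.\<sigma>'_local_ring(2) o_apply gauge by (rule refl)+
  have loc: "z \<in> L.local_ring m" "L.specialise m z \<in> range j" if "z \<in> carrier S.BR" for z
    using S.BR_local_ring[OF j _ _ _ that] \<sigma> \<sigma>' by (simp_all add: image_subset_iff)
  \<comment> \<open>The values lie in the image of j, and j is injective as a homomorphism of
    fields; identities for \<open>lam\<close> are proved after applying j.\<close>
  define lam where "lam z = inv_into UNIV j (L.specialise m z)" for z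
  have lam: "j (lam z) = L.specialise m z" if "z \<in> carrier S.BR" for z
    unfolding lam_def by (rule f_inv_into_f[OF loc(2)[OF that]])
  note inj = injD[OF field_hom_simps(5)[OF j]]
  interpret B: cring S.BR by (rule S.cring_BR)
  have hom: "lam \<in> ring_hom S.BR ?K"
  proof (rule ring_hom_memI)
    fix z w assume zw: "z \<in> carrier S.BR" "w \<in> carrier S.BR"
    show "lam (z \<otimes>\<^bsub>S.BR\<^esub> w) = lam z \<otimes>\<^bsub>?K\<^esub> lam w"
      by (rule inj) (use L.local_ring_ops(2)[OF loc(1)[OF zw(1)] loc(1)[OF zw(2)]] B.m_closed[OF zw] zw in
          \<open>simp add: lam hs S.BR_simps(2)\<close>)
    show "lam (z \<oplus>\<^bsub>S.BR\<^esub> w) = lam z \<oplus>\<^bsub>?K\<^esub> lam w"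
      by (rule inj) (use L.local_ring_ops(4)[OF loc(1)[OF zw(1)] loc(1)[OF zw(2)]] B.a_closed[OF zw] zw in
          \<open>simp add: lam hs S.BR_simps(3)\<close>)
  next
    have "j (lam \<one>\<^bsub>S.BR\<^esub>) = L.specialise m \<one>\<^bsub>S.BR\<^esub>"
      by (rule lam[OF B.one_closed])
    also have "\<dots> = 1"
      unfolding S.BR_simps(4) L.KK_one_poly L.local_ring_of_poly(2) by (rule L.eval_at_one)
    finally have "j (lam \<one>\<^bsub>S.BR\<^esub>) = 1" .
    then show "lam \<one>\<^bsub>S.BR\<^esub> = \<one>\<^bsub>?K\<^esub>"
      using inj[of "lam \<one>\<^bsub>S.BR\<^esub>" 1] by (simp add: hs)
  qed simp
  have const: "lam (KH_const scale a) = i a" for a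
    by (rule inj) (simp add: lam S.BR_gens L.const_facts)
  have \<beta>_lam: "lam (S.\<sigma> x y) = \<beta> x y" for x y
    by (rule inj) (simp add: lam S.BR_gens \<sigma>)
  \<comment> \<open>\<open>lam\<close> takes \<sigma> to \<beta> and restricts to i on the
    constants, so the base change theorem along \<open>lam\<close> has the twisted algebra of
    \<beta> as its target.\<close>
  have "twisted_base_change scale \<Delta> \<epsilon> S.BR (KH_const scale) S.\<sigma> ?K lam"
    by (intro twisted_base_change.intro twisted_data.intro twisted_data_axioms.intro twisted_base_change_axioms.intro
        hopf_algebra_axioms S.cring_BR S.BR_gens S.bilinear_\<sigma> cring_from_type_algebra hom S.\<sigma>_Unit)
  from twisted_base_change.base_change_iso[OF this]
  have "\<exists>\<Phi>. comodule_algebra_iso scale ?K i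
      (base_change scale S.BR (KH_const scale) ?K lam (AH scale \<Delta> \<epsilon> \<alpha>)) (twisted_algebra scale \<Delta> ?K i \<beta>) \<Phi>"
    unfolding AH_def \<beta>_lam comp_def const by blast
  then show ?thesis
    using hom const by blast
qed

end
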